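(* Let $n\ge 2$ and let $V$ be an irreducible non-critical Gelfand-Tsetlin $\mathfrak{gl}_n$-module. Then the following hold. (i) The module $V$ is tame, i.e. the Gelfand-Tsetlin subalgebra $\Gamma$ acts diagonally (diagonalizably) on $V$. (ii) Let $\mathfrak m$ be a maximal ideal of $\Gamma$ such that $V_{\mathfrak m}\neq 0$. If $W$ is an irreducible non-critical Gelfand-Tsetlin $\mathfrak{gl}_n$-module such that $W_{\mathfrak m}\neq 0$, then $W$ is isomorphic to $V$.
   Context: $\mathfrak{gl}_n$ is the Lie algebra of complex $n\times n$ matrices with elementary matrices $E_{ij}$, and $\mathfrak{gl}_1\subset\mathfrak{gl}_2\subset\dots\subset\mathfrak{gl}_n$ is the chain of principal (upper left corner) submatrices. The Gelfand-Tsetlin subalgebra $\Gamma\subset U(\mathfrak{gl}_n)$ is the subalgebra generated by the centers of $U(\mathfrak{gl}_k)$, $k=1,\dots,n$. It is the polynomial algebra in the generators $$c_{mk}=\sum_{(i_1,\dots,i_k)\in\{1,\dots,m\}^k}E_{i_1i_2}E_{i_2i_3}\cdots E_{i_ki_1},\qquad 1\le k\le m\le n.$$ For a maximal ideal $\mathfrak m$ of $\Gamma$ and a $\mathfrak{gl}_n$-module $V$, put $V_{\mathfrak m}=\{v\in V: \mathfrak m^k v=0\text{ for some }k\ge 0\}$. $V$ is a Gelfand-Tsetlin module if $V=\bigoplus_{\mathfrak m}V_{\mathfrak m}$, the sum being over all maximal ideals of $\Gamma$. The Gelfand-Tsetlin support of $V$ is the set of $\mathfrak m$ with $V_{\mathfrak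 m}\ne0$. $T_n(\mathbb C)\simeq\mathbb C^{n(n+1)/2}$ is the set of tableaux $L=(l_{ij})_{1\le j\le i\le n}$, where $(l_{i1},\dots,l_{ii})$ is called the $i$-th row. To $L$ one associates the maximal ideal $\mathfrak m_L$ of $\Gamma$ generated by $c_{mk}-\gamma_{mk}(L)$, where $$\gamma_{mk}(L)=\sum_{i=1}^m(l_{mi}+m-1)^k\prod_{j\ne i}\Bigl(1-\frac1{l_{mi}-l_{mj}}\Bigr),$$ which is a symmetric polynomial in $l_{m1},\dots,l_{mm}$ (and is so interpreted when some entries coincide). Every maximal ideal of $\Gamma$ is of this form, and $L$ is determined by it up to permuting entries within each row. $L$ and $\mathfrak m_L$ are called critical if $L$ has equal entries in some of its rows. A Gelfand-Tsetlin module $V$ is critical if $V_{\mathfrak m}\ne0$ for some critical $\mathfrak m$, and non-critical otherwise. *)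

theory Defs
  imports
    "HOL-Library.Poly_Mapping"
    "HOL-Algebra.QuotRing"
    "HOL-Algebra.Ideal_Product"
    "HOL-Algebra.Generated_Rings"
    "Jordan_Normal_Form.Matrix"
begin

section \<open>Free associative algebras\<close>

text \<open>Words form the free monoid, written additively so that the convolution product of
  finitely supported functions on words is the product of the free associative algebra.\<close>

datatype 'a fword = FWord (letters: "'a list")

instantiation fword :: (type) monoid_add
begin

definition zero_fword :: "'a fword" where "zero_fword = FWord []"

definition plus_fword :: "'a fword \<Rightarrow> 'a fword \<Rightarrow> 'a fword"
  where "plus_fword u v = FWord (letters u @ letters v)"

instance by standard (auto simp: zero_fword_def plus_fword_def)

end

type_synonym 'a free_alg = "'a fword \<Rightarrow>\<^sub>0 complex"

definition monomial :: "'a list \<Rightarrow> 'a free_alg"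
  where "monomial xs = Poly_Mapping.single (FWord xs) 1"

definition free_const :: "complex \<Rightarrow> 'a free_alg"
  where "free_const c = Poly_Mapping.single 0 c"

definition free_ring :: "'a set \<Rightarrow> 'a free_alg ring"
  where "free_ring A =
    \<lparr>carrier = {p. \<forall>w \<in> Poly_Mapping.keys p. set (letters w) \<subseteq> A},
     monoid.mult = (*), one = 1, zero = 0, add = (+)\<rparr>"


section \<open>The Lie algebra and its enveloping algebra\<close>

abbreviation gl :: "nat \<Rightarrow> complex mat set"
  where "gl n \<equiv> carrier_mat n n"

definition lie_bracket :: "complex mat \<Rightarrow> complex mat \<Rightarrow> complex mat"
  where "lie_bracket X Y = X * Y - Y * X"

text \<open>Elementary matrices; the indices \<open>i, j\<close> run through \<open>1, \<dots>, n\<close>, whereas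
  matrix entries are numbered from 0 in the library.\<close>

definition E_mat :: "nat \<Rightarrow> nat \<Rightarrow> nat \<Rightarrow> complex mat"
  where "E_mat n i j = mat n n (\<lambda>(a, b). if Suc a = i \<and> Suc b = j then 1 else 0)"

definition gl_corner :: "nat \<Rightarrow> nat \<Rightarrow> complex mat set"
  where "gl_corner n k =
    {X \<in> gl n. \<forall>i < n. \<forall>j < n. \<not> (i < k \<and> j < k) \<longrightarrow> X $$ (i, j) = 0}"

definition env_rels :: "nat \<Rightarrow> complex mat free_alg set"
  where "env_rels n =
    {monomial [X + Y] - monomial [X] - monomial [Y] | X Y. X \<in> gl n \<and> Y \<in> gl n} \<union>
    {monomial [c \<cdot>\<^sub>m X] - free_const c * monomial [X] | c X. X \<in> gl n} \<union>
    {monomial [X, Y] - monomial [Y, X] - monomial [lie_bracket X Y] | X Y. X \<in> gl n \<and> Y \<in> gl n}"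

definition env_ideal :: "nat \<Rightarrow> complex mat free_alg set"
  where "env_ideal n = Idl\<^bsub>free_ring (gl n)\<^esub> (env_rels n)"

definition U_gl :: "nat \<Rightarrow> complex mat free_alg set ring"
  where "U_gl n = free_ring (gl n) Quot env_ideal n"

definition U_class :: "nat \<Rightarrow> complex mat free_alg \<Rightarrow> complex mat free_alg set"
  where "U_class n p = env_ideal n +>\<^bsub>free_ring (gl n)\<^esub> p"

definition U_const :: "nat \<Rightarrow> complex \<Rightarrow> complex mat free_alg set"
  where "U_const n c = U_class n (free_const c)"

definition U_gen :: "nat \<Rightarrow> complex mat free_alg set set \<Rightarrow> complex mat free_alg set set"
  where "U_gen n S = generate_ring (U_gl n) (range (U_const n) \<union> S)"

text \<open>The enveloping algebra of the corner subalgebra is regarded as a subalgebra of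
  the one of the whole Lie algebra (Poincare-Birkhoff-Witt).\<close>

definition U_sub :: "nat \<Rightarrow> nat \<Rightarrow> complex mat free_alg set set"
  where "U_sub n k = U_gen n ((\<lambda>X. U_class n (monomial [X])) ` gl_corner n k)"

definition U_sub_center :: "nat \<Rightarrow> nat \<Rightarrow> complex mat free_alg set set"
  where "U_sub_center n k =
    {z \<in> U_sub n k. \<forall>y \<in> U_sub n k. z \<otimes>\<^bsub>U_gl n\<^esub> y = y \<otimes>\<^bsub>U_gl n\<^esub> z}"


section \<open>The Gelfand-Tsetlin subalgebra\<close>

definition GT_alg :: "nat \<Rightarrow> complex mat free_alg set ring"
  where "GT_alg n = (U_gl n)\<lparr>carrier := U_gen n (\<Union>k \<in> {1..n}. U_sub_center n k)\<rparr>"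

definition c_GT :: "nat \<Rightarrow> nat \<Rightarrow> nat \<Rightarrow> complex mat free_alg set"
  where "c_GT n m k = U_class n
    (\<Sum>is \<in> {is. length is = k \<and> set is \<subseteq> {1..m}}.
       monomial (map2 (E_mat n) is (rotate1 is)))"

text \<open>Polynomial functions in the coordinates \<open>x 1, \<dots>, x m\<close>.\<close>

inductive poly_fun :: "nat \<Rightarrow> ((nat \<Rightarrow> complex) \<Rightarrow> complex) \<Rightarrow> bool" for m :: nat where
  poly_const: "poly_fun m (\<lambda>x. c)"
| poly_var: "i \<in> {1..m} \<Longrightarrow> poly_fun m (\<lambda>x. x i)"
| poly_add: "poly_fun m f \<Longrightarrow> poly_fun m g \<Longrightarrow> poly_fun m (\<lambda>x. f x + g x)"
| poly_mult: "poly_fun m f \<Longrightarrow> poly_fun m g \<Longrightarrow> poly_fun m (\<lambda>x. f x * g x)"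

text \<open>The rational expression for \<open>\<gamma>\<^sub>m\<^sub>k\<close> agrees with exactly one polynomial function
  wherever it is defined; that function also gives the values at rows with equal entries.\<close>

definition gamma_row :: "nat \<Rightarrow> nat \<Rightarrow> (nat \<Rightarrow> complex) \<Rightarrow> complex"
  where "gamma_row m k = (THE f. poly_fun m f \<and>
    (\<forall>x. inj_on x {1..m} \<longrightarrow>
       f x = (\<Sum>i = 1..m. (x i + of_nat m - 1) ^ k *
                (\<Prod>j \<in> {1..m} - {i}. 1 - 1 / (x i - x j)))))"

text \<open>A tableau is a function \<open>L\<close> of which only the values \<open>L i j\<close>
  with \<open>1 \<le> j \<le> i \<le> n\<close> are used.\<close>

type_synonym tableau = "nat \<Rightarrow> nat \<Rightarrow> complex"

definition max_of_tableau :: "nat \<Rightarrow> tableau \<Rightarrow> complex mat free_alg set set"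
  where "max_of_tableau n L = Idl\<^bsub>GT_alg n\<^esub>
    {c_GT n m k \<ominus>\<^bsub>U_gl n\<^esub> U_const n (gamma_row m k (L m)) | m k. 1 \<le> k \<and> k \<le> m \<and> m \<le> n}"

definition critical_tableau :: "nat \<Rightarrow> tableau \<Rightarrow> bool"
  where "critical_tableau n L \<longleftrightarrow> (\<exists>i \<in> {1..n}. \<not> inj_on (L i) {1..i})"

definition critical_ideal :: "nat \<Rightarrow> complex mat free_alg set set \<Rightarrow> bool"
  where "critical_ideal n \<mm> \<longleftrightarrow> (\<exists>L. critical_tableau n L \<and> \<mm> = max_of_tableau n L)"

primrec ideal_pow :: "('a, 'b) ring_scheme \<Rightarrow> 'a set \<Rightarrow> nat \<Rightarrow> 'a set" where
  "ideal_pow R I 0 = carrier R"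
| "ideal_pow R I (Suc k) = I \<cdot>\<^bsub>R\<^esub> ideal_pow R I k"


section \<open>Modules\<close>

text \<open>A module is given by a vector space structure \<open>s\<close> on a type and a representation
  \<open>\<rho>\<close> on it, of which only the values at \<open>gl n\<close> are used.\<close>

locale gl_module = vector_space s
  for n :: nat
  and s :: "complex \<Rightarrow> 'v::ab_group_add \<Rightarrow> 'v"
  and \<rho> :: "complex mat \<Rightarrow> 'v \<Rightarrow> 'v" +
  assumes linear_rep: "X \<in> gl n \<Longrightarrow> Vector_Spaces.linear s s (\<rho> X)"
    and rep_add: "X \<in> gl n \<Longrightarrow> Y \<in> gl n \<Longrightarrow> \<rho> (X + Y) v = \<rho> X v + \<rho> Y v"
    and rep_scale: "X \<in> gl n \<Longrightarrow> \<rho> (c \<cdot>\<^sub>m X) v = s c (\<rho> X v)"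
    and rep_lie: "X \<in> gl n \<Longrightarrow> Y \<in> gl n \<Longrightarrow> \<rho> (lie_bracket X Y) v = \<rho> X (\<rho> Y v) - \<rho> Y (\<rho> X v)"

definition free_act ::
    "(complex \<Rightarrow> 'v::ab_group_add \<Rightarrow> 'v) \<Rightarrow> ('a \<Rightarrow> 'v \<Rightarrow> 'v) \<Rightarrow> 'a free_alg \<Rightarrow> 'v \<Rightarrow> 'v"
  where "free_act s \<rho> p v = (\<Sum>w \<in> Poly_Mapping.keys p. s (Poly_Mapping.lookup p w) (foldr \<rho> (letters w) v))"

text \<open>The action of the enveloping algebra; the lemma \<open>gl_module.U_act_class\<close> below
  shows that it does not depend on the representative.\<close>

definition U_act ::
    "(complex \<Rightarrow> 'v::ab_group_add \<Rightarrow> 'v) \<Rightarrow> (complex mat \<Rightarrow> 'v \<Rightarrow> 'v) \<Rightarrow>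
      complex mat free_alg set \<Rightarrow> 'v \<Rightarrow> 'v"
  where "U_act s \<rho> u v = free_act s \<rho> (SOME p. p \<in> u) v"

definition submodule ::
    "nat \<Rightarrow> (complex \<Rightarrow> 'v::ab_group_add \<Rightarrow> 'v) \<Rightarrow> (complex mat \<Rightarrow> 'v \<Rightarrow> 'v) \<Rightarrow> 'v set \<Rightarrow> bool"
  where "submodule n s \<rho> N \<longleftrightarrow>
    module.subspace s N \<and> (\<forall>X \<in> gl n. \<forall>v \<in> N. \<rho> X v \<in> N)"

definition irreducible_module ::
    "nat \<Rightarrow> (complex \<Rightarrow> 'v::ab_group_add \<Rightarrow> 'v) \<Rightarrow> (complex mat \<Rightarrow> 'v \<Rightarrow> 'v) \<Rightarrow> bool"
  where "irreducible_module n s \<rho> \<longleftrightarrow>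
    (UNIV :: 'v set) \<noteq> {0} \<and> (\<forall>N. submodule n s \<rho> N \<longrightarrow> N = {0} \<or> N = UNIV)"

definition module_isomorphic ::
    "nat \<Rightarrow> (complex \<Rightarrow> 'v::ab_group_add \<Rightarrow> 'v) \<Rightarrow> (complex mat \<Rightarrow> 'v \<Rightarrow> 'v) \<Rightarrow>
      (complex \<Rightarrow> 'w::ab_group_add \<Rightarrow> 'w) \<Rightarrow> (complex mat \<Rightarrow> 'w \<Rightarrow> 'w) \<Rightarrow> bool"
  where "module_isomorphic n s \<rho> s' \<rho>' \<longleftrightarrow>
    (\<exists>f. Vector_Spaces.linear s s' f \<and> bij f \<and> (\<forall>X \<in> gl n. \<forall>v. f (\<rho> X v) = \<rho>' X (f v)))"

definition GT_component ::
    "nat \<Rightarrow> (complex \<Rightarrow> 'v::ab_group_add \<Rightarrow> 'v) \<Rightarrow> (complex mat \<Rightarrow> 'v \<Rightarrow> 'v) \<Rightarrow>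
      complex mat free_alg set set \<Rightarrow> 'v set"
  where "GT_component n s \<rho> \<mm> =
    {v. \<exists>k. \<forall>u \<in> ideal_pow (GT_alg n) \<mm> k. U_act s \<rho> u v = 0}"

text \<open>The second conjunct says that the module is the internal direct sum of the
  components at all maximal ideals.\<close>

definition GT_module ::
    "nat \<Rightarrow> (complex \<Rightarrow> 'v::ab_group_add \<Rightarrow> 'v) \<Rightarrow> (complex mat \<Rightarrow> 'v \<Rightarrow> 'v) \<Rightarrow> bool"
  where "GT_module n s \<rho> \<longleftrightarrow> gl_module n s \<rho> \<and>
    (\<forall>v. \<exists>!f. (\<forall>\<mm>. if maximalideal \<mm> (GT_alg n) then f \<mm> \<in> GT_component n s \<rho> \<mm> else f \<mm> = 0) \<and>
              finite {\<mm>. f \<mm> \<noteq> 0} \<and> v = (\<Sum>\<mm> | f \<mm> \<noteq> 0. f \<mm>))"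

definition critical_module ::
    "nat \<Rightarrow> (complex \<Rightarrow> 'v::ab_group_add \<Rightarrow> 'v) \<Rightarrow> (complex mat \<Rightarrow> 'v \<Rightarrow> 'v) \<Rightarrow> bool"
  where "critical_module n s \<rho> \<longleftrightarrow>
    (\<exists>\<mm>. maximalideal \<mm> (GT_alg n) \<and> critical_ideal n \<mm> \<and> GT_component n s \<rho> \<mm> \<noteq> {0})"

definition tame_module ::
    "nat \<Rightarrow> (complex \<Rightarrow> 'v::ab_group_add \<Rightarrow> 'v) \<Rightarrow> (complex mat \<Rightarrow> 'v \<Rightarrow> 'v) \<Rightarrow> bool"
  where "tame_module n s \<rho> \<longleftrightarrow>
    (\<exists>B. \<not> module.dependent s B \<and> module.span s B = UNIV \<and>
         (\<forall>b \<in> B. \<forall>u \<in> carrier (GT_alg n). \<exists>c. U_act s \<rho> u b = s c b))"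


section \<open>The enveloping algebra is a ring and acts on every module\<close>

lemma free_ring_simps:
  "a \<oplus>\<^bsub>free_ring A\<^esub> b = a + b" "a \<otimes>\<^bsub>free_ring A\<^esub> b = a * b"
  "\<zero>\<^bsub>free_ring A\<^esub> = 0" "\<one>\<^bsub>free_ring A\<^esub> = 1"
  by (simp_all add: free_ring_def)

lemma in_free_ring_iff:
  "p \<in> carrier (free_ring A) \<longleftrightarrow> (\<forall>w \<in> Poly_Mapping.keys p. set (letters w) \<subseteq> A)"
  by (simp add: free_ring_def)

lemma ring_free_ring: "ring (free_ring A)"
proof -
  have add: "p + q \<in> carrier (free_ring A)"
    if "p \<in> carrier (free_ring A)" "q \<in> carrier (free_ring A)" for p q
    using that Poly_Mapping.keys_add[of p q] unfolding in_free_ring_iff by blast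
  have mult: "p * q \<in> carrier (free_ring A)"
    if p: "p \<in> carrier (free_ring A)" and q: "q \<in> carrier (free_ring A)" for p q
    unfolding in_free_ring_iff
  proof
    fix w assume "w \<in> Poly_Mapping.keys (p * q)"
    then obtain u v where "w = u + v" "u \<in> Poly_Mapping.keys p" "v \<in> Poly_Mapping.keys q"
      using Poly_Mapping.keys_mult[of p q] by blast
    then show "set (letters w) \<subseteq> A"
      using p q unfolding in_free_ring_iff plus_fword_def by simp
  qed
  have uminus: "- p \<in> carrier (free_ring A)" if "p \<in> carrier (free_ring A)" for p
    using that unfolding in_free_ring_iff
    by (metis in_keys_iff lookup_uminus neg_equal_0_iff_equal)
  have zero: "0 \<in> carrier (free_ring A)"
    by (simp add: in_free_ring_iff)
  have one: "1 \<in> carrier (free_ring A)"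
    by (simp add: in_free_ring_iff zero_fword_def)
  have "abelian_group (free_ring A)"
  proof (rule abelian_groupI, unfold free_ring_simps)
    fix p assume "p \<in> carrier (free_ring A)"
    then have "- p \<in> carrier (free_ring A)" by (rule uminus)
    then show "\<exists>q \<in> carrier (free_ring A). q + p = 0"
      using left_minus[of p] by blast
  qed (rule add zero add.assoc add.commute add_0_left; assumption)+
  moreover have "Group.monoid (free_ring A)"
    by (rule Group.monoidI, unfold free_ring_simps)
      (rule mult one mult.assoc mult_1_left mult_1_right; assumption)+
  ultimately show ?thesis
    by (rule ringI) (simp_all only: free_ring_simps distrib_left distrib_right)
qed

lemma monomial_in_carrier: "set xs \<subseteq> A \<Longrightarrow> monomial xs \<in> carrier (free_ring A)"
  by (auto simp: monomial_def free_ring_def)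

lemma free_const_in_carrier: "free_const c \<in> carrier (free_ring A)"
  by (auto simp: free_const_def free_ring_def zero_fword_def)

lemma minus_in_carrier:
  assumes "p \<in> carrier (free_ring A)" "q \<in> carrier (free_ring A)"
  shows "p - q \<in> carrier (free_ring A)"
  using assms keys_diff[of p q] by (auto simp: free_ring_def)

lemma env_rels_in_carrier: "env_rels n \<subseteq> carrier (free_ring (gl n))"
proof
  let ?R = "free_ring (gl n)"
  interpret R: ring ?R by (rule ring_free_ring)
  have scale: "free_const c * monomial [X] \<in> carrier ?R" if "X \<in> gl n" for c X
    using R.m_closed[OF free_const_in_carrier monomial_in_carrier, of "[X]" c] that
    by (simp add: free_ring_def)
  have mono: "monomial [X] \<in> carrier ?R" if "X \<in> gl n" for X
    using that by (intro monomial_in_carrier) simp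
  have mono2: "monomial [X, Y] \<in> carrier ?R" if "X \<in> gl n" "Y \<in> gl n" for X Y
    using that by (intro monomial_in_carrier) simp
  have bracket: "lie_bracket X Y \<in> gl n" if "X \<in> gl n" "Y \<in> gl n" for X Y
    using that unfolding lie_bracket_def by (intro minus_carrier_mat mult_carrier_mat)
  fix r assume "r \<in> env_rels n"
  then consider
      X Y where "X \<in> gl n" "Y \<in> gl n" "r = monomial [X + Y] - monomial [X] - monomial [Y]"
    | c X where "X \<in> gl n" "r = monomial [c \<cdot>\<^sub>m X] - free_const c * monomial [X]"
    | X Y where "X \<in> gl n" "Y \<in> gl n"
        "r = monomial [X, Y] - monomial [Y, X] - monomial [lie_bracket X Y]"
    unfolding env_rels_def by blast
  then show "r \<in> carrier ?R"
  proof cases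
    case 1
    show ?thesis unfolding 1(3)
      by (rule minus_in_carrier[OF minus_in_carrier[OF mono mono] mono]) (use 1(1,2) in simp_all)
  next
    case 2
    show ?thesis unfolding 2(2)
      by (rule minus_in_carrier[OF mono scale]) (use 2(1) in simp_all)
  next
    case 3
    show ?thesis unfolding 3(3)
      by (rule minus_in_carrier[OF minus_in_carrier[OF mono2 mono2] mono[OF bracket]]) (fact 3(1,2))+
  qed
qed

lemma ideal_env_ideal: "ideal (env_ideal n) (free_ring (gl n))"
  unfolding env_ideal_def by (rule ring.genideal_ideal[OF ring_free_ring env_rels_in_carrier])

lemma ring_U_gl: "ring (U_gl n)"
  unfolding U_gl_def by (rule ideal.quotient_is_ring[OF ideal_env_ideal])

context gl_module
begin

lemma foldr_rep_linear:
  "set xs \<subseteq> gl n \<Longrightarrow> Vector_Spaces.linear s s (foldr \<rho> xs)"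
proof (induction xs)
  case Nil
  then show ?case using linear_id by (simp add: id_def)
next
  case (Cons X xs)
  then show ?case
    using Vector_Spaces.linear_compose[of s s "foldr \<rho> xs" s "\<rho> X"] linear_rep[of X] by (simp add: comp_def)
qed

lemma free_act_superset:
  assumes "finite K" "Poly_Mapping.keys p \<subseteq> K"
  shows "free_act s \<rho> p v = (\<Sum>w \<in> K. s (Poly_Mapping.lookup p w) (foldr \<rho> (letters w) v))"
  unfolding free_act_def
  by (rule sum.mono_neutral_left) (use assms in \<open>auto simp: in_keys_iff\<close>)

lemma free_act_add: "free_act s \<rho> (p + q) v = free_act s \<rho> p v + free_act s \<rho> q v"
proof -
  let ?K = "Poly_Mapping.keys p \<union> Poly_Mapping.keys q"
  have "free_act s \<rho> r v = (\<Sum>w \<in> ?K. s (Poly_Mapping.lookup r w) (foldr \<rho> (letters w) v))"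
    if "Poly_Mapping.keys r \<subseteq> ?K" for r
    using that by (intro free_act_superset) auto
  then show ?thesis
    using Poly_Mapping.keys_add[of p q]
    by (simp add: lookup_add scale_left_distrib sum.distrib)
qed

lemma free_act_zero: "free_act s \<rho> 0 v = 0"
  by (simp add: free_act_def)

lemma free_act_sum: "free_act s \<rho> (\<Sum>i \<in> I. p i) v = (\<Sum>i \<in> I. free_act s \<rho> (p i) v)"
  by (induction I rule: infinite_finite_induct) (simp_all add: free_act_add free_act_zero)

lemma free_act_diff: "free_act s \<rho> (p - q) v = free_act s \<rho> p v - free_act s \<rho> q v"
  using free_act_add[of "p - q" q v] by (simp add: algebra_simps)

lemma free_act_single:
  "free_act s \<rho> (Poly_Mapping.single w c) v = s c (foldr \<rho> (letters w) v)"
  by (simp add: free_act_def)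

lemma free_act_linear:
  assumes "p \<in> carrier (free_ring (gl n))"
  shows "Vector_Spaces.linear s s (free_act s \<rho> p)"
proof -
  interpret vector_space_pair s s ..
  have "Vector_Spaces.linear s s (\<lambda>v. \<Sum>w \<in> Poly_Mapping.keys p.
      s (Poly_Mapping.lookup p w) (foldr \<rho> (letters w) v))"
  proof (rule linear_compose_sum, rule ballI, rule linear_compose_scale_right)
    fix w assume "w \<in> Poly_Mapping.keys p"
    then have "set (letters w) \<subseteq> gl n" using assms by (auto simp: free_ring_def)
    then show "Vector_Spaces.linear s s (foldr \<rho> (letters w))" by (rule foldr_rep_linear)
  qed
  then show ?thesis by (simp add: free_act_def[abs_def])
qed

lemma poly_mapping_sum_single:
  fixes p :: "'x \<Rightarrow>\<^sub>0 complex"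
  shows "p = (\<Sum>w \<in> Poly_Mapping.keys p. Poly_Mapping.single w (Poly_Mapping.lookup p w))"
  by (rule poly_mapping_eqI) (auto simp: lookup_sum lookup_single when_def in_keys_iff)

lemma free_act_mult:
  assumes p: "p \<in> carrier (free_ring (gl n))" and q: "q \<in> carrier (free_ring (gl n))"
  shows "free_act s \<rho> (p * q) v = free_act s \<rho> p (free_act s \<rho> q v)"
proof -
  let ?S = "\<lambda>r. \<Sum>w \<in> Poly_Mapping.keys r. Poly_Mapping.single w (Poly_Mapping.lookup r w)"
  have "p * q = ?S p * ?S q"
    by (rule arg_cong2[where f = "(*)"]; rule poly_mapping_sum_single)
  also have "\<dots> = (\<Sum>u \<in> Poly_Mapping.keys p. \<Sum>w \<in> Poly_Mapping.keys q.
      Poly_Mapping.single (u + w) (Poly_Mapping.lookup p u * Poly_Mapping.lookup q w))"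
    by (simp only: sum_product mult_single)
  finally have "free_act s \<rho> (p * q) v = free_act s \<rho> (\<Sum>u \<in> Poly_Mapping.keys p.
      \<Sum>w \<in> Poly_Mapping.keys q.
        Poly_Mapping.single (u + w) (Poly_Mapping.lookup p u * Poly_Mapping.lookup q w)) v"
    by (simp only:)
  also have "\<dots> =
    (\<Sum>u \<in> Poly_Mapping.keys p. \<Sum>w \<in> Poly_Mapping.keys q.
       s (Poly_Mapping.lookup p u * Poly_Mapping.lookup q w) (foldr \<rho> (letters u) (foldr \<rho> (letters w) v)))"
    by (simp add: free_act_sum free_act_single plus_fword_def)
  also have "\<dots> = (\<Sum>u \<in> Poly_Mapping.keys p. s (Poly_Mapping.lookup p u)
      (foldr \<rho> (letters u) (free_act s \<rho> q v)))"
  proof (rule sum.cong[OF refl])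
    fix u assume "u \<in> Poly_Mapping.keys p"
    then have "set (letters u) \<subseteq> gl n" using p by (auto simp: free_ring_def)
    then have "Vector_Spaces.linear s s (foldr \<rho> (letters u))" by (rule foldr_rep_linear)
    then interpret u: Vector_Spaces.linear s s "foldr \<rho> (letters u)" .
    show "(\<Sum>w \<in> Poly_Mapping.keys q.
        s (Poly_Mapping.lookup p u * Poly_Mapping.lookup q w) (foldr \<rho> (letters u) (foldr \<rho> (letters w) v)))
      = s (Poly_Mapping.lookup p u) (foldr \<rho> (letters u) (free_act s \<rho> q v))"
      by (simp add: free_act_def[of s \<rho> q] u.sum u.scale scale_sum_right scale_scale)
  qed
  finally show ?thesis by (simp add: free_act_def)
qed

lemma free_act_env_ideal:
  assumes "p \<in> env_ideal n"
  shows "free_act s \<rho> p v = 0"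
proof -
  let ?R = "free_ring (gl n)"
  let ?I = "{p \<in> carrier ?R. \<forall>v. free_act s \<rho> p v = 0}"
  interpret R: ring ?R by (rule ring_free_ring)
  have eqs: "a \<oplus>\<^bsub>?R\<^esub> b = a + b" "a \<otimes>\<^bsub>?R\<^esub> b = a * b" "\<zero>\<^bsub>?R\<^esub> = 0" for a b
    by (simp_all add: free_ring_def)
  have inv: "\<ominus>\<^bsub>?R\<^esub> a = - a" if "a \<in> carrier ?R" for a
    using R.r_neg[OF that] by (simp add: eqs eq_neg_iff_add_eq_0 add.commute)
  have lin0: "free_act s \<rho> a 0 = 0" if "a \<in> carrier ?R" for a
  proof -
    interpret a: Vector_Spaces.linear s s "free_act s \<rho> a" by (rule free_act_linear[OF that])
    show ?thesis by (rule a.zero)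
  qed
  have "ideal ?I ?R"
  proof (rule idealI)
    show "subgroup ?I (add_monoid ?R)"
    proof (rule R.add.subgroupI)
      show "?I \<noteq> {}" using R.zero_closed free_act_zero by (auto simp: eqs)
      fix a assume a: "a \<in> ?I"
      have "free_act s \<rho> (- a) w = 0" for w
        using a free_act_diff[of 0 a w] by (simp add: free_act_zero)
      then show "\<ominus>\<^bsub>?R\<^esub> a \<in> ?I" using a R.a_inv_closed[of a] by (simp add: inv)
    next
      fix a b assume "a \<in> ?I" "b \<in> ?I"
      then show "a \<oplus>\<^bsub>?R\<^esub> b \<in> ?I"
        using R.a_closed[of a b] by (simp add: eqs free_act_add)
    qed auto
  next
    fix a x assume a: "a \<in> ?I" and x: "x \<in> carrier ?R"
    then show "x \<otimes>\<^bsub>?R\<^esub> a \<in> ?I" "a \<otimes>\<^bsub>?R\<^esub> x \<in> ?I"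
      using R.m_closed[of x a] R.m_closed[of a x] by (simp_all add: eqs free_act_mult lin0)
  qed (rule ring_free_ring)
  moreover have "env_rels n \<subseteq> ?I"
  proof -
    have "free_act s \<rho> r w = 0" if "r \<in> env_rels n" for r w
      using that
      by (auto simp: env_rels_def free_act_diff free_act_single monomial_def free_const_def
          mult_single rep_add rep_scale rep_lie)
    then show ?thesis using env_rels_in_carrier by auto
  qed
  ultimately have "env_ideal n \<subseteq> ?I"
    unfolding env_ideal_def by (rule R.genideal_minimal)
  then show ?thesis using assms by auto
qed

lemma U_act_class:
  assumes "u \<in> carrier (U_gl n)" "p \<in> u"
  shows "U_act s \<rho> u v = free_act s \<rho> p v"
proof -
  interpret I: ideal "env_ideal n" "free_ring (gl n)" by (rule ideal_env_ideal)
  obtain r where u: "u = {i + r | i. i \<in> env_ideal n}"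
    using assms(1)
    by (auto simp: U_gl_def FactRing_def A_RCOSETS_def' a_r_coset_def' free_ring_def)
  have "free_act s \<rho> q v = free_act s \<rho> r v" if "q \<in> u" for q
    using that by (auto simp: u free_act_add free_act_env_ideal)
  then show ?thesis
    using assms(2) someI[of "\<lambda>q. q \<in> u" p] by (simp add: U_act_def)
qed

end

end

theory Submission
  imports Defs "HOL-Combinatorics.Cycles" "HOL-Computational_Algebra.Fundamental_Theorem_Algebra"
    "HOL-Library.Product_Plus" "HOL-Analysis.Continuum_Not_Denumerable"
begin

text \<open>Write \<open>\<lambda>\<^sub>k\<^sub>i = l\<^sub>k\<^sub>i + k - 1\<close> for the shifted entries of a tableau. The centre of the
enveloping algebra of the k-th corner is generated by the traces \<open>casimir k j\<close> of the powers of the matrix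
of generators (\<open>centre_generated\<close>, proved through invariant tensors and \<open>schur_weyl\<close>). It is also
generated by the coefficients of the Capelli determinant \<open>C k u\<close>, a polynomial in u, because Newton's
identities relate the two families (\<open>newton_low\<close>, \<open>newton_high\<close>). Hence a joint eigenvector of the
Gelfand-Tsetlin subalgebra is the same as a vector v with
\<open>C k u v = (\<Prod>i. u - \<lambda>\<^sub>k\<^sub>i) v\<close> for all k and u, and comparison with the values of
the \<open>\<gamma>\<close> polynomials shows that \<open>\<lambda>\<close> is the tableau of its maximal ideal. Every maximal ideal
with a nonzero component yields such a vector: a nonzero vector killed by the ideal exists, and as the
module has countable dimension over an uncountable algebraically closed field, every element of the
subalgebra acts on it by a scalar (\<open>eigenvalue_exists\<close>).

Let v be such a weight vector, with pairwise distinct entries in each row, and put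
\<open>x\<^sub>i = C k \<lambda>\<^sub>k\<^sub>i E\<^sub>k\<^sub>,\<^sub>k\<^sub>+\<^sub>1 v\<close>. The commutation rule between \<open>C k u\<close>
and a vector operator shows that \<open>x\<^sub>i\<close> is a weight vector whose entry \<open>\<lambda>\<^sub>k\<^sub>i\<close> is raised
by one, and that \<open>E\<^sub>k\<^sub>,\<^sub>k\<^sub>+\<^sub>1 v\<close> is a combination of the \<open>x\<^sub>i\<close> (\<open>row_shift\<close>,
\<open>pair_sum\<close>); lowering works in the same way. So in a non-critical module all weight vectors obtained
from v by such moves are again of this kind, they span the submodule generated by v, and an irreducible
module is spanned by joint eigenvectors. This is tameness.

For uniqueness, the key is that the submodule generated by v meets the weight space of v only in the line
of v (\<open>orbit_weight\<close>). A raise followed by the opposite lowering is a scalar, by an explicit computation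
with the Capelli adjugate (\<open>lower_raise\<close>), and a raise and a lowering at different places commute
(\<open>move_commute\<close>). Hence a sequence of moves can be sorted and cancelled, and it acts by a scalar
as soon as its net displacement vanishes. It remains to see that a sequence of moves leading
back to the same character has net displacement zero. Entries of one row that differ by an integer can never
meet on the way, as a meeting would give a nonzero critical weight vector; so they keep
their order, and an order preserving rearrangement of a finite set by integer shifts is the identity
(\<open>order_pres_same_rows\<close>). Finally, if V and W are irreducible with weight vectors v and w for the same
maximal ideal, the submodule of \<open>V \<times> W\<close> generated by \<open>(v, w)\<close> contains neither
\<open>(v, 0)\<close> nor \<open>(0, w)\<close>, so it is the graph of an isomorphism (\<open>common_weight_isomorphic\<close>).\<close>

text \<open>Rows and matrices are indexed from 1; lower bounds of intervals are kept in this form.\<close>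

declare One_nat_def [simp del]

section \<open>Commutators\<close>

definition br :: "'a::ring \<Rightarrow> 'a \<Rightarrow> 'a"
  where "br x y = x * y - y * x"

lemma br_0 [simp]: "br x 0 = 0" "br 0 x = 0"
  by (simp_all add: br_def)

lemma br_1 [simp]: "br (x::'a::ring_1) 1 = 0" "br (1::'a) x = 0"
  by (simp_all add: br_def)

lemma br_self [simp]: "br x x = 0"
  by (simp add: br_def)

lemma br_add: "br x (y + z) = br x y + br x z" "br (x + y) z = br x z + br y z"
  by (simp_all add: br_def algebra_simps)

lemma br_diff: "br x (y - z) = br x y - br x z" "br (x - y) z = br x z - br y z"
  by (simp_all add: br_def algebra_simps)

lemma br_minus: "br x (- y) = - br x y" "br (- x) y = - br x y"
  by (simp_all add: br_def algebra_simps)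

lemma br_sum: "br x (\<Sum>i\<in>I. f i) = (\<Sum>i\<in>I. br x (f i))"
  by (simp add: br_def sum_distrib_left sum_distrib_right sum_subtractf)

lemma br_mult: "br x (y * z) = br x y * z + y * br x z"
  by (simp add: br_def algebra_simps)

lemma br_mult_left: "br (x * y) z = x * br y z + br x z * y"
  by (simp add: br_def algebra_simps)

lemma br_sum_left: "br (\<Sum>i\<in>I. F i) x = (\<Sum>i\<in>I. br (F i) x)"
  by (simp add: br_def sum_distrib_left sum_distrib_right sum_subtractf)

lemma br_if: "br x (if b then y else z) = (if b then br x y else br x z)"
  by simp

lemma br_swap: "br x y = - br y x"
  by (simp add: br_def)

lemma br_jacobi: "br x (br y z) = br (br x y) z + br y (br x z)"
  by (simp add: br_def algebra_simps)

lemma br_eq_0: "br x y = 0 \<longleftrightarrow> x * y = y * x"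
  by (simp add: br_def)

lemma if_times: "(if b then x else 0) * y = (if b then x * y else (0::'a::ring))"
  "y * (if b then x else 0) = (if b then y * x else (0::'a::ring))"
  by simp_all

section \<open>The Capelli determinant and its adjugate\<close>

text \<open>The commutation relations of the matrix units in an arbitrary ring, with central scalars. Both the
enveloping algebra and its twist by \<open>E i j \<mapsto> - E j i\<close> (\<open>twist_family\<close> below) are instances.\<close>

locale gl_family =
  fixes E :: "nat \<Rightarrow> nat \<Rightarrow> 'a::ring_1" and sc :: "complex \<Rightarrow> 'a" and n :: nat
  assumes sc_add: "sc (a + b) = sc a + sc b"
    and sc_mult: "sc (a * b) = sc a * sc b"
    and sc_1 [simp]: "sc 1 = 1"
    and sc_comm: "sc a * x = x * sc a"
    and E_br: "\<lbrakk>i \<in> {1..n}; j \<in> {1..n}; k \<in> {1..n}; l \<in> {1..n}\<rbrakk> \<Longrightarrow>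
      br (E i j) (E k l) = (if j = k then E i l else 0) - (if i = l then E k j else 0)"
begin

lemma sc_0 [simp]: "sc 0 = 0"
  using sc_add[of 0 0] by simp

lemma sc_minus: "sc (- a) = - sc a"
  using sc_add[of a "- a"] by (simp add: eq_neg_iff_add_eq_0 add.commute)

lemma sc_diff: "sc (a - b) = sc a - sc b"
  using sc_add[of a "- b"] by (simp add: sc_minus)

lemma sc_sum: "sc (\<Sum>i\<in>I. f i) = (\<Sum>i\<in>I. sc (f i))"
  by (induction I rule: infinite_finite_induct) (simp_all add: sc_add)

lemma br_sc [simp]: "br x (sc a) = 0" "br (sc a) x = 0"
  by (simp_all add: br_def sc_comm)

lemma sc_cancel: "sc a * x = 0 \<Longrightarrow> a \<noteq> 0 \<Longrightarrow> x = 0"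
  by (metis sc_mult sc_1 mult.assoc mult_1_left mult_zero_right left_inverse)

text \<open>\<open>C k u\<close> is the column determinant \<open>det (u - E)\<close> of the k-th corner with its usual diagonal shifts,
and \<open>A k u\<close> the corresponding adjugate. Both are defined by expansion along the last row and column.
Since the entries do not commute, the recursion carries the pair, and the corner block of the adjugate is
written with a commutator in place of a product.\<close>

primrec CA :: "nat \<Rightarrow> (complex \<Rightarrow> 'a) \<times> (complex \<Rightarrow> nat \<Rightarrow> nat \<Rightarrow> 'a)" where
  "CA 0 = (\<lambda>u. 1, \<lambda>u a b. 0)"
| "CA (Suc k) =
    (\<lambda>u. fst (CA k) (u - 1) * (sc u - E (Suc k) (Suc k))
        - (\<Sum>a=1..k. E (Suc k) a * (\<Sum>b=1..k. snd (CA k) (u - 1) a b * E b (Suc k))),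
     \<lambda>u a b.
       if a = Suc k then
         if b = Suc k then fst (CA k) (u - 1) else (\<Sum>c=1..k. E (Suc k) c * snd (CA k) (u - 1) c b)
       else if b = Suc k then (\<Sum>c=1..k. snd (CA k) (u - 1) a c * E c (Suc k))
       else (if a = b then fst (CA k) (u - 1) else 0)
         + br (E a (Suc k)) (\<Sum>c=1..k. E (Suc k) c * snd (CA k) (u - 1) c b))"

definition C :: "nat \<Rightarrow> complex \<Rightarrow> 'a" where "C k = fst (CA k)"

definition A :: "nat \<Rightarrow> complex \<Rightarrow> nat \<Rightarrow> nat \<Rightarrow> 'a" where "A k = snd (CA k)"

lemma C_0 [simp]: "C 0 u = 1"
  by (simp add: C_def)

lemma C_Suc: "C (Suc k) u = C k (u - 1) * (sc u - E (Suc k) (Suc k))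
    - (\<Sum>a=1..k. E (Suc k) a * (\<Sum>b=1..k. A k (u - 1) a b * E b (Suc k)))"
  by (simp add: C_def A_def)

lemma A_Suc:
  "A (Suc k) u (Suc k) (Suc k) = C k (u - 1)"
  "b \<le> k \<Longrightarrow> A (Suc k) u (Suc k) b = (\<Sum>c=1..k. E (Suc k) c * A k (u - 1) c b)"
  "a \<le> k \<Longrightarrow> A (Suc k) u a (Suc k) = (\<Sum>c=1..k. A k (u - 1) a c * E c (Suc k))"
  "a \<le> k \<Longrightarrow> b \<le> k \<Longrightarrow> A (Suc k) u a b = (if a = b then C k (u - 1) else 0)
      + br (E a (Suc k)) (\<Sum>c=1..k. E (Suc k) c * A k (u - 1) c b)"
  by (auto simp: C_def A_def)

lemma comm_CA:
  assumes "\<And>a b. a \<in> {1..k} \<Longrightarrow> b \<in> {1..k} \<Longrightarrow> br x (E a b) = 0"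
  shows "br x (C k u) = 0 \<and> (\<forall>a\<in>{1..k}. \<forall>b\<in>{1..k}. br x (A k u a b) = 0)"
  using assms
proof (induction k arbitrary: u)
  case (Suc k)
  have IH: "br x (C k u) = 0" "a \<in> {1..k} \<Longrightarrow> b \<in> {1..k} \<Longrightarrow> br x (A k u a b) = 0" for u a b
    using Suc by auto
  have E: "br x (E a b) = 0" if "a \<in> {1..Suc k}" "b \<in> {1..Suc k}" for a b
    using Suc.prems that by blast
  have be: "br x (\<Sum>c=1..k. E (Suc k) c * A k (u - 1) c b) = 0" if "b \<in> {1..k}" for b u
    using that by (simp add: br_sum br_mult E IH)
  have al: "br x (\<Sum>c=1..k. A k (u - 1) b c * E c (Suc k)) = 0" if "b \<in> {1..k}" for b u
    using that by (simp add: br_sum br_mult E IH)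
  have C: "br x (C (Suc k) u) = 0"
    by (simp add: C_Suc br_sum br_mult br_diff E IH al)
  have "br x (A (Suc k) u a b) = 0" if "a \<in> {1..Suc k}" "b \<in> {1..Suc k}" for a b
  proof -
    have "a = Suc k \<or> a \<in> {1..k}" "b = Suc k \<or> b \<in> {1..k}"
      using that by auto
    then show ?thesis
      using be al by (elim disjE) (simp_all add: A_Suc IH br_add br_if E br_jacobi[of x])
  qed
  with C show ?case by simp
qed simp

text \<open>Four ways in which elements can transform under the adjoint action of the k-th corner: as scalars, as
vectors, as covectors and as matrices. All identities below are equalities between families of one of these types.\<close>

definition ginv :: "nat \<Rightarrow> 'a \<Rightarrow> bool"
  where "ginv k x \<longleftrightarrow> (\<forall>i\<in>{1..k}. \<forall>j\<in>{1..k}. br (E i j) x = 0)"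

definition gvec :: "nat \<Rightarrow> (nat \<Rightarrow> 'a) \<Rightarrow> bool"
  where "gvec k g \<longleftrightarrow> (\<forall>i\<in>{1..k}. \<forall>j\<in>{1..k}. \<forall>c\<in>{1..k}. br (E i j) (g c) = (if j = c then g i else 0))"

definition gcov :: "nat \<Rightarrow> (nat \<Rightarrow> 'a) \<Rightarrow> bool"
  where "gcov k h \<longleftrightarrow> (\<forall>i\<in>{1..k}. \<forall>j\<in>{1..k}. \<forall>c\<in>{1..k}. br (E i j) (h c) = - (if i = c then h j else 0))"

definition gadj :: "nat \<Rightarrow> (nat \<Rightarrow> nat \<Rightarrow> 'a) \<Rightarrow> bool"
  where "gadj k X \<longleftrightarrow> (\<forall>i\<in>{1..k}. \<forall>j\<in>{1..k}. \<forall>c\<in>{1..k}. \<forall>d\<in>{1..k}.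
    br (E i j) (X c d) = (if j = c then X i d else 0) - (if i = d then X c j else 0))"

lemma ginvD: "ginv k x \<Longrightarrow> i \<in> {1..k} \<Longrightarrow> j \<in> {1..k} \<Longrightarrow> br (E i j) x = 0"
  by (simp add: ginv_def)

lemma gvecD: "gvec k g \<Longrightarrow> i \<in> {1..k} \<Longrightarrow> j \<in> {1..k} \<Longrightarrow> c \<in> {1..k} \<Longrightarrow>
    br (E i j) (g c) = (if j = c then g i else 0)"
  by (simp add: gvec_def)

lemma gcovD: "gcov k h \<Longrightarrow> i \<in> {1..k} \<Longrightarrow> j \<in> {1..k} \<Longrightarrow> c \<in> {1..k} \<Longrightarrow>
    br (E i j) (h c) = - (if i = c then h j else 0)"
  by (simp add: gcov_def)

lemma gadjD: "gadj k X \<Longrightarrow> i \<in> {1..k} \<Longrightarrow> j \<in> {1..k} \<Longrightarrow> c \<in> {1..k} \<Longrightarrow> d \<in> {1..k} \<Longrightarrow>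
    br (E i j) (X c d) = (if j = c then X i d else 0) - (if i = d then X c j else 0)"
  by (simp add: gadj_def)

lemma gadj_E: "k \<le> n \<Longrightarrow> gadj k E"
  unfolding gadj_def using E_br by auto

lemma gadj_mult:
  assumes X: "gadj k X" and Y: "gadj k Y"
  shows "gadj k (\<lambda>a b. \<Sum>c=1..k. X a c * Y c b)"
  unfolding gadj_def
proof (intro ballI)
  fix i j a d assume i: "i \<in> {1..k}" and j: "j \<in> {1..k}" and "a \<in> {1..k}" "d \<in> {1..k}"
  then have "br (E i j) (\<Sum>c=1..k. X a c * Y c d) = (\<Sum>c=1..k.
      (if j = a then X i c * Y c d else 0) - (if i = c then X a j * Y c d else 0)
      + (if j = c then X a c * Y i d else 0) - (if i = d then X a c * Y c j else 0))"
    unfolding br_sum br_mult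
    by (intro sum.cong refl) (simp add: gadjD[OF X] gadjD[OF Y] ring_distribs)
  also have "\<dots> = (if j = a then \<Sum>c=1..k. X i c * Y c d else 0) - (if i = d then \<Sum>c=1..k. X a c * Y c j else 0)"
    using i j by (simp add: sum.distrib sum_subtractf)
  finally show "br (E i j) (\<Sum>c=1..k. X a c * Y c d) =
    (if j = a then \<Sum>c=1..k. X i c * Y c d else 0) - (if i = d then \<Sum>c=1..k. X a c * Y c j else 0)" .
qed

lemma gadj_gvec:
  assumes X: "gadj k X" and g: "gvec k g"
  shows "gvec k (\<lambda>a. \<Sum>c=1..k. X a c * g c)"
  unfolding gvec_def
proof (intro ballI)
  fix i j a assume i: "i \<in> {1..k}" and j: "j \<in> {1..k}" and "a \<in> {1..k}"
  then have "br (E i j) (\<Sum>c=1..k. X a c * g c) = (\<Sum>c=1..k.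
      (if j = a then X i c * g c else 0) - (if i = c then X a j * g c else 0) + (if j = c then X a c * g i else 0))"
    unfolding br_sum br_mult
    by (intro sum.cong refl) (simp add: gadjD[OF X] gvecD[OF g] ring_distribs)
  also have "\<dots> = (if j = a then \<Sum>c=1..k. X i c * g c else 0)"
    using i j by (simp add: sum.distrib sum_subtractf)
  finally show "br (E i j) (\<Sum>c=1..k. X a c * g c) = (if j = a then \<Sum>c=1..k. X i c * g c else 0)" .
qed

lemma gcov_gadj:
  assumes X: "gadj k X" and h: "gcov k h"
  shows "gcov k (\<lambda>a. \<Sum>c=1..k. h c * X c a)"
  unfolding gcov_def
proof (intro ballI)
  fix i j a assume i: "i \<in> {1..k}" and j: "j \<in> {1..k}" and "a \<in> {1..k}"
  then have "br (E i j) (\<Sum>c=1..k. h c * X c a) = (\<Sum>c=1..k.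
      (if j = c then h c * X i a else 0) - (if i = a then h c * X c j else 0) - (if i = c then h j * X c a else 0))"
    unfolding br_sum br_mult
    by (intro sum.cong refl) (simp add: gadjD[OF X] gcovD[OF h] ring_distribs)
  also have "\<dots> = - (if i = a then \<Sum>c=1..k. h c * X c j else 0)"
    using i j by (simp add: sum.distrib sum_subtractf)
  finally show "br (E i j) (\<Sum>c=1..k. h c * X c a) = - (if i = a then \<Sum>c=1..k. h c * X c j else 0)" .
qed

lemma gcov_gvec:
  assumes h: "gcov k h" and g: "gvec k g"
  shows "ginv k (\<Sum>c=1..k. h c * g c)"
  unfolding ginv_def
proof (intro ballI)
  fix i j assume i: "i \<in> {1..k}" and j: "j \<in> {1..k}"
  then have "br (E i j) (\<Sum>c=1..k. h c * g c) = (\<Sum>c=1..k.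
      (if j = c then h c * g i else 0) - (if i = c then h j * g c else 0))"
    unfolding br_sum br_mult
    by (intro sum.cong refl) (simp add: gcovD[OF h] gvecD[OF g] ring_distribs)
  also have "\<dots> = 0"
    using i j by (simp add: sum_subtractf)
  finally show "br (E i j) (\<Sum>c=1..k. h c * g c) = 0" .
qed

lemma gadj_trace: "gadj k X \<Longrightarrow> ginv k (\<Sum>c=1..k. X c c)"
  unfolding ginv_def by (simp add: br_sum sum_subtractf gadjD)

lemma gadj_diff: "gadj k X \<Longrightarrow> gadj k Y \<Longrightarrow> gadj k (\<lambda>a b. X a b - Y a b)"
  unfolding gadj_def by (simp add: br_diff)

lemma gadj_sc: "gadj k X \<Longrightarrow> gadj k (\<lambda>a b. sc u * X a b)"
  unfolding gadj_def by (simp add: br_mult right_diff_distrib)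

lemma gadj_delta: "ginv k x \<Longrightarrow> gadj k (\<lambda>a b. if a = b then x else 0)"
  unfolding gadj_def ginv_def by simp

lemma gvec_add: "gvec k g \<Longrightarrow> gvec k h \<Longrightarrow> gvec k (\<lambda>c. g c + h c)"
  unfolding gvec_def by (auto simp: br_add)

lemma gvec_diff: "gvec k g \<Longrightarrow> gvec k h \<Longrightarrow> gvec k (\<lambda>c. g c - h c)"
  unfolding gvec_def by (auto simp: br_diff)

lemma gcov_diff: "gcov k g \<Longrightarrow> gcov k h \<Longrightarrow> gcov k (\<lambda>c. g c - h c)"
  unfolding gcov_def by (auto simp: br_diff)

lemma ginv_gvec: "ginv k x \<Longrightarrow> gvec k g \<Longrightarrow> gvec k (\<lambda>c. br x (g c))"
  unfolding gvec_def ginv_def by (simp add: br_jacobi[of "E i j" for i j])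

lemma ginv_gcov: "ginv k x \<Longrightarrow> gcov k g \<Longrightarrow> gcov k (\<lambda>c. br x (g c))"
  unfolding gcov_def ginv_def by (simp add: br_jacobi[of "E i j" for i j] br_minus)

lemma gadj_zero_col:
  assumes "gadj k X" "\<And>a. a \<in> {1..k} \<Longrightarrow> X a k = 0" "a \<in> {1..k}" "b \<in> {1..k}"
  shows "X a b = 0"
  using gadjD[OF assms(1), of k b a k] assms by (auto split: if_splits)

lemma gadj_zero_row:
  assumes "gadj k X" "\<And>a. a \<in> {1..k} \<Longrightarrow> X k a = 0" "a \<in> {1..k}" "b \<in> {1..k}"
  shows "X a b = 0"
  using gadjD[OF assms(1), of a k k b] assms by (auto split: if_splits)

text \<open>A family of vector type is determined by its last entry, since \<open>E a k\<close> carries entry k to entry a. This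
reduces most identities to a single index, for which the recursion is simplest.\<close>

lemma gvec_zero: "gvec k g \<Longrightarrow> g k = 0 \<Longrightarrow> a \<in> {1..k} \<Longrightarrow> g a = 0"
  using gvecD[of k g a k k] by auto

lemma gcov_zero: "gcov k g \<Longrightarrow> g k = 0 \<Longrightarrow> a \<in> {1..k} \<Longrightarrow> g a = 0"
  using gcovD[of k g k a k] by auto

text \<open>All the properties of the determinant and the adjugate that the induction on k has to carry: equivariance, the
two Cayley identities, the trace, the commutators of the determinant with vectors and covectors,
the fact that a commuting vector commutes with its image under the adjugate, and a divergence formula. The last
three are there only because the induction step needs them.\<close>

definition capelli :: "nat \<Rightarrow> bool" where
  "capelli k \<longleftrightarrow> (\<forall>u.
     ginv k (C k u) \<and> gadj k (A k u) \<and>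
     (\<forall>a\<in>{1..k}. \<forall>b\<in>{1..k}. sc u * A k u a b - (\<Sum>c=1..k. E a c * A k u c b) = (if a = b then C k u else 0)) \<and>
     (\<forall>a\<in>{1..k}. \<forall>b\<in>{1..k}. sc u * A k u a b - (\<Sum>c=1..k. A k u a c * E c b) = (if a = b then C k u else 0)) \<and>
     (\<Sum>c=1..k. A k u c c) = C k u - C k (u - 1) \<and>
     (\<forall>g. gvec k g \<longrightarrow> (\<forall>c\<in>{1..k}. br (C k u) (g c) = - (\<Sum>a=1..k. A k u c a * g a))) \<and>
     (\<forall>h. gcov k h \<longrightarrow> (\<forall>c\<in>{1..k}. br (C k u) (h c) = (\<Sum>a=1..k. h a * A k u a c))) \<and>
     (\<forall>g. gvec k g \<longrightarrow> (\<forall>a\<in>{1..k}. \<forall>b\<in>{1..k}. br (g a) (g b) = 0) \<longrightarrow>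
        (\<forall>a\<in>{1..k}. \<forall>b\<in>{1..k}. br (g a) (\<Sum>c=1..k. A k u b c * g c) = 0)) \<and>
     (\<forall>h. gcov k h \<longrightarrow> (\<forall>a\<in>{1..k}. \<forall>b\<in>{1..k}. br (h a) (h b) = 0) \<longrightarrow>
        (\<forall>a\<in>{1..k}. \<forall>b\<in>{1..k}. br (h a) (\<Sum>c=1..k. h c * A k u c b) = 0)) \<and>
     (\<forall>g. gvec k g \<longrightarrow> (\<forall>b\<in>{1..k}. (\<Sum>a=1..k. br (g a) (A k u b a)) =
        (\<Sum>c=1..k. A k (u - 1) b c * g c) - (\<Sum>c=1..k. A k u b c * g c))))"

lemma capelliD:
  assumes "capelli k"
  shows "ginv k (C k u)" "gadj k (A k u)"
    "\<lbrakk>a \<in> {1..k}; b \<in> {1..k}\<rbrakk> \<Longrightarrow> sc u * A k u a b - (\<Sum>c=1..k. E a c * A k u c b) = (if a = b then C k u else 0)"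
    "\<lbrakk>a \<in> {1..k}; b \<in> {1..k}\<rbrakk> \<Longrightarrow> sc u * A k u a b - (\<Sum>c=1..k. A k u a c * E c b) = (if a = b then C k u else 0)"
    "(\<Sum>c=1..k. A k u c c) = C k u - C k (u - 1)"
    "\<lbrakk>gvec k g; c \<in> {1..k}\<rbrakk> \<Longrightarrow> br (C k u) (g c) = - (\<Sum>a=1..k. A k u c a * g a)"
    "\<lbrakk>gcov k g; c \<in> {1..k}\<rbrakk> \<Longrightarrow> br (C k u) (g c) = (\<Sum>a=1..k. g a * A k u a c)"
    "\<lbrakk>gvec k g; \<And>a b. \<lbrakk>a \<in> {1..k}; b \<in> {1..k}\<rbrakk> \<Longrightarrow> br (g a) (g b) = 0; a \<in> {1..k}; b \<in> {1..k}\<rbrakk> \<Longrightarrow>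
        br (g a) (\<Sum>c=1..k. A k u b c * g c) = 0"
    "\<lbrakk>gcov k g; \<And>a b. \<lbrakk>a \<in> {1..k}; b \<in> {1..k}\<rbrakk> \<Longrightarrow> br (g a) (g b) = 0; a \<in> {1..k}; b \<in> {1..k}\<rbrakk> \<Longrightarrow>
        br (g a) (\<Sum>c=1..k. g c * A k u c b) = 0"
    "\<lbrakk>gvec k g; b \<in> {1..k}\<rbrakk> \<Longrightarrow> (\<Sum>a=1..k. br (g a) (A k u b a)) =
        (\<Sum>c=1..k. A k (u - 1) b c * g c) - (\<Sum>c=1..k. A k u b c * g c)"
proof -
  note H1 = assms[unfolded capelli_def, THEN spec, of u]
  note H2 = conjunct2[OF H1] note H3 = conjunct2[OF H2] note H4 = conjunct2[OF H3]
  note H5 = conjunct2[OF H4] note H6 = conjunct2[OF H5] note H7 = conjunct2[OF H6]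
  note H8 = conjunct2[OF H7] note H9 = conjunct2[OF H8] note H10 = conjunct2[OF H9]
  show "ginv k (C k u)" by (rule conjunct1[OF H1])
  show "gadj k (A k u)" by (rule conjunct1[OF H2])
  show "\<lbrakk>a \<in> {1..k}; b \<in> {1..k}\<rbrakk> \<Longrightarrow> sc u * A k u a b - (\<Sum>c=1..k. E a c * A k u c b) = (if a = b then C k u else 0)"
    using conjunct1[OF H3] by blast
  show "\<lbrakk>a \<in> {1..k}; b \<in> {1..k}\<rbrakk> \<Longrightarrow> sc u * A k u a b - (\<Sum>c=1..k. A k u a c * E c b) = (if a = b then C k u else 0)"
    using conjunct1[OF H4] by blast
  show "(\<Sum>c=1..k. A k u c c) = C k u - C k (u - 1)" by (rule conjunct1[OF H5])
  show "\<lbrakk>gvec k g; c \<in> {1..k}\<rbrakk> \<Longrightarrow> br (C k u) (g c) = - (\<Sum>a=1..k. A k u c a * g a)"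
    using conjunct1[OF H6] by blast
  show "\<lbrakk>gcov k g; c \<in> {1..k}\<rbrakk> \<Longrightarrow> br (C k u) (g c) = (\<Sum>a=1..k. g a * A k u a c)"
    using conjunct1[OF H7] by blast
  show "\<lbrakk>gvec k g; \<And>a b. \<lbrakk>a \<in> {1..k}; b \<in> {1..k}\<rbrakk> \<Longrightarrow> br (g a) (g b) = 0; a \<in> {1..k}; b \<in> {1..k}\<rbrakk> \<Longrightarrow>
        br (g a) (\<Sum>c=1..k. A k u b c * g c) = 0"
    using conjunct1[OF H8] by blast
  show "\<lbrakk>gcov k g; \<And>a b. \<lbrakk>a \<in> {1..k}; b \<in> {1..k}\<rbrakk> \<Longrightarrow> br (g a) (g b) = 0; a \<in> {1..k}; b \<in> {1..k}\<rbrakk> \<Longrightarrow>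
        br (g a) (\<Sum>c=1..k. g c * A k u c b) = 0"
    using conjunct1[OF H9] by blast
  show "\<lbrakk>gvec k g; b \<in> {1..k}\<rbrakk> \<Longrightarrow> (\<Sum>a=1..k. br (g a) (A k u b a)) =
        (\<Sum>c=1..k. A k (u - 1) b c * g c) - (\<Sum>c=1..k. A k u b c * g c)"
    using H10 by blast
qed

lemma capelli_0: "capelli 0"
  unfolding capelli_def by (simp add: ginv_def gadj_def)

context
  fixes k :: nat
  assumes k: "Suc k \<le> n" and cap: "capelli k"
begin

declare atLeastAtMost_iff [simp del] sum.cl_ivl_Suc [simp del]

definition e :: "nat \<Rightarrow> 'a" where "e a = E a (Suc k)"
definition f :: "nat \<Rightarrow> 'a" where "f a = E (Suc k) a"
definition H :: 'a where "H = E (Suc k) (Suc k)"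
definition al :: "complex \<Rightarrow> nat \<Rightarrow> 'a" where "al u a = (\<Sum>b=1..k. A k (u - 1) a b * e b)"
definition be :: "complex \<Rightarrow> nat \<Rightarrow> 'a" where "be u b = (\<Sum>a=1..k. f a * A k (u - 1) a b)"

lemma in_n: "a \<in> {1..k} \<Longrightarrow> a \<in> {1..n}" "Suc k \<in> {1..n}" "a \<in> {1..k} \<Longrightarrow> a \<noteq> Suc k" "a \<in> {1..k} \<Longrightarrow> Suc k \<noteq> a"
  using k by (auto simp: atLeastAtMost_iff)

lemma ef_Suc: "e (Suc k) = H" "f (Suc k) = H"
  by (simp_all add: e_def f_def H_def)

lemma gvec_e: "gvec k e"
  unfolding gvec_def e_def by (simp add: E_br in_n)

lemma gcov_f: "gcov k f"
  unfolding gcov_def f_def by (simp add: E_br in_n)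

lemma ginv_H: "ginv k H"
  unfolding ginv_def H_def by (simp add: E_br in_n)

lemma br_H_C: "br H (C k u) = 0" and br_H_A: "a \<in> {1..k} \<Longrightarrow> b \<in> {1..k} \<Longrightarrow> br H (A k u a b) = 0"
  using comm_CA[of k H u] ginv_H unfolding ginv_def by (auto simp: br_swap[of H])

lemma br_ef: "a \<in> {1..k} \<Longrightarrow> b \<in> {1..k} \<Longrightarrow> br (e a) (f b) = E a b - (if a = b then H else 0)"
  "a \<in> {1..k} \<Longrightarrow> b \<in> {1..k} \<Longrightarrow> br (f b) (e a) = (if a = b then H else 0) - E a b"
  "a \<in> {1..k} \<Longrightarrow> b \<in> {1..k} \<Longrightarrow> br (e a) (e b) = 0"
  "a \<in> {1..k} \<Longrightarrow> b \<in> {1..k} \<Longrightarrow> br (f a) (f b) = 0"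
  "a \<in> {1..k} \<Longrightarrow> br H (e a) = - e a" "a \<in> {1..k} \<Longrightarrow> br H (f a) = f a"
  "a \<in> {1..k} \<Longrightarrow> br (e a) H = e a" "a \<in> {1..k} \<Longrightarrow> br (f a) H = - f a"
  unfolding e_def f_def H_def by (simp_all add: E_br in_n)

lemma br_C_ef: "a \<in> {1..k} \<Longrightarrow> br (C k (u - 1)) (e a) = - al u a"
  "a \<in> {1..k} \<Longrightarrow> br (e a) (C k (u - 1)) = al u a"
  "a \<in> {1..k} \<Longrightarrow> br (C k (u - 1)) (f a) = be u a"
  "a \<in> {1..k} \<Longrightarrow> br (f a) (C k (u - 1)) = - be u a"
  using capelliD(6)[OF cap gvec_e] capelliD(7)[OF cap gcov_f]
  by (simp_all add: al_def be_def br_swap[of _ "C k _"])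

lemma br_H_al: "a \<in> {1..k} \<Longrightarrow> br H (al u a) = - al u a" "a \<in> {1..k} \<Longrightarrow> br H (be u a) = be u a"
  unfolding al_def be_def by (simp_all add: br_sum br_mult br_H_A br_ef sum_negf)

lemma gvec_al: "gvec k (al u)" and gcov_be: "gcov k (be u)"
  using gadj_gvec[OF capelliD(2)[OF cap] gvec_e] gcov_gadj[OF capelliD(2)[OF cap] gcov_f]
  by (simp_all add: al_def[abs_def] be_def[abs_def])

lemma br_e_al: "a \<in> {1..k} \<Longrightarrow> b \<in> {1..k} \<Longrightarrow> br (e a) (al u b) = 0"
  "a \<in> {1..k} \<Longrightarrow> b \<in> {1..k} \<Longrightarrow> br (f a) (be u b) = 0"
  using capelliD(8)[OF cap gvec_e br_ef(3)] capelliD(9)[OF cap gcov_f br_ef(4)]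
  by (simp_all add: al_def be_def)

lemma E_al: "a \<in> {1..k} \<Longrightarrow> (\<Sum>c=1..k. E a c * al u c) = sc (u - 1) * al u a - C k (u - 1) * e a"
proof -
  assume a: "a \<in> {1..k}"
  have "(\<Sum>c=1..k. E a c * al u c) = (\<Sum>b=1..k. (\<Sum>c=1..k. E a c * A k (u-1) c b) * e b)"
    unfolding al_def sum_distrib_left sum_distrib_right by (subst sum.swap) (simp add: mult.assoc)
  also have "\<dots> = (\<Sum>b=1..k. sc (u - 1) * (A k (u-1) a b * e b) - (if a = b then C k (u-1) * e b else 0))"
  proof (rule sum.cong[OF refl])
    fix b assume b: "b \<in> {1..k}"
    have "(\<Sum>c=1..k. E a c * A k (u-1) c b) = sc (u-1) * A k (u-1) a b - (if a = b then C k (u-1) else 0)"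
      using capelliD(3)[OF cap a b, of "u-1"] by (simp add: algebra_simps)
    then show "(\<Sum>c=1..k. E a c * A k (u-1) c b) * e b = sc (u - 1) * (A k (u-1) a b * e b) - (if a = b then C k (u-1) * e b else 0)"
      by (simp add: left_diff_distrib mult.assoc)
  qed
  also have "\<dots> = sc (u - 1) * al u a - C k (u - 1) * e a"
    using a by (simp add: sum_subtractf al_def sum_distrib_left)
  finally show ?thesis .
qed

lemma be_E: "a \<in> {1..k} \<Longrightarrow> (\<Sum>c=1..k. be u c * E c a) = sc (u - 1) * be u a - f a * C k (u - 1)"
proof -
  assume a: "a \<in> {1..k}"
  have "(\<Sum>c=1..k. be u c * E c a) = (\<Sum>b=1..k. f b * (\<Sum>c=1..k. A k (u-1) b c * E c a))"
    unfolding be_def sum_distrib_left sum_distrib_right by (subst sum.swap) (simp add: mult.assoc)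
  also have "\<dots> = (\<Sum>b=1..k. sc (u - 1) * (f b * A k (u-1) b a) - (if b = a then f b * C k (u-1) else 0))"
  proof (rule sum.cong[OF refl])
    fix b assume b: "b \<in> {1..k}"
    have "(\<Sum>c=1..k. A k (u-1) b c * E c a) = sc (u-1) * A k (u-1) b a - (if b = a then C k (u-1) else 0)"
      using capelliD(4)[OF cap b a, of "u-1"] by (simp add: algebra_simps)
    moreover have "f b * (sc (u-1) * A k (u-1) b a) = sc (u - 1) * (f b * A k (u-1) b a)"
      by (metis mult.assoc sc_comm)
    ultimately show "f b * (\<Sum>c=1..k. A k (u-1) b c * E c a) = sc (u - 1) * (f b * A k (u-1) b a) - (if b = a then f b * C k (u-1) else 0)"
      by (simp add: right_diff_distrib)
  qed
  also have "\<dots> = sc (u - 1) * be u a - f a * C k (u - 1)"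
    using a by (simp add: sum_subtractf be_def sum_distrib_left)
  finally show ?thesis .
qed

lemma C_Suc_al: "C (Suc k) u = C k (u - 1) * (sc u - H) - (\<Sum>a=1..k. f a * al u a)"
  by (simp add: C_Suc H_def f_def al_def e_def)

lemma C_Suc_be: "C (Suc k) u = C k (u - 1) * (sc u - H) - (\<Sum>a=1..k. be u a * e a)"
proof -
  have "(\<Sum>a=1..k. f a * al u a) = (\<Sum>a=1..k. be u a * e a)"
    unfolding al_def be_def sum_distrib_left sum_distrib_right by (subst sum.swap) (simp add: mult.assoc)
  then show ?thesis by (simp add: C_Suc_al)
qed

lemma A_Suc':
  "A (Suc k) u (Suc k) (Suc k) = C k (u - 1)"
  "b \<in> {1..k} \<Longrightarrow> A (Suc k) u (Suc k) b = be u b"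
  "a \<in> {1..k} \<Longrightarrow> A (Suc k) u a (Suc k) = al u a"
  "a \<in> {1..k} \<Longrightarrow> b \<in> {1..k} \<Longrightarrow> A (Suc k) u a b = (if a = b then C k (u - 1) else 0) + br (e a) (be u b)"
  by (simp_all add: A_Suc al_def be_def e_def f_def atLeastAtMost_iff)

lemma br_e_be: "a \<in> {1..k} \<Longrightarrow> b \<in> {1..k} \<Longrightarrow> br (f b) (al u a) = - br (e a) (be u b)"
proof -
  assume a: "a \<in> {1..k}" and b: "b \<in> {1..k}"
  have "br (e a) (be u b) = br (e a) (br (C k (u - 1)) (f b))"
    using b by (simp add: br_C_ef)
  also have "\<dots> = br (al u a) (f b) + br (C k (u - 1)) (E a b - (if a = b then H else 0))"
    using a b by (subst br_jacobi) (simp add: br_C_ef br_ef)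
  also have "br (C k (u - 1)) (E a b - (if a = b then H else 0)) = 0"
    using ginvD[OF capelliD(1)[OF cap, of "u-1"] a b] br_H_C[of "u-1"]
    by (simp add: br_diff br_swap[of "C k _"])
  finally show ?thesis by (simp add: br_swap[of "f b"])
qed

lemma br_e_C: "a \<in> {1..k} \<Longrightarrow> br (e a) (C (Suc k) u) = 0"
proof -
  assume a: "a \<in> {1..k}"
  have "br (e a) (C (Suc k) u) = al u a * (sc u - H) - C k (u-1) * e a
      - (\<Sum>b=1..k. (E a b - (if a = b then H else 0)) * al u b)"
    unfolding C_Suc_al
    using a by (simp add: br_diff br_sum br_mult br_C_ef br_ef br_e_al)
  also have "(\<Sum>b=1..k. (E a b - (if a = b then H else 0)) * al u b)
    = (\<Sum>b=1..k. E a b * al u b) - H * al u a"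
    using a by (simp add: left_diff_distrib if_times sum_subtractf)
  also have "\<dots> = sc (u - 1) * al u a - C k (u - 1) * e a - H * al u a"
    using E_al[OF a] by simp
  also have "al u a * (sc u - H) - C k (u-1) * e a - \<dots> = al u a + br H (al u a)"
    by (simp add: br_def algebra_simps sc_diff sc_comm[of u])
  finally show ?thesis using a by (simp add: br_H_al)
qed

lemma br_f_C: "a \<in> {1..k} \<Longrightarrow> br (f a) (C (Suc k) u) = 0"
proof -
  assume a: "a \<in> {1..k}"
  have "br (f a) (C (Suc k) u) = - be u a * (sc u - H) + C k (u-1) * f a
      - (\<Sum>b=1..k. be u b * ((if b = a then H else 0) - E b a))"
    unfolding C_Suc_be
    using a by (simp add: br_diff br_sum br_mult br_C_ef br_ef br_e_al)
  also have "(\<Sum>b=1..k. be u b * ((if b = a then H else 0) - E b a))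
    = be u a * H - (\<Sum>b=1..k. be u b * E b a)"
    using a by (simp add: right_diff_distrib if_times sum_subtractf)
  also have "\<dots> = be u a * H - (sc (u - 1) * be u a - f a * C k (u - 1))"
    using be_E[OF a] by simp
  also have "- be u a * (sc u - H) + C k (u-1) * f a - \<dots> = br (C k (u-1)) (f a) - be u a"
    by (simp add: br_def algebra_simps sc_diff sc_comm[of u])
  finally show ?thesis using a by (simp add: br_C_ef)
qed

lemma Suc_cases: "a \<in> {1..Suc k} \<Longrightarrow> (a = Suc k \<Longrightarrow> P) \<Longrightarrow> (a \<in> {1..k} \<Longrightarrow> P) \<Longrightarrow> P"
  by (cases "a = Suc k") (auto simp: atLeastAtMost_iff)

lemma br_H_CSuc: "br H (C (Suc k) u) = 0"
  unfolding C_Suc_al by (simp add: br_diff br_sum br_mult br_H_C br_H_al br_ef)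

lemma ginv_CSuc: "ginv (Suc k) (C (Suc k) u)"
proof -
  have "ginv k (\<Sum>a=1..k. f a * al u a)" by (rule gcov_gvec[OF gcov_f gvec_al])
  then have "ginv k (C (Suc k) u)"
    using capelliD(1)[OF cap, of "u-1"] ginv_H unfolding ginv_def C_Suc_al
    by (simp add: br_diff br_mult)
  moreover have "br (E (Suc k) (Suc k)) (C (Suc k) u) = 0"
    using br_H_CSuc by (simp add: H_def)
  moreover have "br (E (Suc k) a) (C (Suc k) u) = 0" "br (E a (Suc k)) (C (Suc k) u) = 0" if "a \<in> {1..k}" for a
    using br_f_C[OF that] br_e_C[OF that] by (simp_all add: e_def f_def)
  ultimately show ?thesis
    unfolding ginv_def by (intro ballI; elim Suc_cases; simp)
qed

lemma br_e_e_be: "\<lbrakk>i \<in> {1..k}; a \<in> {1..k}; b \<in> {1..k}\<rbrakk> \<Longrightarrow>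
  br (e i) (br (e a) (be u b)) = - (if a = b then al u i else 0) - (if i = b then al u a else 0)"
proof -
  assume i: "i \<in> {1..k}" and a: "a \<in> {1..k}" and b: "b \<in> {1..k}"
  have "br (e i) (br (e a) (be u b)) = - br (e i) (br (f b) (al u a))"
    using a b by (simp add: br_e_be br_minus)
  also have "\<dots> = - br (E i b - (if i = b then H else 0)) (al u a)"
    using i a b by (subst br_jacobi) (simp add: br_ef br_e_al)
  also have "\<dots> = - (if a = b then al u i else 0) - (if i = b then al u a else 0)"
    using i a b by (simp add: br_diff br_H_al gvecD[OF gvec_al] if_distrib[of "\<lambda>x. br x _"])
  finally show ?thesis .
qed

lemma br_f_e_be: "\<lbrakk>j \<in> {1..k}; a \<in> {1..k}; b \<in> {1..k}\<rbrakk> \<Longrightarrow>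
  br (f j) (br (e a) (be u b)) = (if a = b then be u j else 0) + (if j = a then be u b else 0)"
proof -
  assume i: "j \<in> {1..k}" and a: "a \<in> {1..k}" and b: "b \<in> {1..k}"
  have "br (f j) (br (e a) (be u b)) = br ((if a = j then H else 0) - E a j) (be u b)"
    using i a b by (subst br_jacobi) (simp add: br_ef br_e_al)
  also have "\<dots> = (if a = b then be u j else 0) + (if j = a then be u b else 0)"
    using i a b by (simp add: br_diff br_H_al gcovD[OF gcov_be] if_distrib[of "\<lambda>x. br x _"])
  finally show ?thesis .
qed

lemma br_E_e_be: "\<lbrakk>i \<in> {1..k}; j \<in> {1..k}; a \<in> {1..k}; b \<in> {1..k}\<rbrakk> \<Longrightarrow> br (E i j) (br (e a) (be u b)) =
  (if j = a then br (e i) (be u b) else 0) - (if i = b then br (e a) (be u j) else 0)"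
  by (subst br_jacobi) (simp add: gvecD[OF gvec_e] gcovD[OF gcov_be] br_minus)

lemma gadj_ASuc: "gadj (Suc k) (A (Suc k) u)"
  unfolding gadj_def
proof (intro ballI)
  fix i j c d assume i: "i \<in> {1..Suc k}" and j: "j \<in> {1..Suc k}" and c: "c \<in> {1..Suc k}" and d: "d \<in> {1..Suc k}"
  show "br (E i j) (A (Suc k) u c d) = (if j = c then A (Suc k) u i d else 0) - (if i = d then A (Suc k) u c j else 0)"
  proof (rule Suc_cases[OF i]; rule Suc_cases[OF j])
    assume i: "i \<in> {1..k}" and j: "j \<in> {1..k}"
    show ?thesis
      using c d
      by (elim Suc_cases) (simp_all add: i j in_n A_Suc' br_E_e_be ginvD[OF capelliD(1)[OF cap]] gvecD[OF gvec_al] gcovD[OF gcov_be] br_add)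
  next
    assume i: "i = Suc k" and j: "j = Suc k"
    have "br H (br (e a) (be u b)) = 0" if "a \<in> {1..k}" "b \<in> {1..k}" for a b
      using that by (subst br_jacobi) (simp add: br_ef br_H_al br_minus)
    then show ?thesis
      unfolding i j H_def[symmetric] using c d
      by (elim Suc_cases) (simp_all add: in_n A_Suc' br_H_C br_H_al br_add)
  next
    assume i: "i \<in> {1..k}" and j: "j = Suc k"
    show ?thesis
      unfolding j e_def[symmetric] using c d i
      by (elim Suc_cases) (simp_all add: in_n A_Suc' br_C_ef br_e_al br_add br_e_e_be)
  next
    assume i: "i = Suc k" and j: "j \<in> {1..k}"
    show ?thesis
      unfolding i f_def[symmetric] using c d j
      by (elim Suc_cases) (simp_all add: in_n A_Suc' br_C_ef br_e_al br_add br_f_e_be br_e_be)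
  qed
qed

lemma sum_Suc: "(\<Sum>c=1..Suc k. g c) = (\<Sum>c=1..k. g c) + (g (Suc k) :: 'a)"
  by (simp add: sum.cl_ivl_Suc)

lemma Suc_in: "Suc k \<in> {1..Suc k}" "a \<in> {1..k} \<Longrightarrow> a \<in> {1..Suc k}"
  by (simp_all add: atLeastAtMost_iff)

lemma gadj_Suc_left: "gadj (Suc k) (\<lambda>a b. sc u * A (Suc k) u a b - (\<Sum>c=1..Suc k. E a c * A (Suc k) u c b)
    - (if a = b then C (Suc k) u else 0))"
  by (rule gadj_diff[OF gadj_diff[OF gadj_sc[OF gadj_ASuc] gadj_mult[OF gadj_E[OF k] gadj_ASuc]] gadj_delta[OF ginv_CSuc]])

lemma gadj_Suc_right: "gadj (Suc k) (\<lambda>a b. sc u * A (Suc k) u a b - (\<Sum>c=1..Suc k. A (Suc k) u a c * E c b)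
    - (if a = b then C (Suc k) u else 0))"
  by (rule gadj_diff[OF gadj_diff[OF gadj_sc[OF gadj_ASuc] gadj_mult[OF gadj_ASuc gadj_E[OF k]]] gadj_delta[OF ginv_CSuc]])

text \<open>Both sides are of matrix type, so equality in the last row and column suffices; there the identity is a
rewriting of the recursion.\<close>

lemma cayley_left_Suc:
  assumes "a \<in> {1..Suc k}" "b \<in> {1..Suc k}"
  shows "sc u * A (Suc k) u a b - (\<Sum>c=1..Suc k. E a c * A (Suc k) u c b) = (if a = b then C (Suc k) u else 0)"
proof -
  have "sc u * A (Suc k) u a (Suc k) - (\<Sum>c=1..Suc k. E a c * A (Suc k) u c (Suc k))
    - (if a = Suc k then C (Suc k) u else 0) = 0" if "a \<in> {1..Suc k}" for a
    using that
  proof (rule Suc_cases)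
    assume a: "a = Suc k"
    have "sc u * C k (u - 1) - ((\<Sum>c=1..k. f c * al u c) + H * C k (u - 1)) - C (Suc k) u = - br H (C k (u - 1))"
      unfolding C_Suc_al by (simp add: algebra_simps br_def sc_comm[of u])
    then show ?thesis
      unfolding sum_Suc using a by (simp add: A_Suc' br_H_C f_def[symmetric] ef_Suc)
  next
    assume a: "a \<in> {1..k}"
    have "sc u * al u a - ((sc (u - 1) * al u a - C k (u - 1) * e a) + e a * C k (u - 1)) = al u a + br (C k (u - 1)) (e a)"
      by (simp add: algebra_simps br_def sc_diff)
    then show ?thesis
      unfolding sum_Suc using a E_al[OF a, of u] by (simp add: A_Suc' br_C_ef e_def[symmetric] in_n)
  qed
  from gadj_zero_col[OF gadj_Suc_left this assms] show ?thesis by simp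
qed

lemma cayley_right_Suc:
  assumes "a \<in> {1..Suc k}" "b \<in> {1..Suc k}"
  shows "sc u * A (Suc k) u a b - (\<Sum>c=1..Suc k. A (Suc k) u a c * E c b) = (if a = b then C (Suc k) u else 0)"
proof -
  have "sc u * A (Suc k) u (Suc k) a - (\<Sum>c=1..Suc k. A (Suc k) u (Suc k) c * E c a)
    - (if Suc k = a then C (Suc k) u else 0) = 0" if "a \<in> {1..Suc k}" for a
    using that
  proof (rule Suc_cases)
    assume a: "a = Suc k"
    have "sc u * C k (u - 1) - ((\<Sum>c=1..k. be u c * e c) + C k (u - 1) * H) - C (Suc k) u = 0"
      unfolding C_Suc_be by (simp add: algebra_simps br_def sc_comm[of u])
    then show ?thesis
      unfolding sum_Suc using a by (simp add: A_Suc' e_def[symmetric] ef_Suc)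
  next
    assume a: "a \<in> {1..k}"
    have "sc u * be u a - ((sc (u - 1) * be u a - f a * C k (u - 1)) + C k (u - 1) * f a) = be u a - br (C k (u - 1)) (f a)"
      by (simp add: algebra_simps br_def sc_diff)
    then show ?thesis
      unfolding sum_Suc using a be_E[OF a, of u] by (simp add: A_Suc' br_C_ef f_def[symmetric] in_n)
  qed
  from gadj_zero_row[OF gadj_Suc_right this assms] show ?thesis by simp
qed

lemma trace_Suc: "(\<Sum>c=1..Suc k. A (Suc k) u c c) = C (Suc k) u - C (Suc k) (u - 1)"
proof -
  have 1: "C k (u-1) + (\<Sum>b=1..k. br (e a) (f b) * A k (u-1) b a) = (sc (u-1) - H) * A k (u-1) a a"
    if a: "a \<in> {1..k}" for a
  proof -
    have "(\<Sum>b=1..k. br (e a) (f b) * A k (u-1) b a) = (\<Sum>b=1..k. E a b * A k (u-1) b a) - H * A k (u-1) a a"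
      using a by (simp add: br_ef left_diff_distrib sum_subtractf if_times)
    then show ?thesis
      using capelliD(3)[OF cap a a, of "u-1"] by (simp add: algebra_simps)
  qed
  have "(\<Sum>a=1..k. A (Suc k) u a a) = (\<Sum>a=1..k. C k (u-1) + br (e a) (be u a))"
    by (simp add: A_Suc')
  also have "\<dots> = (\<Sum>a=1..k. (C k (u-1) + (\<Sum>b=1..k. br (e a) (f b) * A k (u-1) b a))
      + (\<Sum>b=1..k. f b * br (e a) (A k (u-1) b a)))"
    by (simp add: be_def br_sum br_mult sum.distrib add.assoc)
  also have "\<dots> = (\<Sum>a=1..k. (sc (u-1) - H) * A k (u-1) a a) + (\<Sum>b=1..k. f b * (\<Sum>a=1..k. br (e a) (A k (u-1) b a)))"
    unfolding sum.distrib[of "\<lambda>a. C k (u-1) + _ a"]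
    by (subst sum.swap[of "\<lambda>a b. f b * br (e a) (A k (u-1) b a)"]) (simp add: 1 sum_distrib_left)
  also have "(\<Sum>b=1..k. f b * (\<Sum>a=1..k. br (e a) (A k (u-1) b a))) = (\<Sum>b=1..k. f b * al (u-1) b) - (\<Sum>b=1..k. f b * al u b)"
    using capelliD(10)[OF cap gvec_e, of _ "u-1"] by (simp add: al_def right_diff_distrib sum_subtractf)
  also have "(\<Sum>a=1..k. (sc (u-1) - H) * A k (u-1) a a) = (sc (u-1) - H) * (C k (u-1) - C k (u - 1 - 1))"
    using capelliD(5)[OF cap, of "u-1"] by (simp add: sum_distrib_left[symmetric])
  finally show ?thesis
    using br_H_C[of "u-1"] br_H_C[of "u-1-1"] unfolding sum_Suc A_Suc' C_Suc_al
    by (simp add: algebra_simps sc_diff sc_comm br_eq_0)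
qed

lemma f_A_g: "(\<Sum>a=1..k. f a * (\<Sum>b=1..k. A k (u - 1) a b * g b)) = (\<Sum>b=1..k. be u b * g b)"
  unfolding be_def sum_distrib_left sum_distrib_right by (subst sum.swap) (simp add: mult.assoc)

lemma gvec_last:
  assumes g: "gvec (Suc k) g"
  shows "br (C k u) (g (Suc k)) = 0" "a \<in> {1..k} \<Longrightarrow> b \<in> {1..k} \<Longrightarrow> br (A k u a b) (g (Suc k)) = 0"
    "br H (g (Suc k)) = g (Suc k)" "a \<in> {1..k} \<Longrightarrow> br (f a) (g (Suc k)) = 0"
    "a \<in> {1..k} \<Longrightarrow> br (e a) (g (Suc k)) = g a"
    "a \<in> {1..k} \<Longrightarrow> b \<in> {1..k} \<Longrightarrow> br (f b) (g a) = (if b = a then g (Suc k) else 0) - (if Suc k = a then g b else 0)"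
  using comm_CA[of k "g (Suc k)" u] gvecD[OF g]
  by (auto simp: br_swap[of "g _"] br_swap[of _ "C k u"] br_swap[of _ "A k u _ _"] H_def e_def f_def in_n Suc_in)

lemma gcov_last:
  assumes h: "gcov (Suc k) h"
  shows "br (C k u) (h (Suc k)) = 0" "a \<in> {1..k} \<Longrightarrow> b \<in> {1..k} \<Longrightarrow> br (A k u a b) (h (Suc k)) = 0"
    "br H (h (Suc k)) = - h (Suc k)" "a \<in> {1..k} \<Longrightarrow> br (e a) (h (Suc k)) = 0"
    "a \<in> {1..k} \<Longrightarrow> br (f a) (h (Suc k)) = - h a"
  using comm_CA[of k "h (Suc k)" u] gcovD[OF h]
  by (auto simp: br_swap[of "h _"] br_swap[of _ "C k u"] br_swap[of _ "A k u _ _"] H_def e_def f_def in_n Suc_in)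

lemma C_gvec_Suc:
  assumes g: "gvec (Suc k) g" and c: "c \<in> {1..Suc k}"
  shows "br (C (Suc k) u) (g c) = - (\<Sum>a=1..Suc k. A (Suc k) u c a * g a)"
proof -
  note l = gvec_last[OF g]
  have "br (al u a) (g (Suc k)) = (\<Sum>b=1..k. A k (u-1) a b * g b)" if "a \<in> {1..k}" for a
    using that by (simp add: al_def br_sum_left br_mult_left l)
  then have "br (C (Suc k) u) (g (Suc k)) = - (C k (u-1) * g (Suc k)) - (\<Sum>a=1..k. f a * (\<Sum>b=1..k. A k (u-1) a b * g b))"
    unfolding C_Suc_al by (simp add: br_diff br_mult_left br_sum_left l)
  then have "br (C (Suc k) u) (g (Suc k)) + (\<Sum>a=1..Suc k. A (Suc k) u (Suc k) a * g a) = 0"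
    unfolding sum_Suc f_A_g by (simp add: A_Suc')
  from gvec_zero[OF gvec_add[OF ginv_gvec[OF ginv_CSuc g] gadj_gvec[OF gadj_ASuc g]] this c]
  show ?thesis by (simp add: eq_neg_iff_add_eq_0)
qed

lemma C_gcov_Suc:
  assumes h: "gcov (Suc k) h" and c: "c \<in> {1..Suc k}"
  shows "br (C (Suc k) u) (h c) = (\<Sum>a=1..Suc k. h a * A (Suc k) u a c)"
proof -
  note l = gcov_last[OF h]
  have "br (al u a) (h (Suc k)) = 0" if "a \<in> {1..k}" for a
    using that by (simp add: al_def br_sum_left br_mult_left l)
  then have "br (C (Suc k) u) (h (Suc k)) = C k (u-1) * h (Suc k) + (\<Sum>a=1..k. h a * al u a)"
    unfolding C_Suc_al by (simp add: br_diff br_mult_left br_sum_left l sum_negf)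
  also have "C k (u-1) * h (Suc k) = h (Suc k) * C k (u-1)"
    using l(1)[of "u-1"] by (simp add: br_eq_0)
  finally have "br (C (Suc k) u) (h (Suc k)) - (\<Sum>a=1..Suc k. h a * A (Suc k) u a (Suc k)) = 0"
    unfolding sum_Suc by (simp add: A_Suc')
  from gcov_zero[OF gcov_diff[OF ginv_gcov[OF ginv_CSuc h] gcov_gadj[OF gadj_ASuc h]] this c]
  show ?thesis by simp
qed

lemma symmetric_zero:
  fixes s :: "nat \<Rightarrow> nat \<Rightarrow> 'a"
  assumes D0: "\<And>i. i \<in> {1..k} \<Longrightarrow> D i 0 = 0" and s0: "s (Suc k) (Suc k) = 0"
    and sym: "\<And>a b. a \<in> {1..Suc k} \<Longrightarrow> b \<in> {1..Suc k} \<Longrightarrow> s a b = s b a"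
    and D: "\<And>i. i \<in> {1..k} \<Longrightarrow> D i (s (Suc k) (Suc k)) = s i (Suc k) + s (Suc k) i"
      "\<And>i c. i \<in> {1..k} \<Longrightarrow> c \<in> {1..k} \<Longrightarrow> D i (s c (Suc k)) = s c i"
    and ab: "a \<in> {1..Suc k}" "b \<in> {1..Suc k}"
  shows "s a b = 0"
proof -
  have 1: "s i (Suc k) = 0" if i: "i \<in> {1..k}" for i
  proof -
    have "s i (Suc k) + s i (Suc k) = 0"
      using D(1)[OF i] D0[OF i] s0 sym[of i "Suc k"] i Suc_in by simp
    then have "sc (1 + 1) * s i (Suc k) = 0"
      unfolding sc_add sc_1 distrib_right mult_1_left .
    then show ?thesis by (rule sc_cancel) simp
  qed
  have 2: "s c i = 0" if "i \<in> {1..k}" "c \<in> {1..k}" for i c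
    using D(2)[OF that] D0[OF that(1)] 1[OF that(2)] by simp
  show ?thesis
    using ab 1 2 s0 sym[of a b] sym[of b a] by (elim Suc_cases) (auto simp: Suc_in)
qed

lemma gvec_hat_Suc:
  assumes g: "gvec (Suc k) g" and comm: "\<And>a b. \<lbrakk>a \<in> {1..Suc k}; b \<in> {1..Suc k}\<rbrakk> \<Longrightarrow> br (g a) (g b) = 0"
    and ab: "a \<in> {1..Suc k}" "b \<in> {1..Suc k}"
  shows "br (g a) (\<Sum>c=1..Suc k. A (Suc k) u b c * g c) = 0"
proof (rule symmetric_zero[of "\<lambda>i. br (E i (Suc k))" "\<lambda>a b. br (g a) (\<Sum>c=1..Suc k. A (Suc k) u b c * g c)", OF _ _ _ _ _ ab])
  note l = gvec_last[OF g]
  note v = gvecD[OF gadj_gvec[OF gadj_ASuc g]]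
  show "br (g (Suc k)) (\<Sum>c=1..Suc k. A (Suc k) u (Suc k) c * g c) = 0"
    unfolding sum_Suc
    by (simp add: br_sum br_add br_mult A_Suc' comm Suc_in be_def l br_swap[of "g (Suc k)" "f _"]
        br_swap[of "g (Suc k)" "C k _"] br_swap[of "g (Suc k)" "A k _ _ _"])
  show "br (g a) (\<Sum>c=1..Suc k. A (Suc k) u b c * g c) = br (g b) (\<Sum>c=1..Suc k. A (Suc k) u a c * g c)"
    if a: "a \<in> {1..Suc k}" and b: "b \<in> {1..Suc k}" for a b
  proof -
    have "br (C (Suc k) u) (br (g a) (g b)) = 0"
      using comm a b by simp
    then show ?thesis
      unfolding br_jacobi[of "C (Suc k) u"] C_gvec_Suc[OF g a] C_gvec_Suc[OF g b]
      by (simp add: br_minus br_swap[of "sum _ _"])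
  qed
  fix i assume i: "i \<in> {1..k}"
  show "br (E i (Suc k)) (br (g (Suc k)) (\<Sum>c=1..Suc k. A (Suc k) u (Suc k) c * g c)) =
    br (g i) (\<Sum>c=1..Suc k. A (Suc k) u (Suc k) c * g c) + br (g (Suc k)) (\<Sum>c=1..Suc k. A (Suc k) u i c * g c)"
    unfolding br_jacobi[of "E i (Suc k)"] using i v gvecD[OF g] by (simp add: Suc_in)
  show "br (E i (Suc k)) (br (g c) (\<Sum>ca=1..Suc k. A (Suc k) u (Suc k) ca * g ca)) = br (g c) (\<Sum>c=1..Suc k. A (Suc k) u i c * g c)"
    if "c \<in> {1..k}" for c
    unfolding br_jacobi[of "E i (Suc k)"] using i v gvecD[OF g] that by (simp add: Suc_in in_n)
qed simp

lemma gcov_hat_Suc: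
  assumes g: "gcov (Suc k) g" and comm: "\<And>a b. \<lbrakk>a \<in> {1..Suc k}; b \<in> {1..Suc k}\<rbrakk> \<Longrightarrow> br (g a) (g b) = 0"
    and ab: "a \<in> {1..Suc k}" "b \<in> {1..Suc k}"
  shows "br (g a) (\<Sum>c=1..Suc k. g c * A (Suc k) u c b) = 0"
proof (rule symmetric_zero[of "\<lambda>i x. - br (E (Suc k) i) x" "\<lambda>a b. br (g a) (\<Sum>c=1..Suc k. g c * A (Suc k) u c b)", OF _ _ _ _ _ ab])
  note l = gcov_last[OF g]
  note v = gcovD[OF gcov_gadj[OF gadj_ASuc g]]
  show "br (g (Suc k)) (\<Sum>c=1..Suc k. g c * A (Suc k) u c (Suc k)) = 0"
    unfolding sum_Suc
    by (simp add: br_sum br_add br_mult A_Suc' comm Suc_in al_def l br_swap[of "g (Suc k)" "e _"]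
        br_swap[of "g (Suc k)" "C k _"] br_swap[of "g (Suc k)" "A k _ _ _"])
  show "br (g a) (\<Sum>c=1..Suc k. g c * A (Suc k) u c b) = br (g b) (\<Sum>c=1..Suc k. g c * A (Suc k) u c a)"
    if a: "a \<in> {1..Suc k}" and b: "b \<in> {1..Suc k}" for a b
  proof -
    have "br (C (Suc k) u) (br (g a) (g b)) = 0"
      using comm a b by simp
    then show ?thesis
      unfolding br_jacobi[of "C (Suc k) u"] C_gcov_Suc[OF g a] C_gcov_Suc[OF g b]
      by (simp add: br_minus br_swap[of "sum _ _"])
  qed
  fix i assume i: "i \<in> {1..k}"
  show "- br (E (Suc k) i) (br (g (Suc k)) (\<Sum>c=1..Suc k. g c * A (Suc k) u c (Suc k))) =
    br (g i) (\<Sum>c=1..Suc k. g c * A (Suc k) u c (Suc k)) + br (g (Suc k)) (\<Sum>c=1..Suc k. g c * A (Suc k) u c i)"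
    unfolding br_jacobi[of "E (Suc k) i"] using i v gcovD[OF g] by (simp add: Suc_in br_minus)
  show "- br (E (Suc k) i) (br (g c) (\<Sum>ca=1..Suc k. g ca * A (Suc k) u ca (Suc k))) = br (g c) (\<Sum>c=1..Suc k. g c * A (Suc k) u c i)"
    if "c \<in> {1..k}" for c
    unfolding br_jacobi[of "E (Suc k) i"] using i v gcovD[OF g] that by (simp add: Suc_in in_n br_minus)
qed simp

lemma gvec_divergence:
  assumes g: "gvec m g" and X: "gadj m X"
  shows "gvec m (\<lambda>b. \<Sum>a=1..m. br (g a) (X b a))"
  unfolding gvec_def
proof (intro ballI)
  fix i j b assume i: "i \<in> {1..m}" and j: "j \<in> {1..m}" and b: "b \<in> {1..m}"
  have "br (E i j) (\<Sum>a=1..m. br (g a) (X b a)) = (\<Sum>a=1..m. (if j = a then br (g i) (X b a) else 0)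
      + (if j = b then br (g a) (X i a) else 0) - (if i = a then br (g a) (X b j) else 0))"
    unfolding br_sum br_jacobi[of "E i j"]
    by (intro sum.cong refl) (use i j b in \<open>simp add: gvecD[OF g] gadjD[OF X] br_diff\<close>)
  also have "\<dots> = (if j = b then \<Sum>a=1..m. br (g a) (X i a) else 0)"
    using i j by (simp add: sum.distrib sum_subtractf)
  finally show "br (E i j) (\<Sum>a=1..m. br (g a) (X b a)) = (if j = b then \<Sum>a=1..m. br (g a) (X i a) else 0)" .
qed

lemma divergence_Suc:
  assumes g: "gvec (Suc k) g" and b: "b \<in> {1..Suc k}"
  shows "(\<Sum>a=1..Suc k. br (g a) (A (Suc k) u b a)) =
    (\<Sum>c=1..Suc k. A (Suc k) (u - 1) b c * g c) - (\<Sum>c=1..Suc k. A (Suc k) u b c * g c)"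
proof -
  note l = gvec_last[OF g]
  have gk: "gvec k g"
    using g unfolding gvec_def by (simp add: Suc_in)
  have "(\<Sum>a=1..k. br (g a) (be u a)) = (\<Sum>a=1..k. \<Sum>b=1..k. br (g a) (f b) * A k (u-1) b a)
      + (\<Sum>b=1..k. f b * (\<Sum>a=1..k. br (g a) (A k (u-1) b a)))"
    unfolding be_def br_sum br_mult sum.distrib sum_distrib_left
    by (subst (2) sum.swap) (rule refl)
  also have "(\<Sum>a=1..k. \<Sum>b=1..k. br (g a) (f b) * A k (u-1) b a) = - (g (Suc k) * (\<Sum>a=1..k. A k (u-1) a a))"
    by (simp add: br_swap[of "g _" "f _"] l in_n if_times sum_distrib_left sum_negf)
  also have "(\<Sum>b=1..k. f b * (\<Sum>a=1..k. br (g a) (A k (u-1) b a))) = (\<Sum>b=1..k. be (u-1) b * g b) - (\<Sum>b=1..k. be u b * g b)"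
    using capelliD(10)[OF cap gk, of _ "u-1"] by (simp add: f_A_g[symmetric] right_diff_distrib sum_subtractf)
  finally have "(\<Sum>a=1..Suc k. br (g a) (A (Suc k) u (Suc k) a)) -
    ((\<Sum>c=1..Suc k. A (Suc k) (u - 1) (Suc k) c * g c) - (\<Sum>c=1..Suc k. A (Suc k) u (Suc k) c * g c)) = 0"
    using l(1)[of "u-1"] l(1)[of "u-1-1"] capelliD(5)[OF cap, of "u-1"] unfolding sum_Suc
    by (simp add: A_Suc' br_def algebra_simps)
  from gvec_zero[OF gvec_diff[OF gvec_divergence[OF g gadj_ASuc]
        gvec_diff[OF gadj_gvec[OF gadj_ASuc g] gadj_gvec[OF gadj_ASuc g]]] this b]
  show ?thesis by simp
qed

lemma capelli_Suc: "capelli (Suc k)"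
  unfolding capelli_def
  by (intro allI conjI impI ballI ginv_CSuc gadj_ASuc cayley_left_Suc cayley_right_Suc trace_Suc
      C_gvec_Suc C_gcov_Suc gvec_hat_Suc gcov_hat_Suc divergence_Suc) blast+

end

theorem capelli: "k \<le> n \<Longrightarrow> capelli k"
  by (induction k) (auto intro: capelli_0 capelli_Suc)

end

section \<open>Polynomials with vector coefficients\<close>

lemma vector_poly_zero:
  fixes s :: "complex \<Rightarrow> 'b::ab_group_add \<Rightarrow> 'b"
  assumes vs: "vector_space s" and S: "finite S" "d \<le> card S"
    and z: "\<And>u. u \<in> S \<Longrightarrow> (\<Sum>m<d. s (u ^ m) (z m)) = 0" and m: "m < d"
  shows "z m = 0"
proof (rule ccontr)
  assume nz: "z m \<noteq> 0"
  interpret vector_space s by (rule vs)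
  interpret vector_space_pair s "(*) :: complex \<Rightarrow> complex \<Rightarrow> complex"
    by unfold_locales (simp_all add: algebra_simps)
  have "\<exists>g. Vector_Spaces.linear s (*) g \<and> (\<forall>x\<in>{z m}. g x = 1)"
    by (rule linear_independent_extend) (use nz in simp)
  then obtain g where g1: "g (z m) = 1" and "Vector_Spaces.linear s (*) g" by auto
  then interpret g: Vector_Spaces.linear s "(*)" g by simp
  define q where "q = (\<Sum>m<d. Polynomial.monom (g (z m)) m)"
  have deg: "q = 0 \<or> degree q < d"
  proof (cases "d = 0")
    case False
    then have "degree q \<le> d - 1"
      unfolding q_def by (intro degree_sum_le) (auto intro: order.trans[OF degree_monom_le])
    then show ?thesis using False by auto
  qed (simp add: q_def)
  have "poly q u = 0" if "u \<in> S" for u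
  proof -
    have "poly q u = g (\<Sum>m<d. s (u ^ m) (z m))"
      by (simp add: q_def poly_sum poly_monom g.sum g.scale mult.commute)
    then show ?thesis using z[OF that] g.zero by simp
  qed
  then have sub: "S \<subseteq> {u. poly q u = 0}" by auto
  have "q = 0"
  proof (rule ccontr)
    assume "q \<noteq> 0"
    then have "card S \<le> card {u. poly q u = 0}"
      by (intro card_mono sub poly_roots_finite)
    also have "\<dots> \<le> degree q" using \<open>q \<noteq> 0\<close> by (rule card_poly_roots_bound)
    finally show False using deg \<open>q \<noteq> 0\<close> S by simp
  qed
  moreover have "coeff q m = g (z m)"
    using m by (simp add: q_def coeff_sum)
  ultimately show False using g1 by simp
qed

context gl_family
begin

lemma sc_of_nat: "sc (of_nat m) = of_nat m"
  by (induction m) (simp_all add: sc_add)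

lemma vector_space_sc: "vector_space (\<lambda>c x. sc c * x)"
  by unfold_locales (simp_all add: distrib_left distrib_right sc_add sc_mult mult.assoc)

lemma poly_zero:
  assumes "\<And>u. (\<Sum>m<d. sc (u ^ m) * z m) = 0" "m < d"
  shows "z m = 0"
proof -
  obtain S :: "complex set" where "finite S" "card S = d"
    using infinite_arbitrarily_large[OF infinite_UNIV_char_0] by blast
  then show ?thesis
    using vector_poly_zero[OF vector_space_sc, of S d z m] assms by simp
qed

text \<open>Polynomial dependence on the parameter u with coefficients in the ring; u ranges over complex numbers, so that
evaluation and comparison of coefficients are equivalent (\<open>poly_zero\<close>).\<close>

definition pol :: "nat \<Rightarrow> (complex \<Rightarrow> 'a) \<Rightarrow> bool"
  where "pol d F \<longleftrightarrow> (\<exists>z. \<forall>u. F u = (\<Sum>m<d. sc (u ^ m) * z m))"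

lemma pol_0: "pol d (\<lambda>u. 0)"
  unfolding pol_def by (intro exI[of _ "\<lambda>_. 0"]) simp

lemma pol_add: "pol d F \<Longrightarrow> pol d G \<Longrightarrow> pol d (\<lambda>u. F u + G u)"
  unfolding pol_def
proof (elim exE)
  fix z y assume "\<forall>u. F u = (\<Sum>m<d. sc (u ^ m) * z m)" "\<forall>u. G u = (\<Sum>m<d. sc (u ^ m) * y m)"
  then show "\<exists>z. \<forall>u. F u + G u = (\<Sum>m<d. sc (u ^ m) * z m)"
    by (intro exI[of _ "\<lambda>m. z m + y m"]) (simp add: distrib_left sum.distrib)
qed

lemma pol_sum: "(\<And>i. i \<in> I \<Longrightarrow> pol d (F i)) \<Longrightarrow> pol d (\<lambda>u. \<Sum>i\<in>I. F i u)"
  by (induction I rule: infinite_finite_induct) (simp_all add: pol_0 pol_add)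

lemma pol_power: "m < d \<Longrightarrow> pol d (\<lambda>u. sc (u ^ m) * x)"
  unfolding pol_def by (intro exI[of _ "\<lambda>i. if i = m then x else 0"]) (simp add: if_times)

lemma pol_mono: "pol d F \<Longrightarrow> d \<le> d' \<Longrightarrow> pol d' F"
proof -
  assume "pol d F" "d \<le> d'"
  then obtain z where "F = (\<lambda>u. \<Sum>m<d. sc (u ^ m) * z m)" unfolding pol_def by auto
  then show ?thesis using \<open>d \<le> d'\<close> by (auto intro!: pol_sum pol_power)
qed

lemma pol_mult:
  assumes "pol d F" shows "pol d (\<lambda>u. x * F u)" "pol d (\<lambda>u. F u * x)" "pol (Suc d) (\<lambda>u. sc u * F u)"
proof -
  obtain z where F: "F = (\<lambda>u. \<Sum>m<d. sc (u ^ m) * z m)" using assms unfolding pol_def by auto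
  have "x * F u = (\<Sum>m<d. sc (u ^ m) * (x * z m))" for u
    unfolding F sum_distrib_left by (intro sum.cong refl) (metis mult.assoc sc_comm)
  then show "pol d (\<lambda>u. x * F u)" by (auto intro!: pol_sum pol_power)
  have "F u * x = (\<Sum>m<d. sc (u ^ m) * (z m * x))" for u
    unfolding F sum_distrib_right by (simp add: mult.assoc)
  then show "pol d (\<lambda>u. F u * x)" by (auto intro!: pol_sum pol_power)
  have "sc u * F u = (\<Sum>m<d. sc (u ^ Suc m) * z m)" for u
    unfolding F sum_distrib_left by (simp add: sc_mult mult.assoc)
  then show "pol (Suc d) (\<lambda>u. sc u * F u)" by (auto intro!: pol_sum pol_power simp del: power_Suc)
qed

lemma pol_uminus: "pol d F \<Longrightarrow> pol d (\<lambda>u. - F u)"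
  using pol_mult(1)[of d F "-1"] by simp

lemma pol_diff: "pol d F \<Longrightarrow> pol d G \<Longrightarrow> pol d (\<lambda>u. F u - G u)"
  using pol_add[OF _ pol_uminus] by simp

lemma binomial_minus_one: "(u - 1 :: complex) ^ m = (\<Sum>j\<le>m. (of_nat (m choose j) * (- 1) ^ (m - j)) * u ^ j)"
  using binomial_ring[of u "-1" m] by (simp add: mult_ac)

lemma pol_shift: assumes "pol d F" shows "pol d (\<lambda>u. F (u - 1))"
proof -
  obtain z where F: "F = (\<lambda>u. \<Sum>m<d. sc (u ^ m) * z m)" using assms unfolding pol_def by auto
  have "pol d (\<lambda>u. sc ((u - 1) ^ m) * x)" if "m < d" for m x
    unfolding binomial_minus_one sc_sum sum_distrib_right using that
    by (auto intro!: pol_sum pol_mult(1) pol_power simp: sc_mult mult.assoc)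
  then show ?thesis unfolding F by (auto intro!: pol_sum)
qed

lemma pol_shift_diff: "pol m (\<lambda>u. sc ((u - 1) ^ m - u ^ m))"
proof -
  have "(u - 1 :: complex) ^ m - u ^ m = (\<Sum>j<m. (of_nat (m choose j) * (- 1) ^ (m - j)) * u ^ j)" for u
    unfolding binomial_minus_one by (simp add: lessThan_Suc_atMost[symmetric])
  moreover have "pol m (\<lambda>u. sc (u ^ j))" if "j < m" for j
    using pol_power[OF that, of 1] by simp
  ultimately show ?thesis
    by (auto simp: sc_sum sc_mult intro!: pol_sum pol_mult(1))
qed

lemma pol_C_A: "pol k (\<lambda>u. C k u - sc (u ^ k)) \<and> (\<forall>a\<in>{1..k}. \<forall>b\<in>{1..k}. pol k (\<lambda>u. A k u a b))"
proof (induction k)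
  case 0
  show ?case by (simp add: pol_0)
next
  case (Suc k)
  then have C: "pol k (\<lambda>u. C k u - sc (u ^ k))" and A: "\<And>a b. a \<in> {1..k} \<Longrightarrow> b \<in> {1..k} \<Longrightarrow> pol k (\<lambda>u. A k u a b)"
    by auto
  note A' = pol_mono[OF pol_shift[OF A], of _ _ "Suc k"]
  have R: "pol k (\<lambda>u. C k (u - 1) - sc (u ^ k))"
    using pol_add[OF pol_shift[OF C] pol_shift_diff[of k]] by (simp add: sc_diff)
  have C': "pol (Suc k) (\<lambda>u. C k (u - 1))"
    using pol_add[OF pol_mono[OF R, of "Suc k"] pol_power[of k "Suc k" 1]] by simp
  have "pol (Suc k) (\<lambda>u. sc u * (C k (u - 1) - sc (u ^ k)) - C k (u - 1) * E (Suc k) (Suc k)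
     - (\<Sum>a=1..k. E (Suc k) a * (\<Sum>b=1..k. A k (u - 1) a b * E b (Suc k))))"
    by (intro pol_diff pol_sum pol_mult(1,2) pol_mult(3)[OF R] C' A') auto
  also have "(\<lambda>u. sc u * (C k (u - 1) - sc (u ^ k)) - C k (u - 1) * E (Suc k) (Suc k)
     - (\<Sum>a=1..k. E (Suc k) a * (\<Sum>b=1..k. A k (u - 1) a b * E b (Suc k)))) = (\<lambda>u. C (Suc k) u - sc (u ^ Suc k))"
    by (rule ext) (simp add: C_Suc algebra_simps sc_comm[of _ "C k _"] sc_mult)
  finally have 1: "pol (Suc k) (\<lambda>u. C (Suc k) u - sc (u ^ Suc k))" .
  have "pol (Suc k) (\<lambda>u. A (Suc k) u a b)" if "a \<in> {1..Suc k}" "b \<in> {1..Suc k}" for a b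
  proof -
    have be: "pol (Suc k) (\<lambda>u. \<Sum>c=1..k. E (Suc k) c * A k (u - 1) c b)" if "b \<in> {1..k}" for b
      by (intro pol_sum pol_mult(1) A') (use that in auto)
    have al: "pol (Suc k) (\<lambda>u. \<Sum>c=1..k. A k (u - 1) a c * E c (Suc k))" if "a \<in> {1..k}" for a
      by (intro pol_sum pol_mult(2) A') (use that in auto)
    have ab: "pol (Suc k) (\<lambda>u. (if a = b then C k (u - 1) else 0)
       + br (E a (Suc k)) (\<Sum>c=1..k. E (Suc k) c * A k (u - 1) c b))" if "b \<in> {1..k}" for a b
      unfolding br_def by (intro pol_add pol_diff pol_mult(1,2) be that) (cases "a = b"; simp add: C' pol_0)
    have "a = Suc k \<or> a \<in> {1..k}" "b = Suc k \<or> b \<in> {1..k}" using that by auto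
    then show ?thesis
      using C' al be ab by (elim disjE) (simp_all add: A_Suc)
  qed
  with 1 show ?case by blast
qed

definition z :: "nat \<Rightarrow> nat \<Rightarrow> 'a"
  where "z k = (SOME y. y k = 1 \<and> (\<forall>u. C k u = (\<Sum>m\<le>k. sc (u ^ m) * y m)))"

lemma z_top: "z k k = 1" and C_z: "C k u = (\<Sum>m\<le>k. sc (u ^ m) * z k m)"
proof -
  obtain y where y: "\<And>u. C k u - sc (u ^ k) = (\<Sum>m<k. sc (u ^ m) * y m)"
    using pol_C_A[of k] unfolding pol_def by blast
  have "\<exists>y. y k = 1 \<and> (\<forall>u. C k u = (\<Sum>m\<le>k. sc (u ^ m) * y m))"
    by (rule exI[of _ "y(k := 1)"])
      (auto simp: lessThan_Suc_atMost[symmetric] y[symmetric] intro!: sum.cong)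
  from someI_ex[OF this] show "z k k = 1" "C k u = (\<Sum>m\<le>k. sc (u ^ m) * z k m)"
    unfolding z_def by blast+
qed

lemma br_z:
  assumes "\<And>u. br x (C k u) = 0" "m \<le> k"
  shows "br x (z k m) = 0"
proof (rule poly_zero[where d = "Suc k" and z = "\<lambda>m. br x (z k m)"])
  show "(\<Sum>m<Suc k. sc (u ^ m) * br x (z k m)) = 0" for u
    using assms(1)[of u] by (simp add: C_z br_sum br_mult lessThan_Suc_atMost)
qed (use assms in auto)

primrec Ep :: "nat \<Rightarrow> nat \<Rightarrow> nat \<Rightarrow> nat \<Rightarrow> 'a" where
  "Ep k 0 a b = (if a = b then 1 else 0)"
| "Ep k (Suc q) a b = (\<Sum>c=1..k. E a c * Ep k q c b)"

definition casimir :: "nat \<Rightarrow> nat \<Rightarrow> 'a"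
  where "casimir k j = (\<Sum>a=1..k. Ep k j a a)"

lemma casimir_0: "casimir k 0 = sc (of_nat k)"
  by (simp add: casimir_def sc_of_nat)

lemma gadj_Ep: "k \<le> n \<Longrightarrow> gadj k (Ep k q)"
proof (induction q)
  case 0
  have "gadj k (\<lambda>a b. if a = b then 1 else 0)"
    by (rule gadj_delta) (simp add: ginv_def)
  also have "(\<lambda>a b. if a = b then 1 else 0) = Ep k 0" by (auto simp: fun_eq_iff)
  finally show ?case .
next
  case (Suc q)
  have "gadj k (\<lambda>a b. \<Sum>c=1..k. E a c * Ep k q c b)"
    by (rule gadj_mult[OF gadj_E Suc.IH]) (use Suc in auto)
  also have "(\<lambda>a b. \<Sum>c=1..k. E a c * Ep k q c b) = Ep k (Suc q)" by (auto simp: fun_eq_iff)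
  finally show ?case .
qed

lemma ginv_casimir: "k \<le> n \<Longrightarrow> ginv k (casimir k j)"
  unfolding casimir_def by (intro gadj_trace gadj_Ep)

lemma br_E_z: "k \<le> n \<Longrightarrow> m \<le> k \<Longrightarrow> a \<in> {1..k} \<Longrightarrow> b \<in> {1..k} \<Longrightarrow> br (E a b) (z k m) = 0"
  using capelliD(1)[OF capelli] by (intro br_z) (auto simp: ginv_def)

text \<open>Insert the expansions of \<open>C k u\<close> and \<open>A k u\<close> in powers of u into the Cayley identity. Comparison of
coefficients expresses the adjugate by powers of E and gives the Cayley-Hamilton theorem; the trace identity
\<open>tr A(u) = C(u) - C(u - 1)\<close> then becomes Newton's identities. The shift by one in it is the source of the
binomial coefficients.\<close>

lemma newton:
  assumes k: "k \<le> n"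
  shows cayley_hamilton: "a \<in> {1..k} \<Longrightarrow> b \<in> {1..k} \<Longrightarrow> (\<Sum>m\<le>k. z k m * Ep k m a b) = 0"
    and newton_low: "p < k \<Longrightarrow> (\<Sum>m=Suc p..k. z k m * casimir k (m - Suc p)) =
       - (\<Sum>m=Suc p..k. sc (of_nat (m choose p) * (- 1) ^ (m - p)) * z k m)"
proof -
  have "\<exists>y. \<forall>a\<in>{1..k}. \<forall>b\<in>{1..k}. \<forall>u. A k u a b = (\<Sum>p<k. sc (u ^ p) * y a b p)"
  proof -
    have "\<forall>a. \<forall>b. \<exists>y. a \<in> {1..k} \<and> b \<in> {1..k} \<longrightarrow> (\<forall>u. A k u a b = (\<Sum>p<k. sc (u ^ p) * y p))"
      using pol_C_A[of k] unfolding pol_def by blast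
    then obtain y where "\<forall>a. \<forall>b. a \<in> {1..k} \<and> b \<in> {1..k} \<longrightarrow> (\<forall>u. A k u a b = (\<Sum>p<k. sc (u ^ p) * y a b p))"
      by metis
    then show ?thesis by (intro exI[of _ y]) auto
  qed
  then obtain y where y: "\<And>a b u. a \<in> {1..k} \<Longrightarrow> b \<in> {1..k} \<Longrightarrow> A k u a b = (\<Sum>p<k. sc (u ^ p) * y a b p)"
    by blast
  \<comment> \<open>index shifted by one, and zero outside\<close>
  define w where "w q a b = (if q = 0 \<or> q > k then 0 else y a b (q - 1))" for q a b
  have Aw0: "A k u a b = (\<Sum>q\<le>k. sc (u ^ q) * w (Suc q) a b)" if "a \<in> {1..k}" "b \<in> {1..k}" for u a b
    using y[OF that, of u] by (simp add: w_def lessThan_Suc_atMost[symmetric])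
  have Aw: "sc u * A k u a b = (\<Sum>q\<le>k. sc (u ^ q) * w q a b)" if ab: "a \<in> {1..k}" "b \<in> {1..k}" for u a b
  proof -
    have "(\<Sum>q\<le>k. sc (u ^ q) * w q a b) = (\<Sum>q=1..k. sc (u ^ q) * w q a b)"
      by (rule sum.mono_neutral_right) (auto simp: w_def)
    also have "\<dots> = (\<Sum>p<k. sc (u ^ Suc p) * w (Suc p) a b)"
      by (rule sum.reindex_bij_witness[of _ Suc "\<lambda>q. q - 1"]) (auto simp: Suc_le_eq)
    also have "\<dots> = sc u * A k u a b"
      unfolding y[OF ab] sum_distrib_left by (intro sum.cong refl) (simp add: w_def sc_mult mult.assoc)
    finally show ?thesis by simp
  qed
  have rec: "w q a b = (if a = b then z k q else 0) + (\<Sum>c=1..k. E a c * w (Suc q) c b)"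
    if q: "q \<le> k" and a: "a \<in> {1..k}" and b: "b \<in> {1..k}" for q a b
  proof -
    let ?d = "\<lambda>q. w q a b - (\<Sum>c=1..k. E a c * w (Suc q) c b) - (if a = b then z k q else 0)"
    have "(\<Sum>q<Suc k. sc (u ^ q) * ?d q) = 0" for u
    proof -
      have "(\<Sum>c=1..k. E a c * A k u c b) = (\<Sum>q\<le>k. sc (u ^ q) * (\<Sum>c=1..k. E a c * w (Suc q) c b))"
      proof -
        have "(\<Sum>c=1..k. E a c * A k u c b) = (\<Sum>c=1..k. \<Sum>q\<le>k. sc (u ^ q) * (E a c * w (Suc q) c b))"
        proof (rule sum.cong[OF refl])
          fix c assume c: "c \<in> {1..k}"
          show "E a c * A k u c b = (\<Sum>q\<le>k. sc (u ^ q) * (E a c * w (Suc q) c b))"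
            unfolding Aw0[OF c b] sum_distrib_left by (intro sum.cong refl) (metis mult.assoc sc_comm)
        qed
        then show ?thesis unfolding sum_distrib_left by (subst (asm) sum.swap) simp
      qed
      then show ?thesis
        using capelliD(3)[OF capelli[OF k] a b, of u] unfolding Aw[OF a b] C_z lessThan_Suc_atMost
        by (cases "a = b") (simp_all add: right_diff_distrib sum_subtractf)
    qed
    from poly_zero[OF this, of q] show ?thesis using q by (simp add: algebra_simps split: if_splits)
  qed
  have w: "w q a b = (\<Sum>m=q..k. z k m * Ep k (m - q) a b)" if "q \<le> Suc k" "a \<in> {1..k}" "b \<in> {1..k}" for q a b
    using that
  proof (induction q arbitrary: a b rule: inc_induct)
    case base
    then show ?case by (simp add: w_def)
  next
    case (step q)
    have "w q a b = (if a = b then z k q else 0) + (\<Sum>c=1..k. E a c * (\<Sum>m=Suc q..k. z k m * Ep k (m - Suc q) c b))"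
      using step by (subst rec) (auto intro!: sum.cong)
    also have "(\<Sum>c=1..k. E a c * (\<Sum>m=Suc q..k. z k m * Ep k (m - Suc q) c b)) =
      (\<Sum>c=1..k. \<Sum>m=Suc q..k. z k m * (E a c * Ep k (m - Suc q) c b))"
      unfolding sum_distrib_left
    proof (intro sum.cong refl)
      fix c m assume "c \<in> {1..k}" "m \<in> {Suc q..k}"
      then have "E a c * z k m = z k m * E a c" using br_E_z[OF k, of m a c] step by (simp add: br_eq_0)
      then show "E a c * (z k m * Ep k (m - Suc q) c b) = z k m * (E a c * Ep k (m - Suc q) c b)"
        by (simp flip: mult.assoc)
    qed
    also have "\<dots> = (\<Sum>m=Suc q..k. z k m * Ep k (m - q) a b)"
    proof (subst sum.swap, rule sum.cong[OF refl])
      fix m assume "m \<in> {Suc q..k}"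
      then have "m - q = Suc (m - Suc q)" by auto
      then show "(\<Sum>c=1..k. z k m * (E a c * Ep k (m - Suc q) c b)) = z k m * Ep k (m - q) a b"
        by (simp add: sum_distrib_left)
    qed
    also have "(if a = b then z k q else 0) + \<dots> = (\<Sum>m=q..k. z k m * Ep k (m - q) a b)"
      using step by (simp add: sum.atLeast_Suc_atMost)
    finally show ?case .
  qed
  show "(\<Sum>m\<le>k. z k m * Ep k m a b) = 0" if "a \<in> {1..k}" "b \<in> {1..k}"
    using w[of 0 a b] that by (simp add: w_def atLeast0AtMost)
  show "(\<Sum>m=Suc p..k. z k m * casimir k (m - Suc p)) =
       - (\<Sum>m=Suc p..k. sc (of_nat (m choose p) * (- 1) ^ (m - p)) * z k m)" if p: "p < k"
  proof -
    let ?b = "\<lambda>m p. of_nat (m choose p) * (- 1) ^ (m - p) :: complex"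
    let ?d = "\<lambda>p. (\<Sum>m=Suc p..k. z k m * casimir k (m - Suc p)) + (\<Sum>m=Suc p..k. sc (?b m p) * z k m)"
    have "(\<Sum>p<k. sc (u ^ p) * ?d p) = 0" for u
    proof -
      have "(\<Sum>a=1..k. A k u a a) = (\<Sum>a=1..k. \<Sum>p<k. sc (u ^ p) * (\<Sum>m=Suc p..k. z k m * Ep k (m - Suc p) a a))"
      proof (rule sum.cong[OF refl])
        fix a assume a: "a \<in> {1..k}"
        have "y a a p = (\<Sum>m=Suc p..k. z k m * Ep k (m - Suc p) a a)" if "p < k" for p
          using w[of "Suc p" a a] a that by (simp add: w_def)
        then show "A k u a a = (\<Sum>p<k. sc (u ^ p) * (\<Sum>m=Suc p..k. z k m * Ep k (m - Suc p) a a))"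
          unfolding y[OF a a] by simp
      qed
      also have "\<dots> = (\<Sum>p<k. sc (u ^ p) * (\<Sum>m=Suc p..k. z k m * casimir k (m - Suc p)))"
        unfolding casimir_def sum_distrib_left by (subst sum.swap) (rule sum.cong[OF refl], rule sum.swap)
      finally have 1: "C k u - C k (u - 1) = (\<Sum>p<k. sc (u ^ p) * (\<Sum>m=Suc p..k. z k m * casimir k (m - Suc p)))"
        using capelliD(5)[OF capelli[OF k], of u] by simp
      have "C k (u - 1) = (\<Sum>m\<le>k. \<Sum>p\<le>m. sc (u ^ p) * (sc (?b m p) * z k m))"
        unfolding C_z binomial_minus_one sc_sum sum_distrib_right
        by (intro sum.cong refl) (simp add: sc_mult mult.commute[of _ "_ ^ _"] mult.assoc)
      also have "\<dots> = (\<Sum>m\<le>k. sc (u ^ m) * z k m) + (\<Sum>m\<le>k. \<Sum>p<m. sc (u ^ p) * (sc (?b m p) * z k m))"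
        unfolding sum.distrib[symmetric] by (intro sum.cong refl) (simp add: lessThan_Suc_atMost[symmetric])
      also have "(\<Sum>m\<le>k. \<Sum>p<m. sc (u ^ p) * (sc (?b m p) * z k m)) = (\<Sum>p<k. \<Sum>m=Suc p..k. sc (u ^ p) * (sc (?b m p) * z k m))"
        unfolding sum.Sigma[OF finite_atMost ballI[OF finite_lessThan], simplified] sum.Sigma[OF finite_lessThan ballI[OF finite_atLeastAtMost]]
        by (rule sum.reindex_bij_witness[of _ "\<lambda>(a, b). (b, a)" "\<lambda>(a, b). (b, a)"]) auto
      finally have 2: "C k u - C k (u - 1) = - (\<Sum>p<k. sc (u ^ p) * (\<Sum>m=Suc p..k. sc (?b m p) * z k m))"
        by (simp add: C_z sum_distrib_left)
      show ?thesis
        unfolding distrib_left sum.distrib using trans[OF 1[symmetric] 2] by (simp only: eq_neg_iff_add_eq_0)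
    qed
    from poly_zero[OF this p] show ?thesis by (simp add: eq_neg_iff_add_eq_0)
  qed
qed

lemma newton_high:
  assumes k: "k \<le> n"
  shows "(\<Sum>m\<le>k. z k m * casimir k (m + j)) = 0"
proof -
  have Ep_add: "Ep k (m + j) a b = (\<Sum>d=1..k. Ep k m a d * Ep k j d b)" if "a \<in> {1..k}" for m a b
    using that
  proof (induction m arbitrary: a)
    case 0
    then show ?case by (simp add: if_times)
  next
    case (Suc m)
    have "Ep k (Suc m + j) a b = (\<Sum>d'=1..k. \<Sum>d=1..k. E a d' * (Ep k m d' d * Ep k j d b))"
      by (simp add: Suc sum_distrib_left)
    also have "\<dots> = (\<Sum>d=1..k. Ep k (Suc m) a d * Ep k j d b)"
      by (subst sum.swap) (simp add: sum_distrib_right mult.assoc)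
    finally show ?case .
  qed
  have "(\<Sum>m\<le>k. z k m * casimir k (m + j)) = (\<Sum>a=1..k. \<Sum>m\<le>k. z k m * Ep k (m + j) a a)"
    unfolding casimir_def sum_distrib_left by (rule sum.swap)
  also have "\<dots> = (\<Sum>a=1..k. \<Sum>m\<le>k. \<Sum>d=1..k. z k m * Ep k m a d * Ep k j d a)"
    by (intro sum.cong refl) (simp add: Ep_add sum_distrib_left mult.assoc)
  also have "\<dots> = (\<Sum>a=1..k. \<Sum>d=1..k. (\<Sum>m\<le>k. z k m * Ep k m a d) * Ep k j d a)"
    unfolding sum_distrib_right by (intro sum.cong refl sum.swap)
  also have "\<dots> = 0"
    using cayley_hamilton[OF k] by simp
  finally show ?thesis .
qed

inductive_set alg :: "'a set \<Rightarrow> 'a set" for S where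
  alg_sc: "sc x \<in> alg S"
| alg_gen: "x \<in> S \<Longrightarrow> x \<in> alg S"
| alg_add: "x \<in> alg S \<Longrightarrow> y \<in> alg S \<Longrightarrow> x + y \<in> alg S"
| alg_mult: "x \<in> alg S \<Longrightarrow> y \<in> alg S \<Longrightarrow> x * y \<in> alg S"

lemma alg_uminus: "x \<in> alg S \<Longrightarrow> - x \<in> alg S"
  using alg_mult[OF alg_sc, of x S "-1"] by (simp add: sc_minus)

lemma alg_diff: "x \<in> alg S \<Longrightarrow> y \<in> alg S \<Longrightarrow> x - y \<in> alg S"
  using alg_add[OF _ alg_uminus] by fastforce

lemma alg_1: "1 \<in> alg S" and alg_0: "0 \<in> alg S"
  using alg_sc[of 1 S] alg_sc[of 0 S] by simp_all

lemma alg_sum: "(\<And>i. i \<in> I \<Longrightarrow> F i \<in> alg S) \<Longrightarrow> (\<Sum>i\<in>I. F i) \<in> alg S"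
  by (induction I rule: infinite_finite_induct) (auto intro: alg_0 alg_add)

lemma alg_mono:
  assumes "x \<in> alg S" "S \<subseteq> alg T" shows "x \<in> alg T"
  using assms(1) by induction (use assms(2) in \<open>auto intro: alg.intros\<close>)

lemma alg_comm:
  assumes "x \<in> alg S" "\<And>s. s \<in> S \<Longrightarrow> br y s = 0"
  shows "br y x = 0"
  using assms(1) by induction (simp_all add: assms(2) br_add br_mult)

text \<open>In the identity \<open>newton_low\<close> for p the lowest coefficient \<open>z k (p + 1)\<close> occurs with the factor
\<open>k - p - 1\<close> in total, which is nonzero below the top coefficient; so the identities can be solved from the
top coefficient downwards.\<close>

lemma z_in_alg:
  assumes k: "k \<le> n" and m: "m \<le> k"
  shows "z k m \<in> alg (casimir k ` {1..k})"
  using m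
proof (induction "k - m" arbitrary: m rule: less_induct)
  case less
  let ?S = "casimir k ` {1..k}"
  have c: "casimir k j \<in> alg ?S" if "j \<le> k" for j
    using that by (cases "j = 0") (auto simp: casimir_0 intro: alg_sc alg_gen)
  consider "m = k" | "m = 0" "k > 0" | p where "m = Suc p" "Suc p < k"
  proof (cases m)
    case 0
    then show ?thesis using that less.prems by (cases "k = 0") auto
  next
    case (Suc p)
    then show ?thesis using that less.prems by (cases "m = k") auto
  qed
  then show ?case
  proof cases
    case 1
    then show ?thesis by (simp add: z_top alg_1)
  next
    case 2
    have "z k 0 * sc (of_nat k) + (\<Sum>m=1..k. z k m * casimir k m) = 0"
      using newton_high[OF k, of 0] by (simp add: atMost_atLeast0 sum.atLeast_Suc_atMost casimir_0 One_nat_def)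
    then have "sc (of_nat k) * z k 0 = - (\<Sum>m=1..k. z k m * casimir k m)"
      by (simp add: sc_comm[of _ "z k 0"] eq_neg_iff_add_eq_0)
    then have "sc (1 / of_nat k) * (sc (of_nat k) * z k 0) = sc (1 / of_nat k) * - (\<Sum>m=1..k. z k m * casimir k m)"
      by simp
    moreover have "sc (1 / of_nat k) * (sc (of_nat k) * z k 0) = z k 0"
      using 2 by (simp flip: mult.assoc sc_mult)
    moreover have "(\<Sum>m=1..k. z k m * casimir k m) \<in> alg ?S"
      using less 2 by (intro alg_sum alg_mult c) auto
    ultimately have "z k 0 = sc (1 / of_nat k) * - (\<Sum>m=1..k. z k m * casimir k m)"
        and "sc (1 / of_nat k) * - (\<Sum>m=1..k. z k m * casimir k m) \<in> alg ?S"
      by (simp_all only: alg_mult alg_sc alg_uminus)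
    then show ?thesis using 2 by simp
  next
    case 3
    let ?r = "\<lambda>m. sc (of_nat (m choose p) * (- 1) ^ (m - p)) * z k m"
    let ?t = "of_nat k - of_nat (Suc p) :: complex"
    have "(\<Sum>m=Suc p..k. z k m * casimir k (m - Suc p) + ?r m) = 0"
      using newton_low[OF k, of p] 3 by (simp add: sum.distrib)
    then have "z k (Suc p) * sc (of_nat k) + sc (- of_nat (Suc p)) * z k (Suc p)
        + (\<Sum>m=Suc (Suc p)..k. z k m * casimir k (m - Suc p) + ?r m) = 0"
      using 3 by (simp add: sum.atLeast_Suc_atMost[of "Suc p"] casimir_0)
    moreover have "sc ?t * z k (Suc p) = z k (Suc p) * sc (of_nat k) + sc (- of_nat (Suc p)) * z k (Suc p)"
      unfolding sc_diff sc_minus left_diff_distrib by (simp add: sc_comm[of _ "z k _"])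
    ultimately have "sc ?t * z k (Suc p) = - (\<Sum>m=Suc (Suc p)..k. z k m * casimir k (m - Suc p) + ?r m)"
      by (simp add: eq_neg_iff_add_eq_0)
    then have "sc (1 / ?t) * (sc ?t * z k (Suc p)) = sc (1 / ?t) * - (\<Sum>m=Suc (Suc p)..k. z k m * casimir k (m - Suc p) + ?r m)"
      by simp
    moreover have "sc (1 / ?t) * (sc ?t * z k (Suc p)) = z k (Suc p)"
    proof -
      have "?t \<noteq> 0" using 3 by (metis less_irrefl of_nat_eq_iff right_minus_eq)
      then show ?thesis by (simp flip: mult.assoc sc_mult)
    qed
    moreover have "(\<Sum>m=Suc (Suc p)..k. z k m * casimir k (m - Suc p) + ?r m) \<in> alg ?S"
      using less 3 by (intro alg_sum alg_add alg_mult c alg_sc) auto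
    ultimately have "z k (Suc p) = sc (1 / ?t) * - (\<Sum>m=Suc (Suc p)..k. z k m * casimir k (m - Suc p) + ?r m)"
        and "sc (1 / ?t) * - (\<Sum>m=Suc (Suc p)..k. z k m * casimir k (m - Suc p) + ?r m) \<in> alg ?S"
      by (simp_all only: alg_mult alg_sc alg_uminus)
    then show ?thesis using 3 by (simp only:)
  qed
qed

lemma casimir_in_alg:
  assumes k: "k \<le> n"
  shows "casimir k j \<in> alg (casimir k ` {1..k})"
proof (induction j rule: less_induct)
  case (less j)
  show ?case
  proof (cases "j \<le> k")
    case True
    then show ?thesis by (cases "j = 0") (auto simp: casimir_0 intro: alg_sc alg_gen)
  next
    case False
    have "(\<Sum>m<k. z k m * casimir k (m + (j - k))) + casimir k j = 0"
      using newton_high[OF k, of "j - k"] False by (simp add: lessThan_Suc_atMost[symmetric] z_top)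
    then have "casimir k j = - (\<Sum>m<k. z k m * casimir k (m + (j - k)))"
      by (simp add: eq_neg_iff_add_eq_0 add.commute)
    moreover have "(\<Sum>m<k. z k m * casimir k (m + (j - k))) \<in> alg (casimir k ` {1..k})"
      using False by (intro alg_sum alg_mult z_in_alg[OF k] less) auto
    ultimately show ?thesis by (metis alg_uminus)
  qed
qed

lemma twist_family: "gl_family (\<lambda>i j. - E j i) sc n"
  by unfold_locales (simp_all add: sc_add sc_mult br_minus E_br, rule sc_comm)

text \<open>The twist exchanges raising and lowering operators, so that statements about lowering a weight follow from
those about raising it. The reflection of u carries the root \<open>\<lambda>\<close> to \<open>k - 1 - \<lambda>\<close>.\<close>

theorem twist_C:
  "k \<le> n \<Longrightarrow> gl_family.C (\<lambda>i j. - E j i) sc k u = sc ((- 1) ^ k) * C k (of_nat k - 1 - u)"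
proof (induction k arbitrary: u)
  case 0
  interpret T: gl_family "\<lambda>i j. - E j i" sc n by (rule twist_family)
  show ?case by simp
next
  case (Suc k)
  interpret T: gl_family "\<lambda>i j. - E j i" sc n by (rule twist_family)
  define x where "x = of_nat k - u"
  have k: "k \<le> n" and cap: "capelli k" and Tcap: "T.capelli k" using Suc.prems capelli T.capelli by auto
  note k' = Suc.prems
  have "T.gvec k (E (Suc k))"
    unfolding T.gvec_def using k' by (auto simp: br_minus E_br)
  note 1 = T.capelliD(6)[OF Tcap this, of _ "u - 1"]
  have A: "(\<Sum>b=1..k. T.A k (u - 1) a b * E (Suc k) b) = - (sc ((- 1) ^ k) * be k (x + 1) a)" if "a \<in> {1..k}" for a
  proof -
    have "br (sc ((- 1) ^ k) * C k x) (E (Suc k) a) = sc ((- 1) ^ k) * be k (x + 1) a"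
      using br_C_ef(3)[OF k' cap that, of "x + 1"] by (simp add: br_mult_left f_def[OF k' cap])
    moreover have "T.C k (u - 1) = sc ((- 1) ^ k) * C k x"
      using Suc.IH[OF k, of "u - 1"] by (simp add: x_def algebra_simps)
    moreover have "br (T.C k (u - 1)) (E (Suc k) a) = - (\<Sum>b=1..k. T.A k (u - 1) a b * E (Suc k) b)"
      by (rule 1) (use that in auto)
    ultimately show ?thesis by simp
  qed
  have "T.C (Suc k) u = sc ((- 1) ^ k) * (C k x * (sc u + E (Suc k) (Suc k)))
    - (\<Sum>a=1..k. - E a (Suc k) * (\<Sum>b=1..k. T.A k (u - 1) a b * - E (Suc k) b))"
    unfolding T.C_Suc using Suc.IH[OF k, of "u - 1"] by (simp add: x_def algebra_simps)
  also have "(\<Sum>a=1..k. - E a (Suc k) * (\<Sum>b=1..k. T.A k (u - 1) a b * - E (Suc k) b))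
    = (\<Sum>a=1..k. E a (Suc k) * (\<Sum>b=1..k. T.A k (u - 1) a b * E (Suc k) b))"
    by (simp add: sum_negf)
  also have "\<dots> = - (sc ((- 1) ^ k) * (\<Sum>a=1..k. e k a * be k (x + 1) a))"
    unfolding sum_distrib_left sum_negf[symmetric]
  proof (rule sum.cong[OF refl])
    fix a assume a: "a \<in> {1..k}"
    have "E a (Suc k) * (sc ((- 1) ^ k) * be k (x + 1) a) = sc ((- 1) ^ k) * (e k a * be k (x + 1) a)"
      by (simp add: sc_comm[of _ "E a (Suc k)"] e_def[OF k' cap] flip: mult.assoc)
    then show "(\<Sum>n=1..k. E a (Suc k) * (T.A k (u - 1) a n * E (Suc k) n)) = - (sc ((- 1) ^ k) * (e k a * be k (x + 1) a))"
      using A[OF a] by (simp flip: sum_distrib_left)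
  qed
  also have "(\<Sum>a=1..k. e k a * be k (x + 1) a) = C k x * (sc x - H k) - sc (of_nat k) * C k x - C (Suc k) x"
  proof -
    have s1: "(\<Sum>a=1..k. e k a * be k (x + 1) a) = (\<Sum>a=1..k. br (e k a) (be k (x + 1) a)) + (\<Sum>a=1..k. be k (x + 1) a * e k a)"
      by (simp add: br_def flip: sum.distrib)
    have "(\<Sum>a=1..k. A (Suc k) (x + 1) a a) = (\<Sum>a=1..k. C k x + br (e k a) (be k (x + 1) a))"
      by (intro sum.cong refl) (simp add: A_Suc'[OF k' cap])
    then have s2: "(\<Sum>a=1..k. br (e k a) (be k (x + 1) a)) = C (Suc k) (x + 1) - C (Suc k) x - C k x - sc (of_nat k) * C k x"
      using trace_Suc[OF k' cap, of "x + 1"] by (simp add: sum.distrib A_Suc sc_of_nat algebra_simps)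
    have s3: "(\<Sum>a=1..k. be k (x + 1) a * e k a) = C k x * (sc (x + 1) - H k) - C (Suc k) (x + 1)"
      using C_Suc_be[OF k' cap, of "x + 1"] by (simp add: algebra_simps)
    show ?thesis
      unfolding s1 s2 s3 by (simp add: algebra_simps sc_add)
  qed
  finally show ?case
    unfolding H_def[OF k' cap] x_def by (simp add: algebra_simps sc_diff sc_minus sc_comm[of _ "C k _"])
qed

end

section \<open>Orthogonal projection\<close>

text \<open>Orthogonal projection with respect to finitely many coordinates, by induction on their set. It
replaces complete reducibility: an equivariant orthogonality argument produces
invariant representatives.\<close>

lemma orthogonal_projection:
  fixes K :: "('x \<Rightarrow> complex) set"
  assumes "finite X" and "(\<lambda>x. 0) \<in> K"
    and "\<And>r s. r \<in> K \<Longrightarrow> s \<in> K \<Longrightarrow> (\<lambda>x. r x + s x) \<in> K"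
    and "\<And>a r. r \<in> K \<Longrightarrow> (\<lambda>x. a * r x) \<in> K"
  shows "\<exists>q\<in>K. \<forall>r\<in>K. (\<Sum>x\<in>X. (p x - q x) * cnj (r x)) = 0"
  using assms
proof (induction X arbitrary: K p rule: finite_induct)
  case empty
  then show ?case by auto
next
  case (insert i X)
  note add = insert.prems(2) and scale = insert.prems(3)
  have diff: "(\<lambda>x. r x - s x) \<in> K" if "r \<in> K" "s \<in> K" for r s
    using add[OF that(1) scale[OF that(2), of "-1"]] by simp
  define K0 where "K0 = {r \<in> K. r i = 0}"
  define Y where "Y = insert i X"
  have Y: "finite Y" "i \<in> Y" using insert.hyps by (auto simp: Y_def)
  have IH: "\<exists>q\<in>K0. \<forall>r\<in>K0. (\<Sum>x\<in>Y. (p x - q x) * cnj (r x)) = 0" for p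
  proof -
    have "\<exists>q\<in>K0. \<forall>r\<in>K0. (\<Sum>x\<in>X. (p x - q x) * cnj (r x)) = 0"
      by (rule insert.IH) (use insert.prems in \<open>auto simp: K0_def\<close>)
    then obtain q where q: "q \<in> K0" "\<forall>r\<in>K0. (\<Sum>x\<in>X. (p x - q x) * cnj (r x)) = 0" by blast
    have "(\<Sum>x\<in>Y. (p x - q x) * cnj (r x)) = 0" if r: "r \<in> K0" for r
      using insert.hyps bspec[OF q(2) r] r unfolding Y_def by (simp add: K0_def)
    with q(1) show ?thesis by blast
  qed
  show ?case
  proof (cases "K = K0")
    case True
    then show ?thesis using IH[of p] unfolding Y_def by simp
  next
    case False
    then obtain y where y: "y \<in> K" "y i \<noteq> 0" unfolding K0_def by auto
    obtain q where q: "q \<in> K0" "\<And>r. r \<in> K0 \<Longrightarrow> (\<Sum>x\<in>Y. (y x - q x) * cnj (r x)) = 0"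
      using IH[of y] by blast
    define y' where "y' x = y x - q x" for x
    have y': "y' \<in> K" "y' i \<noteq> 0" using diff[OF y(1), of q] q(1) y(2) by (auto simp: y'_def[abs_def] K0_def)
    define ip where "ip f g = (\<Sum>x\<in>Y. f x * cnj (g x))" for f g :: "'x \<Rightarrow> complex"
    have ip_cnj: "cnj (ip f g) = ip g f" for f g
      by (simp add: ip_def mult.commute)
    have y'0: "ip y' r = 0" if "r \<in> K0" for r using q(2)[OF that] by (simp add: ip_def y'_def)
    have N: "ip y' y' \<noteq> 0"
    proof
      assume "ip y' y' = 0"
      moreover have "ip y' y' = complex_of_real (\<Sum>x\<in>Y. (cmod (y' x))\<^sup>2)"
        unfolding ip_def of_real_sum by (intro sum.cong refl complex_norm_square[symmetric])
      ultimately have "(\<Sum>x\<in>Y. (cmod (y' x))\<^sup>2) = 0" by (metis of_real_eq_0_iff)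
      then have "\<forall>x\<in>Y. (cmod (y' x))\<^sup>2 = 0" using Y by (simp add: sum_nonneg_eq_0_iff)
      then show False using y'(2) Y by simp
    qed
    obtain q0 where q0: "q0 \<in> K0" "\<And>r. r \<in> K0 \<Longrightarrow> ip (\<lambda>x. p x - q0 x) r = 0"
      using IH[of p] unfolding ip_def by blast
    define l where "l = ip p y' / ip y' y'"
    have "ip q0 y' = 0" using y'0[OF q0(1)] ip_cnj[of y' q0] by simp
    have 1: "ip (\<lambda>x. p x - (q0 x + l * y' x)) r = ip p r - ip q0 r - l * ip y' r" for r
      by (simp add: ip_def algebra_simps sum.distrib sum_subtractf sum_distrib_left)
    have 2: "ip f (\<lambda>x. r x + a * y' x) = ip f r + cnj a * ip f y'" for f r a
      by (simp add: ip_def algebra_simps sum.distrib sum_distrib_left)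
    have "ip (\<lambda>x. p x - (q0 x + l * y' x)) r = 0" if r: "r \<in> K" for r
    proof -
      define a where "a = r i / y' i"
      define r0 where "r0 x = r x - a * y' x" for x
      have r0: "r0 \<in> K0"
        using diff[OF r scale[OF y'(1), of a]] y'(2) by (simp add: K0_def r0_def[abs_def] a_def)
      have "ip p r0 - ip q0 r0 = ip (\<lambda>x. p x - q0 x) r0"
        by (simp add: ip_def algebra_simps sum_subtractf)
      then have "ip (\<lambda>x. p x - (q0 x + l * y' x)) r0 = 0"
        unfolding 1 using q0(2)[OF r0] y'0[OF r0] by simp
      moreover have "ip (\<lambda>x. p x - (q0 x + l * y' x)) y' = 0"
        unfolding 1 using N \<open>ip q0 y' = 0\<close> by (simp add: l_def)
      ultimately show ?thesis using 2[of _ r0 a] by (simp add: r0_def)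
    qed
    moreover have "(\<lambda>x. q0 x + l * y' x) \<in> K"
      by (intro add scale y') (use q0 in \<open>simp add: K0_def\<close>)
    ultimately show ?thesis
      unfolding Y_def[symmetric] ip_def by (intro bexI[of _ "\<lambda>x. q0 x + l * y' x"] ballI)
  qed
qed

section \<open>Invariant tensors\<close>

definition Idx :: "nat \<Rightarrow> nat \<Rightarrow> (nat \<Rightarrow> nat) set"
  where "Idx D k = PiE {..<D} (\<lambda>_. {1..k})"

lemma finite_Idx [simp]: "finite (Idx D k)"
  unfolding Idx_def by (rule finite_PiE) auto

lemma Idx_upd: "I \<in> Idx D k \<Longrightarrow> t < D \<Longrightarrow> a \<in> {1..k} \<Longrightarrow> I(t := a) \<in> Idx D k"
  unfolding Idx_def by (auto simp: PiE_iff extensional_def)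

lemma Idx_perm: "I \<in> Idx D k \<Longrightarrow> \<sigma> permutes {..<D} \<Longrightarrow> I \<circ> \<sigma> \<in> Idx D k"
  unfolding Idx_def using permutes_in_image[of \<sigma> "{..<D}"]
  by (auto simp: PiE_iff extensional_def permutes_def)

lemma Idx_mem: "I \<in> Idx D k \<Longrightarrow> t < D \<Longrightarrow> I t \<in> {1..k}"
  unfolding Idx_def by (metis PiE_mem lessThan_iff)

lemma sum_Idx_swap:
  assumes t: "t < D" and a: "a \<in> {1..k}" and b: "b \<in> {1..k}"
  shows "(\<Sum>I\<in>Idx D k. if I t = a then F (I(t := b)) I else 0) =
    (\<Sum>I\<in>Idx D k. if I t = b then F I (I(t := a)) else (0::'b::comm_monoid_add))"
proof -
  have "(\<Sum>I\<in>Idx D k. if I t = a then F (I(t := b)) I else 0) = (\<Sum>I\<in>{I\<in>Idx D k. I t = a}. F (I(t := b)) I)"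
    by (simp add: sum.inter_filter)
  also have "\<dots> = (\<Sum>I\<in>{I\<in>Idx D k. I t = b}. F I (I(t := a)))"
    by (rule sum.reindex_bij_witness[of _ "\<lambda>I. I(t := a)" "\<lambda>I. I(t := b)"]) (use assms in \<open>auto intro: Idx_upd\<close>)
  finally show ?thesis by (simp add: sum.inter_filter)
qed

text \<open>\<open>units D ys T g\<close> applies matrix units, one for each pair in \<open>ys\<close>, in pairwise distinct
positions of a tensor of degree D, avoiding the positions in T, and sums over all choices of the positions.
A product of Lie algebra elements differs from such a sum by terms in which two factors fall on the same
position (\<open>units_left\<close>, \<open>units_right\<close>).\<close>

primrec units :: "nat \<Rightarrow> (nat \<times> nat) list \<Rightarrow> nat set \<Rightarrow> ((nat \<Rightarrow> nat) \<Rightarrow> complex) \<Rightarrow> (nat \<Rightarrow> nat) \<Rightarrow> complex" where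
  "units D [] T g I = g I"
| "units D (y # ys) T g I =
    (\<Sum>t\<in>{..<D} - T. if I t = fst y then units D ys (insert t T) g (I(t := snd y)) else 0)"

definition lam :: "nat \<Rightarrow> nat set \<Rightarrow> nat \<times> nat \<Rightarrow> ((nat \<Rightarrow> nat) \<Rightarrow> complex) \<Rightarrow> (nat \<Rightarrow> nat) \<Rightarrow> complex"
  where "lam D T y g I = (\<Sum>t\<in>{..<D} - T. if I t = fst y then g (I(t := snd y)) else 0)"

lemma sum_remove_eq:
  "(\<Sum>t\<in>{..<D::nat} - T. f t) = (if s \<in> {..<D} - T then f s else 0) + (\<Sum>t\<in>{..<D} - insert s T. (f t :: 'b::ab_group_add))"
proof (cases "s \<in> {..<D} - T")
  case True
  have "{..<D} - insert s T = ({..<D} - T) - {s}" by auto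
  moreover have "(\<Sum>t\<in>{..<D} - T. f t) = f s + (\<Sum>t\<in>{..<D} - T - {s}. f t)"
    by (rule sum.remove) (use True in auto)
  ultimately show ?thesis using True by (simp only: if_True)
next
  case False
  then have "{..<D} - insert s T = {..<D} - T" by auto
  then show ?thesis using False by (simp only: if_False add_0_left)
qed

text \<open>A single Lie algebra element, acting from the left on the sum over distinct positions, either takes
a new position or meets one of the factors, where two matrix units multiply.\<close>

lemma units_left:
  "lam D T y (units D ys T g) I = units D (y # ys) T g I
    + (\<Sum>s<length ys. if snd y = fst (ys ! s) then units D (ys[s := (fst y, snd (ys ! s))]) T g I else 0)"
proof (induction ys arbitrary: T I)
  case Nil
  then show ?case by (simp only: lam_def units.simps list.size lessThan_0 sum.empty add_0_right)
next
  case (Cons x zs)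
  obtain a b where y: "y = (a, b)" by (cases y)
  obtain c d where x: "x = (c, d)" by (cases x)
  let ?W = "{..<D} - T"
  have in1: "(if I t = a then units D (x # zs) T g (I(t := b)) else 0) =
     (if I t = a then (if b = c then units D zs (insert t T) g (I(t := d)) else 0) else 0)
     + (\<Sum>t'\<in>?W - {t}. if I t' = c then if I t = a then units D zs (insert t' T) g (I(t' := d, t := b)) else 0 else 0)"
    if t: "t \<in> ?W" for t
  proof (cases "I t = a")
    case True
    have e1: "units D (x # zs) T g (I(t := b)) = (\<Sum>t'\<in>?W. if (I(t := b)) t' = c then units D zs (insert t' T) g (I(t := b, t' := d)) else 0)"
      by (simp only: x units.simps fst_conv snd_conv)
    have e2: "(\<Sum>t'\<in>?W. if (I(t := b)) t' = c then units D zs (insert t' T) g (I(t := b, t' := d)) else 0) = (if (I(t := b)) t = c then units D zs (insert t T) g (I(t := b, t := d)) else 0)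
      + (\<Sum>t'\<in>?W - {t}. if (I(t := b)) t' = c then units D zs (insert t' T) g (I(t := b, t' := d)) else 0)"
      by (rule sum.remove) (use t in simp_all)
    have e3: "(\<Sum>t'\<in>?W - {t}. if (I(t := b)) t' = c then units D zs (insert t' T) g (I(t := b, t' := d)) else 0) =
      (\<Sum>t'\<in>?W - {t}. if I t' = c then units D zs (insert t' T) g (I(t' := d, t := b)) else 0)"
      by (rule sum.cong) (simp_all add: fun_upd_twist)
    show ?thesis using True unfolding e1 e2 e3 by (simp cong: if_cong)
  qed (simp cong: if_cong)
  have swap: "(\<Sum>t\<in>?W. \<Sum>t'\<in>?W - {t}. F t t') = (\<Sum>t'\<in>?W. \<Sum>t\<in>?W - {t'}. F t t')" for F :: "nat \<Rightarrow> nat \<Rightarrow> complex"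
  proof -
    have "(\<Sum>t\<in>?W. \<Sum>t'\<in>?W - {t}. F t t') = (\<Sum>t\<in>?W. \<Sum>t'\<in>?W. if t' = t then 0 else F t t')"
      by (intro sum.cong refl sum.mono_neutral_cong_left) auto
    also have "\<dots> = (\<Sum>t'\<in>?W. \<Sum>t\<in>?W. if t' = t then 0 else F t t')" by (rule sum.swap)
    also have "\<dots> = (\<Sum>t'\<in>?W. \<Sum>t\<in>?W - {t'}. F t t')"
      by (intro sum.cong refl sum.mono_neutral_cong_right) auto
    finally show ?thesis .
  qed
  have eqW: "?W - {t} = {..<D} - insert t T" for t by auto
  let ?X1 = "\<Sum>t\<in>?W. if I t = a then (if b = c then units D zs (insert t T) g (I(t := d)) else 0) else 0"
  let ?X2 = "\<Sum>t'\<in>?W. \<Sum>t\<in>?W - {t'}. if I t' = c then if I t = a then units D zs (insert t' T) g (I(t' := d, t := b)) else 0 else 0"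
  let ?Y1 = "\<Sum>t'\<in>?W. if I t' = c then units D (y # zs) (insert t' T) g (I(t' := d)) else 0"
  let ?Y2 = "\<Sum>s<length zs. if b = fst (zs ! s) then units D (x # zs[s := (a, snd (zs ! s))]) T g I else 0"
  have s1: "lam D T y (units D (x # zs) T g) I = ?X1 + ?X2"
  proof -
    have "lam D T y (units D (x # zs) T g) I = (\<Sum>t\<in>?W.
     (if I t = a then (if b = c then units D zs (insert t T) g (I(t := d)) else 0) else 0)
     + (\<Sum>t'\<in>?W - {t}. if I t' = c then if I t = a then units D zs (insert t' T) g (I(t' := d, t := b)) else 0 else 0))"
      unfolding lam_def y fst_conv snd_conv by (rule sum.cong[OF refl], rule in1)
    then show ?thesis
      unfolding sum.distrib by (rule trans) (rule arg_cong2[where f = "(+)", OF refl swap])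
  qed
  have s2: "?X1 = (if b = c then units D ((a, d) # zs) T g I else 0)"
    by (cases "b = c") (simp_all cong: if_cong)
  have s3: "?X2 = (\<Sum>t'\<in>?W. if I t' = c then lam D (insert t' T) y (units D zs (insert t' T) g) (I(t' := d)) else 0)"
  proof (rule sum.cong[OF refl])
    fix t' assume "t' \<in> ?W"
    show "(\<Sum>t\<in>?W - {t'}. if I t' = c then if I t = a then units D zs (insert t' T) g (I(t' := d, t := b)) else 0 else 0) =
      (if I t' = c then lam D (insert t' T) y (units D zs (insert t' T) g) (I(t' := d)) else 0)"
      unfolding lam_def y fst_conv snd_conv eqW[symmetric]
      by (cases "I t' = c") (simp_all cong: if_cong)
  qed
  have s4: "(\<Sum>t'\<in>?W. if I t' = c then lam D (insert t' T) y (units D zs (insert t' T) g) (I(t' := d)) else 0) = ?Y1 + ?Y2"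
  proof -
    have "?Y2 = (\<Sum>s<length zs. \<Sum>t'\<in>?W. if I t' = c then if b = fst (zs ! s)
          then units D (zs[s := (a, snd (zs ! s))]) (insert t' T) g (I(t' := d)) else 0 else 0)"
    proof (rule sum.cong[OF refl])
      fix s
      show "(if b = fst (zs ! s) then units D (x # zs[s := (a, snd (zs ! s))]) T g I else 0) =
        (\<Sum>t'\<in>?W. if I t' = c then if b = fst (zs ! s)
          then units D (zs[s := (a, snd (zs ! s))]) (insert t' T) g (I(t' := d)) else 0 else 0)"
        by (cases "b = fst (zs ! s)") (simp_all add: x cong: if_cong)
    qed
    also have "\<dots> = (\<Sum>t'\<in>?W. if I t' = c then \<Sum>s<length zs. if b = fst (zs ! s)
          then units D (zs[s := (a, snd (zs ! s))]) (insert t' T) g (I(t' := d)) else 0 else 0)"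
      by (subst sum.swap, rule sum.cong[OF refl]) (simp cong: if_cong)
    finally have Y2: "?Y2 = (\<Sum>t'\<in>?W. if I t' = c then \<Sum>s<length zs. if b = fst (zs ! s)
          then units D (zs[s := (a, snd (zs ! s))]) (insert t' T) g (I(t' := d)) else 0 else 0)" .
    show ?thesis
      unfolding Y2 sum.distrib[symmetric]
    proof (rule sum.cong[OF refl])
      fix t'
      have IH: "lam D (insert t' T) (a, b) (units D zs (insert t' T) g) (I(t' := d)) =
        units D ((a, b) # zs) (insert t' T) g (I(t' := d)) + (\<Sum>s<length zs. if b = fst (zs ! s)
          then units D (zs[s := (a, snd (zs ! s))]) (insert t' T) g (I(t' := d)) else 0)"
        by (rule Cons.IH[unfolded y fst_conv snd_conv])
      show "(if I t' = c then lam D (insert t' T) y (units D zs (insert t' T) g) (I(t' := d)) else 0) =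
        (if I t' = c then units D (y # zs) (insert t' T) g (I(t' := d)) else 0) +
        (if I t' = c then \<Sum>s<length zs. if b = fst (zs ! s)
          then units D (zs[s := (a, snd (zs ! s))]) (insert t' T) g (I(t' := d)) else 0 else 0)"
        using IH unfolding y by (cases "I t' = c") (simp_all del: units.simps fun_upd_apply)
    qed
  qed
  have s5: "?Y1 = units D (y # x # zs) T g I"
  proof -
    have "units D (y # x # zs) T g I = (\<Sum>t\<in>?W. \<Sum>t'\<in>?W - {t}. if I t = a then if I t' = c then
        units D zs (insert t' (insert t T)) g (I(t := b, t' := d)) else 0 else 0)"
      unfolding y x units.simps fst_conv snd_conv eqW[symmetric]
    proof (rule sum.cong[OF refl])
      fix t
      show "(if I t = a then \<Sum>ta\<in>?W - {t}. if (I(t := b)) ta = c then units D zs (insert ta (insert t T)) g ((I(t := b))(ta := d)) else 0 else 0) =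
        (\<Sum>t'\<in>?W - {t}. if I t = a then if I t' = c then units D zs (insert t' (insert t T)) g (I(t := b, t' := d)) else 0 else 0)"
        by (cases "I t = a") (auto intro!: sum.cong)
    qed
    also have "\<dots> = (\<Sum>t'\<in>?W. \<Sum>t\<in>?W - {t'}. if I t = a then if I t' = c then
        units D zs (insert t' (insert t T)) g (I(t := b, t' := d)) else 0 else 0)"
      by (rule swap)
    also have "\<dots> = ?Y1"
    proof (rule sum.cong[OF refl])
      fix t'
      have tw: "I(t := b, t' := d) = I(t' := d, t := b)" if "t \<noteq> t'" for t
        using that by (auto simp: fun_eq_iff)
      show "(\<Sum>t\<in>?W - {t'}. if I t = a then if I t' = c then
        units D zs (insert t' (insert t T)) g (I(t := b, t' := d)) else 0 else 0) =
        (if I t' = c then units D (y # zs) (insert t' T) g (I(t' := d)) else 0)"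
        unfolding y units.simps fst_conv snd_conv eqW[symmetric]
        by (cases "I t' = c") (simp_all add: tw insert_commute cong: if_cong sum.cong_simp)
    qed
    finally show ?thesis by simp
  qed
  have "(\<Sum>s<length (x # zs). if snd y = fst ((x # zs) ! s) then units D ((x # zs)[s := (fst y, snd ((x # zs) ! s))]) T g I else 0)
     = (if b = c then units D ((a, d) # zs) T g I else 0) + ?Y2"
    by (simp only: list.size add_Suc_right add_0_right sum.lessThan_Suc_shift nth_Cons_0 nth_Cons_Suc list_update_code(2,3) y x fst_conv snd_conv)
  then show ?case
    using s1 s2 s3 s4 s5 by (simp only: ac_simps)
qed

lemma units_untouched:
  "t \<in> T \<Longrightarrow> units D ys T (\<lambda>I. if I t = a then g (I(t := b)) else 0) I =
    (if I t = a then units D ys T g (I(t := b)) else 0)"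
proof (induction ys arbitrary: T I)
  case (Cons y ys)
  have *: "units D ys (insert t' T) (\<lambda>I. if I t = a then g (I(t := b)) else 0) (I(t' := d)) =
    (if I t = a then units D ys (insert t' T) g (I(t := b, t' := d)) else 0)" if "t' \<in> {..<D} - T" for t' d
  proof -
    have "t' \<noteq> t" using that Cons.prems by auto
    moreover have "units D ys (insert t' T) (\<lambda>I. if I t = a then g (I(t := b)) else 0) (I(t' := d)) =
      (if (I(t' := d)) t = a then units D ys (insert t' T) g (I(t' := d, t := b)) else 0)"
      by (rule Cons.IH) (use Cons.prems in simp)
    ultimately show ?thesis by (simp add: fun_upd_twist[of t' t])
  qed
  have ne: "t' \<noteq> t" if "t' \<in> {..<D} - T" for t' using that Cons.prems by auto
  show ?case
  proof (cases "I t = a")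
    case True
    then show ?thesis
      unfolding units.simps if_P[OF True] by (intro sum.cong refl) (simp add: * ne)
  next
    case False
    then show ?thesis
      unfolding units.simps if_not_P[OF False] by (intro sum.neutral ballI) (simp add: *)
  qed
qed simp

lemma units_add: "units D ys T (\<lambda>I. g I + h I) I = units D ys T g I + units D ys T h I"
proof (induction ys arbitrary: T I)
  case (Cons y ys)
  show ?case
    unfolding units.simps Cons.IH sum.distrib[symmetric] by (intro sum.cong refl) simp
qed simp

lemma lam_split:
  "t \<in> {..<D} - T \<Longrightarrow> lam D T y g I = (if I t = fst y then g (I(t := snd y)) else 0) + lam D (insert t T) y g I"
  unfolding lam_def by (subst sum_remove_eq[where s = t]) simp

lemma units_right:
  "units D ys T (lam D T y g) I = units D (y # ys) T g I
    + (\<Sum>s<length ys. if snd (ys ! s) = fst y then units D (ys[s := (fst (ys ! s), snd y)]) T g I else 0)"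
proof (induction ys arbitrary: T I)
  case Nil
  show ?case by (simp only: lam_def units.simps list.size lessThan_0 sum.empty add_0_right)
next
  case (Cons x zs)
  obtain a b where y: "y = (a, b)" by (cases y)
  obtain c d where x: "x = (c, d)" by (cases x)
  let ?W = "{..<D} - T"
  let ?Y0 = "\<Sum>t'\<in>?W. if I t' = c then if d = a then units D zs (insert t' T) g (I(t' := b)) else 0 else 0"
  let ?Y1 = "\<Sum>t'\<in>?W. if I t' = c then units D (y # zs) (insert t' T) g (I(t' := d)) else 0"
  let ?Y2 = "\<Sum>s<length zs. if snd (zs ! s) = a then units D (x # zs[s := (fst (zs ! s), b)]) T g I else 0"
  have IH: "units D zs (insert t' T) (lam D T y g) (I(t' := d)) =
     (if d = a then units D zs (insert t' T) g (I(t' := b)) else 0)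
     + (units D (y # zs) (insert t' T) g (I(t' := d))
     + (\<Sum>s<length zs. if snd (zs ! s) = a then units D (zs[s := (fst (zs ! s), b)]) (insert t' T) g (I(t' := d)) else 0))"
    if t': "t' \<in> ?W" for t'
  proof -
    have "lam D T y g = (\<lambda>I. (if I t' = a then g (I(t' := b)) else 0) + lam D (insert t' T) y g I)"
      using lam_split[OF t', of y g] by (simp add: fun_eq_iff y)
    then have "units D zs (insert t' T) (lam D T y g) (I(t' := d)) =
      units D zs (insert t' T) (\<lambda>I. if I t' = a then g (I(t' := b)) else 0) (I(t' := d))
      + units D zs (insert t' T) (lam D (insert t' T) (a, b) g) (I(t' := d))"
      by (simp only: units_add y)
    then show ?thesis
      unfolding Cons.IH[of "insert t' T", unfolded y fst_conv snd_conv] units_untouched[OF insertI1] y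
      by (simp del: units.simps)
  qed
  have Y2: "?Y2 = (\<Sum>t'\<in>?W. if I t' = c then \<Sum>s<length zs. if snd (zs ! s) = a
          then units D (zs[s := (fst (zs ! s), b)]) (insert t' T) g (I(t' := d)) else 0 else 0)"
  proof -
    have "?Y2 = (\<Sum>s<length zs. \<Sum>t'\<in>?W. if I t' = c then if snd (zs ! s) = a
          then units D (zs[s := (fst (zs ! s), b)]) (insert t' T) g (I(t' := d)) else 0 else 0)"
    proof (rule sum.cong[OF refl])
      fix s
      show "(if snd (zs ! s) = a then units D (x # zs[s := (fst (zs ! s), b)]) T g I else 0) =
        (\<Sum>t'\<in>?W. if I t' = c then if snd (zs ! s) = a
          then units D (zs[s := (fst (zs ! s), b)]) (insert t' T) g (I(t' := d)) else 0 else 0)"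
        by (cases "snd (zs ! s) = a") (simp_all add: x cong: if_cong)
    qed
    then show ?thesis
      by (rule trans) (subst sum.swap, rule sum.cong[OF refl], simp cong: if_cong)
  qed
  have "units D (x # zs) T (lam D T y g) I =
    (\<Sum>t'\<in>?W. if I t' = c then units D zs (insert t' T) (lam D T y g) (I(t' := d)) else 0)"
    by (simp only: x units.simps fst_conv snd_conv)
  moreover have "\<dots> = ?Y0 + (?Y1 + ?Y2)"
    unfolding Y2 sum.distrib[symmetric]
  proof (rule sum.cong[OF refl])
    fix t' assume "t' \<in> ?W"
    from IH[OF this]
    show "(if I t' = c then units D zs (insert t' T) (lam D T y g) (I(t' := d)) else 0) =
       (if I t' = c then if d = a then units D zs (insert t' T) g (I(t' := b)) else 0 else 0)
       + ((if I t' = c then units D (y # zs) (insert t' T) g (I(t' := d)) else 0)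
       + (if I t' = c then \<Sum>s<length zs. if snd (zs ! s) = a
          then units D (zs[s := (fst (zs ! s), b)]) (insert t' T) g (I(t' := d)) else 0 else 0))"
      by (cases "I t' = c") (simp_all del: units.simps)
  qed
  moreover have "?Y0 = (if d = a then units D ((c, b) # zs) T g I else 0)"
    by (cases "d = a") (simp_all cong: if_cong)
  moreover have "?Y1 = units D (x # y # zs) T g I"
    by (simp only: units.simps x fst_conv snd_conv)
  moreover have "units D (x # y # zs) T g I = units D (y # x # zs) T g I"
  proof -
    have eqW: "{..<D} - insert t T = ?W - {t}" for t by auto
    have sw: "(\<Sum>t\<in>?W. \<Sum>t'\<in>?W - {t}. F t t') = (\<Sum>t'\<in>?W. \<Sum>t\<in>?W - {t'}. F t t')" for F :: "nat \<Rightarrow> nat \<Rightarrow> complex"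
    proof -
      have "(\<Sum>t\<in>?W. \<Sum>t'\<in>?W - {t}. F t t') = (\<Sum>t\<in>?W. \<Sum>t'\<in>?W. if t' = t then 0 else F t t')"
        by (intro sum.cong refl sum.mono_neutral_cong_left) auto
      also have "\<dots> = (\<Sum>t'\<in>?W. \<Sum>t\<in>?W. if t' = t then 0 else F t t')" by (rule sum.swap)
      also have "\<dots> = (\<Sum>t'\<in>?W. \<Sum>t\<in>?W - {t'}. F t t')"
        by (intro sum.cong refl sum.mono_neutral_cong_right) auto
      finally show ?thesis .
    qed
    have ex: "units D (p # q # zs) T g I = (\<Sum>t\<in>?W. \<Sum>t'\<in>?W - {t}. if I t = fst p \<and> I t' = fst q then
        units D zs (insert t' (insert t T)) g (I(t := snd p, t' := snd q)) else 0)" for p q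
      unfolding units.simps eqW
    proof (rule sum.cong[OF refl])
      fix t
      show "(if I t = fst p then \<Sum>ta\<in>?W - {t}. if (I(t := snd p)) ta = fst q
           then units D zs (insert ta (insert t T)) g (I(t := snd p, ta := snd q)) else 0 else 0) =
         (\<Sum>t'\<in>?W - {t}. if I t = fst p \<and> I t' = fst q then
           units D zs (insert t' (insert t T)) g (I(t := snd p, t' := snd q)) else 0)"
        by (cases "I t = fst p") (simp_all cong: if_cong sum.cong_simp)
    qed
    have tw: "I(t := u, t' := v) = I(t' := v, t := u)" if "t \<noteq> t'" for t t' u v
      using that by (auto simp: fun_eq_iff)
    show ?thesis
      unfolding ex by (subst sw) (intro sum.cong refl, auto simp: tw insert_commute)
  qed
  moreover have "(\<Sum>s<length (x # zs). if snd ((x # zs) ! s) = fst y then units D ((x # zs)[s := (fst ((x # zs) ! s), snd y)]) T g I else 0)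
     = (if d = a then units D ((c, b) # zs) T g I else 0) + ?Y2"
    by (simp only: list.size add_Suc_right add_0_right sum.lessThan_Suc_shift nth_Cons_0 nth_Cons_Suc list_update_code(2,3) y x fst_conv snd_conv)
  ultimately show ?case
    by (simp only: ac_simps)
qed

lemma units_cong:
  assumes "\<And>I. I \<in> Idx D k \<Longrightarrow> g I = h I" "snd ` set ys \<subseteq> {1..k}" "I \<in> Idx D k"
  shows "units D ys T g I = units D ys T h I"
  using assms(2,3)
proof (induction ys arbitrary: T I)
  case (Cons y ys)
  then show ?case
    unfolding units.simps by (intro sum.cong refl if_cong Cons.IH Idx_upd) auto
qed (use assms(1) in simp)

lemma units_zero: "units D ys T (\<lambda>I. 0) I = 0"
  by (induction ys arbitrary: T I) (simp_all add: sum.neutral)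

lemma units_sum:
  "finite W \<Longrightarrow> units D ys T (\<lambda>J. \<Sum>t\<in>W. if b t then g t J else 0) J = (\<Sum>t\<in>W. if b t then units D ys T (g t) J else 0)"
  by (induction W rule: finite_induct) (simp_all add: units_zero units_add)

definition gl_invariant :: "nat \<Rightarrow> nat \<Rightarrow> ((nat \<Rightarrow> nat) \<Rightarrow> (nat \<Rightarrow> nat) \<Rightarrow> complex) \<Rightarrow> bool" where
  "gl_invariant D k p \<longleftrightarrow> (\<forall>I\<in>Idx D k. \<forall>J\<in>Idx D k. \<forall>a\<in>{1..k}. \<forall>b\<in>{1..k}.
     lam D {} (a, b) (\<lambda>I. p I J) I = lam D {} (b, a) (p I) J)"

text \<open>Invariance under single Lie algebra elements passes to products of them, and by \<open>units_left\<close> and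
\<open>units_right\<close> the correction terms of both sides correspond to each other.\<close>

lemma units_invariant:
  assumes p: "gl_invariant D k p"
  shows "length ys = r \<Longrightarrow> set ys \<subseteq> {1..k} \<times> {1..k} \<Longrightarrow> I \<in> Idx D k \<Longrightarrow> J \<in> Idx D k \<Longrightarrow>
    units D ys {} (\<lambda>I. p I J) I = units D (map prod.swap ys) {} (p I) J"
proof (induction r arbitrary: ys I J)
  case (Suc r)
  obtain a b zs where ys: "ys = (a, b) # zs" and zs: "length zs = r"
    using Suc.prems(1) by (cases ys) auto
  have zin: "set zs \<subseteq> {1..k} \<times> {1..k}" and a: "a \<in> {1..k}" and b: "b \<in> {1..k}"
    using Suc.prems(2) ys by auto
  have sin: "snd ` set (map prod.swap zs) \<subseteq> {1..k}" using zin by auto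
  have zs_upd: "set (zs[s := (a, snd (zs ! s))]) \<subseteq> {1..k} \<times> {1..k}" if "s < length zs" for s
  proof -
    have "zs ! s \<in> {1..k} \<times> {1..k}" using zin that by (meson nth_mem subsetD)
    then have "(a, snd (zs ! s)) \<in> {1..k} \<times> {1..k}" using a by (simp add: mem_Times_iff)
    then show ?thesis
      using zin set_update_subset_insert[of zs s "(a, snd (zs ! s))"] by blast
  qed
  have "lam D {} (a, b) (units D zs {} (\<lambda>I. p I J)) I =
    (\<Sum>t\<in>{..<D}. if I t = a then units D (map prod.swap zs) {} (p (I(t := b))) J else 0)"
    unfolding lam_def fst_conv snd_conv Diff_empty
    by (intro sum.cong refl if_cong Suc.IH Idx_upd zs zin Suc.prems b) auto
  also have "\<dots> = units D (map prod.swap zs) {} (\<lambda>J. lam D {} (a, b) (\<lambda>I. p I J) I) J"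
    unfolding lam_def fst_conv snd_conv Diff_empty by (rule units_sum[symmetric]) simp
  also have "\<dots> = units D (map prod.swap zs) {} (lam D {} (b, a) (p I)) J"
    by (rule units_cong[OF _ sin Suc.prems(4)]) (use p a b Suc.prems in \<open>simp add: gl_invariant_def\<close>)
  finally have 1: "lam D {} (a, b) (units D zs {} (\<lambda>I. p I J)) I = units D (map prod.swap zs) {} (lam D {} (b, a) (p I)) J" .
  have 2: "(\<Sum>s<length zs. if b = fst (zs ! s) then units D (zs[s := (a, snd (zs ! s))]) {} (\<lambda>I. p I J) I else 0) =
    (\<Sum>s<length (map prod.swap zs). if snd (map prod.swap zs ! s) = b
       then units D ((map prod.swap zs)[s := (fst (map prod.swap zs ! s), a)]) {} (p I) J else 0)"
  proof (rule sum.cong)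
    fix s assume s: "s \<in> {..<length (map prod.swap zs)}"
    have "units D (zs[s := (a, snd (zs ! s))]) {} (\<lambda>I. p I J) I = units D (map prod.swap (zs[s := (a, snd (zs ! s))])) {} (p I) J"
      by (rule Suc.IH[OF _ zs_upd Suc.prems(3,4)]) (use s zs in simp_all)
    then show "(if b = fst (zs ! s) then units D (zs[s := (a, snd (zs ! s))]) {} (\<lambda>I. p I J) I else 0) =
      (if snd (map prod.swap zs ! s) = b
       then units D ((map prod.swap zs)[s := (fst (map prod.swap zs ! s), a)]) {} (p I) J else 0)"
      using s by (simp add: map_update eq_commute[of b])
  qed simp
  show ?case
    using units_left[of D "{}" "(a, b)" zs "\<lambda>I. p I J" I] units_right[of D "map prod.swap zs" "{}" "(b, a)" "p I" J] 1 2
    unfolding ys list.map swap_simp fst_conv snd_conv by (simp only: add_right_cancel)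
qed simp

definition PS :: "nat \<Rightarrow> nat \<Rightarrow> (nat \<Rightarrow> nat) \<Rightarrow> (nat \<Rightarrow> nat) set"
  where "PS D m \<tau> = {\<sigma>. \<sigma> permutes {..<D} \<and> (\<forall>s<m. \<sigma> s = \<tau> s)}"

lemma finite_PS [simp]: "finite (PS D m \<tau>)"
  unfolding PS_def by (rule finite_subset[OF _ finite_permutations[of "{..<D}"]]) auto

lemma PS_full:
  assumes "inj_on \<tau> {..<D}" "\<tau> ` {..<D} \<subseteq> {..<D}"
  shows "PS D D \<tau> = {\<lambda>x. if x < D then \<tau> x else x}"
proof -
  let ?s = "\<lambda>x. if x < D then \<tau> x else x"
  have "bij_betw \<tau> {..<D} {..<D}"
    using assms by (simp add: bij_betw_def endo_inj_surj)
  then have "bij_betw ?s {..<D} {..<D}"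
    by (rule iffD1[OF bij_betw_cong, rotated]) simp
  then have "?s permutes {..<D}"
    by (rule bij_imp_permutes) simp
  moreover have "\<sigma> = ?s" if "\<sigma> \<in> PS D D \<tau>" for \<sigma>
    using that permutes_not_in[of \<sigma> "{..<D}"] unfolding PS_def by (auto simp: fun_eq_iff)
  ultimately show ?thesis by (auto simp: PS_def)
qed

lemma units_permutations_aux:
  assumes "m \<le> D" "inj_on \<tau> {..<m}" "\<tau> ` {..<m} \<subseteq> {..<D}"
  shows "units D (map (\<lambda>s. (X s, Y s)) [m..<D]) (\<tau> ` {..<m}) g I =
    (\<Sum>\<sigma>\<in>PS D m \<tau>. if \<forall>s\<in>{m..<D}. I (\<sigma> s) = X s
       then g (\<lambda>t. if t \<in> \<sigma> ` {m..<D} then Y (inv_into UNIV \<sigma> t) else I t) else 0)"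
  using assms
proof (induction m arbitrary: \<tau> I rule: inc_induct)
  case base
  then show ?case by (simp add: PS_full)
next
  case (step m)
  let ?T = "\<tau> ` {..<m}"
  let ?G = "\<lambda>m I \<sigma>. if \<forall>s\<in>{m..<D}. I (\<sigma> s) = X s
       then g (\<lambda>t. if t \<in> \<sigma> ` {m..<D} then Y (inv_into UNIV \<sigma> t) else I t) else 0"
  have upt: "[m..<D] = m # [Suc m..<D]" using step by (simp add: upt_conv_Cons)
  have IH: "units D (map (\<lambda>s. (X s, Y s)) [Suc m..<D]) (insert t ?T) g (I(t := Y m)) =
    (\<Sum>\<sigma>\<in>PS D (Suc m) (\<tau>(m := t)). ?G (Suc m) (I(t := Y m)) \<sigma>)" if t: "t \<in> {..<D} - ?T" for t
  proof -
    have im: "(\<tau>(m := t)) ` {..<Suc m} = insert t ?T" by (auto simp: lessThan_Suc)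
    have "inj_on (\<tau>(m := t)) {..<Suc m}"
      using step.prems(1) t by (auto simp: inj_on_def lessThan_Suc)
    moreover have "(\<tau>(m := t)) ` {..<Suc m} \<subseteq> {..<D}"
      unfolding im using step.prems(2) t by auto
    ultimately show ?thesis
      unfolding im[symmetric] by (rule step.IH)
  qed
  have G: "(if I t = X m then ?G (Suc m) (I(t := Y m)) \<sigma> else 0) = ?G m I \<sigma>"
    if t: "t \<in> {..<D} - ?T" and s: "\<sigma> \<in> PS D (Suc m) (\<tau>(m := t))" for t \<sigma>
  proof -
    have perm: "\<sigma> permutes {..<D}" and sm: "\<sigma> m = t" using s by (auto simp: PS_def)
    have inj: "\<sigma> x = \<sigma> y \<longleftrightarrow> x = y" for x y using permutes_inj[OF perm] by (auto dest: injD)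
    have m: "{m..<D} = insert m {Suc m..<D}" using step by auto
    have "(\<forall>s\<in>{m..<D}. I (\<sigma> s) = X s) \<longleftrightarrow> I t = X m \<and> (\<forall>s\<in>{Suc m..<D}. (I(t := Y m)) (\<sigma> s) = X s)"
      unfolding m sm[symmetric] by (auto simp: inj)
    moreover have "(\<lambda>x. if x \<in> \<sigma> ` {Suc m..<D} then Y (inv_into UNIV \<sigma> x) else (I(t := Y m)) x) =
      (\<lambda>x. if x \<in> \<sigma> ` {m..<D} then Y (inv_into UNIV \<sigma> x) else I x)"
      unfolding m sm[symmetric] using permutes_inv_eq[OF perm, of "\<sigma> m" m] by (auto simp: fun_eq_iff inj)
    ultimately show ?thesis by simp
  qed
  have "units D (map (\<lambda>s. (X s, Y s)) [m..<D]) ?T g I =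
    (\<Sum>t\<in>{..<D} - ?T. if I t = X m then units D (map (\<lambda>s. (X s, Y s)) [Suc m..<D]) (insert t ?T) g (I(t := Y m)) else 0)"
    by (simp only: upt list.map units.simps fst_conv snd_conv)
  also have "\<dots> = (\<Sum>t\<in>{..<D} - ?T. \<Sum>\<sigma>\<in>PS D (Suc m) (\<tau>(m := t)). ?G m I \<sigma>)"
  proof (rule sum.cong[OF refl])
    fix t assume t: "t \<in> {..<D} - ?T"
    have "(\<Sum>\<sigma>\<in>PS D (Suc m) (\<tau>(m := t)). ?G m I \<sigma>) =
        (\<Sum>\<sigma>\<in>PS D (Suc m) (\<tau>(m := t)). if I t = X m then ?G (Suc m) (I(t := Y m)) \<sigma> else 0)"
      by (rule sum.cong[OF refl], rule G[OF t, symmetric])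
    also have "\<dots> = (if I t = X m then \<Sum>\<sigma>\<in>PS D (Suc m) (\<tau>(m := t)). ?G (Suc m) (I(t := Y m)) \<sigma> else 0)"
      by (cases "I t = X m") (simp_all cong: if_cong)
    finally show "(if I t = X m then units D (map (\<lambda>s. (X s, Y s)) [Suc m..<D]) (insert t ?T) g (I(t := Y m)) else 0) =
       (\<Sum>\<sigma>\<in>PS D (Suc m) (\<tau>(m := t)). ?G m I \<sigma>)"
      unfolding IH[OF t] by simp
  qed
  also have "\<dots> = (\<Sum>t\<in>{..<D} - ?T. \<Sum>\<sigma>\<in>{\<sigma>\<in>PS D m \<tau>. \<sigma> m = t}. ?G m I \<sigma>)"
    by (intro sum.cong refl) (auto simp: PS_def less_Suc_eq)
  also have "\<dots> = (\<Sum>\<sigma>\<in>PS D m \<tau>. ?G m I \<sigma>)"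
  proof (rule sum.group)
    show "(\<lambda>\<sigma>. \<sigma> m) ` PS D m \<tau> \<subseteq> {..<D} - ?T"
    proof safe
      fix \<sigma> assume s: "\<sigma> \<in> PS D m \<tau>"
      then have perm: "\<sigma> permutes {..<D}" by (auto simp: PS_def)
      show "\<sigma> m < D" using permutes_in_image[OF perm, of m] step by simp
      fix i assume "\<sigma> m = \<tau> i" "i < m"
      then have "\<sigma> m = \<sigma> i" using s by (auto simp: PS_def)
      then show False using permutes_inj[OF perm] \<open>i < m\<close> by (auto dest: injD)
    qed
  qed simp_all
  finally show ?case .
qed

text \<open>For as many factors as there are positions, the choices of distinct positions are the permutations.\<close>

lemma units_permutations:
  assumes I: "I \<in> Idx D k" and X: "X \<in> Idx D k" and Y: "Y \<in> Idx D k"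
  shows "units D (map (\<lambda>s. (X s, Y s)) [0..<D]) {} g I =
    (\<Sum>\<sigma> | \<sigma> permutes {..<D}. if I \<circ> \<sigma> = X then g (Y \<circ> inv_into UNIV \<sigma>) else 0)"
proof -
  have "(if \<forall>s\<in>{0..<D}. I (\<sigma> s) = X s then g (\<lambda>t. if t \<in> \<sigma> ` {0..<D} then Y (inv_into UNIV \<sigma> t) else I t) else 0)
     = (if I \<circ> \<sigma> = X then g (Y \<circ> inv_into UNIV \<sigma>) else 0)" if s: "\<sigma> permutes {..<D}" for \<sigma>
  proof -
    have out: "Z x = undefined" if "Z \<in> Idx D k" "\<not> x < D" for Z x
      using that by (auto simp: Idx_def PiE_iff extensional_def)
    have "(\<forall>s\<in>{0..<D}. I (\<sigma> s) = X s) \<longleftrightarrow> I \<circ> \<sigma> = X"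
    proof
      assume *: "\<forall>s\<in>{0..<D}. I (\<sigma> s) = X s"
      show "I \<circ> \<sigma> = X"
      proof
        fix x show "(I \<circ> \<sigma>) x = X x"
          using * out[OF Idx_perm[OF I s], of x] out[OF X, of x] by (cases "x < D") auto
      qed
    qed auto
    moreover have "(\<lambda>t. if t \<in> \<sigma> ` {0..<D} then Y (inv_into UNIV \<sigma> t) else I t) = Y \<circ> inv_into UNIV \<sigma>"
    proof
      fix x
      have "\<sigma> ` {0..<D} = {..<D}" using permutes_image[OF s] by (simp add: atLeast0LessThan)
      then show "(if x \<in> \<sigma> ` {0..<D} then Y (inv_into UNIV \<sigma> x) else I x) = (Y \<circ> inv_into UNIV \<sigma>) x"
        using out[OF Idx_perm[OF Y permutes_inv[OF s]], of x] out[OF I, of x] by auto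
    qed
    ultimately show ?thesis by simp
  qed
  then show ?thesis
    using units_permutations_aux[of 0 D "\<lambda>x. x" X Y g I] by (simp add: PS_def)
qed

definition perm_tensor :: "(nat \<Rightarrow> nat) \<Rightarrow> (nat \<Rightarrow> nat) \<Rightarrow> (nat \<Rightarrow> nat) \<Rightarrow> complex"
  where "perm_tensor \<sigma> I J = (if J = I \<circ> \<sigma> then 1 else 0)"

lemma perm_tensor_invariant:
  assumes s: "\<sigma> permutes {..<D}"
  shows "gl_invariant D k (perm_tensor \<sigma>)"
  unfolding gl_invariant_def
proof (intro ballI)
  fix I J a b assume "I \<in> Idx D k" "J \<in> Idx D k" "a \<in> {1..k}" "b \<in> {1..k}"
  have inj: "\<sigma> x = \<sigma> y \<longleftrightarrow> x = y" for x y using permutes_inj[OF s] by (auto dest: injD)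
  have "lam D {} (a, b) (\<lambda>I. perm_tensor \<sigma> I J) I =
    (\<Sum>t\<in>{..<D}. if I t = a \<and> J = I(t := b) \<circ> \<sigma> then 1 else 0)"
    unfolding lam_def perm_tensor_def by (auto intro!: sum.cong)
  also have "\<dots> = (\<Sum>t\<in>{..<D}. if I (\<sigma> t) = a \<and> J = I(\<sigma> t := b) \<circ> \<sigma> then 1 else 0)"
    by (rule sum.reindex_bij_betw[OF permutes_imp_bij[OF s], symmetric])
  also have "\<dots> = (\<Sum>t\<in>{..<D}. if J t = b \<and> J(t := a) = I \<circ> \<sigma> then 1 else 0)"
  proof (intro sum.cong refl if_cong)
    fix t
    show "(I (\<sigma> t) = a \<and> J = I(\<sigma> t := b) \<circ> \<sigma>) = (J t = b \<and> J(t := a) = I \<circ> \<sigma>)"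
      by (auto simp: fun_eq_iff inj)
  qed
  also have "\<dots> = lam D {} (b, a) (perm_tensor \<sigma> I) J"
    unfolding lam_def perm_tensor_def by (auto intro!: sum.cong)
  finally show "lam D {} (a, b) (\<lambda>I. perm_tensor \<sigma> I J) I = lam D {} (b, a) (perm_tensor \<sigma> I) J" .
qed

lemma lam_linear: "lam D T y (\<lambda>I. g I - (\<Sum>i\<in>S. x i * h i I)) I = lam D T y g I - (\<Sum>i\<in>S. x i * lam D T y (h i) I)"
proof -
  have "(\<Sum>i\<in>S. x i * lam D T y (h i) I) = (\<Sum>t\<in>{..<D} - T. if I t = fst y then \<Sum>i\<in>S. x i * h i (I(t := snd y)) else 0)"
    unfolding lam_def sum_distrib_left by (subst sum.swap) (auto intro!: sum.cong)
  then show ?thesis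
    unfolding lam_def by (auto simp: sum_subtractf[symmetric] intro!: sum.cong)
qed

lemma sum_norm_square_sum:
  fixes u :: "'s \<Rightarrow> 'w \<Rightarrow> complex"
  shows "(\<Sum>w\<in>W. (\<Sum>\<sigma>\<in>P. u \<sigma> w) * cnj (\<Sum>\<sigma>\<in>P. u \<sigma> w)) = (\<Sum>\<tau>\<in>P. \<Sum>\<sigma>\<in>P. \<Sum>w\<in>W. u \<sigma> w * cnj (u \<tau> w))"
proof -
  have "(\<Sum>w\<in>W. (\<Sum>\<sigma>\<in>P. u \<sigma> w) * cnj (\<Sum>\<sigma>\<in>P. u \<sigma> w)) = (\<Sum>w\<in>W. \<Sum>\<sigma>\<in>P. \<Sum>\<tau>\<in>P. u \<sigma> w * cnj (u \<tau> w))"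
    by (simp only: cnj_sum sum_product)
  also have "\<dots> = (\<Sum>\<sigma>\<in>P. \<Sum>w\<in>W. \<Sum>\<tau>\<in>P. u \<sigma> w * cnj (u \<tau> w))"
    by (rule sum.swap)
  also have "\<dots> = (\<Sum>\<sigma>\<in>P. \<Sum>\<tau>\<in>P. \<Sum>w\<in>W. u \<sigma> w * cnj (u \<tau> w))"
    by (rule sum.cong[OF refl], rule sum.swap)
  also have "\<dots> = (\<Sum>\<tau>\<in>P. \<Sum>\<sigma>\<in>P. \<Sum>w\<in>W. u \<sigma> w * cnj (u \<tau> w))"
    by (rule sum.swap)
  finally show ?thesis .
qed

text \<open>The condition says that the operator \<open>(\<Sum>\<sigma>. \<chi>(\<sigma>) \<sigma>) x\<close> vanishes, where \<open>\<chi>\<close> is the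
character of the permutation action on tensors. Since \<open>\<chi>(\<sigma> \<tau>\<^sup>-\<^sup>1)\<close> is a Gram matrix, pairing with
x gives a sum of absolute squares; one of the squared numbers is a positive multiple of \<open>x Z\<close>.\<close>

lemma kernel_positive:
  fixes x :: "(nat \<Rightarrow> nat) \<Rightarrow> complex"
  assumes 0: "\<And>Y. Y \<in> Idx D k \<Longrightarrow>
      (\<Sum>I\<in>Idx D k. \<Sum>\<sigma> | \<sigma> permutes {..<D}. if I \<circ> \<sigma> = I then x (Y \<circ> inv_into UNIV \<sigma>) else 0) = 0"
    and Z: "Z \<in> Idx D k"
  shows "x Z = 0"
proof -
  let ?P = "{\<sigma>. \<sigma> permutes {..<D}}" and ?S = "Idx D k"
  have finP: "finite ?P" by (rule finite_permutations) simp
  let ?W = "?S \<times> ?S \<times> ?S"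
  define u where "u \<sigma> = (\<lambda>(I :: nat \<Rightarrow> nat, Y, N). if I \<circ> \<sigma> = N then x (Y \<circ> inv_into UNIV \<sigma>) else 0)" for \<sigma> :: "nat \<Rightarrow> nat"
  define h where "h w = (\<Sum>\<sigma>\<in>?P. u \<sigma> w)" for w
  have "(\<Sum>w\<in>?W. h w * cnj (h w)) = (\<Sum>\<tau>\<in>?P. \<Sum>\<sigma>\<in>?P. \<Sum>w\<in>?W. u \<sigma> w * cnj (u \<tau> w))"
    unfolding h_def by (rule sum_norm_square_sum)
  also have "\<dots> = (\<Sum>\<tau>\<in>?P. \<Sum>\<sigma>\<in>?P. \<Sum>I\<in>?S. \<Sum>Y\<in>?S.
       if I \<circ> \<sigma> = I \<circ> \<tau> then x (Y \<circ> inv_into UNIV \<sigma>) * cnj (x (Y \<circ> inv_into UNIV \<tau>)) else 0)"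
  proof (rule sum.cong[OF refl], rule sum.cong[OF refl])
    fix \<tau> \<sigma> :: "nat \<Rightarrow> nat" assume "\<sigma> \<in> ?P"
    have "(\<Sum>w\<in>?W. u \<sigma> w * cnj (u \<tau> w)) = (\<Sum>I\<in>?S. \<Sum>Y\<in>?S. \<Sum>N\<in>?S. u \<sigma> (I, Y, N) * cnj (u \<tau> (I, Y, N)))"
      by (simp add: sum.cartesian_product)
    also have "\<dots> = (\<Sum>I\<in>?S. \<Sum>Y\<in>?S. if I \<circ> \<sigma> = I \<circ> \<tau> then x (Y \<circ> inv_into UNIV \<sigma>) * cnj (x (Y \<circ> inv_into UNIV \<tau>)) else 0)"
    proof (rule sum.cong[OF refl], rule sum.cong[OF refl])
      fix I Y assume I: "I \<in> ?S"
      have "(\<Sum>N\<in>?S. u \<sigma> (I, Y, N) * cnj (u \<tau> (I, Y, N))) = (\<Sum>N\<in>?S. if I \<circ> \<sigma> = N then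
         (if I \<circ> \<tau> = I \<circ> \<sigma> then x (Y \<circ> inv_into UNIV \<sigma>) * cnj (x (Y \<circ> inv_into UNIV \<tau>)) else 0) else 0)"
        by (rule sum.cong[OF refl]) (simp add: u_def)
      also have "\<dots> = (if I \<circ> \<sigma> = I \<circ> \<tau> then x (Y \<circ> inv_into UNIV \<sigma>) * cnj (x (Y \<circ> inv_into UNIV \<tau>)) else 0)"
        using Idx_perm[OF I, of \<sigma>] \<open>\<sigma> \<in> ?P\<close> by (simp add: eq_commute[of "I \<circ> \<tau>"])
      finally show "(\<Sum>N\<in>?S. u \<sigma> (I, Y, N) * cnj (u \<tau> (I, Y, N))) =
         (if I \<circ> \<sigma> = I \<circ> \<tau> then x (Y \<circ> inv_into UNIV \<sigma>) * cnj (x (Y \<circ> inv_into UNIV \<tau>)) else 0)" .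
    qed
    finally show "(\<Sum>w\<in>?W. u \<sigma> w * cnj (u \<tau> w)) = (\<Sum>I\<in>?S. \<Sum>Y\<in>?S.
       if I \<circ> \<sigma> = I \<circ> \<tau> then x (Y \<circ> inv_into UNIV \<sigma>) * cnj (x (Y \<circ> inv_into UNIV \<tau>)) else 0)" .
  qed
  also have "\<dots> = (\<Sum>\<tau>\<in>?P. 0)"
  proof (rule sum.cong[OF refl])
    fix \<tau> :: "nat \<Rightarrow> nat" assume "\<tau> \<in> ?P"
    then have t: "\<tau> permutes {..<D}" by simp
    let ?t = "inv_into UNIV \<tau>"
    have ti: "?t permutes {..<D}" by (rule permutes_inv[OF t])
    have tt: "\<tau> \<circ> ?t = id" "?t \<circ> \<tau> = id" using permutes_inv_o[OF t] by auto
    have bijS: "bij_betw (\<lambda>Y. Y \<circ> \<tau>) ?S ?S"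
      by (rule bij_betw_byWitness[where f' = "\<lambda>Y. Y \<circ> ?t"]) (simp_all add: comp_assoc tt image_subset_iff Idx_perm t ti)
    have bijP: "bij_betw (\<lambda>\<rho>. \<rho> \<circ> \<tau>) ?P ?P"
      by (rule bij_betw_byWitness[where f' = "\<lambda>\<rho>. \<rho> \<circ> ?t"]) (simp_all add: comp_assoc tt image_subset_iff permutes_compose t ti)
    have "(\<Sum>\<sigma>\<in>?P. \<Sum>I\<in>?S. \<Sum>Y\<in>?S. if I \<circ> \<sigma> = I \<circ> \<tau> then x (Y \<circ> inv_into UNIV \<sigma>) * cnj (x (Y \<circ> ?t)) else 0)
      = (\<Sum>\<rho>\<in>?P. \<Sum>I\<in>?S. \<Sum>Y\<in>?S. if I \<circ> (\<rho> \<circ> \<tau>) = I \<circ> \<tau> then x (Y \<circ> inv_into UNIV (\<rho> \<circ> \<tau>)) * cnj (x (Y \<circ> ?t)) else 0)"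
      by (rule sum.reindex_bij_betw[OF bijP, symmetric])
    also have "\<dots> = (\<Sum>\<rho>\<in>?P. \<Sum>I\<in>?S. \<Sum>Y\<in>?S. if I \<circ> (\<rho> \<circ> \<tau>) = I \<circ> \<tau> then x ((Y \<circ> \<tau>) \<circ> inv_into UNIV (\<rho> \<circ> \<tau>)) * cnj (x ((Y \<circ> \<tau>) \<circ> ?t)) else 0)"
      by (intro sum.cong refl sum.reindex_bij_betw[OF bijS, symmetric])
    also have "\<dots> = (\<Sum>\<rho>\<in>?P. \<Sum>I\<in>?S. \<Sum>Y\<in>?S. if I \<circ> \<rho> = I then x (Y \<circ> inv_into UNIV \<rho>) * cnj (x Y) else 0)"
    proof (intro sum.cong refl)
      fix \<rho> I Y :: "nat \<Rightarrow> nat" assume "\<rho> \<in> ?P"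
      then have "\<rho> permutes {..<D}" by simp
      then have "inv_into UNIV (\<rho> \<circ> \<tau>) = ?t \<circ> inv_into UNIV \<rho>"
        using o_inv_distrib[OF permutes_bij permutes_bij[OF t]] by blast
      then have e1: "(Y \<circ> \<tau>) \<circ> inv_into UNIV (\<rho> \<circ> \<tau>) = Y \<circ> inv_into UNIV \<rho>"
        using tt(1) by (metis comp_assoc comp_id)
      have e2: "(Y \<circ> \<tau>) \<circ> ?t = Y" using tt(1) by (simp add: comp_assoc)
      have e3: "I \<circ> (\<rho> \<circ> \<tau>) = I \<circ> \<tau> \<longleftrightarrow> I \<circ> \<rho> = I"
        using tt(1) by (metis comp_assoc comp_id)
      show "(if I \<circ> (\<rho> \<circ> \<tau>) = I \<circ> \<tau> then x ((Y \<circ> \<tau>) \<circ> inv_into UNIV (\<rho> \<circ> \<tau>)) * cnj (x ((Y \<circ> \<tau>) \<circ> ?t)) else 0) =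
        (if I \<circ> \<rho> = I then x (Y \<circ> inv_into UNIV \<rho>) * cnj (x Y) else 0)"
        unfolding e1 e2 e3 ..
    qed
    also have "\<dots> = (\<Sum>I\<in>?S. \<Sum>\<rho>\<in>?P. \<Sum>Y\<in>?S. if I \<circ> \<rho> = I then x (Y \<circ> inv_into UNIV \<rho>) * cnj (x Y) else 0)"
      by (rule sum.swap)
    also have "\<dots> = (\<Sum>I\<in>?S. \<Sum>Y\<in>?S. \<Sum>\<rho>\<in>?P. if I \<circ> \<rho> = I then x (Y \<circ> inv_into UNIV \<rho>) * cnj (x Y) else 0)"
      by (rule sum.cong[OF refl], rule sum.swap)
    also have "\<dots> = (\<Sum>Y\<in>?S. \<Sum>I\<in>?S. \<Sum>\<rho>\<in>?P. if I \<circ> \<rho> = I then x (Y \<circ> inv_into UNIV \<rho>) * cnj (x Y) else 0)"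
      by (rule sum.swap)
    also have "\<dots> = (\<Sum>Y\<in>?S. (\<Sum>I\<in>?S. \<Sum>\<rho>\<in>?P. if I \<circ> \<rho> = I then x (Y \<circ> inv_into UNIV \<rho>) else 0) * cnj (x Y))"
      by (simp only: sum_distrib_right if_times(1))
    also have "\<dots> = 0" by (intro sum.neutral ballI) (simp add: 0)
    finally show "(\<Sum>\<sigma>\<in>?P. \<Sum>I\<in>?S. \<Sum>Y\<in>?S. if I \<circ> \<sigma> = I \<circ> \<tau> then x (Y \<circ> inv_into UNIV \<sigma>) * cnj (x (Y \<circ> ?t)) else 0) = 0" .
  qed
  finally have "(\<Sum>w\<in>?W. h w * cnj (h w)) = 0" by simp
  moreover have "(\<Sum>w\<in>?W. h w * cnj (h w)) = complex_of_real (\<Sum>w\<in>?W. (cmod (h w))\<^sup>2)"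
    unfolding of_real_sum by (intro sum.cong refl complex_norm_square[symmetric])
  ultimately have "complex_of_real (\<Sum>w\<in>?W. (cmod (h w))\<^sup>2) = 0" by (simp only:)
  then have 1: "(\<Sum>w\<in>?W. (cmod (h w))\<^sup>2) = 0" by (simp only: of_real_eq_0_iff)
  have fin: "finite ?W" by simp
  have "\<forall>w\<in>?W. (cmod (h w))\<^sup>2 = 0"
    by (rule iffD1[OF sum_nonneg_eq_0_iff[OF fin zero_le_power2] 1])
  then have "(cmod (h (Z, Z, Z)))\<^sup>2 = 0"
    by (rule bspec) (use Z in simp)
  then have "h (Z, Z, Z) = 0" by simp
  moreover have "h (Z, Z, Z) = (\<Sum>\<sigma>\<in>?P. if Z \<circ> \<sigma> = Z then x Z else 0)"
    unfolding h_def u_def prod.case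
  proof (intro sum.cong refl if_cong)
    fix \<sigma> assume s: "\<sigma> \<in> ?P" and "Z \<circ> \<sigma> = Z"
    then show "x (Z \<circ> inv_into UNIV \<sigma>) = x Z"
      using permutes_inv_o(1)[of \<sigma> "{..<D}"] by (metis comp_assoc comp_id mem_Collect_eq)
  qed
  moreover have "\<dots> = of_nat (card {\<sigma>\<in>?P. Z \<circ> \<sigma> = Z}) * x Z"
    by (simp add: sum.inter_filter[symmetric] finP)
  moreover have "card {\<sigma>\<in>?P. Z \<circ> \<sigma> = Z} \<noteq> 0"
  proof -
    have "finite {\<sigma>\<in>?P. Z \<circ> \<sigma> = Z}" using finP by simp
    moreover have "id \<in> {\<sigma>\<in>?P. Z \<circ> \<sigma> = Z}" by (simp add: permutes_id)
    ultimately show ?thesis by (metis card_0_eq empty_iff)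
  qed
  ultimately show ?thesis by simp
qed

text \<open>The tensors that commute with the Lie algebra are spanned by permutations. Subtracting the orthogonal projection
to that span leaves an invariant q which is orthogonal to all permutations. Invariance for products of D Lie
algebra elements, summed over the diagonal, turns the orthogonality into the hypothesis of
\<open>kernel_positive\<close>, so q vanishes.\<close>

theorem schur_weyl:
  assumes p: "gl_invariant D k p"
  shows "\<exists>\<alpha>. \<forall>I\<in>Idx D k. \<forall>J\<in>Idx D k. p I J = (\<Sum>\<sigma> | \<sigma> permutes {..<D}. \<alpha> \<sigma> * perm_tensor \<sigma> I J)"
proof -
  let ?P = "{\<sigma>. \<sigma> permutes {..<D}}" and ?S = "Idx D k"
  have finP: "finite ?P" by (rule finite_permutations) simp
  define A where "A = range (\<lambda>\<alpha> (I, J). \<Sum>\<sigma>\<in>?P. \<alpha> \<sigma> * perm_tensor \<sigma> I J :: complex)"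
  have "\<exists>q\<in>A. \<forall>r\<in>A. (\<Sum>x\<in>?S \<times> ?S. ((\<lambda>(I, J). p I J) x - q x) * cnj (r x)) = 0"
  proof (rule orthogonal_projection)
    show "(\<lambda>x. 0) \<in> A" unfolding A_def by (rule range_eqI[of _ _ "\<lambda>_. 0"]) auto
    fix r s assume "r \<in> A" "s \<in> A"
    then obtain f g where "r = (\<lambda>(I, J). \<Sum>\<sigma>\<in>?P. f \<sigma> * perm_tensor \<sigma> I J)" "s = (\<lambda>(I, J). \<Sum>\<sigma>\<in>?P. g \<sigma> * perm_tensor \<sigma> I J)"
      unfolding A_def by auto
    then show "(\<lambda>x. r x + s x) \<in> A"
      unfolding A_def by (intro range_eqI[of _ _ "\<lambda>\<sigma>. f \<sigma> + g \<sigma>"]) (auto simp: distrib_right sum.distrib)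
  next
    fix a r assume "r \<in> A"
    then obtain f where "r = (\<lambda>(I, J). \<Sum>\<sigma>\<in>?P. f \<sigma> * perm_tensor \<sigma> I J)" unfolding A_def by auto
    then show "(\<lambda>x. a * r x) \<in> A"
      unfolding A_def by (intro range_eqI[of _ _ "\<lambda>\<sigma>. a * f \<sigma>"]) (auto simp: sum_distrib_left mult.assoc)
  qed simp
  then obtain \<alpha> where orth: "\<And>r. r \<in> A \<Longrightarrow>
      (\<Sum>x\<in>?S \<times> ?S. ((\<lambda>(I, J). p I J) x - (\<lambda>(I, J). \<Sum>\<sigma>\<in>?P. \<alpha> \<sigma> * perm_tensor \<sigma> I J) x) * cnj (r x)) = 0"
    unfolding A_def by blast
  define q where "q I J = p I J - (\<Sum>\<sigma>\<in>?P. \<alpha> \<sigma> * perm_tensor \<sigma> I J)" for I J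
  have q0: "(\<Sum>I\<in>?S. q I (I \<circ> \<tau>)) = 0" if t: "\<tau> permutes {..<D}" for \<tau>
  proof -
    have "(\<lambda>(I, J). perm_tensor \<tau> I J) \<in> A"
      unfolding A_def by (rule range_eqI[of _ _ "\<lambda>\<sigma>. if \<sigma> = \<tau> then 1 else 0"]) (rule ext, simp add: split_beta if_times finP t)
    from orth[OF this] have "(\<Sum>I\<in>?S. \<Sum>J\<in>?S. q I J * cnj (perm_tensor \<tau> I J)) = 0"
      unfolding q_def by (subst sum.cartesian_product) (simp add: case_prod_beta)
    also have "(\<Sum>I\<in>?S. \<Sum>J\<in>?S. q I J * cnj (perm_tensor \<tau> I J)) = (\<Sum>I\<in>?S. q I (I \<circ> \<tau>))"
    proof (rule sum.cong[OF refl])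
      fix I assume "I \<in> ?S"
      then have "I \<circ> \<tau> \<in> ?S" using t by (rule Idx_perm)
      then show "(\<Sum>J\<in>?S. q I J * cnj (perm_tensor \<tau> I J)) = q I (I \<circ> \<tau>)"
        by (simp add: perm_tensor_def if_distrib[of cnj] if_times cong: if_cong)
    qed
    finally show ?thesis .
  qed
  have q: "gl_invariant D k q"
    unfolding gl_invariant_def
  proof (intro ballI)
    fix I J a b assume IJ: "I \<in> ?S" "J \<in> ?S" and ab: "a \<in> {1..k}" "b \<in> {1..k}"
    have "lam D {} (a, b) (\<lambda>I. perm_tensor \<sigma> I J) I = lam D {} (b, a) (perm_tensor \<sigma> I) J" if "\<sigma> \<in> ?P" for \<sigma>
      using perm_tensor_invariant[of \<sigma> D k] that IJ ab by (simp add: gl_invariant_def)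
    moreover have "lam D {} (a, b) (\<lambda>I. p I J) I = lam D {} (b, a) (p I) J"
      using p IJ ab by (simp add: gl_invariant_def)
    ultimately show "lam D {} (a, b) (\<lambda>I. q I J) I = lam D {} (b, a) (q I) J"
      unfolding q_def[abs_def] lam_linear by simp
  qed
  have "q I M = 0" if I: "I \<in> ?S" and M: "M \<in> ?S" for I M
  proof (rule kernel_positive[of D k "\<lambda>I. q I M", OF _ I])
    fix Y assume Y: "Y \<in> ?S"
    have "(\<Sum>I\<in>?S. \<Sum>\<sigma>\<in>?P. if I \<circ> \<sigma> = I then q (Y \<circ> inv_into UNIV \<sigma>) M else 0) =
      (\<Sum>I\<in>?S. \<Sum>\<sigma>\<in>?P. if M \<circ> \<sigma> = Y then q I (I \<circ> inv_into UNIV \<sigma>) else 0)"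
    proof (rule sum.cong[OF refl])
      fix I assume I: "I \<in> ?S"
      have "set (map (\<lambda>s. (I s, Y s)) [0..<D]) \<subseteq> {1..k} \<times> {1..k}"
        using Idx_mem[OF I] Idx_mem[OF Y] by fastforce
      from units_invariant[OF q refl this I M]
      have "units D (map (\<lambda>s. (I s, Y s)) [0..<D]) {} (\<lambda>I. q I M) I = units D (map (\<lambda>s. (Y s, I s)) [0..<D]) {} (q I) M"
        by (simp add: comp_def)
      then show "(\<Sum>\<sigma>\<in>?P. if I \<circ> \<sigma> = I then q (Y \<circ> inv_into UNIV \<sigma>) M else 0) =
        (\<Sum>\<sigma>\<in>?P. if M \<circ> \<sigma> = Y then q I (I \<circ> inv_into UNIV \<sigma>) else 0)"
        unfolding units_permutations[OF I I Y] units_permutations[OF M Y I] .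
    qed
    also have "\<dots> = (\<Sum>\<sigma>\<in>?P. if M \<circ> \<sigma> = Y then \<Sum>I\<in>?S. q I (I \<circ> inv_into UNIV \<sigma>) else 0)"
      by (subst sum.swap) (intro sum.cong refl, simp)
    also have "\<dots> = 0"
      by (intro sum.neutral ballI) (simp add: q0 permutes_inv)
    finally show "(\<Sum>I\<in>?S. \<Sum>\<sigma>\<in>?P. if I \<circ> \<sigma> = I then q (Y \<circ> inv_into UNIV \<sigma>) M else 0) = 0" .
  qed
  then show ?thesis unfolding q_def by (intro exI[of _ \<alpha>]) simp
qed

section \<open>The centre of the enveloping algebra\<close>

lemma prod_list_update:
  "t < length xs \<Longrightarrow> prod_list (xs[t := y]) = prod_list (take t xs) * y * prod_list (drop (Suc t) xs)" for xs :: "'a::ring_1 list"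
  by (simp add: upd_conv_take_nth_drop mult.assoc)

lemma br_prod_list: "br x (prod_list xs) = (\<Sum>t<length xs. prod_list (xs[t := br x (xs ! t)]))" for xs :: "'a::ring_1 list"
proof (induction xs)
  case (Cons y xs)
  have "br x (prod_list (y # xs)) = br x y * prod_list xs + y * (\<Sum>t<length xs. prod_list (xs[t := br x (xs ! t)]))"
    by (simp add: br_mult Cons)
  also have "\<dots> = (\<Sum>t<length (y # xs). prod_list ((y # xs)[t := br x ((y # xs) ! t)]))"
    by (simp add: sum.lessThan_Suc_shift sum_distrib_left del: sum.lessThan_Suc)
  finally show ?case .
qed simp

definition Lists :: "nat \<Rightarrow> nat \<Rightarrow> nat list set"
  where "Lists k m = {vs. length vs = m \<and> set vs \<subseteq> {1..k}}"

lemma finite_Lists [simp]: "finite (Lists k m)"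
  unfolding Lists_def using finite_lists_length_eq[of "{1..k}" m] by (simp add: conj_commute)

lemma sum_Lists_Suc: "(\<Sum>vs\<in>Lists k (Suc m). F vs) = (\<Sum>a\<in>{1..k}. \<Sum>vs\<in>Lists k m. F (a # vs))"
proof -
  have "(\<Sum>vs\<in>Lists k (Suc m). F vs) = (\<Sum>(a, vs)\<in>{1..k} \<times> Lists k m. F (a # vs))"
    by (rule sum.reindex_bij_witness[of _ "\<lambda>(a, vs). a # vs" "\<lambda>vs. (hd vs, tl vs)"])
      (auto simp: Lists_def length_Suc_conv)
  then show ?thesis by (simp add: sum.cartesian_product)
qed

context gl_family
begin

definition Ew :: "(nat \<times> nat) list \<Rightarrow> 'a"
  where "Ew w = prod_list (map (\<lambda>(i, j). E i j) w)"

lemma Ew_simps [simp]: "Ew [] = 1" "Ew ((i, j) # w) = E i j * Ew w" "Ew (u @ v) = Ew u * Ew v"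
  by (simp_all add: Ew_def)

lemma Ep_chain: "a \<in> {1..k} \<Longrightarrow> b \<in> {1..k} \<Longrightarrow> (\<Sum>js\<in>Lists k q. Ew (zip (a # js) (js @ [b]))) = Ep k (Suc q) a b"
proof (induction q arbitrary: a)
  case 0
  have "Lists k 0 = {[]}" by (auto simp: Lists_def)
  then show ?case using 0 by (simp add: if_times)
next
  case (Suc q)
  have "(\<Sum>js\<in>Lists k (Suc q). Ew (zip (a # js) (js @ [b]))) =
     (\<Sum>c\<in>{1..k}. \<Sum>js\<in>Lists k q. E a c * Ew (zip (c # js) (js @ [b])))"
    by (simp add: sum_Lists_Suc)
  also have "\<dots> = (\<Sum>c\<in>{1..k}. E a c * Ep k (Suc q) c b)"
    using Suc by (intro sum.cong refl) (simp flip: sum_distrib_left del: Ep.simps)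
  finally show ?case by simp
qed

lemma casimir_Lists:
  assumes "m \<ge> 1"
  shows "casimir k m = (\<Sum>vs\<in>Lists k m. Ew (zip vs (rotate1 vs)))"
proof -
  obtain q where m: "m = Suc q" using assms by (cases m) auto
  show ?thesis
    unfolding m casimir_def sum_Lists_Suc by (intro sum.cong refl) (simp add: Ep_chain del: Ep.simps)
qed

text \<open>The filtration by word length, with strict inequality, so that \<open>Filt k 0\<close> is zero and inductions start
without a separate case for scalars.\<close>

inductive_set Filt :: "nat \<Rightarrow> nat \<Rightarrow> 'a set" for k d where
  Filt_0: "0 \<in> Filt k d"
| Filt_step: "x \<in> Filt k d \<Longrightarrow> set w \<subseteq> {1..k} \<times> {1..k} \<Longrightarrow> length w < d \<Longrightarrow> sc a * Ew w + x \<in> Filt k d"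

lemma Filt_word: "set w \<subseteq> {1..k} \<times> {1..k} \<Longrightarrow> length w < d \<Longrightarrow> Ew w \<in> Filt k d"
  using Filt_step[OF Filt_0, of w k d 1] by simp

lemma Filt_add: "x \<in> Filt k d \<Longrightarrow> y \<in> Filt k d \<Longrightarrow> x + y \<in> Filt k d"
  by (induction x rule: Filt.induct) (auto simp: add.assoc intro: Filt_step)

lemma Filt_scale: "x \<in> Filt k d \<Longrightarrow> sc c * x \<in> Filt k d"
proof (induction x rule: Filt.induct)
  case (Filt_step x w a)
  then show ?case
    using Filt.Filt_step[of "sc c * x" k d w "c * a"] by (simp add: distrib_left sc_mult mult.assoc)
qed (simp add: Filt_0)

lemma Filt_uminus: "x \<in> Filt k d \<Longrightarrow> - x \<in> Filt k d"
  using Filt_scale[of x k d "-1"] by (simp add: sc_minus)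

lemma Filt_diff: "x \<in> Filt k d \<Longrightarrow> y \<in> Filt k d \<Longrightarrow> x - y \<in> Filt k d"
  using Filt_add[OF _ Filt_uminus] by fastforce

lemma Filt_sum: "(\<And>i. i \<in> I \<Longrightarrow> F i \<in> Filt k d) \<Longrightarrow> (\<Sum>i\<in>I. F i) \<in> Filt k d"
  by (induction I rule: infinite_finite_induct) (auto intro: Filt_0 Filt_add)

lemma Filt_mono: "x \<in> Filt k d \<Longrightarrow> d \<le> d' \<Longrightarrow> x \<in> Filt k d'"
  by (induction x rule: Filt.induct) (auto intro: Filt_0 Filt_step)

lemma Filt_mult_left: "x \<in> Filt k d \<Longrightarrow> set u \<subseteq> {1..k} \<times> {1..k} \<Longrightarrow> Ew u * x \<in> Filt k (length u + d)"
proof (induction x rule: Filt.induct)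
  case (Filt_step x w a)
  have "Ew u * (sc a * Ew w + x) = sc a * Ew (u @ w) + Ew u * x"
    by (simp add: distrib_left sc_comm[of a "Ew u"] flip: mult.assoc)
  then show ?case
    using Filt.Filt_step[of "Ew u * x" k "length u + d" "u @ w" a] Filt_step by (simp del: Ew_simps(3))
qed (simp add: Filt_0)

lemma Filt_mult_right: "x \<in> Filt k d \<Longrightarrow> set u \<subseteq> {1..k} \<times> {1..k} \<Longrightarrow> x * Ew u \<in> Filt k (d + length u)"
proof (induction x rule: Filt.induct)
  case (Filt_step x w a)
  have "(sc a * Ew w + x) * Ew u = sc a * Ew (w @ u) + x * Ew u"
    by (simp add: distrib_right mult.assoc)
  then show ?case
    using Filt.Filt_step[of "x * Ew u" k "d + length u" "w @ u" a] Filt_step by (simp del: Ew_simps(3))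
qed (simp add: Filt_0)

lemma Filt_mult: "x \<in> Filt k d \<Longrightarrow> y \<in> Filt k d' \<Longrightarrow> x * y \<in> Filt k (d + d')"
proof (induction x rule: Filt.induct)
  case (Filt_step x w a)
  have "sc a * (Ew w * y) + x * y \<in> Filt k (d + d')"
    using Filt_step Filt_mult_left[of y k d' w] by (auto intro!: Filt_add Filt_scale intro: Filt_mono)
  then show ?case by (simp add: distrib_right mult.assoc)
qed (simp add: Filt_0)

lemma Filt_br:
  assumes k: "k \<le> n" and a: "a \<in> {1..k}" and b: "b \<in> {1..k}"
  shows "x \<in> Filt k d \<Longrightarrow> br (E a b) x \<in> Filt k d"
proof (induction x rule: Filt.induct)
  case (Filt_step x w c)
  have word: "br (E a b) (Ew w) \<in> Filt k (Suc (length w))" if "set w \<subseteq> {1..k} \<times> {1..k}" for w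
    using that
  proof (induction w)
    case (Cons y w)
    obtain i j where y: "y = (i, j)" by (cases y)
    have ij: "i \<in> {1..k}" "j \<in> {1..k}" using Cons.prems y by auto
    have w: "Ew (p # w) \<in> Filt k (Suc (length (y # w)))" if "fst p \<in> {1..k}" "snd p \<in> {1..k}" for p
      using that Cons.prems by (intro Filt_word) (auto simp: mem_Times_iff)
    have "br (E a b) (E i j) = (if b = i then E a j else 0) - (if a = j then E i b else 0)"
      using a b ij k by (intro E_br) auto
    then have "br (E a b) (E i j) * Ew w = (if b = i then Ew ((a, j) # w) else 0) - (if a = j then Ew ((i, b) # w) else 0)"
      by (auto simp: left_diff_distrib)
    moreover have "(if b = i then Ew ((a, j) # w) else 0) - (if a = j then Ew ((i, b) # w) else 0) \<in> Filt k (Suc (length (y # w)))"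
      using w[of "(a, j)"] w[of "(i, b)"] a b ij by (intro Filt_diff) (auto intro: Filt_0)
    moreover have "E i j * br (E a b) (Ew w) \<in> Filt k (Suc (length (y # w)))"
      using Filt_mult_left[OF Cons.IH, of "[(i, j)]"] Cons.prems ij by simp
    ultimately show ?case by (simp add: y br_mult Filt_add)
  qed (simp add: Filt_0)
  have "sc c * br (E a b) (Ew w) + br (E a b) x \<in> Filt k d"
    using word[OF Filt_step(2)] Filt_step by (auto intro!: Filt_add Filt_scale intro: Filt_mono)
  then show ?case by (simp add: br_add br_mult)
qed (simp add: Filt_0)

lemma Filt_reorder:
  assumes k: "k \<le> n"
  shows "set w \<subseteq> {1..k} \<times> {1..k} \<Longrightarrow> mset w = mset w' \<Longrightarrow> Ew w - Ew w' \<in> Filt k (length w)"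
proof (induction w arbitrary: w')
  case (Cons y w)
  obtain i j where y: "y = (i, j)" by (cases y)
  have ij: "i \<in> {1..k}" "j \<in> {1..k}" using Cons.prems y by auto
  have "y \<in> set w'" using mset_eq_setD[OF Cons.prems(2)] by auto
  then obtain u v where w': "w' = u @ y # v" by (meson split_list)
  have m: "mset w = mset (u @ v)" using Cons.prems(2) w' by simp
  have uv: "set u \<subseteq> {1..k} \<times> {1..k}" "set v \<subseteq> {1..k} \<times> {1..k}"
    using Cons.prems(1) mset_eq_setD[OF m] by auto
  have len: "length w = length u + length v" using mset_eq_length[OF m] by simp
  have "br (E i j) (Ew u) \<in> Filt k (Suc (length u))"
    by (rule Filt_br[OF k ij Filt_word[OF uv(1)]]) simp
  then have 1: "br (E i j) (Ew u) * Ew v \<in> Filt k (length (y # w))"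
    using Filt_mult_right[OF _ uv(2)] len by fastforce
  have "E i j * (Ew w - Ew (u @ v)) \<in> Filt k (length (y # w))"
    using Filt_mult_left[OF Cons.IH[OF _ m], of "[(i, j)]"] Cons.prems(1) ij by simp
  from Filt_add[OF this 1] show ?case
    by (simp add: y w' br_def algebra_simps)
qed (simp add: Filt_0)

definition word :: "nat \<Rightarrow> (nat \<Rightarrow> nat) \<Rightarrow> (nat \<Rightarrow> nat) \<Rightarrow> (nat \<times> nat) list"
  where "word D I J = map (\<lambda>t. (I t, J t)) [0..<D]"

text \<open>The image of a tensor of degree D, given by its coefficients, under multiplication. Its kernel is not described: only
the preimage of the lower filtration step is used.\<close>

definition Tens :: "nat \<Rightarrow> nat \<Rightarrow> ((nat \<Rightarrow> nat) \<Rightarrow> (nat \<Rightarrow> nat) \<Rightarrow> complex) \<Rightarrow> 'a"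
  where "Tens D k p = (\<Sum>I\<in>Idx D k. \<Sum>J\<in>Idx D k. sc (p I J) * Ew (word D I J))"

lemma word_in: "I \<in> Idx D k \<Longrightarrow> J \<in> Idx D k \<Longrightarrow> set (word D I J) \<subseteq> {1..k} \<times> {1..k}"
  using Idx_mem[of _ D k] by (fastforce simp: word_def)

lemma length_word [simp]: "length (word D I J) = D"
  by (simp add: word_def)

lemma Tens_add: "Tens D k (\<lambda>I J. p I J + q I J) = Tens D k p + Tens D k q"
  by (simp add: Tens_def sc_add distrib_right sum.distrib)

lemma Tens_scale: "Tens D k (\<lambda>I J. a * p I J) = sc a * Tens D k p"
  by (simp add: Tens_def sc_mult sum_distrib_left mult.assoc)

lemma Filt_Suc_Tens: "x \<in> Filt k (Suc D) \<Longrightarrow> \<exists>p. x - Tens D k p \<in> Filt k D"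
proof (induction x rule: Filt.induct)
  case Filt_0
  then show ?case by (intro exI[of _ "\<lambda>_ _. 0"]) (simp add: Tens_def Filt.Filt_0)
next
  case (Filt_step x w a)
  then obtain p where p: "x - Tens D k p \<in> Filt k D" by blast
  show ?case
  proof (cases "length w = D")
    case False
    then have "sc a * Ew w + (x - Tens D k p) \<in> Filt k D"
      using Filt_step by (intro Filt_add Filt_scale Filt_word p) auto
    then show ?thesis by (intro exI[of _ p]) (simp add: add_diff_eq)
  next
    case True
    define I0 J0 where "I0 = (\<lambda>t. if t < D then fst (w ! t) else undefined)" and "J0 = (\<lambda>t. if t < D then snd (w ! t) else undefined)"
    have w: "w ! t \<in> {1..k} \<times> {1..k}" if "t < D" for t
      using Filt_step(2) True that by (meson nth_mem subsetD)
    have IJ: "I0 \<in> Idx D k" "J0 \<in> Idx D k"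
      using w unfolding I0_def J0_def Idx_def by (auto simp: PiE_iff extensional_def mem_Times_iff)
    have "word D I0 J0 = w"
      by (rule nth_equalityI) (use True in \<open>auto simp: word_def I0_def J0_def\<close>)
    moreover have "Tens D k (\<lambda>I J. if I = I0 then if J = J0 then a else 0 else 0) = sc a * Ew (word D I0 J0)"
    proof -
      have "Tens D k (\<lambda>I J. if I = I0 then if J = J0 then a else 0 else 0) =
        (\<Sum>I\<in>Idx D k. if I = I0 then \<Sum>J\<in>Idx D k. if J = J0 then sc a * Ew (word D I J) else 0 else 0)"
        unfolding Tens_def
      proof (rule sum.cong[OF refl])
        fix I
        show "(\<Sum>J\<in>Idx D k. sc (if I = I0 then if J = J0 then a else 0 else 0) * Ew (word D I J)) =
          (if I = I0 then \<Sum>J\<in>Idx D k. if J = J0 then sc a * Ew (word D I J) else 0 else 0)"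
          by (cases "I = I0") (simp_all add: if_distrib[of sc] if_times cong: if_cong)
      qed
      then show ?thesis using IJ by (simp cong: if_cong)
    qed
    ultimately have eq: "(sc a * Ew w + x) - Tens D k (\<lambda>I J. (if I = I0 then if J = J0 then a else 0 else 0) + p I J) = x - Tens D k p"
      by (simp only: Tens_add) simp
    show ?thesis by (rule exI, subst eq, rule p)
  qed
qed

definition ad :: "nat \<Rightarrow> nat \<Rightarrow> nat \<Rightarrow> ((nat \<Rightarrow> nat) \<Rightarrow> (nat \<Rightarrow> nat) \<Rightarrow> complex) \<Rightarrow> (nat \<Rightarrow> nat) \<Rightarrow> (nat \<Rightarrow> nat) \<Rightarrow> complex"
  where "ad D a b p I J = lam D {} (a, b) (\<lambda>I. p I J) I - lam D {} (b, a) (p I) J"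

lemma br_word:
  assumes k: "k \<le> n" and a: "a \<in> {1..k}" and b: "b \<in> {1..k}" and I: "I \<in> Idx D k" and J: "J \<in> Idx D k"
  shows "br (E a b) (Ew (word D I J)) =
    (\<Sum>t<D. (if I t = b then Ew (word D (I(t := a)) J) else 0) - (if J t = a then Ew (word D I (J(t := b))) else 0))"
proof -
  let ?xs = "map (\<lambda>(i, j). E i j) (word D I J)"
  have len: "length ?xs = D" by simp
  have upd: "Ew ((word D I J)[t := (i, j)]) = prod_list (?xs[t := E i j])" for t i j
    by (simp add: Ew_def map_update)
  have "br (E a b) (Ew (word D I J)) = (\<Sum>t<D. prod_list (?xs[t := br (E a b) (?xs ! t)]))"
    unfolding Ew_def br_prod_list len ..
  also have "\<dots> = (\<Sum>t<D. (if I t = b then Ew (word D (I(t := a)) J) else 0) - (if J t = a then Ew (word D I (J(t := b))) else 0))"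
  proof (rule sum.cong[OF refl])
    fix t assume "t \<in> {..<D}"
    then have t: "t < D" by simp
    let ?X = "if I t = b then E a (J t) else 0" and ?Y = "if J t = a then E (I t) b else 0"
    have "br (E a b) (E (I t) (J t)) = (if b = I t then E a (J t) else 0) - (if a = J t then E (I t) b else 0)"
      using a b k Idx_mem[OF I t] Idx_mem[OF J t] by (intro E_br) auto
    moreover have "?xs ! t = E (I t) (J t)" using t by (simp add: word_def)
    ultimately have br: "br (E a b) (?xs ! t) = ?X - ?Y" by (simp add: eq_commute)
    have words: "word D (I(t := a)) J = (word D I J)[t := (a, J t)]" "word D I (J(t := b)) = (word D I J)[t := (I t, b)]"
      using t by (auto simp: word_def nth_list_update intro!: nth_equalityI)
    have "prod_list (?xs[t := ?X - ?Y]) = prod_list (?xs[t := ?X]) - prod_list (?xs[t := ?Y])"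
      using t by (simp add: prod_list_update left_diff_distrib right_diff_distrib)
    moreover have "prod_list (?xs[t := ?X]) = (if I t = b then Ew (word D (I(t := a)) J) else 0)"
      unfolding words upd using t by (cases "I t = b") (simp_all add: prod_list_update)
    moreover have "prod_list (?xs[t := ?Y]) = (if J t = a then Ew (word D I (J(t := b))) else 0)"
      unfolding words upd using t by (cases "J t = a") (simp_all add: prod_list_update)
    ultimately show "prod_list (?xs[t := br (E a b) (?xs ! t)]) =
      (if I t = b then Ew (word D (I(t := a)) J) else 0) - (if J t = a then Ew (word D I (J(t := b))) else 0)"
      unfolding br by simp
  qed
  finally show ?thesis .
qed

lemma br_Tens:
  assumes k: "k \<le> n" and a: "a \<in> {1..k}" and b: "b \<in> {1..k}"
  shows "br (E a b) (Tens D k p) = Tens D k (ad D a b p)"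
proof -
  let ?S = "Idx D k"
  have "br (E a b) (Tens D k p) = (\<Sum>I\<in>?S. \<Sum>J\<in>?S. \<Sum>t<D.
      (if I t = b then sc (p I J) * Ew (word D (I(t := a)) J) else 0) - (if J t = a then sc (p I J) * Ew (word D I (J(t := b))) else 0))"
    unfolding Tens_def br_sum br_mult
    by (intro sum.cong refl) (simp add: br_word[OF k a b] sum_distrib_left right_diff_distrib if_times)
  also have "\<dots> = (\<Sum>I\<in>?S. \<Sum>J\<in>?S. \<Sum>t<D. if I t = b then sc (p I J) * Ew (word D (I(t := a)) J) else 0)
      - (\<Sum>I\<in>?S. \<Sum>J\<in>?S. \<Sum>t<D. if J t = a then sc (p I J) * Ew (word D I (J(t := b))) else 0)"
    by (simp only: sum_subtractf)
  also have "(\<Sum>I\<in>?S. \<Sum>J\<in>?S. \<Sum>t<D. if I t = b then sc (p I J) * Ew (word D (I(t := a)) J) else 0) =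
      (\<Sum>I\<in>?S. \<Sum>J\<in>?S. sc (lam D {} (a, b) (\<lambda>I. p I J) I) * Ew (word D I J))"
  proof -
    have "(\<Sum>I\<in>?S. \<Sum>t<D. if I t = b then sc (p I J) * Ew (word D (I(t := a)) J) else 0) =
      (\<Sum>I\<in>?S. sc (lam D {} (a, b) (\<lambda>I. p I J) I) * Ew (word D I J))" for J
    proof -
      have "(\<Sum>I\<in>?S. \<Sum>t<D. if I t = b then sc (p I J) * Ew (word D (I(t := a)) J) else 0)
        = (\<Sum>t<D. \<Sum>I\<in>?S. if I t = b then sc (p I J) * Ew (word D (I(t := a)) J) else 0)"
        by (rule sum.swap)
      also have "\<dots> = (\<Sum>t<D. \<Sum>I\<in>?S. if I t = a then sc (p (I(t := b)) J) * Ew (word D I J) else 0)"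
        by (intro sum.cong refl sum_Idx_swap[where F = "\<lambda>I' I. sc (p I' J) * Ew (word D I J)", symmetric] a b) auto
      also have "\<dots> = (\<Sum>I\<in>?S. \<Sum>t<D. if I t = a then sc (p (I(t := b)) J) * Ew (word D I J) else 0)"
        by (rule sum.swap)
      also have "\<dots> = (\<Sum>I\<in>?S. sc (lam D {} (a, b) (\<lambda>I. p I J) I) * Ew (word D I J))"
        unfolding lam_def fst_conv snd_conv Diff_empty sc_sum sum_distrib_right by (intro sum.cong refl) simp
      finally show ?thesis .
    qed
    then show ?thesis by (subst (1 2) sum.swap) simp
  qed
  also have "(\<Sum>I\<in>?S. \<Sum>J\<in>?S. \<Sum>t<D. if J t = a then sc (p I J) * Ew (word D I (J(t := b))) else 0) =
      (\<Sum>I\<in>?S. \<Sum>J\<in>?S. sc (lam D {} (b, a) (p I) J) * Ew (word D I J))"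
  proof (rule sum.cong[OF refl])
    fix I
    have "(\<Sum>J\<in>?S. \<Sum>t<D. if J t = a then sc (p I J) * Ew (word D I (J(t := b))) else 0)
      = (\<Sum>t<D. \<Sum>J\<in>?S. if J t = a then sc (p I J) * Ew (word D I (J(t := b))) else 0)"
      by (rule sum.swap)
    also have "\<dots> = (\<Sum>t<D. \<Sum>J\<in>?S. if J t = b then sc (p I (J(t := a))) * Ew (word D I J) else 0)"
      by (intro sum.cong refl sum_Idx_swap[where F = "\<lambda>J' J. sc (p I J') * Ew (word D I J)", symmetric] a b) auto
    also have "\<dots> = (\<Sum>J\<in>?S. \<Sum>t<D. if J t = b then sc (p I (J(t := a))) * Ew (word D I J) else 0)"
      by (rule sum.swap)
    also have "\<dots> = (\<Sum>J\<in>?S. sc (lam D {} (b, a) (p I) J) * Ew (word D I J))"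
      unfolding lam_def fst_conv snd_conv Diff_empty sc_sum sum_distrib_right by (intro sum.cong refl) simp
    finally show "(\<Sum>J\<in>?S. \<Sum>t<D. if J t = a then sc (p I J) * Ew (word D I (J(t := b))) else 0) =
      (\<Sum>J\<in>?S. sc (lam D {} (b, a) (p I) J) * Ew (word D I J))" .
  qed
  finally show ?thesis
    by (simp add: Tens_def ad_def sc_diff left_diff_distrib sum_subtractf)
qed

end

lemma lam_adjoint:
  assumes a: "a \<in> {1..k}" and b: "b \<in> {1..k}"
  shows "(\<Sum>I\<in>Idx D k. lam D {} (a, b) g I * cnj (h I)) = (\<Sum>I\<in>Idx D k. g I * cnj (lam D {} (b, a) h I))"
proof -
  have "(\<Sum>I\<in>Idx D k. lam D {} (a, b) g I * cnj (h I)) = (\<Sum>I\<in>Idx D k. \<Sum>t<D. if I t = a then g (I(t := b)) * cnj (h I) else 0)"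
    unfolding lam_def fst_conv snd_conv Diff_empty sum_distrib_right by (intro sum.cong refl) simp
  also have "\<dots> = (\<Sum>t<D. \<Sum>I\<in>Idx D k. if I t = a then g (I(t := b)) * cnj (h I) else 0)"
    by (rule sum.swap)
  also have "\<dots> = (\<Sum>t<D. \<Sum>I\<in>Idx D k. if I t = b then g I * cnj (h (I(t := a))) else 0)"
    by (intro sum.cong refl sum_Idx_swap[where F = "\<lambda>I' I. g I' * cnj (h I)"] a b) auto
  also have "\<dots> = (\<Sum>I\<in>Idx D k. \<Sum>t<D. if I t = b then g I * cnj (h (I(t := a))) else 0)"
    by (rule sum.swap)
  also have "\<dots> = (\<Sum>I\<in>Idx D k. g I * cnj (lam D {} (b, a) h I))"
    unfolding lam_def fst_conv snd_conv Diff_empty cnj_sum sum_distrib_left by (intro sum.cong refl) simp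
  finally show ?thesis .
qed

lemma sum_PiE_Un:
  assumes "A \<inter> B = {}"
  shows "(\<Sum>I\<in>PiE (A \<union> B) (\<lambda>_. V). F I) = (\<Sum>X\<in>PiE A (\<lambda>_. V). \<Sum>Y\<in>PiE B (\<lambda>_. V). F (\<lambda>t. if t \<in> A then X t else Y t))"
proof -
  have "(\<Sum>I\<in>PiE (A \<union> B) (\<lambda>_. V). F I) = (\<Sum>(X, Y)\<in>PiE A (\<lambda>_. V) \<times> PiE B (\<lambda>_. V). F (\<lambda>t. if t \<in> A then X t else Y t))"
    by (rule sum.reindex_bij_witness[of _ "\<lambda>(X, Y) t. if t \<in> A then X t else Y t" "\<lambda>I. (restrict I A, restrict I B)"])
      (use assms in \<open>auto simp: PiE_iff extensional_def fun_eq_iff split: if_splits intro!: arg_cong[of _ _ F]\<close>)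
  then show ?thesis by (simp add: sum.cartesian_product)
qed

lemma cycle_decomp_permutes: "cycle_decomp S \<sigma> \<Longrightarrow> \<sigma> permutes S"
proof (induction rule: cycle_decomp.induct)
  case empty
  show ?case by (rule permutes_id)
next
  case (comp S \<sigma> cs)
  then show ?case
    by (intro permutes_compose) (auto intro: permutes_subset[OF cycle_permutes] permutes_subset)
qed

context gl_family
begin

text \<open>A cyclic word summed over all labels is the trace of a power.\<close>

lemma cycle_sum:
  fixes cs :: "nat list"
  assumes cs: "distinct cs" "cs \<noteq> []"
  shows "(\<Sum>X\<in>PiE (set cs) (\<lambda>_. {1..k}). Ew (map (\<lambda>t. (X t, X (cycle_of_list cs t))) cs)) = casimir k (length cs)"
proof -
  have rot: "map (cycle_of_list cs) cs = rotate1 cs"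
    using cyclic_rotation[of cs "Suc 0"] cs by simp
  have zip: "map (\<lambda>t. (X t, X (cycle_of_list cs t))) cs = zip (map X cs) (rotate1 (map X cs))" for X :: "nat \<Rightarrow> nat"
  proof -
    have "rotate1 (map X cs) = map (\<lambda>t. X (cycle_of_list cs t)) cs"
      unfolding rotate1_map rot[symmetric] by simp
    then show ?thesis by (simp add: zip_map_map zip_same_conv_map)
  qed
  have bij: "bij_betw (\<lambda>X. map X cs) (PiE (set cs) (\<lambda>_. {1..k})) (Lists k (length cs))"
  proof (rule bij_betw_imageI)
    show "inj_on (\<lambda>X. map X cs) (PiE (set cs) (\<lambda>_. {1..k}))"
    proof (rule inj_onI)
      fix X X' assume X: "X \<in> PiE (set cs) (\<lambda>_. {1..k})" "X' \<in> PiE (set cs) (\<lambda>_. {1..k})" and eq: "map X cs = map X' cs"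
      show "X = X'" by (rule PiE_ext[OF X]) (use eq in simp)
    qed
    show "(\<lambda>X. map X cs) ` PiE (set cs) (\<lambda>_. {1..k}) = Lists k (length cs)"
    proof (intro equalityI subsetI)
      fix vs assume "vs \<in> (\<lambda>X. map X cs) ` PiE (set cs) (\<lambda>_. {1..k})"
      then show "vs \<in> Lists k (length cs)" by (fastforce simp: Lists_def dest: PiE_mem)
    next
      fix vs assume vs: "vs \<in> Lists k (length cs)"
      define X where "X t = (if t \<in> set cs then the (map_of (zip cs vs) t) else undefined)" for t
      have nth: "X (cs ! i) = vs ! i" if "i < length cs" for i
        using that vs cs(1) by (simp add: X_def Lists_def map_of_zip_nth)
      have "map X cs = vs"
        by (rule nth_equalityI) (use vs nth in \<open>auto simp: Lists_def\<close>)
      moreover have "X \<in> PiE (set cs) (\<lambda>_. {1..k})"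
      proof (rule PiE_I)
        fix t assume "t \<in> set cs"
        then obtain i where i: "i < length cs" "t = cs ! i" by (auto simp: in_set_conv_nth)
        then have "vs ! i \<in> set vs" using vs by (simp add: Lists_def)
        then show "X t \<in> {1..k}" using vs nth[OF i(1)] i(2) by (auto simp: Lists_def)
      qed (simp add: X_def)
      ultimately show "vs \<in> (\<lambda>X. map X cs) ` PiE (set cs) (\<lambda>_. {1..k})" by blast
    qed
  qed
  have "length cs \<ge> 1" using cs(2) by (cases cs) auto
  then show ?thesis
    unfolding zip casimir_Lists[OF \<open>length cs \<ge> 1\<close>]
    by (rule_tac sum.reindex_bij_betw[OF bij])
qed

lemma casimir_mult_Filt: "m \<ge> 1 \<Longrightarrow> y \<in> Filt k d \<Longrightarrow> casimir k m * y \<in> Filt k (m + d)"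
  unfolding casimir_Lists sum_distrib_right
proof (intro Filt_sum)
  fix vs assume vs: "vs \<in> Lists k m" and y: "y \<in> Filt k d"
  have "set (zip vs (rotate1 vs)) \<subseteq> {1..k} \<times> {1..k}"
    using vs set_zip_leftD[of _ _ vs "rotate1 vs"] set_zip_rightD[of _ _ vs "rotate1 vs"] unfolding Lists_def by fastforce
  from Filt_mult_left[OF y this] show "Ew (zip vs (rotate1 vs)) * y \<in> Filt k (m + d)"
    using vs by (simp add: Lists_def)
qed

text \<open>A permutation factors into disjoint cycles, and reordering the letters of a word costs only shorter words.
So the contraction of a word along a permutation is a product of traces up to lower order.\<close>

lemma permutation_sum:
  fixes ts :: "nat list"
  assumes k: "k \<le> n"
  shows "cycle_decomp S \<sigma> \<Longrightarrow> distinct ts \<Longrightarrow> set ts = S \<Longrightarrow>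
    \<exists>a\<in>alg (range (casimir k)). (\<Sum>I\<in>PiE S (\<lambda>_. {1..k}). Ew (map (\<lambda>t. (I t, I (\<sigma> t))) ts)) - a \<in> Filt k (card S)"
proof (induction arbitrary: ts rule: cycle_decomp.induct)
  case empty
  then show ?case by (intro bexI[of _ 1]) (auto simp: Filt_0 alg_1)
next
  case (comp S \<sigma> cs)
  have fin: "finite S" using comp.hyps(1) by (induction rule: cycle_decomp.induct) auto
  have perm: "\<sigma> permutes S" by (rule cycle_decomp_permutes[OF comp.hyps(1)])
  obtain us where us: "set us = S" "distinct us" using finite_distinct_list[OF fin] by blast
  obtain a where a: "a \<in> alg (range (casimir k))"
    and y: "(\<Sum>I\<in>PiE S (\<lambda>_. {1..k}). Ew (map (\<lambda>t. (I t, I (\<sigma> t))) us)) - a \<in> Filt k (card S)" (is "?Y - a \<in> _")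
    using comp.IH[OF us(2,1)] by blast
  let ?\<rho> = "cycle_of_list cs \<circ> \<sigma>"
  have S': "card (set cs \<union> S) = length cs + card S"
    using comp.hyps fin by (simp add: card_Un_disjoint distinct_card)
  have rcs: "?\<rho> t = cycle_of_list cs t" if "t \<in> set cs" for t
  proof -
    have "t \<notin> S" using that comp.hyps by auto
    then show ?thesis using permutes_not_in[OF perm] by simp
  qed
  have rS: "?\<rho> t = \<sigma> t" "\<sigma> t \<in> S" if "t \<in> S" for t
    using permutes_in_image[OF perm, of t] that comp.hyps id_outside_supp[of "\<sigma> t" cs] by auto
  have cyc_in: "cycle_of_list cs t \<in> set cs" if "t \<in> set cs" for t
    using that cycle_permutes[of cs] by (simp add: permutes_in_image)
  let ?P = "PiE (set cs \<union> S) (\<lambda>_. {1..k})"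
  let ?F = "\<lambda>I ts. Ew (map (\<lambda>t. (I t, I (?\<rho> t))) ts)"
  have main: "(\<Sum>I\<in>?P. ?F I (cs @ us)) =
    (\<Sum>X\<in>PiE (set cs) (\<lambda>_. {1..k}). Ew (map (\<lambda>t. (X t, X (cycle_of_list cs t))) cs)) * ?Y"
  proof -
    have "(\<Sum>I\<in>?P. ?F I (cs @ us)) = (\<Sum>X\<in>PiE (set cs) (\<lambda>_. {1..k}). \<Sum>Y\<in>PiE S (\<lambda>_. {1..k}).
       ?F (\<lambda>t. if t \<in> set cs then X t else Y t) (cs @ us))"
      by (rule sum_PiE_Un) (use comp.hyps in auto)
    also have "\<dots> = (\<Sum>X\<in>PiE (set cs) (\<lambda>_. {1..k}). \<Sum>Y\<in>PiE S (\<lambda>_. {1..k}).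
       Ew (map (\<lambda>t. (X t, X (cycle_of_list cs t))) cs) * Ew (map (\<lambda>t. (Y t, Y (\<sigma> t))) us))"
    proof (intro sum.cong refl)
      fix X Y :: "nat \<Rightarrow> nat"
      let ?I = "\<lambda>t. if t \<in> set cs then X t else Y t"
      have "map (\<lambda>t. (?I t, ?I (?\<rho> t))) cs = map (\<lambda>t. (X t, X (cycle_of_list cs t))) cs"
        by (rule map_cong[OF refl]) (simp only: rcs cyc_in if_True)
      moreover have "map (\<lambda>t. (?I t, ?I (?\<rho> t))) us = map (\<lambda>t. (Y t, Y (\<sigma> t))) us"
      proof (rule map_cong[OF refl])
        fix t assume "t \<in> set us"
        then have "t \<in> S" using us by simp
        then have "t \<notin> set cs" "\<sigma> t \<notin> set cs" using comp.hyps rS(2)[of t] by auto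
        then show "(?I t, ?I (?\<rho> t)) = (Y t, Y (\<sigma> t))" using rS(1)[OF \<open>t \<in> S\<close>] by simp
      qed
      ultimately show "?F ?I (cs @ us) = Ew (map (\<lambda>t. (X t, X (cycle_of_list cs t))) cs) * Ew (map (\<lambda>t. (Y t, Y (\<sigma> t))) us)"
        by (simp only: map_append Ew_simps)
    qed
    also have "\<dots> = (\<Sum>X\<in>PiE (set cs) (\<lambda>_. {1..k}). Ew (map (\<lambda>t. (X t, X (cycle_of_list cs t))) cs)) * ?Y"
      by (simp only: sum_product)
    finally show ?thesis .
  qed
  have "\<exists>a\<in>alg (range (casimir k)). (\<Sum>I\<in>?P. ?F I (cs @ us)) - a \<in> Filt k (card (set cs \<union> S))"
  proof (cases "cs = []")
    case True
    have "(\<Sum>I\<in>?P. ?F I (cs @ us)) = ?Y" unfolding main by (simp add: True)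
    with y have "(\<Sum>I\<in>?P. ?F I (cs @ us)) - a \<in> Filt k (card (set cs \<union> S))"
      using True by simp
    then show ?thesis by (rule bexI[OF _ a])
  next
    case False
    then have m: "length cs \<ge> 1" by (cases cs) auto
    have "casimir k (length cs) * ?Y - casimir k (length cs) * a \<in> Filt k (length cs + card S)"
      unfolding right_diff_distrib[symmetric] by (rule casimir_mult_Filt[OF m y])
    moreover have "casimir k (length cs) * a \<in> alg (range (casimir k))"
      by (rule alg_mult[OF alg_gen a]) simp
    ultimately show ?thesis
      unfolding main cycle_sum[OF comp.hyps(2) False] S' by blast
  qed
  then obtain a' where a': "a' \<in> alg (range (casimir k))" "(\<Sum>I\<in>?P. ?F I (cs @ us)) - a' \<in> Filt k (card (set cs \<union> S))"
    by blast
  have "(\<Sum>I\<in>?P. ?F I ts) - (\<Sum>I\<in>?P. ?F I (cs @ us)) \<in> Filt k (card (set cs \<union> S))"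
    unfolding sum_subtractf[symmetric]
  proof (rule Filt_sum)
    fix I assume I: "I \<in> ?P"
    have ts: "mset ts = mset (cs @ us)"
      using comp.prems comp.hyps us by (intro set_eq_iff_mset_eq_distinct[THEN iffD1]) auto
    have "set (map (\<lambda>t. (I t, I (?\<rho> t))) ts) \<subseteq> {1..k} \<times> {1..k}"
    proof
      fix x assume "x \<in> set (map (\<lambda>t. (I t, I (?\<rho> t))) ts)"
      then obtain t where t: "t \<in> set cs \<union> S" "x = (I t, I (?\<rho> t))" using comp.prems by auto
      have "?\<rho> t \<in> set cs \<union> S" using t(1) rcs rS cyc_in by (metis Un_iff)
      then show "x \<in> {1..k} \<times> {1..k}" using t PiE_mem[OF I] by blast
    qed
    moreover have "mset (map (\<lambda>t. (I t, I (?\<rho> t))) ts) = mset (map (\<lambda>t. (I t, I (?\<rho> t))) (cs @ us))"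
      using ts by (metis mset_map)
    ultimately have "?F I ts - ?F I (cs @ us) \<in> Filt k (length (map (\<lambda>t. (I t, I (?\<rho> t))) ts))"
      by (rule Filt_reorder[OF k])
    moreover have "length ts = card (set cs \<union> S)" using comp.prems distinct_card by metis
    ultimately show "?F I ts - ?F I (cs @ us) \<in> Filt k (card (set cs \<union> S))" by simp
  qed
  from Filt_add[OF this a'(2)] have "(\<Sum>I\<in>?P. ?F I ts) - a' \<in> Filt k (card (set cs \<union> S))" by simp
  then show ?case using a'(1) by blast
qed

lemma br_alg_casimir:
  assumes k: "k \<le> n" and x: "x \<in> alg (range (casimir k))" shows "ginv k x"
  unfolding ginv_def using alg_comm[OF x] ginv_casimir[OF k] by (auto simp: ginv_def)

text \<open>Induction on the degree. The leading coefficients p are unique only up to the subspace K of tensors whose product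
has lower degree; K is stable under the adjoint action. Taking p orthogonal to K makes p invariant, since
\<open>ad p\<close> lies in K as x is central, and it is orthogonal to K because the adjoint of \<open>ad\<close> is again an
\<open>ad\<close>. By \<open>schur_weyl\<close> p is a combination of permutations, which by \<open>permutation_sum\<close> are
polynomials in the traces up to lower degree.\<close>

theorem centre_generated:
  assumes k: "k \<le> n"
  shows "x \<in> Filt k D \<Longrightarrow> ginv k x \<Longrightarrow> x \<in> alg (range (casimir k))"
proof (induction D arbitrary: x)
  case 0
  then have "x = 0" by (auto elim: Filt.cases)
  then show ?case by (simp add: alg_0)
next
  case (Suc D)
  let ?S = "Idx D k"
  obtain p where p: "x - Tens D k p \<in> Filt k D" using Filt_Suc_Tens[OF Suc.prems(1)] by blast
  define K where "K = {q. Tens D k (curry q) \<in> Filt k D}"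
  have K0: "(\<lambda>x. 0) \<in> K" by (simp add: K_def Tens_def curry_def Filt_0)
  have Kadd: "(\<lambda>x. r x + s x) \<in> K" if "r \<in> K" "s \<in> K" for r s
    using that Tens_add[of D k "curry r" "curry s"] by (simp add: K_def curry_def Filt_add)
  have Kscale: "(\<lambda>x. a * r x) \<in> K" if "r \<in> K" for a r
    using that Tens_scale[of D k a "curry r"] by (simp add: K_def curry_def Filt_scale)
  have Kad: "(\<lambda>(I, J). ad D a b (curry q) I J) \<in> K" if "q \<in> K" "a \<in> {1..k}" "b \<in> {1..k}" for a b q
  proof -
    have "Tens D k (ad D a b (curry q)) \<in> Filt k D"
      unfolding br_Tens[OF k that(2,3), symmetric] using that by (intro Filt_br[OF k]) (auto simp: K_def)
    then show ?thesis by (simp add: K_def curry_def)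
  qed
  have "\<exists>q\<in>K. \<forall>r\<in>K. (\<Sum>x\<in>?S \<times> ?S. ((\<lambda>(I, J). p I J) x - q x) * cnj (r x)) = 0"
    by (rule orthogonal_projection[OF finite_cartesian_product[OF finite_Idx finite_Idx] K0 Kadd Kscale])
  then obtain q where q: "q \<in> K"
    and orth0: "\<forall>r\<in>K. (\<Sum>x\<in>?S \<times> ?S. ((\<lambda>(I, J). p I J) x - q x) * cnj (r x)) = 0"
    by (rule bexE)
  note orth = bspec[OF orth0]
  define p' where "p' I J = p I J - q (I, J)" for I J
  have orth': "(\<Sum>I\<in>?S. \<Sum>J\<in>?S. p' I J * cnj (r (I, J))) = 0" if "r \<in> K" for r
    using orth[OF that] by (simp add: p'_def sum.cartesian_product case_prod_beta)
  have "Tens D k p = Tens D k p' + Tens D k (curry q)"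
    using Tens_add[of D k p' "curry q"] by (simp add: p'_def)
  then have xp': "x - Tens D k p' \<in> Filt k D"
    using Filt_add[OF p, of "Tens D k (curry q)"] q by (simp add: K_def)
  have "gl_invariant D k p'"
    unfolding gl_invariant_def
  proof (intro ballI)
    fix I J a b assume I: "I \<in> ?S" and J: "J \<in> ?S" and a: "a \<in> {1..k}" and b: "b \<in> {1..k}"
    define r where "r = (\<lambda>(I, J). ad D a b p' I J)"
    have "Tens D k (curry r) = br (E a b) x - br (E a b) (x - Tens D k p')"
      using br_Tens[OF k a b, of D p'] by (simp add: r_def br_diff curry_def)
    also have "\<dots> = - br (E a b) (x - Tens D k p')"
      using ginvD[OF Suc.prems(2) a b] by simp
    finally have r: "r \<in> K"
      unfolding K_def using Filt_uminus[OF Filt_br[OF k a b xp']] by simp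
    have "(\<Sum>I\<in>?S. \<Sum>J\<in>?S. ad D a b p' I J * cnj (r (I, J))) = (\<Sum>I\<in>?S. \<Sum>J\<in>?S. p' I J * cnj (ad D b a (curry r) I J))"
    proof -
      have 1: "(\<Sum>I\<in>?S. \<Sum>J\<in>?S. lam D {} (a, b) (\<lambda>I. p' I J) I * cnj (r (I, J))) =
        (\<Sum>I\<in>?S. \<Sum>J\<in>?S. p' I J * cnj (lam D {} (b, a) (\<lambda>I. r (I, J)) I))"
        using lam_adjoint[OF a b, of D] by (subst (1 2) sum.swap) simp
      have 2: "(\<Sum>I\<in>?S. \<Sum>J\<in>?S. lam D {} (b, a) (p' I) J * cnj (r (I, J))) =
        (\<Sum>I\<in>?S. \<Sum>J\<in>?S. p' I J * cnj (lam D {} (a, b) (\<lambda>J. r (I, J)) J))"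
        using lam_adjoint[OF b a, of D] by simp
      show ?thesis
        unfolding ad_def using 1 2
        by (simp add: left_diff_distrib right_diff_distrib sum_subtractf curry_def)
    qed
    also have "\<dots> = 0"
      using orth'[OF Kad[OF r b a]] by simp
    finally have 0: "(\<Sum>x\<in>?S \<times> ?S. r x * cnj (r x)) = 0"
      by (simp add: r_def sum.cartesian_product case_prod_beta)
    have "(\<Sum>x\<in>?S \<times> ?S. r x * cnj (r x)) = complex_of_real (\<Sum>x\<in>?S \<times> ?S. (cmod (r x))\<^sup>2)"
      unfolding of_real_sum by (intro sum.cong refl complex_norm_square[symmetric])
    with 0 have "complex_of_real (\<Sum>x\<in>?S \<times> ?S. (cmod (r x))\<^sup>2) = 0" by (simp only:)
    then have 1: "(\<Sum>x\<in>?S \<times> ?S. (cmod (r x))\<^sup>2) = 0" by (simp only: of_real_eq_0_iff)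
    have fin: "finite (?S \<times> ?S)" by simp
    have "\<forall>x\<in>?S \<times> ?S. (cmod (r x))\<^sup>2 = 0"
      by (rule iffD1[OF sum_nonneg_eq_0_iff[OF fin zero_le_power2] 1])
    then have "(cmod (r (I, J)))\<^sup>2 = 0"
      by (rule bspec) (use I J in simp)
    then show "lam D {} (a, b) (\<lambda>I. p' I J) I = lam D {} (b, a) (p' I) J"
      by (simp add: r_def ad_def)
  qed
  from schur_weyl[OF this] obtain \<alpha> where \<alpha>: "\<And>I J. I \<in> ?S \<Longrightarrow> J \<in> ?S \<Longrightarrow>
      p' I J = (\<Sum>\<sigma> | \<sigma> permutes {..<D}. \<alpha> \<sigma> * perm_tensor \<sigma> I J)" by blast
  let ?P = "{\<sigma>. \<sigma> permutes {..<D}}"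
  let ?Z = "\<lambda>\<sigma>. \<Sum>I\<in>?S. Ew (map (\<lambda>t. (I t, I (\<sigma> t))) [0..<D])"
  have "Tens D k p' = (\<Sum>I\<in>?S. \<Sum>J\<in>?S. \<Sum>\<sigma>\<in>?P. sc (\<alpha> \<sigma>) * (sc (perm_tensor \<sigma> I J) * Ew (word D I J)))"
    unfolding Tens_def by (intro sum.cong refl) (simp add: \<alpha> sc_sum sum_distrib_right sc_mult mult.assoc)
  also have "\<dots> = (\<Sum>I\<in>?S. \<Sum>\<sigma>\<in>?P. \<Sum>J\<in>?S. sc (\<alpha> \<sigma>) * (sc (perm_tensor \<sigma> I J) * Ew (word D I J)))"
    by (rule sum.cong[OF refl], rule sum.swap)
  also have "\<dots> = (\<Sum>I\<in>?S. \<Sum>\<sigma>\<in>?P. sc (\<alpha> \<sigma>) * Ew (map (\<lambda>t. (I t, I (\<sigma> t))) [0..<D]))"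
  proof (intro sum.cong refl)
    fix I \<sigma> assume I: "I \<in> ?S" and s: "\<sigma> \<in> ?P"
    have "I \<circ> \<sigma> \<in> ?S" using Idx_perm[OF I] s by simp
    then have "(\<Sum>J\<in>?S. sc (perm_tensor \<sigma> I J) * Ew (word D I J)) = Ew (word D I (I \<circ> \<sigma>))"
      by (simp add: perm_tensor_def if_distrib[of sc] if_times cong: if_cong)
    then show "(\<Sum>J\<in>?S. sc (\<alpha> \<sigma>) * (sc (perm_tensor \<sigma> I J) * Ew (word D I J))) = sc (\<alpha> \<sigma>) * Ew (map (\<lambda>t. (I t, I (\<sigma> t))) [0..<D])"
      by (simp add: word_def flip: sum_distrib_left)
  qed
  also have "\<dots> = (\<Sum>\<sigma>\<in>?P. sc (\<alpha> \<sigma>) * ?Z \<sigma>)"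
    by (subst sum.swap) (simp add: sum_distrib_left)
  finally have Tp': "Tens D k p' = (\<Sum>\<sigma>\<in>?P. sc (\<alpha> \<sigma>) * ?Z \<sigma>)" .
  have "\<exists>a. \<forall>\<sigma>\<in>?P. a \<sigma> \<in> alg (range (casimir k)) \<and> ?Z \<sigma> - a \<sigma> \<in> Filt k D"
  proof (rule bchoice, rule ballI)
    fix \<sigma> assume "\<sigma> \<in> ?P"
    then have "cycle_decomp {..<D} \<sigma>" by (intro cycle_decomposition) auto
    from permutation_sum[OF k this, of "[0..<D]"] show "\<exists>a. a \<in> alg (range (casimir k)) \<and> ?Z \<sigma> - a \<in> Filt k D"
      by (auto simp: Idx_def atLeast0LessThan)
  qed
  then obtain a where a: "\<And>\<sigma>. \<sigma> \<in> ?P \<Longrightarrow> a \<sigma> \<in> alg (range (casimir k))" "\<And>\<sigma>. \<sigma> \<in> ?P \<Longrightarrow> ?Z \<sigma> - a \<sigma> \<in> Filt k D"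
    by blast
  define A' where "A' = (\<Sum>\<sigma>\<in>?P. sc (\<alpha> \<sigma>) * a \<sigma>)"
  have A': "A' \<in> alg (range (casimir k))"
    unfolding A'_def by (intro alg_sum alg_mult alg_sc a(1))
  have "Tens D k p' - A' \<in> Filt k D"
    unfolding Tp' A'_def sum_subtractf[symmetric] right_diff_distrib[symmetric]
    by (intro Filt_sum Filt_scale a(2))
  from Filt_add[OF xp' this] have "x - A' \<in> Filt k D" by simp
  moreover have "ginv k (x - A')"
    using Suc.prems(2) br_alg_casimir[OF k A'] by (simp add: ginv_def br_diff)
  ultimately have "x - A' \<in> alg (range (casimir k))" by (rule Suc.IH)
  from alg_add[OF this A'] show ?case by simp
qed

end

section \<open>The polynomials of a tableau row\<close>

definition rowpoly :: "nat \<Rightarrow> (nat \<Rightarrow> complex) \<Rightarrow> complex poly"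
  where "rowpoly m l = (\<Prod>i=1..m. [:- l i, 1:])"

text \<open>The coefficient of \<open>u ^ p\<close> in \<open>P(u) - P(u - 1)\<close>, where P has the coefficients c (see
\<open>shift_difference\<close>).\<close>

definition newton_rhs :: "nat \<Rightarrow> (nat \<Rightarrow> complex) \<Rightarrow> nat \<Rightarrow> complex"
  where "newton_rhs m c p = - (\<Sum>q=Suc p..m. of_nat (q choose p) * (- 1) ^ (q - p) * c q)"

lemma poly_rowpoly: "poly (rowpoly m l) u = (\<Prod>i=1..m. u - l i)"
  by (simp add: rowpoly_def poly_prod)

lemma degree_rowpoly: "degree (rowpoly m l) = m"
  unfolding rowpoly_def by (subst degree_prod_eq_sum_degree) auto

lemma coeff_rowpoly_top: "coeff (rowpoly m l) m = 1"
proof -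
  have "lead_coeff (rowpoly m l) = 1" unfolding rowpoly_def lead_coeff_prod by simp
  then show ?thesis by (simp add: degree_rowpoly)
qed

lemma poly_rowpoly_sum: "poly (rowpoly m l) u = (\<Sum>q\<le>m. coeff (rowpoly m l) q * u ^ q)"
  unfolding poly_altdef degree_rowpoly ..

lemma coeff_quotient:
  assumes "P = [:- a, 1:] * Q" "degree P \<le> m" "p \<le> m"
  shows "coeff Q p = (\<Sum>q=Suc p..m. coeff P q * a ^ (q - Suc p) :: complex)"
  using assms(3)
proof (induction p rule: inc_induct)
  case base
  have "coeff Q m = 0"
  proof (cases "Q = 0")
    case False
    then have "degree P = Suc (degree Q)" unfolding assms(1) by (subst degree_mult_eq) auto
    then show ?thesis using assms(2) by (intro coeff_eq_0) simp
  qed simp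
  then show ?case by simp
next
  case (step p)
  have "coeff P (Suc p) = coeff Q p - a * coeff Q (Suc p)"
    unfolding assms(1) by simp
  then have "coeff Q p = coeff P (Suc p) + a * (\<Sum>q=Suc (Suc p)..m. coeff P q * a ^ (q - Suc (Suc p)))"
    using step by simp
  also have "a * (\<Sum>q=Suc (Suc p)..m. coeff P q * a ^ (q - Suc (Suc p))) = (\<Sum>q=Suc (Suc p)..m. coeff P q * a ^ (q - Suc p))"
    unfolding sum_distrib_left
  proof (rule sum.cong[OF refl])
    fix q assume "q \<in> {Suc (Suc p)..m}"
    then have "q - Suc p = Suc (q - Suc (Suc p))" by auto
    then show "a * (coeff P q * a ^ (q - Suc (Suc p))) = coeff P q * a ^ (q - Suc p)" by simp
  qed
  also have "coeff P (Suc p) + \<dots> = (\<Sum>q=Suc p..m. coeff P q * a ^ (q - Suc p))"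
    using step by (simp add: sum.atLeast_Suc_atMost[of "Suc p"])
  finally show ?case .
qed

text \<open>The rational expression for \<open>\<gamma>\<close> in the shifted entries; it is the sum of \<open>l i ^ j\<close> times the residue of
\<open>P(u - 1) / P(u)\<close> at \<open>l i\<close>, up to sign.\<close>

definition gam :: "nat \<Rightarrow> (nat \<Rightarrow> complex) \<Rightarrow> nat \<Rightarrow> complex"
  where "gam m l j = (\<Sum>i=1..m. l i ^ j * (\<Prod>r\<in>{1..m} - {i}. 1 - 1 / (l i - l r)))"

lemma shift_difference:
  "(\<Sum>q\<le>m. c q * u ^ q) - (\<Sum>q\<le>m. c q * (u - 1) ^ q) = (\<Sum>p<m. newton_rhs m c p * u ^ p)"
proof -
  have "(\<Sum>q\<le>m. c q * (u - 1) ^ q) = (\<Sum>q\<le>m. c q * u ^ q + (\<Sum>p<q. of_nat (q choose p) * (- 1) ^ (q - p) * c q * u ^ p))"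
    using binomial_ring[of u "-1"]
    by (intro sum.cong refl) (simp add: lessThan_Suc_atMost[symmetric] distrib_left sum_distrib_left mult_ac)
  also have "\<dots> = (\<Sum>q\<le>m. c q * u ^ q) + (\<Sum>q\<le>m. \<Sum>p<q. of_nat (q choose p) * (- 1) ^ (q - p) * c q * u ^ p)"
    by (rule sum.distrib)
  also have "(\<Sum>q\<le>m. \<Sum>p<q. of_nat (q choose p) * (- 1) ^ (q - p) * c q * u ^ p) =
     (\<Sum>p<m. \<Sum>q=Suc p..m. of_nat (q choose p) * (- 1) ^ (q - p) * c q * u ^ p)"
    unfolding sum.Sigma[OF finite_atMost ballI[OF finite_lessThan], simplified] sum.Sigma[OF finite_lessThan ballI[OF finite_atLeastAtMost]]
    by (rule sum.reindex_bij_witness[of _ "\<lambda>(a, b). (b, a)" "\<lambda>(a, b). (b, a)"]) auto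
  finally show ?thesis
    by (simp add: newton_rhs_def sum_distrib_right sum_negf)
qed

text \<open>By Lagrange interpolation at the points \<open>l i\<close> the polynomial \<open>P(u) - P(u - 1)\<close> is the sum of the quotients
\<open>P(u) / (u - l i)\<close> weighted with the products in \<open>gam\<close>. Comparing coefficients gives the same
identities that \<open>newton_low\<close> gives for the traces.\<close>

lemma gam_low:
  assumes inj: "inj_on l {1..m}" and p: "p < m"
  shows "(\<Sum>q=Suc p..m. coeff (rowpoly m l) q * gam m l (q - Suc p)) = newton_rhs m (coeff (rowpoly m l)) p"
proof -
  let ?P = "rowpoly m l"
  define Q where "Q i = (\<Prod>r\<in>{1..m} - {i}. [:- l r, 1:])" for i
  define R where "R i = (\<Prod>r\<in>{1..m} - {i}. 1 - 1 / (l i - l r))" for i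
  define T where "T = (\<Sum>p<m. Polynomial.monom (newton_rhs m (coeff ?P) p) p)"
  have PQ: "?P = [:- l i, 1:] * Q i" if "i \<in> {1..m}" for i
    unfolding rowpoly_def Q_def using that by (simp add: prod.remove)
  have T: "poly T u = poly ?P u - poly ?P (u - 1)" for u
    using shift_difference[of "coeff ?P" u m] by (simp add: T_def poly_sum poly_monom poly_rowpoly_sum)
  have degT: "degree T < m"
    unfolding T_def using p by (intro degree_sum_less) (auto intro: le_less_trans[OF degree_monom_le])
  have degQ: "degree (Q i) < m" if "i \<in> {1..m}" for i
    unfolding Q_def using that by (subst degree_prod_eq_sum_degree) auto
  have degR: "degree (\<Sum>i=1..m. smult (R i) (Q i)) < m"
    using p degQ by (intro degree_sum_less) (auto intro: le_less_trans[OF degree_smult_le])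
  have "(\<Sum>i=1..m. smult (R i) (Q i)) = T"
  proof (rule poly_eqI_degree)
    fix u assume "u \<in> l ` {1..m}"
    then obtain a where a: "a \<in> {1..m}" "u = l a" by auto
    have Q0: "poly (Q i) (l a) = 0" if "i \<in> {1..m}" "i \<noteq> a" for i
      unfolding Q_def poly_prod by (rule prod_zero[OF finite_Diff[OF finite_atLeastAtMost]], rule bexI[of _ a]) (use a that in auto)
    have ne: "l a - l r \<noteq> 0" if "r \<in> {1..m} - {a}" for r
      using inj_onD[OF inj _ a(1), of r] that by fastforce
    have "poly (\<Sum>i=1..m. smult (R i) (Q i)) u = (\<Sum>i\<in>{1..m}. if i = a then R a * poly (Q a) (l a) else 0)"
      unfolding poly_sum a by (intro sum.cong refl) (auto simp: Q0)
    also have "\<dots> = R a * poly (Q a) (l a)" using a by simp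
    also have "\<dots> = (\<Prod>r\<in>{1..m} - {a}. l a - 1 - l r)"
      unfolding R_def Q_def poly_prod prod.distrib[symmetric]
      by (intro prod.cong refl) (use ne in \<open>simp add: field_simps\<close>)
    also have "\<dots> = poly ?P u - poly ?P (u - 1)"
      unfolding PQ[OF a(1)] a(2) Q_def by (simp add: poly_prod algebra_simps)
    finally show "poly (\<Sum>i=1..m. smult (R i) (Q i)) u = poly T u" by (simp add: T)
  qed (use degR degT inj in \<open>simp_all add: card_image\<close>)
  then have "coeff (\<Sum>i=1..m. smult (R i) (Q i)) p = coeff T p" by simp
  moreover have "coeff T p = newton_rhs m (coeff ?P) p"
    using p by (simp add: T_def coeff_sum)
  moreover have "coeff (\<Sum>i=1..m. smult (R i) (Q i)) p = (\<Sum>i=1..m. \<Sum>q=Suc p..m. R i * (coeff ?P q * l i ^ (q - Suc p)))"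
    unfolding coeff_sum coeff_smult
    by (intro sum.cong refl) (subst coeff_quotient[OF PQ], use p in \<open>auto simp: degree_rowpoly sum_distrib_left\<close>)
  ultimately show ?thesis
    unfolding gam_def R_def sum_distrib_left by (subst sum.swap) (simp add: mult_ac)
qed

lemma gam_high: "(\<Sum>q\<le>m. coeff (rowpoly m l) q * gam m l (q + j)) = 0"
proof -
  have "(\<Sum>q\<le>m. coeff (rowpoly m l) q * gam m l (q + j)) =
    (\<Sum>i=1..m. \<Sum>q\<le>m. l i ^ j * (\<Prod>r\<in>{1..m} - {i}. 1 - 1 / (l i - l r)) * (coeff (rowpoly m l) q * l i ^ q))"
    unfolding gam_def sum_distrib_left by (subst sum.swap) (simp add: power_add mult_ac)
  also have "\<dots> = (\<Sum>i=1..m. l i ^ j * (\<Prod>r\<in>{1..m} - {i}. 1 - 1 / (l i - l r)) * poly (rowpoly m l) (l i))"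
    by (simp add: poly_rowpoly_sum sum_distrib_left)
  also have "\<dots> = 0"
    unfolding poly_rowpoly by (intro sum.neutral ballI) auto
  finally show ?thesis .
qed

subsection \<open>The polynomials gamma\<close>

lemma poly_fun_sum: "(\<And>i. i \<in> I \<Longrightarrow> poly_fun m (F i)) \<Longrightarrow> poly_fun m (\<lambda>x. \<Sum>i\<in>I. F i x)"
  by (induction I rule: infinite_finite_induct) (auto intro: poly_fun.intros)

lemma poly_fun_uminus: "poly_fun m F \<Longrightarrow> poly_fun m (\<lambda>x. - F x)"
  using poly_fun.poly_mult[OF poly_fun.poly_const[of m "-1"], of F] by simp

lemma poly_fun_diff: "poly_fun m F \<Longrightarrow> poly_fun m G \<Longrightarrow> poly_fun m (\<lambda>x. F x - G x)"
  using poly_fun.poly_add[OF _ poly_fun_uminus] by simp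

definition lams :: "nat \<Rightarrow> (nat \<Rightarrow> complex) \<Rightarrow> nat \<Rightarrow> complex"
  where "lams m x i = x i + of_nat m - 1"

lemma poly_fun_coeff: "poly_fun m (\<lambda>x. coeff (rowpoly m (lams m x)) q)"
proof -
  have "poly_fun m (\<lambda>x. coeff (\<Prod>i\<in>S. [:- lams m x i, 1:]) q)" if "S \<subseteq> {1..m}" "finite S" for S q
    using that(2,1)
  proof (induction S arbitrary: q rule: finite_induct)
    case empty
    show ?case by (simp add: poly_fun.poly_const)
  next
    case (insert i S)
    have IH: "poly_fun m (\<lambda>x. coeff (\<Prod>i\<in>S. [:- lams m x i, 1:]) q)" for q
      using insert by auto
    have l: "poly_fun m (\<lambda>x. - lams m x i)"
      unfolding lams_def using insert.prems
      by (intro poly_fun_uminus poly_fun_diff poly_fun.poly_add poly_fun.poly_var poly_fun.poly_const) auto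
    show ?case
      using insert.hyps poly_fun.poly_add[OF poly_fun.poly_mult[OF l IH[of q]] IH[of "q - 1"]] poly_fun.poly_mult[OF l IH[of 0]]
      by (cases q) (simp_all add: coeff_pCons)
  qed
  then show ?thesis unfolding rowpoly_def by simp
qed

text \<open>On the line \<open>x + t (1, 2, \<dots>)\<close> two polynomial functions become polynomials in t, and all but finitely many
points of the line have distinct coordinates.\<close>

lemma poly_fun_unique:
  assumes F: "poly_fun m F" and G: "poly_fun m G"
    and eq: "\<And>x. inj_on x {1..m} \<Longrightarrow> F x = G x"
  shows "F = G"
proof
  fix x :: "nat \<Rightarrow> complex"
  let ?y = "\<lambda>t i. x i + t * of_nat i :: complex"
  have line: "\<exists>h. \<forall>t. H (?y t) = poly h t" if "poly_fun m H" for H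
    using that
  proof induction
    case (poly_const c)
    show ?case by (intro exI[of _ "[:c:]"]) simp
  next
    case (poly_var i)
    show ?case by (intro exI[of _ "[:x i, of_nat i:]"]) simp
  next
    case (poly_add F G)
    then obtain f g where "\<forall>t. F (?y t) = poly f t" "\<forall>t. G (?y t) = poly g t" by blast
    then show ?case by (intro exI[of _ "f + g"]) simp
  next
    case (poly_mult F G)
    then obtain f g where "\<forall>t. F (?y t) = poly f t" "\<forall>t. G (?y t) = poly g t" by blast
    then show ?case by (intro exI[of _ "f * g"]) simp
  qed
  obtain f g where f: "\<And>t. F (?y t) = poly f t" and g: "\<And>t. G (?y t) = poly g t"
    using line[OF F] line[OF G] by blast
  define B where "B = (\<lambda>(i, j). (x j - x i) / (of_nat i - of_nat j)) ` ({1..m} \<times> {1..m})"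
  have fin: "finite B" unfolding B_def by simp
  have "poly (f - g) t = 0" if t: "t \<notin> B" for t
  proof -
    have "inj_on (?y t) {1..m}"
    proof (rule inj_onI, rule ccontr)
      fix i j assume ij: "i \<in> {1..m}" "j \<in> {1..m}" "?y t i = ?y t j" "i \<noteq> j"
      then have "t * (of_nat i - of_nat j) = x j - x i" by (simp add: algebra_simps)
      then have "t = (x j - x i) / (of_nat i - of_nat j)" using ij(4) by (simp add: field_simps)
      then have "t \<in> B" unfolding B_def using ij(1,2) by (intro image_eqI[of _ _ "(i, j)"]) auto
      then show False using t by simp
    qed
    from eq[OF this] show ?thesis by (simp add: f g)
  qed
  then have "UNIV \<subseteq> B \<union> {t. poly (f - g) t = 0}" by auto
  moreover have "infinite (UNIV :: complex set)" by (rule infinite_UNIV_char_0)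
  ultimately have "infinite {t. poly (f - g) t = 0}" using fin by (meson finite_UnI finite_subset)
  then have "f - g = 0" using poly_roots_finite by blast
  then show "F x = G x" using f[of 0] g[of 0] by simp
qed

lemma poly_fun_newton_rhs:
  "poly_fun m (\<lambda>x. newton_rhs m (coeff (rowpoly m (lams m x))) p)"
  unfolding newton_rhs_def
proof (rule poly_fun_uminus, rule poly_fun_sum)
  fix q
  show "poly_fun m (\<lambda>x. of_nat (q choose p) * (- 1) ^ (q - p) * coeff (rowpoly m (lams m x)) q)"
    by (rule poly_fun.poly_mult[OF poly_fun.poly_const poly_fun_coeff])
qed

lemma inj_on_lams: "inj_on x {1..m} \<Longrightarrow> inj_on (lams m x) {1..m}"
  unfolding lams_def by (rule inj_onI) (auto dest: inj_onD)

text \<open>The Newton identities determine \<open>gam\<close> recursively from the coefficients of the row polynomial, without division.\<close>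

lemma gamma_exists: "\<exists>F. poly_fun m F \<and> (\<forall>x. inj_on x {1..m} \<longrightarrow> F x = gam m (lams m x) j)"
proof (induction j rule: less_induct)
  case (less j)
  let ?c = "\<lambda>x. coeff (rowpoly m (lams m x))"
  have "\<forall>i. \<exists>F. i < j \<longrightarrow> poly_fun m F \<and> (\<forall>x. inj_on x {1..m} \<longrightarrow> F x = gam m (lams m x) i)"
    by (rule allI) (use less in simp)
  from choice[OF this]
  obtain F where F0: "\<forall>i. i < j \<longrightarrow> poly_fun m (F i) \<and> (\<forall>x. inj_on x {1..m} \<longrightarrow> F i x = gam m (lams m x) i)"
    by (rule exE)
  have F1: "i < j \<Longrightarrow> poly_fun m (F i)" for i
    using F0[THEN spec, of i] by simp
  have F2: "F i x = gam m (lams m x) i" if "i < j" "inj_on x {1..m}" for i x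
    by (rule F0[THEN spec, of i, THEN mp, OF that(1), THEN conjunct2, THEN spec, THEN mp, OF that(2)])
  show ?case
  proof (cases "j < m")
    case True
    define p where "p = m - 1 - j"
    have p: "p < m" "m - Suc p = j" "Suc p \<le> m" using True by (auto simp: p_def)
    let ?F = "\<lambda>x. newton_rhs m (?c x) p - (\<Sum>q=Suc p..<m. ?c x q * F (q - Suc p) x)"
    have 1: "poly_fun m ?F"
    proof (rule poly_fun_diff[OF poly_fun_newton_rhs], rule poly_fun_sum)
      fix q assume "q \<in> {Suc p..<m}"
      then have "q - Suc p < j" using p by auto
      then show "poly_fun m (\<lambda>x. ?c x q * F (q - Suc p) x)"
        by (rule poly_fun.poly_mult[OF poly_fun_coeff F1])
    qed
    have 2: "?F x = gam m (lams m x) j" if x: "inj_on x {1..m}" for x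
    proof -
      have "{Suc p..m} = insert m {Suc p..<m}" using p by auto
      then have "newton_rhs m (?c x) p = gam m (lams m x) j + (\<Sum>q=Suc p..<m. ?c x q * gam m (lams m x) (q - Suc p))"
        using gam_low[OF inj_on_lams[OF x] p(1)] p(2) by (simp add: coeff_rowpoly_top)
      moreover have "(\<Sum>q=Suc p..<m. ?c x q * gam m (lams m x) (q - Suc p)) = (\<Sum>q=Suc p..<m. ?c x q * F (q - Suc p) x)"
      proof (rule sum.cong[OF refl])
        fix q assume "q \<in> {Suc p..<m}"
        then have "q - Suc p < j" using p by auto
        from F2[OF this x] show "?c x q * gam m (lams m x) (q - Suc p) = ?c x q * F (q - Suc p) x" by simp
      qed
      ultimately show ?thesis by simp
    qed
    show ?thesis by (rule exI[of _ ?F], rule conjI[OF 1], rule allI, rule impI, rule 2)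
  next
    case False
    let ?F = "\<lambda>x. - (\<Sum>q<m. ?c x q * F (q + (j - m)) x)"
    have 1: "poly_fun m ?F"
    proof (rule poly_fun_uminus, rule poly_fun_sum)
      fix q assume "q \<in> {..<m}"
      then have "q + (j - m) < j" using False by auto
      then show "poly_fun m (\<lambda>x. ?c x q * F (q + (j - m)) x)"
        by (rule poly_fun.poly_mult[OF poly_fun_coeff F1])
    qed
    have 2: "?F x = gam m (lams m x) j" if x: "inj_on x {1..m}" for x
    proof -
      have "(\<Sum>q<m. ?c x q * gam m (lams m x) (q + (j - m))) + gam m (lams m x) j = 0"
        using gam_high[of m "lams m x" "j - m"] False by (simp add: lessThan_Suc_atMost[symmetric] coeff_rowpoly_top)
      moreover have "(\<Sum>q<m. ?c x q * gam m (lams m x) (q + (j - m))) = (\<Sum>q<m. ?c x q * F (q + (j - m)) x)"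
      proof (rule sum.cong[OF refl])
        fix q assume "q \<in> {..<m}"
        then have "q + (j - m) < j" using False by auto
        from F2[OF this x] show "?c x q * gam m (lams m x) (q + (j - m)) = ?c x q * F (q + (j - m)) x" by simp
      qed
      ultimately show ?thesis by (simp only: neg_eq_iff_add_eq_0)
    qed
    show ?thesis by (rule exI[of _ ?F], rule conjI[OF 1], rule allI, rule impI, rule 2)
  qed
qed

lemma gamma_row:
  shows poly_fun_gamma_row: "poly_fun m (gamma_row m j)"
    and gamma_row_inj: "inj_on x {1..m} \<Longrightarrow> gamma_row m j x = gam m (lams m x) j"
proof -
  have gam: "(\<Sum>i = 1..m. (x i + of_nat m - 1) ^ j * (\<Prod>r \<in> {1..m} - {i}. 1 - 1 / (x i - x r))) = gam m (lams m x) j" for x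
    by (simp add: gam_def lams_def)
  obtain F where F0: "poly_fun m F \<and> (\<forall>x. inj_on x {1..m} \<longrightarrow> F x = gam m (lams m x) j)"
    using gamma_exists by (rule exE)
  then have F: "poly_fun m F" "inj_on x {1..m} \<Longrightarrow> F x = gam m (lams m x) j" for x
    by simp_all
  have "gamma_row m j = F"
    unfolding gamma_row_def gam
  proof (rule the_equality)
    fix f assume f: "poly_fun m f \<and> (\<forall>x. inj_on x {1..m} \<longrightarrow> f x = gam m (lams m x) j)"
    show "f = F" by (rule poly_fun_unique[OF _ F(1)]) (simp_all add: f F(2))
  qed (simp add: F)
  then show "poly_fun m (gamma_row m j)" "inj_on x {1..m} \<Longrightarrow> gamma_row m j x = gam m (lams m x) j"
    using F by simp_all
qed

lemma gamma_row_low: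
  assumes p: "p < m"
  shows "(\<Sum>q=Suc p..m. coeff (rowpoly m (lams m x)) q * gamma_row m (q - Suc p) x) = newton_rhs m (coeff (rowpoly m (lams m x))) p"
proof -
  have "(\<lambda>x. \<Sum>q=Suc p..m. coeff (rowpoly m (lams m x)) q * gamma_row m (q - Suc p) x) = (\<lambda>x. newton_rhs m (coeff (rowpoly m (lams m x))) p)"
  proof (rule poly_fun_unique[of m])
    show "poly_fun m (\<lambda>x. \<Sum>q=Suc p..m. coeff (rowpoly m (lams m x)) q * gamma_row m (q - Suc p) x)"
      by (intro poly_fun_sum poly_fun.poly_mult poly_fun_coeff poly_fun_gamma_row)
    show "poly_fun m (\<lambda>x. newton_rhs m (coeff (rowpoly m (lams m x))) p)"
      by (rule poly_fun_newton_rhs)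
    fix x :: "nat \<Rightarrow> complex" assume x: "inj_on x {1..m}"
    show "(\<Sum>q=Suc p..m. coeff (rowpoly m (lams m x)) q * gamma_row m (q - Suc p) x) = newton_rhs m (coeff (rowpoly m (lams m x))) p"
      unfolding gamma_row_inj[OF x] by (rule gam_low[OF inj_on_lams[OF x] p])
  qed
  then show ?thesis by (rule fun_cong)
qed

lemma gamma_row_high: "(\<Sum>q\<le>m. coeff (rowpoly m (lams m x)) q * gamma_row m (q + j) x) = 0"
proof -
  have "(\<lambda>x. \<Sum>q\<le>m. coeff (rowpoly m (lams m x)) q * gamma_row m (q + j) x) = (\<lambda>x. 0)"
  proof (rule poly_fun_unique[of m])
    fix x :: "nat \<Rightarrow> complex" assume "inj_on x {1..m}"
    then show "(\<Sum>q\<le>m. coeff (rowpoly m (lams m x)) q * gamma_row m (q + j) x) = 0"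
      using gam_high[of m "lams m x" j] by (simp only: gamma_row_inj)
  qed (intro poly_fun_sum poly_fun.poly_mult poly_fun.poly_const poly_fun_coeff poly_fun_gamma_row)+
  then show ?thesis by (rule fun_cong)
qed

text \<open>The roots, in some order, form the row of the tableau belonging to given eigenvalues.\<close>

lemma monic_poly_roots:
  assumes "c m = 1"
  shows "\<exists>l. \<forall>u. (\<Sum>q\<le>m. c q * u ^ q) = poly (rowpoly m l) u"
proof -
  define P where "P = (\<Sum>q\<le>m. Polynomial.monom (c q) q)"
  have cP: "coeff P q = (if q \<le> m then c q else 0)" for q
    by (simp add: P_def coeff_sum)
  have deg: "degree P = m"
    by (rule antisym) (auto intro!: degree_le le_degree simp: cP assms)
  have lead: "lead_coeff P = 1" by (simp add: deg cP assms)
  obtain rs where rs: "mset rs = proots P" by (metis ex_mset)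
  have len: "length rs = m"
    using size_proots_complex[of P] deg by (metis rs size_mset)
  have "P = smult (lead_coeff P) (\<Prod>x\<in>#proots P. [:- x, 1:])"
    by (rule complex_poly_decompose_multiset[symmetric])
  also have "\<dots> = (\<Prod>x\<leftarrow>rs. [:- x, 1:])"
    unfolding lead by (simp flip: rs prod_mset_prod_list)
  also have "\<dots> = (\<Prod>i=1..m. [:- (rs ! (i - 1)), 1:])"
  proof -
    have "(\<Prod>x\<leftarrow>rs. [:- x, 1:]) = (\<Prod>i<m. [:- (rs ! i), 1:])"
      by (simp add: prod.list_conv_set_nth len atLeast0LessThan)
    also have "\<dots> = (\<Prod>i=1..m. [:- (rs ! (i - 1)), 1:])"
      by (rule prod.reindex_bij_witness[of _ "\<lambda>i. i - 1" Suc]) auto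
    finally show ?thesis .
  qed
  finally have "P = rowpoly m (\<lambda>i. rs ! (i - 1))" by (simp add: rowpoly_def)
  moreover have "(\<Sum>q\<le>m. c q * u ^ q) = poly P u" for u
    by (simp add: P_def poly_sum poly_monom)
  ultimately show ?thesis by (intro exI[of _ "\<lambda>i. rs ! (i - 1)"]) simp
qed

section \<open>Representations and their weight vectors\<close>

context gl_family
begin

text \<open>The commutator of the determinant with a vector is expressed by the adjugate; multiplying by
\<open>u - E\<close> and using the Cayley identity removes the adjugate.\<close>

lemma C_gvec_pair:
  assumes k: "k \<le> n" and g: "gvec k g" and b: "b \<in> {1..k}"
  shows "C k u * (sc u * g b - (\<Sum>c=1..k. E b c * g c) + g b) = (sc u * g b - (\<Sum>c=1..k. E b c * g c)) * C k u"
proof -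
  note cap = capelliD[OF capelli[OF k]]
  have CE: "br (C k u) (E b c) = 0" if "c \<in> {1..k}" for c
    using ginvD[OF cap(1) b that] by (subst br_swap) simp
  have "br (C k u) (sc u * g b - (\<Sum>c=1..k. E b c * g c))
      = sc u * br (C k u) (g b) - (\<Sum>c=1..k. E b c * br (C k u) (g c))"
    by (simp add: br_diff br_mult br_sum CE)
  moreover have "sc u * br (C k u) (g b) = - (\<Sum>a=1..k. sc u * A k u b a * g a)"
    by (simp add: cap(6)[OF g b] sum_distrib_left mult.assoc)
  moreover have "(\<Sum>c=1..k. E b c * br (C k u) (g c)) = - (\<Sum>a=1..k. (\<Sum>c=1..k. E b c * A k u c a) * g a)"
  proof -
    have "(\<Sum>c=1..k. E b c * br (C k u) (g c)) = - (\<Sum>c=1..k. \<Sum>a=1..k. E b c * A k u c a * g a)"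
      by (simp add: cap(6)[OF g] sum_distrib_left mult.assoc sum_negf)
    also have "(\<Sum>c=1..k. \<Sum>a=1..k. E b c * A k u c a * g a) = (\<Sum>a=1..k. (\<Sum>c=1..k. E b c * A k u c a) * g a)"
      unfolding sum_distrib_right by (rule sum.swap)
    finally show ?thesis .
  qed
  ultimately have "br (C k u) (sc u * g b - (\<Sum>c=1..k. E b c * g c))
      = - (\<Sum>a=1..k. (sc u * A k u b a - (\<Sum>c=1..k. E b c * A k u c a)) * g a)"
    by (simp add: left_diff_distrib sum_subtractf)
  also have "(\<Sum>a=1..k. (sc u * A k u b a - (\<Sum>c=1..k. E b c * A k u c a)) * g a) = (\<Sum>a=1..k. if b = a then C k u * g a else 0)"
    using cap(3)[OF b] by (intro sum.cong refl) (simp add: if_times)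
  also have "\<dots> = C k u * g b" using b by simp
  finally show ?thesis by (simp add: br_def distrib_left algebra_simps)
qed

lemma C_gcov_pair:
  assumes k: "k \<le> n" and g: "gcov k g" and b: "b \<in> {1..k}"
  shows "C k u * (sc u * g b - (\<Sum>c=1..k. g c * E c b)) = (sc u * g b - (\<Sum>c=1..k. g c * E c b) + g b) * C k u"
proof -
  note cap = capelliD[OF capelli[OF k]]
  have CE: "br (C k u) (E c b) = 0" if "c \<in> {1..k}" for c
    using ginvD[OF cap(1) that b] by (subst br_swap) simp
  have "br (C k u) (sc u * g b - (\<Sum>c=1..k. g c * E c b))
      = sc u * br (C k u) (g b) - (\<Sum>c=1..k. br (C k u) (g c) * E c b)"
    by (simp add: br_diff br_mult br_sum CE)
  moreover have "sc u * br (C k u) (g b) = (\<Sum>a=1..k. g a * (sc u * A k u a b))"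
    unfolding cap(7)[OF g b] sum_distrib_left
    by (intro sum.cong refl) (metis sc_comm mult.assoc)
  moreover have "(\<Sum>c=1..k. br (C k u) (g c) * E c b) = (\<Sum>a=1..k. g a * (\<Sum>c=1..k. A k u a c * E c b))"
  proof -
    have "(\<Sum>c=1..k. br (C k u) (g c) * E c b) = (\<Sum>c=1..k. \<Sum>a=1..k. g a * (A k u a c * E c b))"
      by (simp add: cap(7)[OF g] sum_distrib_right mult.assoc)
    also have "\<dots> = (\<Sum>a=1..k. g a * (\<Sum>c=1..k. A k u a c * E c b))"
      unfolding sum_distrib_left by (rule sum.swap)
    finally show ?thesis .
  qed
  ultimately have "br (C k u) (sc u * g b - (\<Sum>c=1..k. g c * E c b))
      = (\<Sum>a=1..k. g a * (sc u * A k u a b - (\<Sum>c=1..k. A k u a c * E c b)))"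
    by (simp add: right_diff_distrib sum_subtractf)
  also have "\<dots> = (\<Sum>a=1..k. if a = b then g a * C k u else 0)"
    using cap(4)[OF _ b] by (intro sum.cong refl) (simp add: if_times)
  also have "\<dots> = g b * C k u" using b by simp
  finally show ?thesis by (simp add: br_def distrib_right algebra_simps)
qed

lemma br_C_C:
  assumes "k \<le> n" "l \<le> n" shows "br (C k u) (C l v) = 0"
proof -
  have *: "br (C k u) (C l v) = 0" if "k \<le> l" "l \<le> n" for k l u v
  proof -
    have "br (C l v) (C k u) = 0"
    proof (rule comm_CA[THEN conjunct1])
      fix a b assume ab: "a \<in> {1..k}" "b \<in> {1..k}"
      then have "br (E a b) (C l v) = 0"
        using that by (intro ginvD[OF capelliD(1)[OF capelli]]) auto
      then show "br (C l v) (E a b) = 0" by (subst br_swap) simp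
    qed
    then show ?thesis by (subst br_swap) simp
  qed
  show ?thesis
  proof (cases "k \<le> l")
    case False
    then show ?thesis using *[of l k v u] assms by (subst br_swap) simp
  qed (use * assms in simp)
qed

lemma br_C_step:
  assumes "Suc k \<le> n" "l \<le> n" "l \<noteq> k" "1 \<le> k"
  shows "br (C l u) (E k (Suc k)) = 0" "br (C l u) (E (Suc k) k) = 0"
proof -
  have "br (E k (Suc k)) (C l u) = 0 \<and> br (E (Suc k) k) (C l u) = 0"
  proof (cases "l < k")
    case True
    have "br (E k (Suc k)) (C l u) = 0"
      by (rule comm_CA[THEN conjunct1]) (use True assms in \<open>simp add: E_br\<close>)
    moreover have "br (E (Suc k) k) (C l u) = 0"
      by (rule comm_CA[THEN conjunct1]) (use True assms in \<open>simp add: E_br\<close>)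
    ultimately show ?thesis ..
  next
    case False
    then have "k \<in> {1..l}" "Suc k \<in> {1..l}" using assms by auto
    then show ?thesis using ginvD[OF capelliD(1)[OF capelli[OF assms(2)]]] by blast
  qed
  then show "br (C l u) (E k (Suc k)) = 0" "br (C l u) (E (Suc k) k) = 0"
    using br_swap[of "C l u"] by simp_all
qed

end

text \<open>Only the ring action enters the weight calculus, so that it applies to a module, to a twisted module and to a
direct product alike.\<close>

locale gl_rep = gl_family E sc n + vector_space s
  for E :: "nat \<Rightarrow> nat \<Rightarrow> 'a::ring_1" and sc n and s :: "complex \<Rightarrow> 'm::ab_group_add \<Rightarrow> 'm" +
  fixes act :: "'a \<Rightarrow> 'm \<Rightarrow> 'm" (infixr "\<rhd>" 75)
  assumes act_add_left: "(x + y) \<rhd> v = x \<rhd> v + y \<rhd> v"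
    and act_mult: "(x * y) \<rhd> v = x \<rhd> (y \<rhd> v)"
    and act_sc: "sc a \<rhd> v = s a v"
    and act_add: "x \<rhd> (v + w) = x \<rhd> v + x \<rhd> w"
begin

lemma act_1 [simp]: "1 \<rhd> v = v"
  using act_sc[of 1 v] by simp

lemma act_0 [simp]: "x \<rhd> 0 = 0" "0 \<rhd> v = 0"
  using act_add[of x 0 0] act_add_left[of 0 0 v] by simp_all

lemma act_scale: "x \<rhd> s a v = s a (x \<rhd> v)"
  by (simp add: act_sc[symmetric] act_mult[symmetric] sc_comm[of a x])

lemma act_minus: "x \<rhd> (- v) = - (x \<rhd> v)" "(- x) \<rhd> v = - (x \<rhd> v)"
  using act_add[of x "- v" v] act_add_left[of "- x" x v] by (simp_all add: eq_neg_iff_add_eq_0)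

lemma act_diff: "x \<rhd> (v - w) = x \<rhd> v - x \<rhd> w"
  using act_add[of x v "- w"] by (simp add: act_minus)

lemma act_diff_left: "(x - y) \<rhd> v = x \<rhd> v - y \<rhd> v"
  using act_add_left[of x "- y" v] by (simp add: act_minus)

lemma act_sum: "x \<rhd> (\<Sum>i\<in>I. g i) = (\<Sum>i\<in>I. x \<rhd> g i)"
  by (induction I rule: infinite_finite_induct) (simp_all add: act_add)

lemma act_sum_left: "(\<Sum>i\<in>I. g i) \<rhd> v = (\<Sum>i\<in>I. g i \<rhd> v)"
  by (induction I rule: infinite_finite_induct) (simp_all add: act_add_left)

lemma act_comm: "br x y = 0 \<Longrightarrow> x \<rhd> y \<rhd> v = y \<rhd> x \<rhd> v"
  by (simp add: br_eq_0 act_mult[symmetric])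

lemma vs: "vector_space s" ..

lemma act_C: "C k u \<rhd> v = (\<Sum>m\<le>k. s (u ^ m) (z k m \<rhd> v))"
  by (simp add: C_z act_sum_left act_mult act_sc)

text \<open>Here l lists the roots, that is the shifted entries of the k-th row.\<close>

definition row :: "nat \<Rightarrow> (nat \<Rightarrow> complex) \<Rightarrow> 'm \<Rightarrow> bool"
  where "row k l v \<longleftrightarrow> (\<forall>u. C k u \<rhd> v = s (poly (rowpoly k l) u) v)"

lemma rowD: "row k l v \<Longrightarrow> C k u \<rhd> v = s (poly (rowpoly k l) u) v"
  by (simp add: row_def)

lemma row_0: "row 0 l v"
  by (simp add: row_def rowpoly_def)

text \<open>One value of u is left out because \<open>row_shift\<close> divides by \<open>u - a\<close>.\<close>

lemma z_scalar:
  assumes "\<And>u. u \<noteq> a \<Longrightarrow> C k u \<rhd> v = s (poly (rowpoly k l) u) v" "m \<le> k"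
  shows "z k m \<rhd> v = s (coeff (rowpoly k l) m) v"
proof -
  have "infinite (- {a})" by (simp add: infinite_UNIV_char_0)
  then obtain S where S: "finite S" "card S = Suc k" "S \<subseteq> - {a}"
    by (meson infinite_arbitrarily_large)
  have "z k m \<rhd> v - s (coeff (rowpoly k l) m) v = 0"
  proof (rule vector_poly_zero[OF vs S(1), where d = "Suc k" and z = "\<lambda>m. z k m \<rhd> v - s (coeff (rowpoly k l) m) v"])
    fix u assume "u \<in> S"
    then have "C k u \<rhd> v = s (poly (rowpoly k l) u) v" using S by (intro assms(1)) auto
    then show "(\<Sum>m<Suc k. s (u ^ m) (z k m \<rhd> v - s (coeff (rowpoly k l) m) v)) = 0"
      by (simp add: act_C poly_rowpoly_sum lessThan_Suc_atMost scale_right_diff_distrib sum_subtractf scale_sum_left mult.commute)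
  qed (use S assms(2) in auto)
  then show ?thesis by simp
qed

lemma row_z:
  assumes "\<And>m. m \<le> k \<Longrightarrow> z k m \<rhd> v = s (coeff (rowpoly k l) m) v"
  shows "row k l v"
  unfolding row_def act_C poly_rowpoly_sum scale_sum_left
  by (intro allI sum.cong refl) (simp add: assms mult.commute)

text \<open>Put \<open>x = C k (l i) w\<close>. The relation at \<open>u = l i\<close> gives \<open>C k (l i) w' = l i x\<close>; applying
\<open>C k (l i)\<close> to the relation at u then gives
\<open>(u - l i) C k u x = P(u) (u + \<epsilon> - l i) x\<close>.\<close>

lemma row_shift:
  assumes k: "k \<le> n" and i: "i \<in> {1..k}"
    and pr: "\<And>u. C k u \<rhd> (s u w - w') = s (poly (rowpoly k l) u) (s (u + \<epsilon>) w - w')"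
  shows "row k (l(i := l i - \<epsilon>)) (C k (l i) \<rhd> w)"
proof (rule row_z, rule z_scalar[where a = "l i"])
  let ?x = "C k (l i) \<rhd> w"
  define Q where "Q = (\<Prod>r\<in>{1..k} - {i}. [:- l r, 1:])"
  have P: "rowpoly k l = [:- l i, 1:] * Q"
    unfolding rowpoly_def Q_def using i by (simp add: prod.remove)
  have P': "rowpoly k (l(i := l i - \<epsilon>)) = [:- (l i - \<epsilon>), 1:] * Q"
    unfolding rowpoly_def Q_def using i by (simp add: prod.remove)
  have comm: "C k u \<rhd> C k u' \<rhd> y = C k u' \<rhd> C k u \<rhd> y" for u u' y
    by (rule act_comm[OF br_C_C[OF k k]])
  have w': "C k (l i) \<rhd> w' = s (l i) ?x"
    using pr[of "l i"] by (simp add: P act_diff act_scale)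
  fix u assume u: "u \<noteq> l i"
  have "C k (l i) \<rhd> C k u \<rhd> (s u w - w') = C k (l i) \<rhd> s (poly (rowpoly k l) u) (s (u + \<epsilon>) w - w')"
    by (simp only: pr)
  then have "C k u \<rhd> (s u ?x - s (l i) ?x) = s (poly (rowpoly k l) u) (s (u + \<epsilon>) ?x - s (l i) ?x)"
    unfolding comm[of "l i"] by (simp only: act_diff act_scale w')
  then have "s (u - l i) (C k u \<rhd> ?x) = s (u - l i) (s (poly (rowpoly k (l(i := l i - \<epsilon>))) u) ?x)"
    by (simp only: scale_left_diff_distrib[symmetric] act_scale P P' poly_mult scale_scale)
      (simp add: algebra_simps)
  from this[unfolded scale_cancel_left] u
  show "C k u \<rhd> ?x = s (poly (rowpoly k (l(i := l i - \<epsilon>))) u) ?x"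
    by simp
qed

text \<open>The vector \<open>C k u w - P(u) w\<close> is a polynomial in u of degree less than k. By the relation its leading
coefficient is \<open>\<epsilon> w\<close>, and by Lagrange interpolation at the roots of P it is the right-hand side.\<close>

lemma pair_sum:
  assumes k: "k \<le> n" and inj: "inj_on l {1..k}"
    and pr: "\<And>u. C k u \<rhd> (s u w - w') = s (poly (rowpoly k l) u) (s (u + \<epsilon>) w - w')"
  shows "s \<epsilon> w = (\<Sum>i=1..k. s (1 / (\<Prod>r\<in>{1..k} - {i}. l i - l r)) (C k (l i) \<rhd> w))"
proof (cases "k = 0")
  case True
  then show ?thesis using pr[of 0] by (simp add: rowpoly_def)
next
  case k0: False
  define p where "p = coeff (rowpoly k l)"
  define d where "d i = (\<Prod>r\<in>{1..k} - {i}. l i - l r)" for i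
  define Q where "Q i = (\<Prod>r\<in>{1..k} - {i}. [:- l r, 1:])" for i
  define r where "r y m = z k m \<rhd> y - s (p m) y" for y m
  have R: "C k u \<rhd> y - s (poly (rowpoly k l) u) y = (\<Sum>m<k. s (u ^ m) (r y m))" for u y
  proof -
    have "C k u \<rhd> y - s (poly (rowpoly k l) u) y = (\<Sum>m\<le>k. s (u ^ m) (r y m))"
      by (simp add: r_def p_def act_C poly_rowpoly_sum scale_right_diff_distrib sum_subtractf scale_sum_left mult.commute)
    also have "\<dots> = (\<Sum>m<k. s (u ^ m) (r y m))"
      by (simp add: lessThan_Suc_atMost[symmetric] r_def p_def z_top coeff_rowpoly_top)
    finally show ?thesis .
  qed
  define y where "y m = (if m = 0 then 0 else r w (m - 1)) - (if m < k then r w' m else 0) - s (\<epsilon> * p m) w" for m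
  obtain S :: "complex set" where S: "finite S" "card S = Suc k"
    using infinite_arbitrarily_large[OF infinite_UNIV_char_0] by blast
  \<comment> \<open>coefficients of \<open>C k u (u w - w') - P(u) ((u + \<epsilon>) w - w')\<close>, collected in powers of u\<close>
  have "y k = 0"
  proof (rule vector_poly_zero[OF vs S(1), where d = "Suc k" and z = y])
    fix u
    have "(\<Sum>m<Suc k. s (u ^ m) (if m = 0 then 0 else r w (m - 1))) = s u (C k u \<rhd> w - s (poly (rowpoly k l) u) w)"
      unfolding R by (subst sum.lessThan_Suc_shift) (simp add: scale_sum_right)
    moreover have "(\<Sum>m<Suc k. s (u ^ m) (if m < k then r w' m else 0)) = C k u \<rhd> w' - s (poly (rowpoly k l) u) w'"
      unfolding R by simp
    moreover have "(\<Sum>m<Suc k. s (u ^ m) (s (\<epsilon> * p m) w)) = s (\<epsilon> * poly (rowpoly k l) u) w"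
      unfolding poly_rowpoly_sum p_def sum_distrib_left scale_sum_left lessThan_Suc_atMost
      by (intro sum.cong refl) (simp add: mult_ac)
    ultimately have "(\<Sum>m<Suc k. s (u ^ m) (y m)) = s u (C k u \<rhd> w - s (poly (rowpoly k l) u) w)
        - (C k u \<rhd> w' - s (poly (rowpoly k l) u) w') - s (\<epsilon> * poly (rowpoly k l) u) w"
      unfolding y_def scale_right_diff_distrib sum_subtractf by (simp only:)
    also have "\<dots> = C k u \<rhd> (s u w - w') - s (poly (rowpoly k l) u) (s (u + \<epsilon>) w - w')"
      by (simp add: act_diff act_scale scale_right_diff_distrib scale_left_distrib scale_right_distrib mult.commute)
    finally show "(\<Sum>m<Suc k. s (u ^ m) (y m)) = 0" unfolding pr by simp
  qed (use S in auto)
  then have top: "s \<epsilon> w = r w (k - 1)"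
    unfolding y_def p_def coeff_rowpoly_top using k0 by simp
  have d0: "d i \<noteq> 0" if "i \<in> {1..k}" for i
  proof -
    have "l i - l r \<noteq> 0" if "r \<in> {1..k} - {i}" for r
      using inj_onD[OF inj, of r i] that \<open>i \<in> {1..k}\<close> by auto
    then show ?thesis unfolding d_def by (simp add: prod_zero_iff)
  qed
  have Qd: "poly (Q i) (l i) = d i" for i by (simp add: Q_def d_def poly_prod)
  have Q0: "poly (Q i) (l a) = 0" if "a \<in> {1..k}" "i \<noteq> a" for i a
    unfolding Q_def poly_prod by (rule prod_zero[OF finite_Diff[OF finite_atLeastAtMost]], rule bexI[of _ a]) (use that in auto)
  have degQ: "degree (Q i) = k - 1" if "i \<in> {1..k}" for i
    unfolding Q_def using that by (subst degree_prod_eq_sum_degree) auto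
  have leadQ: "coeff (Q i) (k - 1) = 1" if "i \<in> {1..k}" for i
  proof -
    have "lead_coeff (Q i) = 1" unfolding Q_def lead_coeff_prod by simp
    then show ?thesis by (simp add: degQ[OF that])
  qed
  have Qsum: "poly (Q i) u = (\<Sum>m<k. u ^ m * coeff (Q i) m)" if "i \<in> {1..k}" for i u
  proof -
    have "{..degree (Q i)} = {..<k}" using degQ[OF that] k0 by auto
    then show ?thesis unfolding poly_altdef by (simp only: mult.commute)
  qed
  have "r w (k - 1) - (\<Sum>i=1..k. s (coeff (Q i) (k - 1) / d i) (C k (l i) \<rhd> w)) = 0"
  proof (rule vector_poly_zero[OF vs, where S = "l ` {1..k}" and d = k and z = "\<lambda>m. r w m - (\<Sum>i=1..k. s (coeff (Q i) m / d i) (C k (l i) \<rhd> w))"])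
    fix u assume "u \<in> l ` {1..k}"
    then obtain a where a: "a \<in> {1..k}" "u = l a" by auto
    have P0: "poly (rowpoly k l) (l a) = 0"
      unfolding poly_rowpoly by (rule prod_zero) (use a in auto)
    have "(\<Sum>m<k. s (u ^ m) (\<Sum>i=1..k. s (coeff (Q i) m / d i) (C k (l i) \<rhd> w)))
        = (\<Sum>i=1..k. \<Sum>m<k. s (u ^ m * coeff (Q i) m / d i) (C k (l i) \<rhd> w))"
      unfolding scale_sum_right by (subst sum.swap) simp
    also have "\<dots> = (\<Sum>i=1..k. s (poly (Q i) u / d i) (C k (l i) \<rhd> w))"
      by (intro sum.cong refl) (simp add: Qsum scale_sum_left sum_divide_distrib)
    also have "\<dots> = (\<Sum>i=1..k. if i = a then C k (l a) \<rhd> w else 0)"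
      using d0 a by (intro sum.cong refl) (auto simp: Q0 Qd)
    also have "\<dots> = C k (l a) \<rhd> w" using a by simp
    finally show "(\<Sum>m<k. s (u ^ m) (r w m - (\<Sum>i=1..k. s (coeff (Q i) m / d i) (C k (l i) \<rhd> w)))) = 0"
      using R[where u = u and y = w] P0 unfolding a(2) by (simp add: scale_right_diff_distrib sum_subtractf)
  qed (use inj k0 in \<open>simp_all add: card_image\<close>)
  then show ?thesis unfolding top by (simp add: leadQ d_def)
qed

text \<open>The relation required by \<open>row_shift\<close> and \<open>pair_sum\<close>, with \<open>\<epsilon> = -1\<close> for raising and
\<open>\<epsilon> = 1\<close> for lowering. All b are allowed, not only \<open>b = k\<close>, as the whole vector enters \<open>lower_raise\<close>.\<close>

lemma pair_e:
  assumes k: "Suc k \<le> n" and b: "b \<in> {1..k}" and v: "row k l v"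
  defines "w \<equiv> E b (Suc k) \<rhd> v" and "w' \<equiv> (\<Sum>c=1..k. E b c \<rhd> E c (Suc k) \<rhd> v) - E b (Suc k) \<rhd> v"
  shows "C k u \<rhd> (s u w - w') = s (poly (rowpoly k l) u) (s (u + (- 1)) w - w')"
proof -
  have "gvec k (\<lambda>a. E a (Suc k))" unfolding gvec_def using k by (simp add: E_br)
  from C_gvec_pair[OF _ this b, of u, THEN arg_cong[where f = "\<lambda>x. x \<rhd> v"]] k
  have "C k u \<rhd> (s u w - (\<Sum>c=1..k. E b c \<rhd> E c (Suc k) \<rhd> v) + w)
     = (sc u * E b (Suc k) - (\<Sum>c=1..k. E b c * E c (Suc k))) \<rhd> C k u \<rhd> v"
    by (simp add: act_mult act_add_left act_diff_left act_sum_left act_sc w_def)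
  also have "\<dots> = s (poly (rowpoly k l) u) (s u w - (\<Sum>c=1..k. E b c \<rhd> E c (Suc k) \<rhd> v))"
    by (simp add: rowD[OF v] act_scale act_mult act_diff_left act_sum_left act_sc w_def)
  finally show ?thesis
    unfolding w'_def w_def by (simp add: algebra_simps)
qed

lemma pair_f:
  assumes k: "Suc k \<le> n" and b: "b \<in> {1..k}" and v: "row k l v"
  defines "w \<equiv> E (Suc k) b \<rhd> v" and "w' \<equiv> (\<Sum>c=1..k. E (Suc k) c \<rhd> E c b \<rhd> v)"
  shows "C k u \<rhd> (s u w - w') = s (poly (rowpoly k l) u) (s (u + 1) w - w')"
proof -
  have "gcov k (\<lambda>a. E (Suc k) a)" unfolding gcov_def using k by (simp add: E_br)
  from C_gcov_pair[OF _ this b, of u, THEN arg_cong[where f = "\<lambda>x. x \<rhd> v"]] k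
  have "C k u \<rhd> (s u w - w')
     = (sc u * E (Suc k) b - (\<Sum>c=1..k. E (Suc k) c * E c b) + E (Suc k) b) \<rhd> C k u \<rhd> v"
    by (simp add: act_mult act_add_left act_diff_left act_sum_left act_sc w_def w'_def)
  also have "\<dots> = s (poly (rowpoly k l) u) (s u w - w' + w)"
    by (simp add: rowD[OF v] act_scale act_mult act_diff_left act_add_left act_sum_left act_sc w_def w'_def)
  finally show ?thesis by (simp add: algebra_simps)
qed

definition wt :: "(nat \<Rightarrow> nat \<Rightarrow> complex) \<Rightarrow> 'm set"
  where "wt L = {v. \<forall>k\<in>{1..n}. row k (L k) v}"

lemma wt_row: "v \<in> wt L \<Longrightarrow> k \<le> n \<Longrightarrow> row k (L k) v"
  unfolding wt_def by (cases "k = 0") (auto simp: row_0)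

lemma wt_C: "v \<in> wt L \<Longrightarrow> k \<le> n \<Longrightarrow> C k u \<rhd> v = s (poly (rowpoly k (L k)) u) v"
  by (rule rowD[OF wt_row])

lemma row_subspace: "subspace {v. row k l v}"
  by (auto simp: row_def intro!: subspaceI simp: act_add act_scale scale_right_distrib mult.commute)

lemma wt_subspace: "subspace (wt L)"
proof -
  have "wt L = (\<Inter>k\<in>{1..n}. {v. row k (L k) v})" by (auto simp: wt_def)
  then show ?thesis by (simp add: subspace_Inter row_subspace)
qed

lemma row_comm: "row k l v \<Longrightarrow> (\<And>u. br (C k u) x = 0) \<Longrightarrow> row k l (x \<rhd> v)"
  unfolding row_def by (simp add: act_comm act_scale)

lemma wt_step:
  assumes k: "Suc k \<le> n" "1 \<le> k" and v: "v \<in> wt L" and x: "x = E k (Suc k) \<or> x = E (Suc k) k"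
    and r: "row k l (C k u \<rhd> x \<rhd> v)"
  shows "C k u \<rhd> x \<rhd> v \<in> wt (L(k := l))"
  unfolding wt_def
proof (rule CollectI, rule ballI)
  fix m assume m: "m \<in> {1..n}"
  show "row m ((L(k := l)) m) (C k u \<rhd> x \<rhd> v)"
  proof (cases "m = k")
    case False
    have "row m (L m) (x \<rhd> v)"
      by (rule row_comm[OF wt_row[OF v]]) (use m x br_C_step[OF k(1) _ False k(2)] in auto)
    then have "row m (L m) (C k u \<rhd> x \<rhd> v)"
      by (rule row_comm) (use m k in \<open>simp add: br_C_C\<close>)
    then show ?thesis using False by simp
  qed (use r in simp)
qed

lemma wt_raise:
  assumes k: "Suc k \<le> n" and i: "i \<in> {1..k}" and v: "v \<in> wt L"
  shows "C k (L k i) \<rhd> E k (Suc k) \<rhd> v \<in> wt (L(k := (L k)(i := L k i + 1)))"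
proof (rule wt_step[OF k _ v])
  show "row k ((L k)(i := L k i + 1)) (C k (L k i) \<rhd> E k (Suc k) \<rhd> v)"
    using row_shift[OF _ i pair_e[OF k _ wt_row[OF v]], of k] i k by simp
qed (use i in auto)

lemma wt_lower:
  assumes k: "Suc k \<le> n" and i: "i \<in> {1..k}" and v: "v \<in> wt L"
  shows "C k (L k i) \<rhd> E (Suc k) k \<rhd> v \<in> wt (L(k := (L k)(i := L k i - 1)))"
proof (rule wt_step[OF k _ v])
  show "row k ((L k)(i := L k i - 1)) (C k (L k i) \<rhd> E (Suc k) k \<rhd> v)"
    using row_shift[OF _ i pair_f[OF k _ wt_row[OF v]], of k] i k by simp
qed (use i in auto)

end

section \<open>Raising and lowering weight vectors\<close>

context gl_rep
begin

text \<open>The eigenvalues of the traces and the numbers \<open>\<gamma>\<close> satisfy the same recursion, by Newton's identities on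
either side.\<close>

lemma casimir_row:
  assumes k: "k \<le> n" and v: "row k (lams k x) v"
  shows "casimir k j \<rhd> v = s (gamma_row k j x) v"
proof (induction j rule: less_induct)
  case (less j)
  define c where "c = coeff (rowpoly k (lams k x))"
  have z: "z k m \<rhd> v = s (c m) v" if "m \<le> k" for m
    unfolding c_def by (rule z_scalar[OF rowD[OF v] that])
  have c1: "c k = 1" unfolding c_def by (rule coeff_rowpoly_top)
  show ?case
  proof (cases "j < k")
    case True
    define p where "p = k - 1 - j"
    have p: "p < k" "k - Suc p = j" "Suc p \<le> k" using True by (auto simp: p_def)
    have set: "{Suc p..k} = insert k {Suc p..<k}" using p by auto
    have 1: "newton_rhs k c p = gamma_row k j x + (\<Sum>m=Suc p..<k. c m * gamma_row k (m - Suc p) x)"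
      using gamma_row_low[OF p(1), of x] p(2) by (simp add: set c_def[symmetric] c1)
    have "(\<Sum>m=Suc p..k. z k m * casimir k (m - Suc p)) \<rhd> v = s (newton_rhs k c p) v"
      unfolding newton_low[OF k p(1)] newton_rhs_def
      by (simp add: act_minus act_sum_left act_mult act_sc z scale_sum_left)
    then have "casimir k j \<rhd> v + (\<Sum>m=Suc p..<k. z k m \<rhd> casimir k (m - Suc p) \<rhd> v) = s (newton_rhs k c p) v"
      by (simp add: set p(2) z_top act_sum_left act_add_left act_mult)
    moreover have "(\<Sum>m=Suc p..<k. z k m \<rhd> casimir k (m - Suc p) \<rhd> v) = s (\<Sum>m=Suc p..<k. c m * gamma_row k (m - Suc p) x) v"
      unfolding scale_sum_left
    proof (rule sum.cong[OF refl])
      fix m assume m: "m \<in> {Suc p..<k}"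
      then have "m - Suc p < j" using p by auto
      then show "z k m \<rhd> casimir k (m - Suc p) \<rhd> v = s (c m * gamma_row k (m - Suc p) x) v"
        using m by (simp add: less act_scale z mult.commute)
    qed
    ultimately show ?thesis unfolding 1 by (simp add: scale_left_distrib)
  next
    case False
    have 1: "(\<Sum>m<k. c m * gamma_row k (m + (j - k)) x) + gamma_row k j x = 0"
      using gamma_row_high[of k x "j - k"] False by (simp add: lessThan_Suc_atMost[symmetric] c_def[symmetric] c1)
    have "(\<Sum>m\<le>k. z k m * casimir k (m + (j - k))) \<rhd> v = 0"
      using newton_high[OF k, of "j - k"] by simp
    then have "(\<Sum>m<k. z k m \<rhd> casimir k (m + (j - k)) \<rhd> v) + casimir k j \<rhd> v = 0"
      using False by (simp add: lessThan_Suc_atMost[symmetric] z_top act_sum_left act_add_left act_mult)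
    moreover have "(\<Sum>m<k. z k m \<rhd> casimir k (m + (j - k)) \<rhd> v) = s (\<Sum>m<k. c m * gamma_row k (m + (j - k)) x) v"
      unfolding scale_sum_left
    proof (rule sum.cong[OF refl])
      fix m assume m: "m \<in> {..<k}"
      then have "m + (j - k) < j" using False by auto
      then show "z k m \<rhd> casimir k (m + (j - k)) \<rhd> v = s (c m * gamma_row k (m + (j - k)) x) v"
        using m by (simp add: less act_scale z mult.commute)
    qed
    ultimately have "s (\<Sum>m<k. c m * gamma_row k (m + (j - k)) x) v + casimir k j \<rhd> v
      = s (\<Sum>m<k. c m * gamma_row k (m + (j - k)) x) v + s (gamma_row k j x) v"
      unfolding scale_left_distrib[symmetric] 1 by simp
    then show ?thesis by (rule add_left_imp_eq)
  qed
qed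

lemma wt_casimir:
  "v \<in> wt L \<Longrightarrow> k \<le> n \<Longrightarrow> casimir k j \<rhd> v = s (gamma_row k j (\<lambda>i. L k i - of_nat k + 1)) v"
proof (rule casimir_row)
  have "lams k (\<lambda>i. L k i - of_nat k + 1) = L k" by (simp add: lams_def fun_eq_iff)
  then show "v \<in> wt L \<Longrightarrow> k \<le> n \<Longrightarrow> row k (lams k (\<lambda>i. L k i - of_nat k + 1)) v" by (simp add: wt_row)
qed

lemma wt_diag:
  assumes v: "v \<in> wt L" and k: "k \<in> {1..n}"
  shows "\<exists>c. E k k \<rhd> v = s c v"
proof -
  obtain q where q: "k = Suc q" using k by (cases k) auto
  have c: "casimir m (Suc 0) = (\<Sum>a=1..m. E a a)" for m
    unfolding casimir_def by (intro sum.cong refl) (simp add: if_times)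
  have "E k k = casimir k (Suc 0) - casimir q (Suc 0)"
    unfolding c q by simp
  then have "E k k \<rhd> v = s (gamma_row k (Suc 0) (\<lambda>i. L k i - of_nat k + 1) - gamma_row q (Suc 0) (\<lambda>i. L q i - of_nat q + 1)) v"
    using k by (simp add: act_diff_left wt_casimir[OF v] q scale_left_diff_distrib)
  then show ?thesis by blast
qed

text \<open>Let \<open>\<lambda> = L k i\<close>, \<open>x\<^sub>b = C k \<lambda> E\<^sub>b\<^sub>,\<^sub>k\<^sub>+\<^sub>1 v\<close> and \<open>y\<^sub>b = C k (\<lambda> + 1) E\<^sub>k\<^sub>+\<^sub>1\<^sub>,\<^sub>k x\<^sub>b\<close>. Then
\<open>(\<lambda> + 1 - E) y\<close> has k-th entry a multiple of v and zero entries elsewhere, because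
\<open>\<Sum>b. E\<^sub>k\<^sub>+\<^sub>1\<^sub>,\<^sub>b x\<^sub>b = C (k + 1) (\<lambda> + 1) v\<close>. Multiplication by the adjugate, whose last diagonal
entry is \<open>C (k - 1) \<lambda>\<close>, shows that \<open>C k (\<lambda> + 1) y\<^sub>k\<close> is a multiple of v. Since \<open>y\<^sub>k\<close> has
the weight of v, \<open>C k (\<lambda> + 1)\<close> is a scalar on it, and this scalar is nonzero as the raised row has distinct entries.\<close>

lemma lower_raise:
  assumes K: "Suc k \<le> n" and i: "i \<in> {1..k}" and v: "v \<in> wt L"
    and inj: "inj_on ((L k)(i := L k i + 1)) {1..k}"
  shows "\<exists>c. C k (L k i + 1) \<rhd> E (Suc k) k \<rhd> C k (L k i) \<rhd> E k (Suc k) \<rhd> v = s c v"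
proof -
  define a where "a = L k i"
  define P where "P m = poly (rowpoly m (L m)) (a + 1)" for m
  define x where "x b = C k a \<rhd> E b (Suc k) \<rhd> v" for b
  define y where "y b = C k (a + 1) \<rhd> E (Suc k) k \<rhd> x b" for b
  have k: "k \<le> n" "k \<in> {1..k}" using K i by auto
  note cap = capelliD[OF capelli[OF k(1)]]
  have rv: "row k (L k) v" by (rule wt_row[OF v k(1)])
  have P0: "poly (rowpoly k (L k)) a = 0"
    unfolding poly_rowpoly a_def by (rule prod_zero) (use i in auto)
  have Cv: "C k a \<rhd> v = 0" by (simp add: rowD[OF rv] P0)
  have EC: "E c b \<rhd> C k u \<rhd> w = C k u \<rhd> E c b \<rhd> w" if "b \<in> {1..k}" "c \<in> {1..k}" for b c u w
    by (rule act_comm[OF ginvD[OF cap(1) that(2,1)]])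
  have xs: "(\<Sum>b=1..k. E c b \<rhd> x b) = s (a + 1) (x c)" if c: "c \<in> {1..k}" for c
  proof -
    have "(\<Sum>b=1..k. E c b \<rhd> x b) = C k a \<rhd> (\<Sum>b=1..k. E c b \<rhd> E b (Suc k) \<rhd> v)"
      unfolding act_sum x_def using c by (intro sum.cong refl EC) auto
    moreover have "C k a \<rhd> (s a (E c (Suc k) \<rhd> v) - ((\<Sum>b=1..k. E c b \<rhd> E b (Suc k) \<rhd> v) - E c (Suc k) \<rhd> v)) = 0"
      unfolding pair_e[OF K c rv] P0 by simp
    ultimately show ?thesis
      by (simp add: act_diff act_add act_scale x_def scale_left_distrib algebra_simps)
  qed
  have fx: "(\<Sum>b=1..k. E (Suc k) b \<rhd> x b) = s (P (Suc k)) v"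
  proof -
    have A: "(\<Sum>b=1..k. A k a c b \<rhd> E b (Suc k) \<rhd> v) = - x c" if c: "c \<in> {1..k}" for c
    proof -
      have "gvec k (\<lambda>a. E a (Suc k))" unfolding gvec_def using K by (simp add: E_br)
      from cap(6)[OF this c, of a]
      have "(\<Sum>b=1..k. A k a c b * E b (Suc k)) = - br (C k a) (E c (Suc k))" by simp
      from this[THEN arg_cong[where f = "\<lambda>w. w \<rhd> v"]]
      show ?thesis by (simp add: br_def act_diff_left act_minus act_mult Cv x_def act_sum_left)
    qed
    have br: "br (E (Suc k) (Suc k)) (C k a) = 0"
      by (rule comm_CA[THEN conjunct1]) (use K in \<open>simp add: E_br\<close>)
    then have H: "C k a \<rhd> E (Suc k) (Suc k) \<rhd> v = 0"
      using act_comm[OF br, of v] by (simp add: Cv)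
    have "C (Suc k) (a + 1) \<rhd> v = (\<Sum>b=1..k. E (Suc k) b \<rhd> x b)"
    proof -
      have "C (Suc k) (a + 1) \<rhd> v = - (\<Sum>b=1..k. E (Suc k) b \<rhd> (\<Sum>c=1..k. A k a b c \<rhd> E c (Suc k) \<rhd> v))"
        unfolding C_Suc by (simp add: act_diff_left act_mult act_diff act_sc act_scale Cv H act_sum_left)
      also have "(\<Sum>b=1..k. E (Suc k) b \<rhd> (\<Sum>c=1..k. A k a b c \<rhd> E c (Suc k) \<rhd> v)) = (\<Sum>b=1..k. - (E (Suc k) b \<rhd> x b))"
      proof (rule sum.cong[OF refl])
        fix b assume "b \<in> {1..k}"
        from A[OF this] show "E (Suc k) b \<rhd> (\<Sum>c=1..k. A k a b c \<rhd> E c (Suc k) \<rhd> v) = - (E (Suc k) b \<rhd> x b)"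
          by (simp only: act_minus)
      qed
      finally show ?thesis by (simp add: sum_negf)
    qed
    then show ?thesis unfolding wt_C[OF v K] P_def by simp
  qed
  have eqn: "s (a + 1) (y c) - (\<Sum>b=1..k. E c b \<rhd> y b) = (if c = k then s (P (Suc k) * P k) v else 0)"
    if c: "c \<in> {1..k}" for c
  proof -
    have "E c b \<rhd> y b = C k (a + 1) \<rhd> E (Suc k) k \<rhd> E c b \<rhd> x b
        - (if c = k then C k (a + 1) \<rhd> E (Suc k) b \<rhd> x b else 0)" if b: "b \<in> {1..k}" for b
    proof -
      have "br (E c b) (E (Suc k) k) = (if c = k then - E (Suc k) b else 0)"
        using b c K by (simp add: E_br)
      then have "E c b * E (Suc k) k = E (Suc k) k * E c b + (if c = k then - E (Suc k) b else 0)"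
        by (simp add: br_def algebra_simps)
      from this[THEN arg_cong[where f = "\<lambda>w. w \<rhd> x b"]]
      have "E c b \<rhd> E (Suc k) k \<rhd> x b = E (Suc k) k \<rhd> E c b \<rhd> x b + (if c = k then - (E (Suc k) b \<rhd> x b) else 0)"
        by (simp add: act_mult act_add_left act_minus split: if_splits)
      then show ?thesis unfolding y_def EC[OF b c] by (simp add: act_add act_minus)
    qed
    then have "(\<Sum>b=1..k. E c b \<rhd> y b) = C k (a + 1) \<rhd> E (Suc k) k \<rhd> (\<Sum>b=1..k. E c b \<rhd> x b)
        - (if c = k then C k (a + 1) \<rhd> (\<Sum>b=1..k. E (Suc k) b \<rhd> x b) else 0)"
      by (simp add: act_sum sum_subtractf)
    also have "\<dots> = s (a + 1) (y c) - (if c = k then s (P (Suc k) * P k) v else 0)"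
      unfolding xs[OF c] fx by (simp add: y_def act_scale rowD[OF rv] P_def)
    finally show ?thesis by simp
  qed
  have "C k (a + 1) \<rhd> y k = (\<Sum>b=1..k. (if k = b then C k (a + 1) else 0) \<rhd> y b)"
    using k by (simp add: if_distrib[of "\<lambda>w. w \<rhd> _"] cong: if_cong)
  also have "\<dots> = (\<Sum>b=1..k. A k (a + 1) k b \<rhd> s (a + 1) (y b)) - (\<Sum>b=1..k. \<Sum>c=1..k. A k (a + 1) k c \<rhd> E c b \<rhd> y b)"
    unfolding sum_subtractf[symmetric]
  proof (rule sum.cong[OF refl])
    fix b assume b: "b \<in> {1..k}"
    show "(if k = b then C k (a + 1) else 0) \<rhd> y b = A k (a + 1) k b \<rhd> s (a + 1) (y b) - (\<Sum>c=1..k. A k (a + 1) k c \<rhd> E c b \<rhd> y b)"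
      unfolding cap(4)[OF k(2) b, symmetric]
      by (simp add: act_diff_left act_mult act_sc act_scale act_sum_left)
  qed
  also have "(\<Sum>b=1..k. \<Sum>c=1..k. A k (a + 1) k c \<rhd> E c b \<rhd> y b) = (\<Sum>c=1..k. A k (a + 1) k c \<rhd> (\<Sum>b=1..k. E c b \<rhd> y b))"
    unfolding act_sum by (rule sum.swap)
  also have "(\<Sum>b=1..k. A k (a + 1) k b \<rhd> s (a + 1) (y b)) - \<dots> = (\<Sum>c=1..k. A k (a + 1) k c \<rhd> (s (a + 1) (y c) - (\<Sum>b=1..k. E c b \<rhd> y b)))"
    by (simp add: act_diff sum_subtractf)
  also have "\<dots> = (\<Sum>c=1..k. if c = k then A k (a + 1) k k \<rhd> s (P (Suc k) * P k) v else 0)"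
    by (rule sum.cong[OF refl]) (simp add: eqn)
  also have "\<dots> = s (P (Suc k) * P k) (A k (a + 1) k k \<rhd> v)"
    using k by (simp add: act_scale)
  also have "A k (a + 1) k k = C (k - 1) a"
    using k(2) A_Suc(1)[of "k - 1" "a + 1"] by simp
  also have "C (k - 1) a \<rhd> v = s (poly (rowpoly (k - 1) (L (k - 1))) a) v"
    using k by (intro wt_C[OF v]) simp
  finally have 1: "C k (a + 1) \<rhd> y k = s (P (Suc k) * P k * poly (rowpoly (k - 1) (L (k - 1))) a) v"
    by simp
  have rx: "row k ((L k)(i := a + 1)) (x k)"
    using row_shift[OF k(1) i pair_e[OF K k(2) rv]] unfolding x_def a_def by simp
  have "row k (L k) (y k)"
    using row_shift[OF k(1) i pair_f[OF K k(2) rx]] unfolding y_def a_def by simp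
  then have "s (P k) (y k) = C k (a + 1) \<rhd> y k" by (simp add: rowD P_def)
  then have "s (P k) (y k) = s (P k) (s (P (Suc k) * poly (rowpoly (k - 1) (L (k - 1))) a) v)"
    unfolding 1 by (simp add: mult_ac)
  moreover have "P k \<noteq> 0"
  proof
    assume "P k = 0"
    then obtain j where j: "j \<in> {1..k}" "a + 1 = L k j"
      unfolding P_def poly_rowpoly by (auto simp: prod_zero_iff)
    then have "j \<noteq> i" by (auto simp: a_def)
    then show False using inj_onD[OF inj, of i j] j i by (simp add: a_def)
  qed
  ultimately have "y k = s (P (Suc k) * poly (rowpoly (k - 1) (L (k - 1))) a) v"
    unfolding scale_cancel_left by simp
  then show ?thesis unfolding y_def x_def a_def by blast
qed

text \<open>The previous lemma for the twisted representation.\<close>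

lemma raise_lower:
  assumes K: "Suc k \<le> n" and i: "i \<in> {1..k}" and v: "v \<in> wt L"
    and inj: "inj_on ((L k)(i := L k i - 1)) {1..k}"
  shows "\<exists>c. C k (L k i - 1) \<rhd> E k (Suc k) \<rhd> C k (L k i) \<rhd> E (Suc k) k \<rhd> v = s c v"
proof -
  interpret T: gl_rep "\<lambda>i j. - E j i" sc n s act
    by (rule gl_rep.intro[OF twist_family vs]) (unfold gl_rep_axioms_def, simp add: act_add_left act_mult act_sc act_add)
  define M where "M m j = of_nat m - 1 - L m j" for m j
  have "v \<in> T.wt M"
    unfolding T.wt_def
  proof (rule CollectI, rule ballI)
    fix m assume m: "m \<in> {1..n}"
    show "T.row m (M m) v"
      unfolding T.row_def
    proof
      fix u
      have "(- 1) ^ m * poly (rowpoly m (L m)) (of_nat m - 1 - u) = poly (rowpoly m (M m)) u"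
      proof -
        have "(- 1) ^ m * poly (rowpoly m (L m)) (of_nat m - 1 - u) = (\<Prod>j=1..m. - 1 * (of_nat m - 1 - u - L m j))"
          unfolding prod.distrib by (simp add: poly_rowpoly)
        also have "\<dots> = poly (rowpoly m (M m)) u"
          unfolding poly_rowpoly M_def by (intro prod.cong refl) simp
        finally show ?thesis .
      qed
      moreover have "T.C m u \<rhd> v = s ((- 1) ^ m * poly (rowpoly m (L m)) (of_nat m - 1 - u)) v"
        using m by (simp add: twist_C act_mult act_sc wt_C[OF v])
      ultimately show "T.C m u \<rhd> v = s (poly (rowpoly m (M m)) u) v" by simp
    qed
  qed
  moreover have "inj_on ((M k)(i := M k i + 1)) {1..k}"
  proof (rule inj_onI)
    fix a b assume ab: "a \<in> {1..k}" "b \<in> {1..k}" "((M k)(i := M k i + 1)) a = ((M k)(i := M k i + 1)) b"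
    then have "((L k)(i := L k i - 1)) a = ((L k)(i := L k i - 1)) b"
      by (auto simp: M_def algebra_simps split: if_splits)
    then show "a = b" by (rule inj_onD[OF inj _ ab(1,2)])
  qed
  ultimately obtain c where "T.C k (M k i + 1) \<rhd> (- E k (Suc k)) \<rhd> T.C k (M k i) \<rhd> (- E (Suc k) k) \<rhd> v = s c v"
    using T.lower_raise[OF K i] by blast
  moreover have "T.C k (M k i) = sc ((- 1) ^ k) * C k (L k i)" "T.C k (M k i + 1) = sc ((- 1) ^ k) * C k (L k i - 1)"
    using K by (simp_all add: twist_C M_def)
  ultimately have "s ((- 1) ^ k * (- 1) ^ k) (C k (L k i - 1) \<rhd> E k (Suc k) \<rhd> C k (L k i) \<rhd> E (Suc k) k \<rhd> v) = s c v"
    by (simp add: act_mult act_sc act_minus act_scale)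
  then show ?thesis by (auto simp: power_mult_distrib[symmetric])
qed

text \<open>The Lie algebra is generated by the matrix units next to the diagonal and the diagonal ones.\<close>

lemma E_invariant:
  assumes N: "subspace N"
    and tableau_after: "\<And>k x. 1 \<le> k \<Longrightarrow> Suc k \<le> n \<Longrightarrow> x \<in> N \<Longrightarrow> E k (Suc k) \<rhd> x \<in> N \<and> E (Suc k) k \<rhd> x \<in> N"
    and dg: "\<And>k x. k \<in> {1..n} \<Longrightarrow> x \<in> N \<Longrightarrow> E k k \<rhd> x \<in> N"
  shows "i \<in> {1..n} \<Longrightarrow> j \<in> {1..n} \<Longrightarrow> x \<in> N \<Longrightarrow> E i j \<rhd> x \<in> N"
proof -
  have br: "br X Y \<rhd> x \<in> N" if "\<And>x. x \<in> N \<Longrightarrow> X \<rhd> x \<in> N" "\<And>x. x \<in> N \<Longrightarrow> Y \<rhd> x \<in> N" "x \<in> N" for X Y x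
    unfolding br_def act_diff_left act_mult by (intro subspace_diff[OF N] that)
  have up: "\<forall>x\<in>N. E i (i + Suc d) \<rhd> x \<in> N \<and> E (i + Suc d) i \<rhd> x \<in> N" if "i + Suc d \<le> n" "1 \<le> i" for i d
    using that
  proof (induction d)
    case 0
    then show ?case using tableau_after[of i] by simp
  next
    case (Suc d)
    define m where "m = i + Suc d"
    have IH: "x \<in> N \<Longrightarrow> E i m \<rhd> x \<in> N" "x \<in> N \<Longrightarrow> E m i \<rhd> x \<in> N" for x
      using Suc by (simp_all add: m_def)
    have g: "x \<in> N \<Longrightarrow> E m (Suc m) \<rhd> x \<in> N" "x \<in> N \<Longrightarrow> E (Suc m) m \<rhd> x \<in> N" for x
      using tableau_after[of m] Suc.prems by (simp_all add: m_def)
    have "br (E i m) (E m (Suc m)) = E i (Suc m)" "br (E (Suc m) m) (E m i) = E (Suc m) i"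
      using Suc.prems by (simp_all add: E_br m_def)
    then show ?case
      using br[OF IH(1) g(1)] br[OF g(2) IH(2)] by (simp add: m_def)
  qed
  assume ij: "i \<in> {1..n}" "j \<in> {1..n}" "x \<in> N"
  consider "i = j" | d where "j = i + Suc d" | d where "i = j + Suc d"
    by (metis less_iff_Suc_add add_Suc_right linorder_neqE_nat)
  then show "E i j \<rhd> x \<in> N"
  proof cases
    case 1
    then show ?thesis using dg ij by simp
  next
    case 2
    then show ?thesis using up[of i d] ij by simp
  next
    case 3
    then show ?thesis using up[of j d] ij by simp
  qed
qed

end

section \<open>Moves of a tableau\<close>

text \<open>A letter \<open>(b, k, i)\<close> raises (for b true) or lowers entry i of row k by one.\<close>

type_synonym letter = "bool \<times> nat \<times> nat"

fun shift :: "letter \<Rightarrow> (nat \<Rightarrow> nat \<Rightarrow> complex) \<Rightarrow> nat \<Rightarrow> nat \<Rightarrow> complex"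
  where "shift (b, k, i) L = L(k := (L k)(i := L k i + (if b then 1 else - 1)))"

fun legal :: "nat \<Rightarrow> letter \<Rightarrow> bool"
  where "legal n (b, k, i) \<longleftrightarrow> Suc k \<le> n \<and> i \<in> {1..k}"

definition noncrit :: "nat \<Rightarrow> (nat \<Rightarrow> nat \<Rightarrow> complex) \<Rightarrow> bool"
  where "noncrit n L \<longleftrightarrow> (\<forall>k\<in>{1..n}. inj_on (L k) {1..k})"

definition same_rows :: "nat \<Rightarrow> (nat \<Rightarrow> nat \<Rightarrow> complex) \<Rightarrow> (nat \<Rightarrow> nat \<Rightarrow> complex) \<Rightarrow> bool"
  where "same_rows n L M \<longleftrightarrow> (\<forall>k\<in>{1..n}. \<forall>u. poly (rowpoly k (L k)) u = poly (rowpoly k (M k)) u)"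

text \<open>Entries of one row that differ by an integer are displaced by integers and keep their order.\<close>

definition order_pres :: "nat \<Rightarrow> (nat \<Rightarrow> nat \<Rightarrow> complex) \<Rightarrow> (nat \<Rightarrow> nat \<Rightarrow> complex) \<Rightarrow> bool"
  where "order_pres n L M \<longleftrightarrow> (\<forall>k\<in>{1..n}. \<forall>i\<in>{1..k}. (\<exists>d::int. M k i = L k i + of_int d) \<and>
    (\<forall>j\<in>{1..k}. \<forall>d::int. d > 0 \<longrightarrow> L k j - L k i = of_int d \<longrightarrow> (\<exists>d'::int. d' > 0 \<and> M k j - M k i = of_int d')))"

lemma order_presD:
  assumes "order_pres n L M" "k \<in> {1..n}" "i \<in> {1..k}"
  shows "\<exists>d::int. M k i = L k i + of_int d"
    and "j \<in> {1..k} \<Longrightarrow> d > 0 \<Longrightarrow> L k j - L k i = of_int d \<Longrightarrow> \<exists>d'::int. d' > 0 \<and> M k j - M k i = of_int d'"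
  using assms unfolding order_pres_def by blast+

lemma order_presI:
  assumes "\<And>k i. k \<in> {1..n} \<Longrightarrow> i \<in> {1..k} \<Longrightarrow> \<exists>d::int. M k i = L k i + of_int d"
    "\<And>k i j d. k \<in> {1..n} \<Longrightarrow> i \<in> {1..k} \<Longrightarrow> j \<in> {1..k} \<Longrightarrow> d > 0 \<Longrightarrow> L k j - L k i = of_int d \<Longrightarrow>
      \<exists>d'::int. d' > 0 \<and> M k j - M k i = of_int d'"
  shows "order_pres n L M"
  using assms unfolding order_pres_def by blast

lemma order_pres_refl: "order_pres n L L"
  by (rule order_presI) (auto intro: exI[of _ "0::int"])

lemma order_pres_trans:
  assumes 1: "order_pres n L M" and 2: "order_pres n M N" shows "order_pres n L N"
proof (rule order_presI)
  fix k i assume ki: "k \<in> {1..n}" "i \<in> {1..k}"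
  obtain d e :: int where "M k i = L k i + of_int d" "N k i = M k i + of_int e"
    using order_presD(1)[OF 1 ki] order_presD(1)[OF 2 ki] by blast
  then show "\<exists>d::int. N k i = L k i + of_int d" by (intro exI[of _ "d + e"]) simp
  fix j and d :: int assume j: "j \<in> {1..k}" and d: "d > 0" "L k j - L k i = of_int d"
  obtain d' :: int where "d' > 0" "M k j - M k i = of_int d'"
    using order_presD(2)[OF 1 ki j d] by blast
  then show "\<exists>d'::int. d' > 0 \<and> N k j - N k i = of_int d'" by (rule order_presD(2)[OF 2 ki j])
qed

lemma order_pres_sym:
  assumes 1: "order_pres n L M" and nc: "noncrit n L" shows "order_pres n M L"
proof (rule order_presI)
  fix k i assume ki: "k \<in> {1..n}" "i \<in> {1..k}"
  obtain e :: int where e: "M k i = L k i + of_int e"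
    using order_presD(1)[OF 1 ki] by blast
  then show "\<exists>d::int. L k i = M k i + of_int d" by (intro exI[of _ "- e"]) simp
  fix j and d :: int assume j: "j \<in> {1..k}" and d: "d > 0" "M k j - M k i = of_int d"
  obtain e' :: int where e': "M k j = L k j + of_int e'"
    using order_presD(1)[OF 1 ki(1) j] by blast
  define c where "c = d + e - e'"
  have c: "L k j - L k i = of_int c" using d e e' by (simp add: c_def algebra_simps)
  have "c \<noteq> 0"
  proof
    assume "c = 0"
    then have "L k j = L k i" using c by simp
    moreover have "inj_on (L k) {1..k}" using nc ki unfolding noncrit_def by blast
    ultimately have "j = i" using j ki by (auto dest: inj_onD)
    then show False using d by simp
  qed
  moreover have "\<not> c < 0"
  proof
    assume "c < 0"
    then have "- c > 0" "L k i - L k j = of_int (- c)" using c by (simp_all add: algebra_simps)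
    from order_presD(2)[OF 1 ki(1) j ki(2) this] obtain d' :: int where d': "d' > 0" "M k i - M k j = of_int d'" by blast
    have "of_int (d + d') = (0::complex)" using d(2) d'(2) by (simp flip: d(2) d'(2))
    then have "d + d' = 0" by (simp only: of_int_eq_0_iff)
    then show False using d(1) d'(1) by simp
  qed
  ultimately show "\<exists>d'::int. d' > 0 \<and> L k j - L k i = of_int d'" using c by (intro exI[of _ c]) simp
qed

text \<open>A single move changes an integer difference by at most one; a positive difference could stop being positive only by
becoming zero, that is if the new tableau were critical.\<close>

lemma order_pres_shift:
  assumes nc: "noncrit n (shift a L)" shows "order_pres n L (shift a L)"
proof -
  obtain b q r where a: "a = (b, q, r)" by (cases a)
  define \<epsilon> :: "nat \<Rightarrow> nat \<Rightarrow> int" where "\<epsilon> k i = (if k = q \<and> i = r then if b then 1 else - 1 else 0)" for k i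
  have M: "shift a L k i = L k i + of_int (\<epsilon> k i)" for k i by (simp add: a \<epsilon>_def)
  show ?thesis
  proof (rule order_presI)
    show "\<exists>d::int. shift a L k i = L k i + of_int d" for k i using M by blast
    fix k i j and d :: int
    assume ki: "k \<in> {1..n}" "i \<in> {1..k}" "j \<in> {1..k}" and d: "d > 0" "L k j - L k i = of_int d"
    then have ji: "j \<noteq> i" by auto
    define c where "c = d + \<epsilon> k j - \<epsilon> k i"
    have c: "shift a L k j - shift a L k i = of_int c" using d(2) by (simp add: M c_def algebra_simps)
    have "c \<ge> 0" using d(1) ji by (auto simp: c_def \<epsilon>_def)
    moreover have "c \<noteq> 0"
    proof
      assume "c = 0"
      then have "shift a L k j = shift a L k i" using c by simp
      moreover have "inj_on (shift a L k) {1..k}" using nc ki unfolding noncrit_def by blast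
      ultimately show False using ji ki by (auto dest: inj_onD)
    qed
    ultimately show "\<exists>d'::int. d' > 0 \<and> shift a L k j - shift a L k i = of_int d'"
      using c by (intro exI[of _ c]) simp
  qed
qed

lemma finite_maximum:
  assumes "finite B" "B \<noteq> {}"
  shows "\<exists>b\<in>B. \<forall>a\<in>B. (g a :: real) \<le> g b"
proof -
  have "Max (g ` B) \<in> g ` B" by (rule Max_in) (use assms in auto)
  then obtain b where b: "b \<in> B" "Max (g ` B) = g b" by auto
  have "g a \<le> g b" if "a \<in> B" for a
    unfolding b(2)[symmetric] by (rule Max_ge) (use assms that in auto)
  then show ?thesis using b(1) by blast
qed

text \<open>If some entry moved up, choose one with maximal real part among these. Its new value is an old entry, which is
larger and hence moved up too, contradicting maximality. Downward moves are excluded symmetrically.\<close>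

lemma order_pres_same_rows:
  assumes p: "order_pres n L M" and sm: "same_rows n M L" and k: "k \<in> {1..n}" and i: "i \<in> {1..k}"
  shows "M k i = L k i"
proof -
  have root: "\<exists>j\<in>{1..k}. M k i = L k j" if "i \<in> {1..k}" for i
  proof -
    have "poly (rowpoly k (M k)) (M k i) = 0"
      unfolding poly_rowpoly by (rule prod_zero) (use that in auto)
    then have "poly (rowpoly k (L k)) (M k i) = 0" using sm k unfolding same_rows_def by simp
    then show ?thesis unfolding poly_rowpoly by (auto simp: prod_zero_iff)
  qed
  have no_up: "\<not> (\<exists>d::int. d > 0 \<and> M k i = L k i + of_int d)" if "i \<in> {1..k}" for i
  proof
    assume ex: "\<exists>d::int. d > 0 \<and> M k i = L k i + of_int d"
    define B where "B = {i \<in> {1..k}. \<exists>d::int. d > 0 \<and> M k i = L k i + of_int d}"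
    have B: "finite B" unfolding B_def by simp
    have "i \<in> B" unfolding B_def using that ex by simp
    then have "B \<noteq> {}" by blast
    obtain b where b: "b \<in> B" "\<And>a. a \<in> B \<Longrightarrow> Re (L k a) \<le> Re (L k b)"
      using finite_maximum[OF B \<open>B \<noteq> {}\<close>, of "\<lambda>a. Re (L k a)"] by blast
    obtain d :: int where d: "d > 0" "M k b = L k b + of_int d" and bk: "b \<in> {1..k}" using b(1) by (auto simp: B_def)
    obtain j where j: "j \<in> {1..k}" "M k b = L k j" using root[OF bk] by blast
    have L: "L k j = L k b + of_int d" using d(2) unfolding j(2) .
    then have "L k j - L k b = of_int d" by simp
    from order_presD(2)[OF p k bk j(1) d(1) this] obtain d' :: int where d': "d' > 0" "M k j - M k b = of_int d'" by blast
    have "M k j = L k j + of_int d'" using d'(2) unfolding j(2) by (simp add: diff_eq_eq add.commute)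
    then have "j \<in> B" unfolding B_def using j(1) d'(1) by blast
    then have "Re (L k j) \<le> Re (L k b)" by (rule b(2))
    moreover have "Re (L k j) = Re (L k b) + of_int d" by (simp add: L)
    ultimately show False using d(1) by simp
  qed
  have no_down: "\<not> (\<exists>d::int. d > 0 \<and> M k i = L k i - of_int d)" if "i \<in> {1..k}" for i
  proof
    assume ex: "\<exists>d::int. d > 0 \<and> M k i = L k i - of_int d"
    define B where "B = {i \<in> {1..k}. \<exists>d::int. d > 0 \<and> M k i = L k i - of_int d}"
    have B: "finite B" unfolding B_def by simp
    have "i \<in> B" unfolding B_def using that ex by simp
    then have "B \<noteq> {}" by blast
    obtain b where b: "b \<in> B" "\<And>a. a \<in> B \<Longrightarrow> Re (L k b) \<le> Re (L k a)"
      using finite_maximum[OF B \<open>B \<noteq> {}\<close>, of "\<lambda>a. - Re (L k a)"] by auto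
    obtain d :: int where d: "d > 0" "M k b = L k b - of_int d" and bk: "b \<in> {1..k}" using b(1) by (auto simp: B_def)
    obtain j where j: "j \<in> {1..k}" "M k b = L k j" using root[OF bk] by blast
    have L: "L k j = L k b - of_int d" using d(2) unfolding j(2) .
    then have "L k b - L k j = of_int d" by simp
    from order_presD(2)[OF p k j(1) bk d(1) this] obtain d' :: int where d': "d' > 0" "M k b - M k j = of_int d'" by blast
    have "M k j = L k j - of_int d'" using d'(2) unfolding j(2) by (simp add: diff_eq_eq eq_diff_eq add.commute)
    then have "j \<in> B" unfolding B_def using j(1) d'(1) by blast
    then have "Re (L k b) \<le> Re (L k j)" by (rule b(2))
    moreover have "Re (L k j) = Re (L k b) - of_int d" by (simp add: L)
    ultimately show False using d(1) by simp
  qed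
  obtain d :: int where d: "M k i = L k i + of_int d" using order_presD(1)[OF p k i] by blast
  have "\<not> d > 0" using no_up[OF i] d by blast
  moreover have "\<not> d < 0"
  proof
    assume "d < 0"
    then have "- d > 0 \<and> M k i = L k i - of_int (- d)" using d by simp
    then show False using no_down[OF i] by blast
  qed
  ultimately show ?thesis using d by simp
qed

context gl_rep
begin

text \<open>Joint eigenvectors for other characters do not contribute: apply \<open>C k u\<close> minus its scalar on one of
them, for k and u at which the characters differ.\<close>

lemma separated_zero:
  assumes "finite R" "x \<in> wt L" "x = (\<Sum>r\<in>R. y r)"
    "\<And>r. r \<in> R \<Longrightarrow> y r \<in> wt (M r)" "\<And>r. r \<in> R \<Longrightarrow> y r \<noteq> 0 \<Longrightarrow> \<not> same_rows n (M r) L"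
  shows "x = 0"
  using assms
proof (induction R arbitrary: x y rule: finite_induct)
  case (insert r R)
  show ?case
  proof (cases "y r = 0")
    case True
    show ?thesis
    proof (rule insert.IH)
      show "x = (\<Sum>r\<in>R. y r)" using insert.prems(2) insert.hyps True by simp
    qed (use insert.prems in auto)
  next
    case False
    then obtain k u where k: "k \<in> {1..n}" and ne: "poly (rowpoly k (M r k)) u \<noteq> poly (rowpoly k (L k)) u"
      using insert.prems(4)[of r] by (auto simp: same_rows_def)
    have k': "k \<le> n" using k by simp
    define T where "T w = C k u \<rhd> w - s (poly (rowpoly k (M r k)) u) w" for w
    have Tw: "T w = s (poly (rowpoly k (N k)) u - poly (rowpoly k (M r k)) u) w" if "w \<in> wt N" for w N
      by (simp add: T_def wt_C[OF that k'] scale_left_diff_distrib)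
    have "T x = 0"
    proof (rule insert.IH)
      show "T x \<in> wt L"
        unfolding Tw[OF insert.prems(1)] by (rule subspace_scale[OF wt_subspace insert.prems(1)])
      have "T (\<Sum>q\<in>insert r R. y q) = (\<Sum>q\<in>insert r R. T (y q))"
        by (simp only: T_def act_sum scale_sum_right sum_subtractf)
      also have "\<dots> = T (y r) + (\<Sum>q\<in>R. T (y q))"
        using insert.hyps by simp
      also have "T (y r) = 0"
        using Tw[OF insert.prems(3)[OF insertI1]] by simp
      finally show "T x = (\<Sum>q\<in>R. T (y q))" unfolding insert.prems(2) by simp
      fix q assume q: "q \<in> R"
      have "y q \<in> wt (M q)" by (rule insert.prems(3)) (use q in simp)
      note Tq = Tw[OF this]
      show "T (y q) \<in> wt (M q)"
        unfolding Tq by (rule subspace_scale[OF wt_subspace insert.prems(3)]) (use q in simp)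
      assume "T (y q) \<noteq> 0"
      then have "y q \<noteq> 0" unfolding Tq by auto
      then show "\<not> same_rows n (M q) L" by (intro insert.prems(4)) (use q in simp)
    qed
    then show ?thesis using ne unfolding Tw[OF insert.prems(1)] by simp
  qed
qed simp

definition others :: "(nat \<Rightarrow> nat \<Rightarrow> complex) \<Rightarrow> 'm set"
  where "others L = {x. \<exists>M. x \<in> wt M \<and> \<not> same_rows n M L}"

lemma others_span_zero:
  assumes x: "x \<in> wt L" "x \<in> span (others L)"
  shows "x = 0"
proof -
  from x(2) obtain T r where T: "finite T" "T \<subseteq> others L" "x = (\<Sum>a\<in>T. s (r a) a)"
    unfolding span_explicit by blast
  have "\<forall>a. \<exists>M. a \<in> T \<longrightarrow> a \<in> wt M \<and> \<not> same_rows n M L"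
    using T(2) unfolding others_def by blast
  from choice[OF this] obtain M where M: "\<forall>a. a \<in> T \<longrightarrow> a \<in> wt (M a) \<and> \<not> same_rows n (M a) L"
    by (rule exE)
  show ?thesis
  proof (rule separated_zero[OF T(1) x(1) T(3)])
    fix a assume "a \<in> T"
    with M have a: "a \<in> wt (M a)" "\<not> same_rows n (M a) L" by simp_all
    show "s (r a) a \<in> wt (M a)" by (rule subspace_scale[OF wt_subspace a(1)])
    show "\<not> same_rows n (M a) L" by (rule a(2))
  qed
qed

text \<open>The normalization for which the steps \<open>E k (Suc k)\<close> and \<open>E (Suc k) k\<close> are the sums of the
moves in row k (see \<open>move_sum\<close>).\<close>

definition lcoef :: "bool \<Rightarrow> nat \<Rightarrow> (nat \<Rightarrow> complex) \<Rightarrow> nat \<Rightarrow> complex"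
  where "lcoef b k l i = (if b then - 1 else 1) / (\<Prod>r\<in>{1..k} - {i}. l i - l r)"

fun move :: "letter \<Rightarrow> (nat \<Rightarrow> nat \<Rightarrow> complex) \<Rightarrow> 'm \<Rightarrow> 'm" where
  "move (b, k, i) L v = s (lcoef b k (L k) i)
     (C k (L k i) \<rhd> (if b then E k (Suc k) else E (Suc k) k) \<rhd> v)"

lemma move_0 [simp]: "move a L 0 = 0"
  by (cases a) simp

lemma move_scale: "move a L (s c v) = s c (move a L v)"
  by (cases a) (simp add: act_scale mult.commute)

lemma move_wt: "legal n a \<Longrightarrow> v \<in> wt L \<Longrightarrow> move a L v \<in> wt (shift a L)"
proof -
  assume legal: "legal n a" and v: "v \<in> wt L"
  obtain b k i where a: "a = (b, k, i)" by (cases a)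
  have ki: "Suc k \<le> n" "i \<in> {1..k}" using legal a by auto
  show ?thesis
    using wt_raise[OF ki v] wt_lower[OF ki v]
    by (cases b) (auto simp: a intro: subspace_scale[OF wt_subspace])
qed

end

locale noncritical_rep = gl_rep E sc n s act
  for E :: "nat \<Rightarrow> nat \<Rightarrow> 'a::ring_1" and sc n and s :: "complex \<Rightarrow> 'm::ab_group_add \<Rightarrow> 'm"
    and act :: "'a \<Rightarrow> 'm \<Rightarrow> 'm" (infixr "\<rhd>" 75) +
  assumes wt_noncrit: "v \<in> wt L \<Longrightarrow> v \<noteq> 0 \<Longrightarrow> noncrit n L"
begin

lemma move_sum:
  assumes k: "Suc k \<le> n" "1 \<le> k" and v: "v \<in> wt L"
  shows "E k (Suc k) \<rhd> v = (\<Sum>i=1..k. move (True, k, i) L v)"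
    and "E (Suc k) k \<rhd> v = (\<Sum>i=1..k. move (False, k, i) L v)"
proof -
  have "E k (Suc k) \<rhd> v = (\<Sum>i=1..k. move (True, k, i) L v) \<and> E (Suc k) k \<rhd> v = (\<Sum>i=1..k. move (False, k, i) L v)"
  proof (cases "v = 0")
    case False
    have k': "k \<le> n" "k \<in> {1..k}" "k \<in> {1..n}" using k by auto
    have inj: "inj_on (L k) {1..k}"
      using wt_noncrit[OF v False] k'(3) unfolding noncrit_def by blast
    have "s (- 1) (E k (Suc k) \<rhd> v) = (\<Sum>i=1..k. s (1 / (\<Prod>r\<in>{1..k} - {i}. L k i - L k r)) (C k (L k i) \<rhd> E k (Suc k) \<rhd> v))"
      by (rule pair_sum[OF k'(1) inj pair_e[OF k(1) k'(2) wt_row[OF v k'(1)]]])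
    from this[THEN arg_cong[where f = "s (- 1)"]]
    have 1: "E k (Suc k) \<rhd> v = (\<Sum>i=1..k. move (True, k, i) L v)"
      by (simp add: scale_sum_right lcoef_def)
    have "s 1 (E (Suc k) k \<rhd> v) = (\<Sum>i=1..k. s (1 / (\<Prod>r\<in>{1..k} - {i}. L k i - L k r)) (C k (L k i) \<rhd> E (Suc k) k \<rhd> v))"
      by (rule pair_sum[OF k'(1) inj pair_f[OF k(1) k'(2) wt_row[OF v k'(1)]]])
    then show ?thesis using 1 by (simp add: lcoef_def)
  qed simp
  then show "E k (Suc k) \<rhd> v = (\<Sum>i=1..k. move (True, k, i) L v)"
    and "E (Suc k) k \<rhd> v = (\<Sum>i=1..k. move (False, k, i) L v)"
    by simp_all
qed

lemma move_opposite:
  assumes okb: "legal n (b, q)" and v: "v \<in> wt L"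
  shows "\<exists>c. move (\<not> b, q) (shift (b, q) L) (move (b, q) L v) = s c v"
proof -
  obtain k i where q: "q = (k, i)" by (cases q)
  have k: "Suc k \<le> n" and i: "i \<in> {1..k}" using okb q by auto
  show ?thesis
  proof (cases "move (b, q) L v = 0")
    case True
    then show ?thesis by (intro exI[of _ 0]) simp
  next
    case False
    have "noncrit n (shift (b, q) L)" by (rule wt_noncrit[OF move_wt[OF okb v] False])
    then have "inj_on (shift (b, q) L k) {1..k}" unfolding noncrit_def using k i by auto
    then have inj: "inj_on ((L k)(i := L k i + (if b then 1 else - 1))) {1..k}" by (simp add: q)
    show ?thesis
    proof (cases b)
      case True
      then obtain c where "C k (L k i + 1) \<rhd> E (Suc k) k \<rhd> C k (L k i) \<rhd> E k (Suc k) \<rhd> v = s c v"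
        using lower_raise[OF k i v] inj by auto
      then show ?thesis using True by (auto simp: q act_scale)
    next
      case b: False
      then obtain c where "C k (L k i - 1) \<rhd> E k (Suc k) \<rhd> C k (L k i) \<rhd> E (Suc k) k \<rhd> v = s c v"
        using raise_lower[OF k i v] inj by auto
      then show ?thesis using b by (auto simp: q act_scale)
    qed
  qed
qed

text \<open>In different rows the operators commute. In the same row write the commutator of the raising and the lowering step,
which acts by a scalar on v, as the sum of the commutators T of single moves. Each summand is a joint eigenvector, and
order preservation shows that the summand for the pair of places (i, j) is the only one of its character; as the
scalar multiple of v has a different character as well, this summand vanishes.\<close>

lemma move_commute:
  assumes okq: "legal n (True, q)" and okr: "legal n (False, r)" and ne: "q \<noteq> r" and v: "v \<in> wt L"
  shows "move (True, q) (shift (False, r) L) (move (False, r) L v) = move (False, r) (shift (True, q) L) (move (True, q) L v)"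
proof -
  obtain k i l j where q: "q = (k, i)" and r: "r = (l, j)" by (cases q, cases r)
  have k: "Suc k \<le> n" "i \<in> {1..k}" "1 \<le> k" "k \<le> n" and l: "Suc l \<le> n" "j \<in> {1..l}" "1 \<le> l" "l \<le> n"
    using okq okr q r by auto
  show ?thesis
  proof (cases "k = l")
    case False
    have 1: "C k u \<rhd> E (Suc l) l \<rhd> w = E (Suc l) l \<rhd> C k u \<rhd> w" for u w
      by (rule act_comm[OF br_C_step(2)]) (use k l False in auto)
    have 2: "C l u \<rhd> E k (Suc k) \<rhd> w = E k (Suc k) \<rhd> C l u \<rhd> w" for u w
      by (rule act_comm[OF br_C_step(1)]) (use k l False in auto)
    have 3: "C k u \<rhd> C l u' \<rhd> w = C l u' \<rhd> C k u \<rhd> w" for u u' w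
      by (rule act_comm[OF br_C_C]) (use k l in auto)
    have "br (E k (Suc k)) (E (Suc l) l) = 0" using k l False by (simp add: E_br)
    then have 4: "E k (Suc k) \<rhd> E (Suc l) l \<rhd> w = E (Suc l) l \<rhd> E k (Suc k) \<rhd> w" for w
      by (rule act_comm)
    have "C k u \<rhd> E k (Suc k) \<rhd> C l u' \<rhd> E (Suc l) l \<rhd> v = C l u' \<rhd> E (Suc l) l \<rhd> C k u \<rhd> E k (Suc k) \<rhd> v" for u u'
      unfolding 2[symmetric] 4 3 by (simp only: 1)
    then show ?thesis using False by (simp add: q r act_scale mult.commute)
  next
    case kl: True
    note l = l[folded kl]
    define T where "T x y = move (True, k, x) (shift (False, k, y) L) (move (False, k, y) L v)
        - move (False, k, y) (shift (True, k, x) L) (move (True, k, x) L v)" for x y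
    define M where "M x y = shift (True, k, x) (shift (False, k, y) L)" for x y
    have M': "M x y = shift (False, k, y) (shift (True, k, x) L)" for x y
      unfolding M_def by (auto simp: fun_eq_iff)
    have Mv: "M x y k m = L k m + (if m = x then 1 else 0) - (if m = y then 1 else 0)" for x y m
      by (simp add: M_def)
    have ij: "i \<noteq> j" using ne q r kl by simp
    have okx: "legal n (b, k, x)" if "x \<in> {1..k}" for b x using k that by simp
    have Twt: "T x y \<in> wt (M x y)" if "x \<in> {1..k}" "y \<in> {1..k}" for x y
      unfolding T_def
    proof (rule subspace_diff[OF wt_subspace])
      show "move (True, k, x) (shift (False, k, y) L) (move (False, k, y) L v) \<in> wt (M x y)"
        unfolding M_def by (intro move_wt okx that v)
      show "move (False, k, y) (shift (True, k, x) L) (move (True, k, x) L v) \<in> wt (M x y)"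
        unfolding M' by (intro move_wt okx that v)
    qed
    have path: "order_pres n L (shift a' (shift a L))" if "legal n a" "legal n a'" "move a' (shift a L) (move a L v) \<noteq> 0" for a a'
    proof -
      have "move a L v \<noteq> 0" using that(3) by auto
      then have "order_pres n L (shift a L)"
        by (intro order_pres_shift wt_noncrit[OF move_wt[OF that(1) v]])
      moreover have "order_pres n (shift a L) (shift a' (shift a L))"
        by (intro order_pres_shift wt_noncrit[OF move_wt[OF that(2) move_wt[OF that(1) v]]] that(3))
      ultimately show ?thesis by (rule order_pres_trans)
    qed
    have Tpres: "order_pres n L (M x y)" if "x \<in> {1..k}" "y \<in> {1..k}" "T x y \<noteq> 0" for x y
    proof -
      from that(3) have "move (True, k, x) (shift (False, k, y) L) (move (False, k, y) L v) \<noteq> 0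
          \<or> move (False, k, y) (shift (True, k, x) L) (move (True, k, x) L v) \<noteq> 0"
        unfolding T_def by auto
      then show ?thesis
        using path[OF okx[OF that(2)] okx[OF that(1)]] path[OF okx[OF that(1)] okx[OF that(2)]]
        unfolding M'[of x y] by (metis M_def M')
    qed
    have "T i j = 0"
    proof (rule ccontr)
      assume nz: "T i j \<noteq> 0"
      then have "v \<noteq> 0" unfolding T_def by auto
      then have ncL: "noncrit n L" by (rule wt_noncrit[OF v])
      have bck: "order_pres n (M i j) L" by (rule order_pres_sym[OF Tpres[OF k(2) l(2) nz] ncL])
      obtain h where h: "E k k \<rhd> v - E (Suc k) (Suc k) \<rhd> v = s h v"
      proof -
        obtain c c' where "E k k \<rhd> v = s c v" "E (Suc k) (Suc k) \<rhd> v = s c' v"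
          using wt_diag[OF v, of k] wt_diag[OF v, of "Suc k"] k by auto
        then show ?thesis using that[of "c - c'"] by (simp add: scale_left_diff_distrib)
      qed
      have ef: "E k (Suc k) \<rhd> E (Suc k) k \<rhd> v - E (Suc k) k \<rhd> E k (Suc k) \<rhd> v = s h v"
      proof -
        have "br (E k (Suc k)) (E (Suc k) k) = E k k - E (Suc k) (Suc k)" using k by (simp add: E_br)
        from this[THEN arg_cong[where f = "\<lambda>w. w \<rhd> v"]] show ?thesis
          by (simp add: br_def act_diff_left act_mult h)
      qed
      have "E k (Suc k) \<rhd> E (Suc k) k \<rhd> v = (\<Sum>y=1..k. E k (Suc k) \<rhd> move (False, k, y) L v)"
        unfolding move_sum(2)[OF k(1,3) v] act_sum ..
      also have "\<dots> = (\<Sum>y=1..k. \<Sum>x=1..k. move (True, k, x) (shift (False, k, y) L) (move (False, k, y) L v))"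
        by (intro sum.cong refl move_sum(1)[OF k(1,3)] move_wt okx v)
      finally have a: "E k (Suc k) \<rhd> E (Suc k) k \<rhd> v = (\<Sum>x=1..k. \<Sum>y=1..k. move (True, k, x) (shift (False, k, y) L) (move (False, k, y) L v))"
        by (subst sum.swap)
      have "E (Suc k) k \<rhd> E k (Suc k) \<rhd> v = (\<Sum>x=1..k. E (Suc k) k \<rhd> move (True, k, x) L v)"
        unfolding move_sum(1)[OF k(1,3) v] act_sum ..
      also have "\<dots> = (\<Sum>x=1..k. \<Sum>y=1..k. move (False, k, y) (shift (True, k, x) L) (move (True, k, x) L v))"
        by (intro sum.cong refl move_sum(2)[OF k(1,3)] move_wt okx v)
      finally have "(\<Sum>x=1..k. \<Sum>y=1..k. T x y) = s h v"
        using ef a unfolding T_def sum_subtractf by simp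
      then have S: "(\<Sum>p\<in>{1..k} \<times> {1..k}. T (fst p) (snd p)) = s h v"
        by (simp add: sum.cartesian_product split_def)
      define R where "R = {1..k} \<times> {1..k} - {(i, j)}"
      define y where "y p = (if p = (0, 0) then s h v else - T (fst p) (snd p))" for p
      define N where "N p = (if p = (0, 0) then L else M (fst p) (snd p))" for p
      have R0: "(0, 0) \<notin> R" "finite R" unfolding R_def by auto
      have "(\<Sum>p\<in>R. y p) = - (\<Sum>p\<in>R. T (fst p) (snd p))"
        unfolding sum_negf[symmetric] by (rule sum.cong[OF refl]) (use R0 in \<open>auto simp: y_def\<close>)
      moreover have "(\<Sum>p\<in>{1..k} \<times> {1..k}. T (fst p) (snd p)) = T i j + (\<Sum>p\<in>R. T (fst p) (snd p))"
        unfolding R_def by (subst sum.remove[of _ "(i, j)"]) (use k l in auto)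
      ultimately have eq: "T i j = (\<Sum>p\<in>insert (0, 0) R. y p)"
        using R0 S by (simp add: y_def eq_diff_eq)
      have "T i j = 0"
      proof (rule separated_zero[OF _ Twt[OF k(2) l(2)] eq])
        fix p assume p: "p \<in> insert (0, 0) R"
        show "y p \<in> wt (N p)"
        proof (cases "p = (0, 0)")
          case True
          then show ?thesis by (simp add: y_def N_def subspace_scale[OF wt_subspace v])
        next
          case False
          then have "fst p \<in> {1..k}" "snd p \<in> {1..k}" using p by (auto simp: R_def)
          from Twt[OF this] show ?thesis
            using False by (simp add: y_def N_def subspace_neg[OF wt_subspace])
        qed
        assume yp: "y p \<noteq> 0"
        show "\<not> same_rows n (N p) (M i j)"
        proof
          assume sm: "same_rows n (N p) (M i j)"
          have kk: "k \<in> {1..n}" using k by auto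
          show False
          proof (cases "p = (0, 0)")
            case True
            have "L k i = M i j k i"
              by (rule order_pres_same_rows[OF bck _ kk k(2)]) (use sm True in \<open>simp add: N_def\<close>)
            then show False using ij by (simp add: Mv)
          next
            case False
            then have "p \<in> {1..k} \<times> {1..k}" "p \<noteq> (i, j)" using p by (simp_all add: R_def)
            then obtain x y where xy: "p = (x, y)" "x \<in> {1..k}" "y \<in> {1..k}" "(x, y) \<noteq> (i, j)"
              by (cases p) simp
            have "T x y \<noteq> 0" using yp unfolding y_def if_not_P[OF False] by (simp add: xy(1))
            from order_pres_trans[OF bck Tpres[OF xy(2,3) this]] have pre: "order_pres n (M i j) (M x y)" .
            have sm': "same_rows n (M x y) (M i j)" using sm unfolding N_def if_not_P[OF False] by (simp add: xy(1))
            have "M x y k i = M i j k i" "M x y k j = M i j k j"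
              using order_pres_same_rows[OF pre sm' kk k(2)] order_pres_same_rows[OF pre sm' kk l(2)] by simp_all
            then show False using xy(4) ij by (auto simp: Mv split: if_splits)
          qed
        qed
      qed (use R0 in simp)
      then show False using nz by simp
    qed
    then show ?thesis unfolding T_def q r kl[symmetric] by simp
  qed
qed

end

section \<open>Words of moves\<close>

primrec tableau_after :: "letter list \<Rightarrow> (nat \<Rightarrow> nat \<Rightarrow> complex) \<Rightarrow> nat \<Rightarrow> nat \<Rightarrow> complex" where
  "tableau_after [] L = L"
| "tableau_after (a # as) L = tableau_after as (shift a L)"

definition net :: "letter list \<Rightarrow> nat \<times> nat \<Rightarrow> int"
  where "net as q = int (count_list as (True, q)) - int (count_list as (False, q))"

lemma net_simps [simp]:
  "net [] q = 0" "net (as @ bs) q = net as q + net bs q"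
  "net ((b, r) # as) q = (if r = q then if b then 1 else - 1 else 0) + net as q"
  by (auto simp: net_def)

lemma tableau_after_net: "tableau_after as L k i = L k i + of_int (net as (k, i))"
proof (induction as arbitrary: L)
  case (Cons a as)
  obtain b q r where a: "a = (b, q, r)" by (cases a)
  show ?case unfolding tableau_after.simps Cons by (simp add: a)
qed simp

lemma tableau_after_cong: "net as = net bs \<Longrightarrow> tableau_after as L = tableau_after bs L"
  by (simp add: fun_eq_iff tableau_after_net)

lemma shift_opp [simp]: "shift (\<not> b, q) (shift (b, q) L) = L"
  by (cases q) (auto simp: fun_eq_iff)

context gl_rep
begin

primrec moves :: "letter list \<Rightarrow> (nat \<Rightarrow> nat \<Rightarrow> complex) \<Rightarrow> 'm \<Rightarrow> 'm" where
  "moves [] L v = v"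
| "moves (a # as) L v = moves as (shift a L) (move a L v)"

lemma moves_append: "moves (as @ bs) L v = moves bs (tableau_after as L) (moves as L v)"
  by (induction as arbitrary: L v) simp_all

lemma moves_scale: "moves as L (s c v) = s c (moves as L v)"
  by (induction as arbitrary: L v) (simp_all add: move_scale)

lemma moves_0 [simp]: "moves as L 0 = 0"
  by (induction as arbitrary: L) simp_all

lemma moves_wt: "\<forall>a\<in>set as. legal n a \<Longrightarrow> v \<in> wt L \<Longrightarrow> moves as L v \<in> wt (tableau_after as L)"
  by (induction as arbitrary: L v) (simp_all add: move_wt)

end

definition plus :: "nat \<Rightarrow> letter list \<Rightarrow> bool"
  where "plus n as \<longleftrightarrow> (\<forall>a\<in>set as. fst a \<and> legal n a)"

definition minus :: "nat \<Rightarrow> letter list \<Rightarrow> bool"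
  where "minus n as \<longleftrightarrow> (\<forall>a\<in>set as. \<not> fst a \<and> legal n a)"

lemma plus_Cons: "plus n (a # as) \<longleftrightarrow> (\<exists>q. a = (True, q)) \<and> legal n a \<and> plus n as"
  by (cases a) (auto simp: plus_def)

lemma minus_Cons: "minus n (a # as) \<longleftrightarrow> (\<exists>q. a = (False, q)) \<and> legal n a \<and> minus n as"
  by (cases a) (auto simp: minus_def)

lemma plus_minus_Nil [simp]: "plus n []" "minus n []"
  by (simp_all add: plus_def minus_def)

lemma plus_minus_append: "plus n (as @ bs) \<longleftrightarrow> plus n as \<and> plus n bs" "minus n (as @ bs) \<longleftrightarrow> minus n as \<and> minus n bs"
  by (auto simp: plus_def minus_def)

lemma plus_net_nonneg: "plus n as \<Longrightarrow> net as q \<ge> 0"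
  by (induction as) (auto simp: plus_Cons)

lemma minus_net_nonpos: "minus n as \<Longrightarrow> net as q \<le> 0"
  by (induction as) (auto simp: minus_Cons)

lemma plus_net_pos: "plus n as \<Longrightarrow> net as q > 0 \<Longrightarrow> (True, q) \<in> set as"
  by (induction as) (auto simp: plus_Cons split: if_splits)

section \<open>Sorting and cancelling moves\<close>

context noncritical_rep
begin

lemma moves_pres:
  "\<forall>a\<in>set as. legal n a \<Longrightarrow> v \<in> wt L \<Longrightarrow> moves as L v \<noteq> 0 \<Longrightarrow> order_pres n L (tableau_after as L)"
proof (induction as arbitrary: L v)
  case Nil
  then show ?case by (simp add: order_pres_refl)
next
  case (Cons a as)
  have w: "move a L v \<in> wt (shift a L)" using Cons.prems by (intro move_wt) simp_all
  have nz: "move a L v \<noteq> 0" using Cons.prems(3) by auto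
  have "order_pres n L (shift a L)" by (rule order_pres_shift[OF wt_noncrit[OF w nz]])
  moreover have "order_pres n (shift a L) (tableau_after as (shift a L))"
    by (rule Cons.IH[OF _ w]) (use Cons.prems in simp_all)
  ultimately show ?case by (simp add: order_pres_trans)
qed

text \<open>A lowering that is applied first can be postponed past all raisings, unless it meets its inverse, and then the two cancel.\<close>

lemma push_right:
  "plus n ps \<Longrightarrow> legal n (False, q) \<Longrightarrow> v \<in> wt L \<Longrightarrow>
    \<exists>c ps' ms. moves ((False, q) # ps) L v = s c (moves (ps' @ ms) L v) \<and> plus n ps' \<and> minus n ms
      \<and> net (ps' @ ms) = net ((False, q) # ps)"
proof (induction ps arbitrary: L v)
  case Nil
  then show ?case
    by (intro exI[of _ 1] exI[of _ "[]"] exI[of _ "[(False, q)]"]) (simp add: minus_Cons)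
next
  case (Cons p ps)
  obtain r where p: "p = (True, r)" and okp: "legal n (True, r)" and ps: "plus n ps"
    using Cons.prems(1) by (auto simp: plus_Cons)
  show ?case
  proof (cases "r = q")
    case True
    obtain c where "move (True, q) (shift (False, q) L) (move (False, q) L v) = s c v"
      using move_opposite[OF Cons.prems(2,3)] by auto
    moreover have "shift (True, q) (shift (False, q) L) = L" using shift_opp[of False q L] by simp
    ultimately have "moves ((False, q) # p # ps) L v = s c (moves (ps @ []) L v)"
      by (simp add: p True moves_scale del: shift.simps move.simps)
    then show ?thesis
      by (intro exI[of _ c] exI[of _ ps] exI[of _ "[]"]) (simp add: ps p True fun_eq_iff)
  next
    case False
    have w: "move (True, r) L v \<in> wt (shift (True, r) L)" by (rule move_wt[OF okp Cons.prems(3)])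
    have sh: "shift (True, r) (shift (False, q) L) = shift (False, q) (shift (True, r) L)"
      by (cases q, cases r) (auto simp: fun_eq_iff)
    from Cons.IH[OF ps Cons.prems(2) w] obtain c ps' ms where IH:
      "moves ((False, q) # ps) (shift (True, r) L) (move (True, r) L v) = s c (moves (ps' @ ms) (shift (True, r) L) (move (True, r) L v))"
      "plus n ps'" "minus n ms" "net (ps' @ ms) = net ((False, q) # ps)" by blast
    have "moves ((False, q) # p # ps) L v = moves ((False, q) # ps) (shift (True, r) L) (move (True, r) L v)"
      unfolding moves.simps p move_commute[OF okp Cons.prems(2) False Cons.prems(3)] sh ..
    also have "\<dots> = s c (moves ((p # ps') @ ms) L v)"
      unfolding IH(1) p by simp
    finally show ?thesis
    proof (intro exI conjI)
      show "plus n (p # ps')" using IH(2) okp p by (simp add: plus_Cons del: legal.simps)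
      show "minus n ms" by (rule IH(3))
      show "net ((p # ps') @ ms) = net ((False, q) # p # ps)"
      proof
        fix x
        from IH(4) have "net (ps' @ ms) x = net ((False, q) # ps) x" by (rule fun_cong)
        then show "net ((p # ps') @ ms) x = net ((False, q) # p # ps) x" by (simp add: p)
      qed
    qed
  qed
qed

lemma sort_word:
  "\<forall>a\<in>set as. legal n a \<Longrightarrow> v \<in> wt L \<Longrightarrow>
    \<exists>c ps ms. moves as L v = s c (moves (ps @ ms) L v) \<and> plus n ps \<and> minus n ms \<and> net (ps @ ms) = net as"
proof (induction as arbitrary: L v)
  case Nil
  then show ?case by (intro exI[of _ 1] exI[of _ "[]"]) simp
next
  case (Cons a as)
  obtain b q where a: "a = (b, q)" by (cases a)
  have legal: "legal n (b, q)" using Cons.prems(1) a by simp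
  have w: "move (b, q) L v \<in> wt (shift (b, q) L)" by (rule move_wt[OF legal Cons.prems(2)])
  have "\<forall>a\<in>set as. legal n a" using Cons.prems(1) by simp
  from Cons.IH[OF this w] obtain c ps ms where IH:
    "moves as (shift (b, q) L) (move (b, q) L v) = s c (moves (ps @ ms) (shift (b, q) L) (move (b, q) L v))"
    "plus n ps" "minus n ms" "net (ps @ ms) = net as" by blast
  have net: "net (ps @ ms) x = net as x" for x by (simp only: IH(4))
  have 1: "moves (a # as) L v = s c (moves ((b, q) # ps @ ms) L v)"
    unfolding a moves.simps IH(1) ..
  show ?case
  proof (cases b)
    case True
    show ?thesis
    proof (intro exI conjI)
      show "moves (a # as) L v = s c (moves (((b, q) # ps) @ ms) L v)" unfolding 1 by simp
      show "plus n ((b, q) # ps)" using IH(2) legal True by (simp add: plus_Cons del: legal.simps)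
      show "minus n ms" by (rule IH(3))
      show "net (((b, q) # ps) @ ms) = net (a # as)" using net by (simp add: a fun_eq_iff)
    qed
  next
    case False
    then have bq: "(b, q) = (False, q)" by simp
    from push_right[OF IH(2) legal[unfolded bq] Cons.prems(2)]
    obtain c' ps' ms' where P: "moves ((b, q) # ps) L v = s c' (moves (ps' @ ms') L v)" "plus n ps'" "minus n ms'"
        "net (ps' @ ms') = net ((b, q) # ps)"
      unfolding bq by blast
    have netP: "net ps' x + net ms' x = (if q = x then - 1 else 0) + net ps x" for x
      using fun_cong[OF P(4), of x] False by simp
    show ?thesis
    proof (intro exI conjI)
      have "moves ((b, q) # ps @ ms) L v = moves (((b, q) # ps) @ ms) L v" by simp
      also have "\<dots> = moves ms (tableau_after (ps' @ ms') L) (s c' (moves (ps' @ ms') L v))"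
        unfolding moves_append[of "(b, q) # ps"] P(1) tableau_after_cong[OF P(4), symmetric] ..
      also have "\<dots> = s c' (moves ((ps' @ ms') @ ms) L v)"
        unfolding moves_append[of "ps' @ ms'"] by (rule moves_scale)
      finally show "moves (a # as) L v = s (c * c') (moves (ps' @ (ms' @ ms)) L v)"
        unfolding 1 by simp
      show "plus n ps'" by (rule P(2))
      show "minus n (ms' @ ms)" using P(3) IH(3) by (simp add: plus_minus_append)
      show "net (ps' @ (ms' @ ms)) = net (a # as)"
      proof
        fix x show "net (ps' @ (ms' @ ms)) x = net (a # as) x"
          using net[of x] netP[of x] False by (cases "q = x"; auto simp: a)
      qed
    qed
  qed
qed

lemma commute_left:
  "plus n ps \<Longrightarrow> legal n (False, q) \<Longrightarrow> (True, q) \<notin> set ps \<Longrightarrow> v \<in> wt L \<Longrightarrow>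
    moves (ps @ [(False, q)]) L v = moves ((False, q) # ps) L v"
proof (induction ps arbitrary: L v)
  case (Cons p ps)
  obtain r where p: "p = (True, r)" and okp: "legal n (True, r)" and ps: "plus n ps"
    using Cons.prems(1) by (auto simp: plus_Cons)
  have ne: "r \<noteq> q" using Cons.prems(3) p by auto
  have w: "move (True, r) L v \<in> wt (shift (True, r) L)" by (rule move_wt[OF okp Cons.prems(4)])
  have sh: "shift (True, r) (shift (False, q) L) = shift (False, q) (shift (True, r) L)"
    by (cases q, cases r) (auto simp: fun_eq_iff)
  have "moves ((p # ps) @ [(False, q)]) L v = moves ((False, q) # ps) (shift (True, r) L) (move (True, r) L v)"
    using Cons.IH[OF ps Cons.prems(2) _ w] Cons.prems(3) by (simp add: p del: shift.simps move.simps)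
  also have "\<dots> = moves ((False, q) # p # ps) L v"
    unfolding moves.simps p move_commute[OF okp Cons.prems(2) ne Cons.prems(4)] sh ..
  finally show ?case .
qed simp

text \<open>The lowering is moved back to the last raising at the same place; everything in between is a raising elsewhere.\<close>

lemma push_left:
  "plus n ps \<Longrightarrow> legal n (False, q) \<Longrightarrow> (True, q) \<in> set ps \<Longrightarrow> v \<in> wt L \<Longrightarrow>
    \<exists>c ps'. moves (ps @ [(False, q)]) L v = s c (moves ps' L v) \<and> plus n ps' \<and> net ps' = net (ps @ [(False, q)])"
proof (induction ps arbitrary: L v)
  case (Cons p ps)
  obtain r where p: "p = (True, r)" and okp: "legal n (True, r)" and ps: "plus n ps"
    using Cons.prems(1) by (auto simp: plus_Cons)
  have w: "move (True, r) L v \<in> wt (shift (True, r) L)" by (rule move_wt[OF okp Cons.prems(4)])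
  show ?case
  proof (cases "(True, q) \<in> set ps")
    case True
    from Cons.IH[OF ps Cons.prems(2) True w] obtain c ps' where IH:
      "moves (ps @ [(False, q)]) (shift (True, r) L) (move (True, r) L v) = s c (moves ps' (shift (True, r) L) (move (True, r) L v))"
      "plus n ps'" "net ps' = net (ps @ [(False, q)])" by blast
    show ?thesis
    proof (intro exI conjI)
      show "moves ((p # ps) @ [(False, q)]) L v = s c (moves (p # ps') L v)"
        using IH(1) by (simp add: p del: shift.simps move.simps)
      show "plus n (p # ps')" using IH(2) okp p by (simp add: plus_Cons del: legal.simps)
      show "net (p # ps') = net ((p # ps) @ [(False, q)])" using IH(3) by (simp add: p fun_eq_iff)
    qed
  next
    case False
    then have r: "r = q" using Cons.prems(3) p by auto
    obtain c where c: "move (False, q) (shift (True, q) L) (move (True, q) L v) = s c v"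
      using move_opposite[of True q v L] okp Cons.prems(4) r by auto
    have sh: "shift (False, q) (shift (True, q) L) = L" using shift_opp[of True q L] by simp
    show ?thesis
    proof (intro exI conjI)
      have "moves ((p # ps) @ [(False, q)]) L v = moves (ps @ [(False, q)]) (shift (True, q) L) (move (True, q) L v)"
        by (simp add: p r)
      also have "\<dots> = moves ((False, q) # ps) (shift (True, q) L) (move (True, q) L v)"
        by (rule commute_left[OF ps Cons.prems(2) False w[unfolded r]])
      also have "\<dots> = s c (moves ps L v)"
        unfolding moves.simps c sh by (rule moves_scale)
      finally show "moves ((p # ps) @ [(False, q)]) L v = s c (moves ps L v)" .
      show "plus n ps" by (rule ps)
      show "net ps = net ((p # ps) @ [(False, q)])" by (simp add: p r fun_eq_iff)
    qed
  qed
qed simp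

text \<open>Zero displacement provides a raising to cancel for each lowering.\<close>

lemma sorted_scalar:
  "plus n ps \<Longrightarrow> minus n ms \<Longrightarrow> net (ps @ ms) = (\<lambda>_. 0) \<Longrightarrow> v \<in> wt L \<Longrightarrow> \<exists>c. moves (ps @ ms) L v = s c v"
proof (induction ms arbitrary: ps)
  case Nil
  have "ps = []"
  proof (cases ps)
    case (Cons p qs)
    obtain r where p: "p = (True, r)" and qs: "plus n qs"
      using Nil.prems(1) Cons by (auto simp: plus_Cons)
    have "net ps r > 0" using plus_net_nonneg[OF qs, of r] by (simp add: Cons p)
    then show ?thesis using fun_cong[OF Nil.prems(3), of r] by simp
  qed
  then show ?case by (intro exI[of _ 1]) simp
next
  case (Cons m ms)
  obtain q where m: "m = (False, q)" and okm: "legal n (False, q)" and ms: "minus n ms"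
    using Cons.prems(2) by (auto simp: minus_Cons)
  have "net ps q > 0"
    using fun_cong[OF Cons.prems(3), of q] minus_net_nonpos[OF ms, of q] by (simp add: m)
  then have "(True, q) \<in> set ps" by (rule plus_net_pos[OF Cons.prems(1)])
  from push_left[OF Cons.prems(1) okm this Cons.prems(4)] obtain c ps' where P:
    "moves (ps @ [(False, q)]) L v = s c (moves ps' L v)" "plus n ps'" "net ps' = net (ps @ [(False, q)])" by blast
  have "net (ps' @ ms) = (\<lambda>_. 0)"
  proof
    fix x show "net (ps' @ ms) x = 0"
      using fun_cong[OF Cons.prems(3), of x] fun_cong[OF P(3), of x] by (simp add: m)
  qed
  from Cons.IH[OF P(2) ms this Cons.prems(4)] obtain d where d: "moves (ps' @ ms) L v = s d v" by blast
  have "moves (ps @ m # ms) L v = moves ((ps @ [(False, q)]) @ ms) L v" by (simp add: m)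
  also have "\<dots> = s c (moves (ps' @ ms) L v)"
    unfolding moves_append[of "ps @ [(False, q)]"] moves_append[of ps'] P(1) tableau_after_cong[OF P(3), symmetric]
    by (rule moves_scale)
  finally show ?case unfolding d by (intro exI[of _ "c * d"]) simp
qed

lemma word_scalar:
  assumes "\<forall>a\<in>set as. legal n a" "v \<in> wt L" "net as = (\<lambda>_. 0)"
  shows "\<exists>c. moves as L v = s c v"
proof -
  from sort_word[OF assms(1,2)] obtain c ps ms where 1: "moves as L v = s c (moves (ps @ ms) L v)"
    "plus n ps" "minus n ms" "net (ps @ ms) = net as" by blast
  obtain d where "moves (ps @ ms) L v = s d v"
    using sorted_scalar[OF 1(2,3) _ assms(2)] 1(4) assms(3) by auto
  then show ?thesis unfolding 1(1) by (intro exI[of _ "c * d"]) simp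
qed

definition orbit :: "(nat \<Rightarrow> nat \<Rightarrow> complex) \<Rightarrow> 'm \<Rightarrow> 'm set"
  where "orbit L v = {moves as L v | as. \<forall>a\<in>set as. legal n a}"

lemma orbit_self: "v \<in> orbit L v"
  unfolding orbit_def by (rule CollectI, rule exI[of _ "[]"]) simp

lemma orbit_wt: "v \<in> wt L \<Longrightarrow> x \<in> orbit L v \<Longrightarrow> \<exists>M. x \<in> wt M"
  unfolding orbit_def using moves_wt by blast

lemma orbit_invariant:
  assumes v: "v \<in> wt L" and ij: "i \<in> {1..n}" "j \<in> {1..n}" and x: "x \<in> span (orbit L v)"
  shows "E i j \<rhd> x \<in> span (orbit L v)"
proof -
  let ?N = "span (orbit L v)"
  have ext: "X \<rhd> x \<in> ?N" if X: "\<And>as. \<forall>a\<in>set as. legal n a \<Longrightarrow> X \<rhd> moves as L v \<in> ?N" and x: "x \<in> ?N" for X x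
    using x
  proof (induction rule: span_induct_alt)
    case (step c y z)
    then have "X \<rhd> y \<in> ?N" using X unfolding orbit_def by blast
    then show ?case using step by (simp add: act_add act_scale span_add span_scale)
  qed (simp add: span_zero)
  have next': "move a (tableau_after as L) (moves as L v) \<in> ?N" if "\<forall>a\<in>set as. legal n a" "legal n a" for a as
  proof -
    have "move a (tableau_after as L) (moves as L v) = moves (as @ [a]) L v" by (simp add: moves_append)
    moreover have "moves (as @ [a]) L v \<in> orbit L v"
      unfolding orbit_def using that by (intro CollectI exI[of _ "as @ [a]"]) simp
    ultimately show ?thesis by (simp add: span_base)
  qed
  show ?thesis
  proof (rule E_invariant[OF subspace_span _ _ ij x])
    fix k x assume k: "1 \<le> k" "Suc k \<le> n" and x: "x \<in> ?N"
    have "E k (Suc k) \<rhd> moves as L v \<in> ?N \<and> E (Suc k) k \<rhd> moves as L v \<in> ?N" if as: "\<forall>a\<in>set as. legal n a" for as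
      unfolding move_sum[OF k(2,1) moves_wt[OF as v]]
      by (intro conjI span_sum next' as) (use k in auto)
    then show "E k (Suc k) \<rhd> x \<in> ?N \<and> E (Suc k) k \<rhd> x \<in> ?N"
      using ext[OF _ x, of "E k (Suc k)"] ext[OF _ x, of "E (Suc k) k"] by simp
  next
    fix k x assume k: "k \<in> {1..n}" and x: "x \<in> ?N"
    show "E k k \<rhd> x \<in> ?N"
    proof (rule ext[OF _ x])
      fix as :: "letter list" assume as: "\<forall>a\<in>set as. legal n a"
      obtain c where "E k k \<rhd> moves as L v = s c (moves as L v)"
        using wt_diag[OF moves_wt[OF as v] k] by blast
      moreover have "moves as L v \<in> orbit L v" using as unfolding orbit_def by blast
      ultimately show "E k k \<rhd> moves as L v \<in> ?N" by (simp add: span_base span_scale)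
    qed
  qed
qed

text \<open>A sequence of moves applied to v either ends in a different character, or it has displacement zero and gives a
multiple of v. Vectors of other characters do not contribute to a vector of the weight of v.\<close>

theorem orbit_weight:
  assumes v: "v \<in> wt L" and x: "x \<in> wt L" "x \<in> span (orbit L v)"
  shows "\<exists>c. x = s c v"
proof -
  have "orbit L v \<subseteq> span (insert v (others L))"
  proof
    fix y assume "y \<in> orbit L v"
    then obtain as where as: "\<forall>a\<in>set as. legal n a" and y: "y = moves as L v" unfolding orbit_def by blast
    have w: "y \<in> wt (tableau_after as L)" unfolding y by (rule moves_wt[OF as v])
    show "y \<in> span (insert v (others L))"
    proof (cases "y = 0")
      case False
      show ?thesis
      proof (cases "same_rows n (tableau_after as L) L")
        case True
        have pre: "order_pres n L (tableau_after as L)" by (rule moves_pres[OF as v]) (use False y in simp)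
        have "net as = (\<lambda>_. 0)"
        proof
          fix q :: "nat \<times> nat"
          obtain k i where q: "q = (k, i)" by (cases q)
          show "net as q = 0"
          proof (cases "Suc k \<le> n \<and> i \<in> {1..k}")
            case True
            have "tableau_after as L k i = L k i"
              by (rule order_pres_same_rows[OF pre \<open>same_rows n (tableau_after as L) L\<close>]) (use True in auto)
            then show ?thesis by (simp add: tableau_after_net q)
          next
            case False
            then have "(b, q) \<notin> set as" for b using as by (force simp: q)
            then show ?thesis by (simp add: net_def)
          qed
        qed
        then obtain c where "y = s c v" unfolding y using word_scalar[OF as v] by blast
        then show ?thesis by (simp add: span_base span_scale)
      next
        case sm: False
        have "y \<in> others L" unfolding others_def using w sm by blast
        then show ?thesis by (simp add: span_base)
      qed
    qed (simp add: span_zero)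
  qed
  then have "span (orbit L v) \<subseteq> span (insert v (others L))"
    by (rule span_minimal[OF _ subspace_span])
  then have "x \<in> span (insert v (others L))" using x(2) by blast
  then obtain c where c: "x - s c v \<in> span (others L)" unfolding span_insert by blast
  have "x - s c v \<in> wt L" by (rule subspace_diff[OF wt_subspace x(1) subspace_scale[OF wt_subspace v]])
  from others_span_zero[OF this c] show ?thesis by (intro exI[of _ c]) simp
qed

end

section \<open>Joint eigenvectors\<close>

context gl_family
begin

definition gens :: "nat \<Rightarrow> 'a set"
  where "gens k = {E a b | a b. a \<in> {1..k} \<and> b \<in> {1..k}}"

definition GZ :: "'a set"
  where "GZ = (\<Union>k\<in>{1..n}. range (casimir k))"

lemma alg_subset: "S \<subseteq> T \<Longrightarrow> alg S \<subseteq> alg T"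
  by (auto intro: alg_mono alg_gen)

lemma casimir_in_gens: "casimir k j \<in> alg (gens k)"
proof -
  have "a \<in> {1..k} \<Longrightarrow> Ep k j a b \<in> alg (gens k)" if "b \<in> {1..k}" for a b
  proof (induction j arbitrary: a)
    case 0
    then show ?case using alg_0 alg_1 by simp
  next
    case (Suc j)
    have "E a c \<in> alg (gens k)" if "c \<in> {1..k}" for c
      by (rule alg_gen) (use Suc.prems that in \<open>auto simp: gens_def\<close>)
    then show ?case using Suc.IH by (auto intro!: alg_sum alg_mult)
  qed
  then show ?thesis unfolding casimir_def by (intro alg_sum)
qed

lemma gens_Filt: "x \<in> alg (gens k) \<Longrightarrow> \<exists>D. x \<in> Filt k D"
proof (induction rule: alg.induct)
  case (alg_sc x)
  have "sc x * Ew [] \<in> Filt k (Suc 0)" by (intro Filt_scale Filt_word) simp_all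
  then show ?case by auto
next
  case (alg_gen x)
  then obtain a b where x: "x = E a b" "a \<in> {1..k}" "b \<in> {1..k}" unfolding gens_def by blast
  have "Ew [(a, b)] \<in> Filt k (Suc (Suc 0))" by (rule Filt_word) (use x in simp_all)
  then show ?case unfolding x by auto
next
  case (alg_add x y)
  then obtain D D' where "x \<in> Filt k D" "y \<in> Filt k D'" by blast
  then have "x \<in> Filt k (max D D')" "y \<in> Filt k (max D D')" by (auto intro: Filt_mono)
  then show ?case by (blast intro: Filt_add)
next
  case (alg_mult x y)
  then show ?case by (blast intro: Filt_mult)
qed

lemma ginv_gens: "ginv k x \<Longrightarrow> y \<in> alg (gens k) \<Longrightarrow> br x y = 0"
proof (rule alg_comm)
  fix s assume "ginv k x" "s \<in> gens k"
  then have "br s x = 0" unfolding gens_def by (auto dest: ginvD)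
  then show "br x s = 0" by (subst br_swap) simp
qed

lemma gens_mono: "k \<le> l \<Longrightarrow> gens k \<subseteq> gens l"
  unfolding gens_def by fastforce

lemma casimir_commute:
  assumes "k \<le> n" "l \<le> n" shows "br (casimir k i) (casimir l j) = 0"
proof -
  have *: "br (casimir l j) (casimir k i) = 0" if "k \<le> l" "l \<le> n" for k l i j
    using alg_subset[OF gens_mono[OF that(1)]] casimir_in_gens
    by (intro ginv_gens[OF ginv_casimir[OF that(2)]]) blast
  show ?thesis
  proof (cases "k \<le> l")
    case True
    then show ?thesis using *[of k l j i] assms by (subst br_swap) simp
  next
    case False
    then show ?thesis using *[of l k i j] assms by simp
  qed
qed

lemma GZ_commute:
  assumes x: "x \<in> alg GZ" and y: "y \<in> alg GZ" shows "br x y = 0"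
proof (rule alg_comm[OF y])
  fix t assume t: "t \<in> GZ"
  have "br t x = 0"
  proof (rule alg_comm[OF x])
    fix r assume "r \<in> GZ"
    then show "br t r = 0" using t unfolding GZ_def by (auto simp: casimir_commute)
  qed
  then show "br x t = 0" by (subst br_swap) simp
qed

lemma GZ_gens: "alg GZ \<subseteq> alg (gens n)"
proof
  fix x assume "x \<in> alg GZ"
  then show "x \<in> alg (gens n)"
  proof (rule alg_mono)
    show "GZ \<subseteq> alg (gens n)"
      unfolding GZ_def using casimir_in_gens alg_subset[OF gens_mono] by fastforce
  qed
qed

lemma GZ_generators: "alg GZ \<subseteq> alg {casimir k j | k j. 1 \<le> j \<and> j \<le> k \<and> k \<le> n}" (is "_ \<subseteq> alg ?S")
proof
  fix x assume "x \<in> alg GZ"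
  then show "x \<in> alg ?S"
  proof (rule alg_mono)
    show "GZ \<subseteq> alg ?S"
    proof
      fix y assume "y \<in> GZ"
      then obtain k j where k: "k \<in> {1..n}" and y: "y = casimir k j" unfolding GZ_def by blast
      have "casimir k ` {1..k} \<subseteq> ?S"
      proof
        fix t assume "t \<in> casimir k ` {1..k}"
        then obtain i where i: "i \<in> {1..k}" "t = casimir k i" by blast
        then show "t \<in> ?S" using k by (intro CollectI exI[of _ k] exI[of _ i]) auto
      qed
      from alg_subset[OF this] show "y \<in> alg ?S"
        using casimir_in_alg[of k j] k unfolding y by auto
    qed
  qed
qed

lemma z_in_GZ:
  assumes "k \<in> {1..n}" "m \<le> k" shows "z k m \<in> alg GZ"
proof -
  have "casimir k ` {1..k} \<subseteq> GZ" unfolding GZ_def using assms by blast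
  from alg_subset[OF this] show ?thesis using z_in_alg[of k m] assms by auto
qed

text \<open>A tableau for the character \<open>\<chi>\<close>. It depends on \<open>\<chi>\<close> alone, hence it is the same tableau for all modules in
which \<open>\<chi>\<close> occurs. The top coefficient is set to 1 explicitly since \<open>\<chi>\<close> is not assumed to be a character.\<close>

definition roots :: "('a \<Rightarrow> complex) \<Rightarrow> nat \<Rightarrow> nat \<Rightarrow> complex"
  where "roots \<chi> k = (SOME l. \<forall>u. (\<Sum>q\<le>k. (if q = k then 1 else \<chi> (z k q)) * u ^ q) = poly (rowpoly k l) u)"

lemma roots: "(\<Sum>q\<le>k. (if q = k then 1 else \<chi> (z k q)) * u ^ q) = poly (rowpoly k (roots \<chi> k)) u"
proof -
  have "\<exists>l. \<forall>u. (\<Sum>q\<le>k. (if q = k then 1 else \<chi> (z k q)) * u ^ q) = poly (rowpoly k l) u"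
    by (rule monic_poly_roots) simp
  from someI_ex[OF this] show ?thesis unfolding roots_def by (rule spec)
qed

text \<open>Evaluation of a complex polynomial at an element of a noncommutative ring with central scalars.\<close>

definition ev :: "'a \<Rightarrow> complex poly \<Rightarrow> 'a"
  where "ev u p = fold_coeffs (\<lambda>a x. sc a + u * x) p 0"

lemma ev_0 [simp]: "ev u 0 = 0"
  by (simp add: ev_def)

lemma ev_pCons [simp]: "ev u (pCons a p) = sc a + u * ev u p"
  by (cases "p = 0 \<and> a = 0") (auto simp: ev_def)

lemma ev_add: "ev u (p + q) = ev u p + ev u q"
  by (induction p q rule: poly_induct2) (simp_all add: sc_add distrib_left)

lemma ev_smult: "ev u (smult a p) = sc a * ev u p"
proof (induction p)
  case (pCons b p)
  have "u * (sc a * ev u p) = sc a * (u * ev u p)"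
    by (simp only: mult.assoc[symmetric] sc_comm[of a u])
  then show ?case by (simp add: pCons sc_mult distrib_left)
qed simp

lemma ev_mult: "ev u (p * q) = ev u p * ev u q"
proof (induction p)
  case (pCons a p)
  then show ?case by (simp add: ev_add ev_smult distrib_right mult.assoc)
qed simp

lemma ev_sum: "ev u (\<Sum>i\<in>I. p i) = (\<Sum>i\<in>I. ev u (p i))"
  by (induction I rule: infinite_finite_induct) (simp_all add: ev_add)

lemma ev_linear: "ev u [:- c, 1:] = u - sc c"
  by (simp add: sc_minus)

lemma ev_alg: "u \<in> alg S \<Longrightarrow> ev u p \<in> alg S"
  by (induction p) (auto intro: alg_0 alg_add alg_mult alg_sc)

end

context gl_rep
begin

lemma wt_GZ: "x \<in> alg GZ \<Longrightarrow> v \<in> wt L \<Longrightarrow> \<exists>c. x \<rhd> v = s c v"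
proof (induction rule: alg.induct)
  case (alg_sc c)
  then show ?case by (auto simp: act_sc)
next
  case (alg_gen x)
  then obtain k j where "k \<in> {1..n}" "x = casimir k j" unfolding GZ_def by blast
  then show ?case using wt_casimir[OF alg_gen(2), of k j] by auto
next
  case (alg_add x y)
  then obtain a b where "x \<rhd> v = s a v" "y \<rhd> v = s b v" by blast
  then show ?case by (intro exI[of _ "a + b"]) (simp add: act_add_left scale_left_distrib)
next
  case (alg_mult x y)
  then obtain a b where "x \<rhd> v = s a v" "y \<rhd> v = s b v" by blast
  then show ?case by (intro exI[of _ "b * a"]) (simp add: act_mult act_scale)
qed

lemma eigenvector_wt:
  assumes "\<And>x. x \<in> alg GZ \<Longrightarrow> x \<rhd> v = s (\<chi> x) v"
  shows "v \<in> wt (roots \<chi>)"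
  unfolding wt_def row_def
proof (rule CollectI, intro ballI allI)
  fix k u assume k: "k \<in> {1..n}"
  have "C k u \<rhd> v = (\<Sum>q\<le>k. s ((if q = k then 1 else \<chi> (z k q)) * u ^ q) v)"
    unfolding act_C
  proof (rule sum.cong[OF refl])
    fix q assume q: "q \<in> {..k}"
    have "z k q \<rhd> v = s (if q = k then 1 else \<chi> (z k q)) v"
      using assms[OF z_in_GZ[OF k, of q]] q by (cases "q = k") (simp_all add: z_top)
    then show "s (u ^ q) (z k q \<rhd> v) = s ((if q = k then 1 else \<chi> (z k q)) * u ^ q) v"
      by (simp add: mult.commute)
  qed
  then show "C k u \<rhd> v = s (poly (rowpoly k (roots \<chi> k)) u) v"
    unfolding roots[symmetric] scale_sum_left .
qed

lemma Filt_span: "x \<in> Filt k D \<Longrightarrow> x \<rhd> v \<in> span (range (\<lambda>w. Ew w \<rhd> v))"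
proof (induction rule: Filt.induct)
  case (Filt_step x w a)
  have "Ew w \<rhd> v \<in> span (range (\<lambda>w. Ew w \<rhd> v))" by (rule span_base) simp
  then show ?case using Filt_step by (simp add: act_add_left act_mult act_sc span_add span_scale)
qed (simp add: span_zero)

text \<open>A countable set has countably many finite subsets, and the span of each of them contains only finitely many
elements of an independent set.\<close>

lemma span_countable_independent:
  assumes X: "countable X" and B: "independent B" "B \<subseteq> span X"
  shows "countable B"
proof -
  have "B \<subseteq> (\<Union>T\<in>{T. finite T \<and> T \<subseteq> X}. B \<inter> span T)"
  proof
    fix b assume b: "b \<in> B"
    then have "b \<in> span X" using B by blast
    then obtain T r where "finite T" "T \<subseteq> X" "b = (\<Sum>a\<in>T. s (r a) a)" unfolding span_explicit by blast
    moreover have "(\<Sum>a\<in>T. s (r a) a) \<in> span T" by (intro span_sum span_scale span_base)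
    ultimately show "b \<in> (\<Union>T\<in>{T. finite T \<and> T \<subseteq> X}. B \<inter> span T)" using b by blast
  qed
  moreover have "countable (\<Union>T\<in>{T. finite T \<and> T \<subseteq> X}. B \<inter> span T)"
  proof (rule countable_UN)
    show "countable {T. finite T \<and> T \<subseteq> X}" by (rule countable_Collect_finite_subset[OF X])
    fix T assume "T \<in> {T. finite T \<and> T \<subseteq> X}"
    then have "finite (B \<inter> span T)"
      using independent_span_bound[of T "B \<inter> span T"] independent_mono[OF B(1), of "B \<inter> span T"] by blast
    then show "countable (B \<inter> span T)" by (rule countable_finite)
  qed
  ultimately show ?thesis by (rule countable_subset)
qed

text \<open>Amitsur's argument. If u has no eigenvalue on v, then for every c there is \<open>y c\<close> with \<open>(u - c) (y c) = v\<close>.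
By partial fractions these vectors are independent: clearing denominators in a relation gives a
nonzero polynomial in u that kills v, and such a polynomial is a product of linear factors, which are all
injective. But the vectors lie in the span of the words applied to v, which has countable dimension.\<close>

theorem eigenvalue_exists:
  assumes S: "alg S \<subseteq> alg (gens n)" and comm: "\<And>x y. x \<in> alg S \<Longrightarrow> y \<in> alg S \<Longrightarrow> br x y = 0"
    and v: "v \<noteq> 0" and u: "u \<in> alg S"
    and field: "\<And>c. (u - sc c) \<rhd> v \<noteq> 0 \<Longrightarrow> \<exists>w\<in>alg S. w \<rhd> (u - sc c) \<rhd> v = v"
  shows "\<exists>c. u \<rhd> v = s c v"
proof (rule ccontr)
  assume no: "\<nexists>c. u \<rhd> v = s c v"
  have uc: "u - sc c \<in> alg S" for c by (rule alg_diff[OF u alg_sc])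
  have "\<forall>c. \<exists>w. w \<in> alg S \<and> w \<rhd> (u - sc c) \<rhd> v = v"
  proof
    fix c
    have "(u - sc c) \<rhd> v \<noteq> 0" using no by (auto simp: act_diff_left act_sc)
    from field[OF this] show "\<exists>w. w \<in> alg S \<and> w \<rhd> (u - sc c) \<rhd> v = v" by blast
  qed
  from choice[OF this] obtain w where w: "\<forall>c. w c \<in> alg S \<and> w c \<rhd> (u - sc c) \<rhd> v = v" by (rule exE)
  define y where "y c = w c \<rhd> v" for c
  have swap: "x \<rhd> x' \<rhd> t = x' \<rhd> x \<rhd> t" if "x \<in> alg S" "x' \<in> alg S" for x x' t
    by (rule act_comm[OF comm[OF that]])
  have yc: "(u - sc c) \<rhd> y c = v" for c
    unfolding y_def using swap[OF uc w[THEN spec, THEN conjunct1]] w[THEN spec, of c] by simp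
  have nonzero: "p \<noteq> 0 \<Longrightarrow> ev u p \<rhd> v \<noteq> 0" for p
  proof (induction "degree p" arbitrary: p)
    case 0
    then obtain a where "p = [:a:]" "a \<noteq> 0" by (metis degree_0_id of_nat_eq_0_iff degree_eq_zeroE pCons_0_0)
    then show ?case using v by (simp add: act_sc)
  next
    case (Suc d)
    then have "\<not> constant (poly p)" by (simp add: constant_degree)
    then obtain r where "poly p r = 0" using fundamental_theorem_of_algebra by blast
    then obtain q where p: "p = [:- r, 1:] * q" by (metis poly_eq_0_iff_dvd dvdE)
    have q: "q \<noteq> 0" using Suc.prems p by auto
    have "degree p = Suc (degree q)" unfolding p using q by (subst degree_mult_eq) auto
    then have nz: "ev u q \<rhd> v \<noteq> 0" using Suc.hyps q by simp
    show ?case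
    proof
      assume "ev u p \<rhd> v = 0"
      then have "(u - sc r) \<rhd> ev u q \<rhd> v = 0"
        unfolding p ev_mult ev_linear by (simp only: act_mult)
      then have "w r \<rhd> (u - sc r) \<rhd> ev u q \<rhd> v = 0" by simp
      moreover have "w r \<rhd> (u - sc r) \<rhd> ev u q \<rhd> v = ev u q \<rhd> w r \<rhd> (u - sc r) \<rhd> v"
        unfolding swap[OF uc ev_alg[OF u], of r q v] by (rule swap[OF w[THEN spec, THEN conjunct1] ev_alg[OF u]])
      ultimately show False using nz w[THEN spec, of r] by simp
    qed
  qed
  have indep: "a c = 0" if F: "finite F" and rel: "(\<Sum>c\<in>F. s (a c) (y c)) = 0" and c: "c \<in> F" for F a c
  proof (rule ccontr)
    assume ac: "a c \<noteq> 0"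
    define Q where "Q d = (\<Prod>b\<in>F - {d}. [:- b, 1:])" for d :: complex
    define P where "P = (\<Sum>d\<in>F. smult (a d) (Q d))"
    have "poly (Q d) c = 0" if "d \<in> F" "d \<noteq> c" for d
      unfolding Q_def poly_prod by (rule prod_zero[OF finite_Diff[OF F]], rule bexI[of _ c]) (use that c in auto)
    then have "poly P c = (\<Sum>d\<in>F. if d = c then a c * poly (Q c) c else 0)"
      unfolding P_def poly_sum by (intro sum.cong refl) auto
    also have "\<dots> = a c * poly (Q c) c" using F c by simp
    also have "\<dots> \<noteq> 0" using ac F by (simp add: Q_def poly_prod)
    finally have "P \<noteq> 0" by auto
    moreover have "ev u P \<rhd> v = 0"
    proof -
      have Fy: "ev u (\<Prod>b\<in>F. [:- b, 1:]) \<rhd> y d = ev u (Q d) \<rhd> v" if d: "d \<in> F" for d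
      proof -
        have "(\<Prod>b\<in>F. [:- b, 1:]) = Q d * [:- d, 1:]"
          unfolding Q_def using F d by (subst prod.remove[of F d]) (simp_all add: mult.commute)
        then show ?thesis by (simp only: ev_mult ev_linear act_mult yc)
      qed
      have "ev u P \<rhd> v = (\<Sum>d\<in>F. s (a d) (ev u (Q d) \<rhd> v))"
        unfolding P_def ev_sum ev_smult by (simp add: act_sum_left act_mult act_sc)
      also have "\<dots> = ev u (\<Prod>b\<in>F. [:- b, 1:]) \<rhd> (\<Sum>d\<in>F. s (a d) (y d))"
        unfolding act_sum act_scale by (intro sum.cong refl) (simp add: Fy)
      finally show ?thesis unfolding rel by simp
    qed
    ultimately show False using nonzero by blast
  qed
  have inj: "inj y"
  proof (rule injI, rule ccontr)
    fix c d assume cd: "y c = y d" "c \<noteq> d"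
    have "(\<Sum>b\<in>{c, d}. s (if b = c then 1 else - 1) (y b)) = 0" using cd by simp
    from indep[OF _ this, of c] show False by simp
  qed
  have "independent (range y)"
  proof
    assume "dependent (range y)"
    then obtain T r t where T: "finite T" "T \<subseteq> range y" "(\<Sum>x\<in>T. s (r x) x) = 0" "t \<in> T" "r t \<noteq> 0"
      unfolding dependent_explicit by blast
    obtain F where F: "finite F" "T = y ` F" using finite_subset_image[OF T(1,2)] by blast
    obtain c where c: "c \<in> F" "t = y c" using T(4) F(2) by blast
    have "(\<Sum>c\<in>F. s (r (y c)) (y c)) = 0"
      using T(3) unfolding F(2) by (subst (asm) sum.reindex) (use inj in \<open>auto intro: inj_on_subset\<close>)
    from indep[OF F(1) this c(1)] show False using T(5) c(2) by simp
  qed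
  moreover have "range y \<subseteq> span (range (\<lambda>t. Ew t \<rhd> v))"
  proof
    fix x assume "x \<in> range y"
    then obtain c where x: "x = w c \<rhd> v" by (auto simp: y_def)
    have "w c \<in> alg (gens n)" using w S by blast
    then obtain D where "w c \<in> Filt n D" using gens_Filt by blast
    then show "x \<in> span (range (\<lambda>t. Ew t \<rhd> v))" unfolding x by (rule Filt_span)
  qed
  ultimately have "countable (range y)"
    using span_countable_independent[of "range (\<lambda>t. Ew t \<rhd> v)" "range y"] by simp
  then have "countable (UNIV :: complex set)" using inj countable_image_inj_on by blast
  then have "countable (Re ` UNIV)" by (rule countable_image)
  moreover have "Re ` UNIV = (UNIV :: real set)"
  proof (rule surjI)
    show "Re (complex_of_real x) = x" for x by simp
  qed
  ultimately show False using uncountable_UNIV_real by simp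
qed

definition irreducible :: bool
  where "irreducible \<longleftrightarrow> (\<forall>N. subspace N \<longrightarrow> (\<forall>i\<in>{1..n}. \<forall>j\<in>{1..n}. \<forall>x\<in>N. E i j \<rhd> x \<in> N) \<longrightarrow> N = {0} \<or> N = UNIV)"

lemma irreducibleD:
  assumes "irreducible" "subspace N" "\<And>i j x. i \<in> {1..n} \<Longrightarrow> j \<in> {1..n} \<Longrightarrow> x \<in> N \<Longrightarrow> E i j \<rhd> x \<in> N" "x \<in> N" "x \<noteq> 0"
  shows "N = UNIV"
  using assms(1)[unfolded irreducible_def, THEN spec, of N] assms(2-5) by blast

end

lemma (in noncritical_rep) orbit_spans:
  "irreducible \<Longrightarrow> v \<in> wt L \<Longrightarrow> v \<noteq> 0 \<Longrightarrow> span (orbit L v) = UNIV"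
  by (rule irreducibleD[OF _ subspace_span orbit_invariant span_base[OF orbit_self]])

section \<open>Irreducible representations with a common weight\<close>

text \<open>The submodule N of the product generated by \<open>(v, w)\<close> projects onto both factors by irreducibility. If it contained
a vector \<open>(0, y)\<close> with y nonzero, it would contain \<open>(0, w)\<close>, which has the weight of \<open>(v, w)\<close> but is not a
multiple of it, against \<open>orbit_weight\<close>. So N is a graph.\<close>

theorem common_weight_isomorphic:
  fixes E :: "nat \<Rightarrow> nat \<Rightarrow> 'a::ring_1" and s1 :: "complex \<Rightarrow> 'v::ab_group_add \<Rightarrow> 'v" and s2 :: "complex \<Rightarrow> 'w::ab_group_add \<Rightarrow> 'w"
  assumes V: "noncritical_rep E sc n s1 act1" and W: "noncritical_rep E sc n s2 act2"
    and irrV: "gl_rep.irreducible E n s1 act1" and irrW: "gl_rep.irreducible E n s2 act2"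
    and v: "v \<in> gl_rep.wt E sc n s1 act1 L" "v \<noteq> 0" and w: "w \<in> gl_rep.wt E sc n s2 act2 L" "w \<noteq> 0"
  shows "\<exists>g. Vector_Spaces.linear s1 s2 g \<and> bij g \<and> (\<forall>i\<in>{1..n}. \<forall>j\<in>{1..n}. \<forall>x. g (act1 (E i j) x) = act2 (E i j) (g x))"
proof -
  interpret V: noncritical_rep E sc n s1 act1 by (rule V)
  interpret W: noncritical_rep E sc n s2 act2 by (rule W)
  define sP where "sP c p = (s1 c (fst p), s2 c (snd p))" for c p
  define aP where "aP x p = (act1 x (fst p), act2 x (snd p))" for x p
  have vsP: "vector_space sP"
    by unfold_locales (simp_all add: sP_def prod_eq_iff V.scale_right_distrib V.scale_left_distrib W.scale_right_distrib W.scale_left_distrib)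
  interpret P: gl_rep E sc n sP aP
  proof (rule gl_rep.intro[OF V.gl_family_axioms vsP], unfold_locales)
    show "aP (x + y) p = aP x p + aP y p" for x y p by (simp add: aP_def V.act_add_left W.act_add_left)
    show "aP (x * y) p = aP x (aP y p)" for x y p by (simp add: aP_def V.act_mult W.act_mult)
    show "aP (sc a) p = sP a p" for a p by (simp add: aP_def sP_def V.act_sc W.act_sc)
    show "aP x (p + q) = aP x p + aP x q" for x p q by (simp add: aP_def V.act_add W.act_add)
  qed
  have wtP: "p \<in> P.wt M \<longleftrightarrow> fst p \<in> V.wt M \<and> snd p \<in> W.wt M" for p M
    unfolding P.wt_def V.wt_def W.wt_def P.row_def V.row_def W.row_def aP_def sP_def
    by (cases p) auto
  interpret P: noncritical_rep E sc n sP aP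
  proof unfold_locales
    fix p L assume p: "p \<in> P.wt L" "p \<noteq> 0"
    then have "fst p \<noteq> 0 \<or> snd p \<noteq> 0" by (simp add: prod_eq_iff)
    then show "noncrit n L" using p(1) V.wt_noncrit W.wt_noncrit unfolding wtP by blast
  qed
  define N where "N = P.span (P.orbit L (v, w))"
  have vw: "(v, w) \<in> P.wt L" using v w by (simp add: wtP)
  have N: "P.subspace N" unfolding N_def by (rule P.subspace_span)
  have inv: "aP (E i j) p \<in> N" if "i \<in> {1..n}" "j \<in> {1..n}" "p \<in> N" for i j p
    using P.orbit_invariant[OF vw that(1,2)] that(3) unfolding N_def by blast
  have N0: "(0, 0) \<in> N" using P.subspace_0[OF N] by (simp add: zero_prod_def)
  have Nadd: "(x + x', y + y') \<in> N" if "(x, y) \<in> N" "(x', y') \<in> N" for x x' y y'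
    using P.subspace_add[OF N that] by simp
  have Ndiff: "(x - x', y - y') \<in> N" if "(x, y) \<in> N" "(x', y') \<in> N" for x x' y y'
    using P.subspace_diff[OF N that] by simp
  have Nscale: "(s1 c x, s2 c y) \<in> N" if "(x, y) \<in> N" for c x y
    using P.subspace_scale[OF N that, of c] by (simp add: sP_def)
  have Ninv: "(act1 (E i j) x, act2 (E i j) y) \<in> N" if "i \<in> {1..n}" "j \<in> {1..n}" "(x, y) \<in> N" for i j x y
    using inv[OF that] by (simp add: aP_def)
  have vwN: "(v, w) \<in> N" unfolding N_def by (rule P.span_base[OF P.orbit_self])
  have scalar: "\<exists>c. p = sP c (v, w)" if "p \<in> N" "p \<in> P.wt L" for p
    using P.orbit_weight[OF vw that(2)] that(1) unfolding N_def by blast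
  have "{x. \<exists>y. (x, y) \<in> N} = UNIV"
  proof (rule V.irreducibleD[OF irrV _ _ _ v(2)])
    show "V.subspace {x. \<exists>y. (x, y) \<in> N}"
      by (rule V.subspaceI) (use N0 Nadd Nscale in blast)+
  qed (use Ninv vwN in blast)+
  then have ex: "\<exists>y. (x, y) \<in> N" for x by blast
  have "{y. \<exists>x. (x, y) \<in> N} = UNIV"
  proof (rule W.irreducibleD[OF irrW _ _ _ w(2)])
    show "W.subspace {y. \<exists>x. (x, y) \<in> N}"
      by (rule W.subspaceI) (use N0 Nadd Nscale in blast)+
  qed (use Ninv vwN in blast)+
  then have ex': "\<exists>x. (x, y) \<in> N" for y by blast
  have right: "y = 0" if "(0, y) \<in> N" for y
  proof (rule ccontr)
    assume y: "y \<noteq> 0"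
    have "{y. (0, y) \<in> N} = UNIV"
    proof (rule W.irreducibleD[OF irrW _ _ _ y])
      show "W.subspace {y. (0, y) \<in> N}"
        by (rule W.subspaceI) (use N0 Nadd[of 0 _ 0] Nscale[of 0] in auto)
    qed (use Ninv[of _ _ 0] that in auto)
    then have 1: "(0, w) \<in> N" by blast
    have "(0, w) \<in> P.wt L" using w V.subspace_0[OF V.wt_subspace] by (simp add: wtP)
    from scalar[OF 1 this] obtain c where "(0, w) = sP c (v, w)" by blast
    then have "s1 c v = 0" "w = s2 c w" by (simp_all add: sP_def)
    then show False using v(2) w(2) by simp
  qed
  have left: "x = 0" if "(x, 0) \<in> N" for x
  proof (rule ccontr)
    assume x: "x \<noteq> 0"
    have "{x. (x, 0) \<in> N} = UNIV"
    proof (rule V.irreducibleD[OF irrV _ _ _ x])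
      show "V.subspace {x. (x, 0) \<in> N}"
        by (rule V.subspaceI) (use N0 Nadd[of _ 0 _ 0] Nscale[of _ 0] in auto)
    qed (use Ninv[of _ _ _ 0] that in auto)
    then have 1: "(v, 0) \<in> N" by blast
    have "(v, 0) \<in> P.wt L" using v W.subspace_0[OF W.wt_subspace] by (simp add: wtP)
    from scalar[OF 1 this] obtain c where "(v, 0) = sP c (v, w)" by blast
    then have "s2 c w = 0" "v = s1 c v" by (auto simp: sP_def)
    then show False using v(2) w(2) by simp
  qed
  obtain g where g: "\<forall>x. (x, g x) \<in> N" using choice[of "\<lambda>x y. (x, y) \<in> N"] ex by blast
  have gI: "g x = y" if "(x, y) \<in> N" for x y
  proof -
    have "(x - x, g x - y) \<in> N" by (rule Ndiff[OF g[THEN spec] that])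
    then show ?thesis using right[of "g x - y"] by simp
  qed
  show ?thesis
  proof (intro exI conjI)
    show "Vector_Spaces.linear s1 s2 g"
      unfolding Vector_Spaces.linear_iff using g V.vs W.vs by (auto intro!: gI Nadd Nscale)
    show "bij g"
    proof (rule bijI)
      show "inj g"
      proof (rule injI)
        fix x y assume "g x = g y"
        then have "(x - y, 0) \<in> N" using Ndiff[OF g[THEN spec, of x] g[THEN spec, of y]] by simp
        then show "x = y" using left[of "x - y"] by simp
      qed
      show "surj g" using ex' gI by (metis surjI)
    qed
    show "\<forall>i\<in>{1..n}. \<forall>j\<in>{1..n}. \<forall>x. g (act1 (E i j) x) = act2 (E i j) (g x)"
      using g by (auto intro!: gI Ninv)
  qed
qed

section \<open>Classes in the enveloping algebra\<close>

abbreviation FR :: "nat \<Rightarrow> complex mat free_alg ring"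
  where "FR m \<equiv> free_ring (gl m)"

lemma U_class_closed: "p \<in> carrier (FR m) \<Longrightarrow> U_class m p \<in> carrier (U_gl m)"
proof -
  interpret I: ideal "env_ideal m" "FR m" by (rule ideal_env_ideal)
  assume "p \<in> carrier (FR m)"
  then show ?thesis
    unfolding U_gl_def FactRing_def U_class_def using I.a_rcosetsI[OF I.a_subset] by simp
qed

lemma U_class_exists: "u \<in> carrier (U_gl m) \<Longrightarrow> \<exists>p\<in>carrier (FR m). u = U_class m p"
  by (auto simp: U_gl_def FactRing_def A_RCOSETS_def' U_class_def)

lemma U_class_add:
  assumes "p \<in> carrier (FR m)" "q \<in> carrier (FR m)"
  shows "U_class m p \<oplus>\<^bsub>U_gl m\<^esub> U_class m q = U_class m (p + q)"
proof -
  interpret I: ideal "env_ideal m" "FR m" by (rule ideal_env_ideal)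
  show ?thesis
    using I.a_rcos_sum[OF assms] by (simp add: U_gl_def FactRing_def U_class_def free_ring_simps)
qed

lemma U_class_mult:
  assumes "p \<in> carrier (FR m)" "q \<in> carrier (FR m)"
  shows "U_class m p \<otimes>\<^bsub>U_gl m\<^esub> U_class m q = U_class m (p * q)"
proof -
  interpret I: ideal "env_ideal m" "FR m" by (rule ideal_env_ideal)
  show ?thesis
    using I.rcoset_mult_add[OF assms] by (simp add: U_gl_def FactRing_def U_class_def free_ring_simps)
qed

lemma U_class_one: "\<one>\<^bsub>U_gl m\<^esub> = U_class m 1"
  by (simp add: U_gl_def FactRing_def U_class_def free_ring_simps)

lemma U_class_self: "p \<in> carrier (FR m) \<Longrightarrow> p \<in> U_class m p"
proof -
  interpret I: ideal "env_ideal m" "FR m" by (rule ideal_env_ideal)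
  assume "p \<in> carrier (FR m)"
  then show ?thesis unfolding U_class_def by (rule I.a_rcos_self)
qed

lemma U_class_mem: "p \<in> U_class m q \<longleftrightarrow> p - q \<in> env_ideal m"
proof
  assume "p \<in> U_class m q"
  then show "p - q \<in> env_ideal m" by (auto simp: U_class_def a_r_coset_def' free_ring_simps)
next
  assume "p - q \<in> env_ideal m"
  then show "p \<in> U_class m q"
    unfolding U_class_def a_r_coset_def' by (auto simp: free_ring_simps intro!: bexI[of _ "p - q"])
qed

lemma U_class_eqI:
  assumes "p - q \<in> env_ideal m" "q \<in> carrier (FR m)" shows "U_class m p = U_class m q"
proof -
  interpret I: ideal "env_ideal m" "FR m" by (rule ideal_env_ideal)
  have "p \<in> U_class m q" using assms(1) by (simp add: U_class_mem)
  then show ?thesis unfolding U_class_def using I.a_repr_independence'[OF _ assms(2)] by metis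
qed

lemma U_class_zero: "\<zero>\<^bsub>U_gl m\<^esub> = U_class m 0"
proof -
  interpret I: ideal "env_ideal m" "FR m" by (rule ideal_env_ideal)
  have "env_ideal m = U_class m 0"
  proof (intro equalityI subsetI)
    show "x \<in> env_ideal m \<Longrightarrow> x \<in> U_class m 0" "x \<in> U_class m 0 \<Longrightarrow> x \<in> env_ideal m" for x
      by (simp_all add: U_class_mem)
  qed
  then show ?thesis by (simp add: U_gl_def FactRing_def)
qed

lemma free_one_zero_carrier: "1 \<in> carrier (FR m)" "0 \<in> carrier (FR m)"
  by (simp_all add: in_free_ring_iff zero_fword_def)

lemma U_act_U_class:
  assumes "gl_module m s \<rho>" "p \<in> carrier (FR m)"
  shows "U_act s \<rho> (U_class m p) v = free_act s \<rho> p v"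
  by (rule gl_module.U_act_class[OF assms(1) U_class_closed[OF assms(2)] U_class_self[OF assms(2)]])

lemma U_gl_nontrivial: "\<one>\<^bsub>U_gl m\<^esub> \<noteq> \<zero>\<^bsub>U_gl m\<^esub>"
proof
  assume "\<one>\<^bsub>U_gl m\<^esub> = \<zero>\<^bsub>U_gl m\<^esub>"
  then have "1 \<in> U_class m 0"
    unfolding U_class_one U_class_zero using U_class_self[OF free_one_zero_carrier(1)] by metis
  then have one: "1 \<in> env_ideal m" by (simp add: U_class_mem)
  \<comment> \<open>the trivial one-dimensional module separates 1 from 0\<close>
  interpret gl_module m "(*) :: complex \<Rightarrow> complex \<Rightarrow> complex" "\<lambda>X v. 0"
    by unfold_locales (auto simp: Vector_Spaces.linear_iff algebra_simps intro!: vector_space.intro)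
  have l: "letters (0 :: complex mat fword) = []" by (simp add: zero_fword_def)
  have "free_act (*) (\<lambda>X v. 0) (Poly_Mapping.single (0 :: complex mat fword) 1) (1::complex) = 1"
    by (simp only: free_act_single l foldr_Nil id_apply mult_1)
  then have "free_act (*) (\<lambda>X v. 0) (1 :: complex mat free_alg) (1::complex) = 1"
    by (simp only: single_one)
  moreover have "free_act (*) (\<lambda>X v. 0) (1 :: complex mat free_alg) (1::complex) = 0"
    by (rule free_act_env_ideal[OF one])
  ultimately show False by (metis zero_neq_one)
qed

section \<open>The enveloping algebras as one ring\<close>

text \<open>The enveloping algebra is a ring on a carrier set that depends on a number, whereas the calculus above
lives in a type. The product of these rings over all n is a type on its own, and the generators of one of them are
placed in its coordinate.\<close>

typedef env = "{x :: nat \<Rightarrow> complex mat free_alg set. \<forall>m. x m \<in> carrier (U_gl m)}" morphisms coord Env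
  by (rule exI[of _ "\<lambda>m. \<zero>\<^bsub>U_gl m\<^esub>"]) (simp add: ring.ring_simprules[OF ring_U_gl])

lemma coord_closed [simp]: "coord x m \<in> carrier (U_gl m)"
  using coord[of x] by simp

lemma coord_Env: "(\<And>m. x m \<in> carrier (U_gl m)) \<Longrightarrow> coord (Env x) m = x m"
  by (simp add: Env_inverse)

lemma env_eqI: "(\<And>m. coord x m = coord y m) \<Longrightarrow> x = y"
  by (simp add: coord_inject[symmetric] fun_eq_iff)

lemma U_gl_zero [simp]:
  "\<zero>\<^bsub>U_gl m\<^esub> \<in> carrier (U_gl m)" "\<zero>\<^bsub>U_gl m\<^esub> \<oplus>\<^bsub>U_gl m\<^esub> \<zero>\<^bsub>U_gl m\<^esub> = \<zero>\<^bsub>U_gl m\<^esub>"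
  "u \<in> carrier (U_gl m) \<Longrightarrow> u \<otimes>\<^bsub>U_gl m\<^esub> \<zero>\<^bsub>U_gl m\<^esub> = \<zero>\<^bsub>U_gl m\<^esub>"
  "u \<in> carrier (U_gl m) \<Longrightarrow> \<zero>\<^bsub>U_gl m\<^esub> \<otimes>\<^bsub>U_gl m\<^esub> u = \<zero>\<^bsub>U_gl m\<^esub>"
proof -
  interpret R: ring "U_gl m" by (rule ring_U_gl)
  show "\<zero>\<^bsub>U_gl m\<^esub> \<in> carrier (U_gl m)" by (rule R.zero_closed)
  show "\<zero>\<^bsub>U_gl m\<^esub> \<oplus>\<^bsub>U_gl m\<^esub> \<zero>\<^bsub>U_gl m\<^esub> = \<zero>\<^bsub>U_gl m\<^esub>" by (rule R.l_zero[OF R.zero_closed])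
  show "u \<in> carrier (U_gl m) \<Longrightarrow> u \<otimes>\<^bsub>U_gl m\<^esub> \<zero>\<^bsub>U_gl m\<^esub> = \<zero>\<^bsub>U_gl m\<^esub>" by (rule R.r_null)
  show "u \<in> carrier (U_gl m) \<Longrightarrow> \<zero>\<^bsub>U_gl m\<^esub> \<otimes>\<^bsub>U_gl m\<^esub> u = \<zero>\<^bsub>U_gl m\<^esub>" by (rule R.l_null)
qed

instantiation env :: ring_1
begin

definition "0 = Env (\<lambda>m. \<zero>\<^bsub>U_gl m\<^esub>)"
definition "1 = Env (\<lambda>m. \<one>\<^bsub>U_gl m\<^esub>)"
definition "x + y = Env (\<lambda>m. coord x m \<oplus>\<^bsub>U_gl m\<^esub> coord y m)"
definition "x * y = Env (\<lambda>m. coord x m \<otimes>\<^bsub>U_gl m\<^esub> coord y m)"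
definition "- x = Env (\<lambda>m. \<ominus>\<^bsub>U_gl m\<^esub> coord x m)"
definition "(x :: env) - y = x + (- y)"

lemma coord_0: "coord 0 m = \<zero>\<^bsub>U_gl m\<^esub>"
  unfolding zero_env_def
proof (rule coord_Env)
  fix m
  interpret R: ring "U_gl m" by (rule ring_U_gl)
  show "\<zero>\<^bsub>U_gl m\<^esub> \<in> carrier (U_gl m)" by (rule R.zero_closed)
qed

lemma coord_1: "coord 1 m = \<one>\<^bsub>U_gl m\<^esub>"
  unfolding one_env_def
proof (rule coord_Env)
  fix m
  interpret R: ring "U_gl m" by (rule ring_U_gl)
  show "\<one>\<^bsub>U_gl m\<^esub> \<in> carrier (U_gl m)" by (rule R.one_closed)
qed

lemma coord_add: "coord (x + y) m = coord x m \<oplus>\<^bsub>U_gl m\<^esub> coord y m"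
  unfolding plus_env_def
proof (rule coord_Env)
  fix m
  interpret R: ring "U_gl m" by (rule ring_U_gl)
  show "coord x m \<oplus>\<^bsub>U_gl m\<^esub> coord y m \<in> carrier (U_gl m)" by (rule R.add.m_closed[OF coord_closed coord_closed])
qed

lemma coord_mult: "coord (x * y) m = coord x m \<otimes>\<^bsub>U_gl m\<^esub> coord y m"
  unfolding times_env_def
proof (rule coord_Env)
  fix m
  interpret R: ring "U_gl m" by (rule ring_U_gl)
  show "coord x m \<otimes>\<^bsub>U_gl m\<^esub> coord y m \<in> carrier (U_gl m)" by (rule R.m_closed[OF coord_closed coord_closed])
qed

lemma coord_uminus: "coord (- x) m = \<ominus>\<^bsub>U_gl m\<^esub> coord x m"
  unfolding uminus_env_def
proof (rule coord_Env)
  fix m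
  interpret R: ring "U_gl m" by (rule ring_U_gl)
  show "\<ominus>\<^bsub>U_gl m\<^esub> coord x m \<in> carrier (U_gl m)" by (rule R.a_inv_closed[OF coord_closed])
qed

instance
proof
  fix a b c :: env
  show "a + b + c = a + (b + c)"
  proof (rule env_eqI)
    fix m
    interpret R: ring "U_gl m" by (rule ring_U_gl)
    show "coord (a + b + c) m = coord (a + (b + c)) m" by (simp add: coord_add R.a_assoc)
  qed
  show "a + b = b + a"
  proof (rule env_eqI)
    fix m
    interpret R: ring "U_gl m" by (rule ring_U_gl)
    show "coord (a + b) m = coord (b + a) m" by (simp add: coord_add R.a_comm)
  qed
  show "0 + a = a"
  proof (rule env_eqI)
    fix m
    interpret R: ring "U_gl m" by (rule ring_U_gl)
    show "coord (0 + a) m = coord (a) m" by (simp add: coord_add coord_0)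
  qed
  show "- a + a = 0"
  proof (rule env_eqI)
    fix m
    interpret R: ring "U_gl m" by (rule ring_U_gl)
    show "coord (- a + a) m = coord (0) m" by (simp add: coord_add coord_0 coord_uminus R.l_neg)
  qed
  show "a * b * c = a * (b * c)"
  proof (rule env_eqI)
    fix m
    interpret R: ring "U_gl m" by (rule ring_U_gl)
    show "coord (a * b * c) m = coord (a * (b * c)) m" by (simp add: coord_mult R.m_assoc)
  qed
  show "(a + b) * c = a * c + b * c"
  proof (rule env_eqI)
    fix m
    interpret R: ring "U_gl m" by (rule ring_U_gl)
    show "coord ((a + b) * c) m = coord (a * c + b * c) m" by (simp add: coord_mult coord_add R.l_distr)
  qed
  show "a * (b + c) = a * b + a * c"
  proof (rule env_eqI)
    fix m
    interpret R: ring "U_gl m" by (rule ring_U_gl)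
    show "coord (a * (b + c)) m = coord (a * b + a * c) m" by (simp add: coord_mult coord_add R.r_distr)
  qed
  show "1 * a = a"
  proof (rule env_eqI)
    fix m
    interpret R: ring "U_gl m" by (rule ring_U_gl)
    show "coord (1 * a) m = coord (a) m" by (simp add: coord_mult coord_1)
  qed
  show "a * 1 = a"
  proof (rule env_eqI)
    fix m
    interpret R: ring "U_gl m" by (rule ring_U_gl)
    show "coord (a * 1) m = coord (a) m" by (simp add: coord_mult coord_1)
  qed
  show "a - b = a + - b" by (rule minus_env_def)
  have "coord 0 0 \<noteq> coord 1 0" using U_gl_nontrivial[of 0] unfolding coord_0 coord_1 by (rule not_sym)
  then show "(0::env) \<noteq> 1" by metis
qed

end

definition scE :: "complex \<Rightarrow> env"
  where "scE c = Env (\<lambda>m. U_const m c)"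

definition emb :: "nat \<Rightarrow> complex mat \<Rightarrow> env"
  where "emb n X = Env (\<lambda>m. if m = n then U_class n (monomial [X]) else \<zero>\<^bsub>U_gl m\<^esub>)"

lemma coord_scE: "coord (scE c) m = U_class m (free_const c)"
  unfolding scE_def U_const_def by (rule coord_Env) (rule U_class_closed[OF free_const_in_carrier])

lemma monomial_single_carrier: "X \<in> gl m \<Longrightarrow> monomial [X] \<in> carrier (FR m)"
  by (rule monomial_in_carrier) simp

lemma coord_emb:
  assumes "X \<in> gl n"
  shows "coord (emb n X) m = (if m = n then U_class n (monomial [X]) else \<zero>\<^bsub>U_gl m\<^esub>)"
  unfolding emb_def
  by (rule coord_Env) (use U_class_closed[OF monomial_single_carrier[OF assms]] in simp)

lemma free_const_comm: "free_const c * p = p * free_const c"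
proof -
  let ?S = "\<Sum>w \<in> Poly_Mapping.keys p. Poly_Mapping.single w (Poly_Mapping.lookup p w)"
  have p: "p = ?S"
    by (rule poly_mapping_eqI) (auto simp: lookup_sum lookup_single when_def in_keys_iff)
  have "free_const c * ?S = ?S * free_const c"
    by (simp add: free_const_def sum_distrib_left sum_distrib_right mult_single mult.commute)
  then show ?thesis using p by metis
qed

lemma env_rel: "r \<in> env_rels m \<Longrightarrow> r \<in> env_ideal m"
  unfolding env_ideal_def using ring.genideal_self[OF ring_free_ring env_rels_in_carrier] by blast

lemma lie_bracket_carrier: "X \<in> gl m \<Longrightarrow> Y \<in> gl m \<Longrightarrow> lie_bracket X Y \<in> gl m"
  unfolding lie_bracket_def by (intro minus_carrier_mat mult_carrier_mat)

lemma emb_add: assumes X: "X \<in> gl n" and Y: "Y \<in> gl n" shows "emb n (X + Y) = emb n X + emb n Y"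
proof (rule env_eqI)
  fix m
  have XY: "X + Y \<in> gl n" using X Y by simp
  note c = monomial_single_carrier[OF X] monomial_single_carrier[OF Y]
  have "monomial [X + Y] - monomial [X] - monomial [Y] \<in> env_rels n"
    unfolding env_rels_def using X Y by blast
  then have "monomial [X + Y] - (monomial [X] + monomial [Y]) \<in> env_ideal n"
    by (simp add: env_rel diff_diff_eq)
  moreover have "monomial [X] + monomial [Y] \<in> carrier (FR n)"
    using ring.ring_simprules(1)[OF ring_free_ring c] by (simp add: free_ring_simps)
  ultimately have "U_class n (monomial [X + Y]) = U_class n (monomial [X] + monomial [Y])"
    by (rule U_class_eqI)
  then show "coord (emb n (X + Y)) m = coord (emb n X + emb n Y) m"
    by (simp add: coord_add coord_emb XY X Y U_class_add c)
qed

lemma emb_scale: assumes X: "X \<in> gl n" shows "emb n (c \<cdot>\<^sub>m X) = scE c * emb n X"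
proof (rule env_eqI)
  fix m
  have cX: "c \<cdot>\<^sub>m X \<in> gl n" using X by simp
  note k = free_const_in_carrier[of c "gl n"] monomial_single_carrier[OF X]
  have "monomial [c \<cdot>\<^sub>m X] - free_const c * monomial [X] \<in> env_rels n"
    unfolding env_rels_def using X by blast
  then have "monomial [c \<cdot>\<^sub>m X] - free_const c * monomial [X] \<in> env_ideal n"
    by (rule env_rel)
  moreover have "free_const c * monomial [X] \<in> carrier (FR n)"
    using ring.ring_simprules(5)[OF ring_free_ring k] by (simp add: free_ring_simps)
  ultimately have 1: "U_class n (monomial [c \<cdot>\<^sub>m X]) = U_class n (free_const c * monomial [X])"
    by (rule U_class_eqI)
  have 2: "U_class m (free_const c) \<in> carrier (U_gl m)" by (rule U_class_closed[OF free_const_in_carrier])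
  show "coord (emb n (c \<cdot>\<^sub>m X)) m = coord (scE c * emb n X) m"
  proof (cases "m = n")
    case True
    then show ?thesis by (simp add: coord_mult coord_emb cX X coord_scE U_class_mult k 1)
  next
    case False
    then show ?thesis by (simp add: coord_mult coord_emb cX X coord_scE 2)
  qed
qed

lemma emb_bracket:
  assumes X: "X \<in> gl n" and Y: "Y \<in> gl n"
  shows "emb n X * emb n Y = emb n Y * emb n X + emb n (lie_bracket X Y)"
proof (rule env_eqI)
  fix m
  note L = lie_bracket_carrier[OF X Y]
  note c = monomial_single_carrier[OF X] monomial_single_carrier[OF Y] monomial_single_carrier[OF L]
  have two: "monomial [A, B] = monomial [A] * monomial [B]" for A B :: "complex mat"
    by (simp add: monomial_def mult_single plus_fword_def)
  have "monomial [X, Y] - monomial [Y, X] - monomial [lie_bracket X Y] \<in> env_rels n"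
    unfolding env_rels_def using X Y by blast
  then have "monomial [X] * monomial [Y] - (monomial [Y] * monomial [X] + monomial [lie_bracket X Y]) \<in> env_ideal n"
    by (simp add: env_rel diff_diff_eq two)
  moreover have m: "monomial [Y] * monomial [X] \<in> carrier (FR n)"
    using ring.ring_simprules(5)[OF ring_free_ring c(2,1)] by (simp add: free_ring_simps)
  moreover have "monomial [Y] * monomial [X] + monomial [lie_bracket X Y] \<in> carrier (FR n)"
    using ring.ring_simprules(1)[OF ring_free_ring m c(3)] by (simp add: free_ring_simps)
  ultimately have "U_class n (monomial [X] * monomial [Y]) = U_class n (monomial [Y] * monomial [X] + monomial [lie_bracket X Y])"
    by (metis U_class_eqI)
  then show "coord (emb n X * emb n Y) m = coord (emb n Y * emb n X + emb n (lie_bracket X Y)) m"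
    by (simp add: coord_mult coord_add coord_emb X Y L U_class_add U_class_mult c m)
qed

lemma scE_simps:
  shows scE_add: "scE (a + b) = scE a + scE b" and scE_mult: "scE (a * b) = scE a * scE b"
    and scE_1: "scE 1 = 1" and scE_comm: "scE a * x = x * scE a"
proof -
  note k = free_const_in_carrier
  show "scE (a + b) = scE a + scE b"
    by (rule env_eqI) (simp only: coord_scE coord_add U_class_add[OF k k], simp only: free_const_def single_add)
  show "scE (a * b) = scE a * scE b"
    by (rule env_eqI) (simp only: coord_scE coord_mult U_class_mult[OF k k], simp add: free_const_def mult_single)
  show "scE 1 = 1"
    by (rule env_eqI) (simp add: coord_scE coord_1 U_class_one free_const_def)
  show "scE a * x = x * scE a"
  proof (rule env_eqI)
    fix m
    obtain p where "p \<in> carrier (FR m)" "coord x m = U_class m p" using U_class_exists[OF coord_closed] by blast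
    then show "coord (scE a * x) m = coord (x * scE a) m"
      by (simp add: coord_scE coord_mult U_class_mult k free_const_comm)
  qed
qed

definition EE :: "nat \<Rightarrow> nat \<Rightarrow> nat \<Rightarrow> env"
  where "EE n i j = emb n (E_mat n i j)"

lemma E_mat_carrier [simp]: "E_mat n i j \<in> gl n"
  by (simp add: E_mat_def)

lemma E_mat_mult:
  assumes "j \<in> {1..n}"
  shows "E_mat n i j * E_mat n k l = (if j = k then 1 else 0) \<cdot>\<^sub>m E_mat n i l"
proof (rule eq_matI)
  fix a b assume "a < dim_row ((if j = k then 1 else 0) \<cdot>\<^sub>m E_mat n i l)" "b < dim_col ((if j = k then 1 else 0) \<cdot>\<^sub>m E_mat n i l)"
  then have ab: "a < n" "b < n" by (simp_all add: E_mat_def)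
  have "(E_mat n i j * E_mat n k l) $$ (a, b) = (\<Sum>c\<in>{0..<n}. (if Suc a = i \<and> Suc c = j then 1 else 0) * (if Suc c = k \<and> Suc b = l then 1 else 0))"
    using ab by (simp add: E_mat_def scalar_prod_def)
  also have "\<dots> = (\<Sum>c\<in>{0..<n}. if c = j - 1 then (if Suc a = i \<and> j = k \<and> Suc b = l then 1 else 0) else 0)"
    using assms by (intro sum.cong refl) auto
  also have "\<dots> = (if Suc a = i \<and> j = k \<and> Suc b = l then 1 else 0)"
    using assms by (subst sum.delta) auto
  finally show "(E_mat n i j * E_mat n k l) $$ (a, b) = ((if j = k then 1 else 0) \<cdot>\<^sub>m E_mat n i l) $$ (a, b)"
    using ab by (simp add: E_mat_def)
qed (simp_all add: E_mat_def)

lemma emb_minus: "X \<in> gl n \<Longrightarrow> Y \<in> gl n \<Longrightarrow> emb n (X - Y) = emb n X - emb n Y"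
proof -
  assume X: "X \<in> gl n" and Y: "Y \<in> gl n"
  have "(X - Y) + Y = X" using X Y by (intro eq_matI) auto
  then have "emb n X = emb n (X - Y) + emb n Y" using emb_add[OF minus_carrier_mat[OF Y, of X] Y] by simp
  then show ?thesis by simp
qed

lemma gl_family_env: "gl_family (EE n) scE n"
proof
  show "scE (a + b) = scE a + scE b" "scE (a * b) = scE a * scE b" "scE 1 = 1" "scE a * x = x * scE a" for a b x
    by (rule scE_simps)+
  have sc0: "scE 0 = 0" using scE_add[of 0 0] by simp
  fix i j k l assume ij: "i \<in> {1..n}" "j \<in> {1..n}" "k \<in> {1..n}" "l \<in> {1..n}"
  have "br (EE n i j) (EE n k l) = emb n (lie_bracket (E_mat n i j) (E_mat n k l))"
    unfolding br_def EE_def using emb_bracket[of "E_mat n i j" n "E_mat n k l"] by simp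
  also have "\<dots> = scE (if j = k then 1 else 0) * EE n i l - scE (if l = i then 1 else 0) * EE n k j"
    unfolding lie_bracket_def E_mat_mult[OF ij(2)] E_mat_mult[OF ij(4)] EE_def
    by (subst emb_minus) (simp_all add: emb_scale)
  also have "\<dots> = (if j = k then EE n i l else 0) - (if i = l then EE n k j else 0)"
    by (simp add: sc0 scE_1)
  finally show "br (EE n i j) (EE n k l) = (if j = k then EE n i l else 0) - (if i = l then EE n k j else 0)" .
qed

text \<open>Induction on the set S of places where X may be nonzero, removing one entry at a time.\<close>

lemma emb_expand:
  assumes "finite S" "S \<subseteq> {1..n} \<times> {1..n}" "X \<in> gl n"
    "\<And>a b. a < n \<Longrightarrow> b < n \<Longrightarrow> (Suc a, Suc b) \<notin> S \<Longrightarrow> X $$ (a, b) = 0"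
  shows "emb n X = (\<Sum>(a, b)\<in>S. scE (X $$ (a - 1, b - 1)) * EE n a b)"
  using assms
proof (induction S arbitrary: X rule: finite_induct)
  case empty
  have "X = 0 \<cdot>\<^sub>m X" by (rule eq_matI) (use empty in auto)
  then have "emb n X = scE 0 * emb n X" using emb_scale[OF empty(2), of 0] by simp
  moreover have "scE 0 = 0" using scE_add[of 0 0] by simp
  ultimately show ?case by simp
next
  case (insert p S)
  obtain i j where p: "p = (i, j)" by (cases p)
  have ij: "i \<in> {1..n}" "j \<in> {1..n}" using insert.prems p by auto
  define Y where "Y = mat n n (\<lambda>(a, b). if Suc a = i \<and> Suc b = j then 0 else X $$ (a, b))"
  have Y: "Y \<in> gl n" by (simp add: Y_def)
  have ijn: "i - 1 < n" "j - 1 < n" using ij by auto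
  have "X = X $$ (i - 1, j - 1) \<cdot>\<^sub>m E_mat n i j + Y"
    by (rule eq_matI) (use insert.prems(2) ij in \<open>auto simp: Y_def E_mat_def\<close>)
  then have "emb n X = emb n (X $$ (i - 1, j - 1) \<cdot>\<^sub>m E_mat n i j + Y)" by (rule arg_cong)
  also have "\<dots> = scE (X $$ (i - 1, j - 1)) * EE n i j + emb n Y"
    by (simp add: emb_add emb_scale Y EE_def)
  also have "emb n Y = (\<Sum>(a, b)\<in>S. scE (Y $$ (a - 1, b - 1)) * EE n a b)"
  proof (rule insert.IH[OF _ Y])
    show "S \<subseteq> {1..n} \<times> {1..n}" using insert.prems(1) by simp
    fix a b assume ab: "a < n" "b < n" "(Suc a, Suc b) \<notin> S"
    show "Y $$ (a, b) = 0"
      using ab insert.prems(3)[of a b] by (auto simp: Y_def p)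
  qed
  also have "\<dots> = (\<Sum>(a, b)\<in>S. scE (X $$ (a - 1, b - 1)) * EE n a b)"
  proof (rule sum.cong[OF refl], clarify)
    fix a b assume ab: "(a, b) \<in> S"
    then have "a \<in> {1..n}" "b \<in> {1..n}" "(a, b) \<noteq> (i, j)" using insert.prems(1) insert.hyps(2) p by auto
    then have "Y $$ (a - 1, b - 1) = X $$ (a - 1, b - 1)" by (auto simp: Y_def)
    then show "scE (Y $$ (a - 1, b - 1)) * EE n a b = scE (X $$ (a - 1, b - 1)) * EE n a b" by simp
  qed
  finally show ?case using insert.hyps by (simp add: p)
qed

section \<open>The Gelfand-Tsetlin subalgebra\<close>

locale gl_env = fixes n :: nat

sublocale gl_env \<subseteq> gl_family "EE n" scE n
  by (rule gl_family_env)

context gl_env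
begin

abbreviation cn :: "env \<Rightarrow> complex mat free_alg set"
  where "cn x \<equiv> coord x n"

text \<open>Generation in the enveloping algebra and in the product ring correspond under the coordinate; this transfers
all the subalgebras below.\<close>

lemma U_gen_coord: "U_gen n (cn ` S) = cn ` alg S"
proof (intro equalityI subsetI)
  fix u assume "u \<in> U_gen n (cn ` S)"
  then show "u \<in> cn ` alg S"
    unfolding U_gen_def
  proof (induction rule: generate_ring.induct)
    case one
    show ?case using alg_1 by (auto simp: coord_1[symmetric])
  next
    case (incl h)
    then consider c where "h = cn (scE c)" | x where "x \<in> S" "h = cn x"
      by (auto simp: U_const_def coord_scE)
    then show ?case by cases (auto intro: alg_sc alg_gen)
  next
    case (a_inv h)
    then show ?case by (auto simp: coord_uminus[symmetric] intro: alg_uminus)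
  next
    case (eng_add g h)
    then show ?case by (auto simp: coord_add[symmetric] intro: alg_add)
  next
    case (eng_mult g h)
    then show ?case by (auto simp: coord_mult[symmetric] intro: alg_mult)
  qed
next
  fix u assume "u \<in> cn ` alg S"
  then obtain x where x: "x \<in> alg S" and u: "u = cn x" by blast
  from x have "cn x \<in> generate_ring (U_gl n) (range (U_const n) \<union> cn ` S)"
  proof induction
    case (alg_sc c)
    have "cn (scE c) \<in> range (U_const n)" by (simp add: U_const_def coord_scE)
    then show ?case by (intro generate_ring.incl) simp
  next
    case (alg_gen x)
    then show ?case by (intro generate_ring.incl) simp
  qed (simp_all add: coord_add coord_mult generate_ring.eng_add generate_ring.eng_mult)
  then show "u \<in> U_gen n (cn ` S)" unfolding U_gen_def u .
qed

lemma emb_corner: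
  assumes k: "k \<le> n" and X: "X \<in> gl_corner n k"
  shows "emb n X \<in> alg (gens k)"
proof -
  have "emb n X = (\<Sum>(a, b)\<in>{1..k} \<times> {1..k}. scE (X $$ (a - 1, b - 1)) * EE n a b)"
  proof (rule emb_expand)
    show "X \<in> gl n" using X unfolding gl_corner_def by blast
    show "{1..k} \<times> {1..k} \<subseteq> {1..n} \<times> {1..n}" using k by auto
    fix a b assume ab: "a < n" "b < n" "(Suc a, Suc b) \<notin> {1..k} \<times> {1..k}"
    then have "\<not> (a < k \<and> b < k)" by auto
    then show "X $$ (a, b) = 0" using X ab unfolding gl_corner_def by blast
  qed simp
  also have "\<dots> \<in> alg (gens k)"
  proof (rule alg_sum)
    fix p assume p: "p \<in> {1..k} \<times> {1..k}"
    obtain a b where ab: "p = (a, b)" by (cases p)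
    have "EE n a b \<in> gens k" using p ab unfolding gens_def by blast
    then show "(case p of (a, b) \<Rightarrow> scE (X $$ (a - 1, b - 1)) * EE n a b) \<in> alg (gens k)"
      unfolding ab by (simp add: alg_mult alg_sc alg_gen)
  qed
  finally show ?thesis .
qed

lemma U_sub_eq:
  assumes k: "k \<le> n" shows "U_sub n k = cn ` alg (gens k)"
proof -
  let ?T = "emb n ` gl_corner n k"
  have "cn ` ?T = (\<lambda>X. U_class n (monomial [X])) ` gl_corner n k"
    unfolding image_image by (rule image_cong[OF refl]) (auto simp: coord_emb gl_corner_def)
  then have 1: "U_sub n k = cn ` alg ?T"
    unfolding U_sub_def U_gen_coord[symmetric] by simp
  have "?T \<subseteq> alg (gens k)" using emb_corner[OF k] by blast
  then have "alg ?T \<subseteq> alg (gens k)" by (blast intro: alg_mono)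
  moreover have "gens k \<subseteq> ?T"
  proof
    fix x assume "x \<in> gens k"
    then obtain a b where ab: "a \<in> {1..k}" "b \<in> {1..k}" "x = emb n (E_mat n a b)" unfolding gens_def EE_def by blast
    have "E_mat n a b \<in> gl_corner n k" unfolding gl_corner_def using ab k by (auto simp: E_mat_def)
    then show "x \<in> ?T" unfolding ab(3) by (rule imageI)
  qed
  then have "alg (gens k) \<subseteq> alg ?T" by (rule alg_subset)
  ultimately show ?thesis unfolding 1 by blast
qed

lemma center_casimir:
  assumes k: "k \<le> n" shows "cn (casimir k j) \<in> U_sub_center n k"
proof -
  have "cn (casimir k j) \<otimes>\<^bsub>U_gl n\<^esub> u = u \<otimes>\<^bsub>U_gl n\<^esub> cn (casimir k j)" if u: "u \<in> U_sub n k" for u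
  proof -
    obtain y where y: "y \<in> alg (gens k)" "u = cn y" using u unfolding U_sub_eq[OF k] by blast
    have "br (casimir k j) y = 0" by (rule ginv_gens[OF ginv_casimir[OF k] y(1)])
    then show ?thesis unfolding y(2) coord_mult[symmetric] by (simp add: br_eq_0)
  qed
  moreover have "cn (casimir k j) \<in> U_sub n k"
    unfolding U_sub_eq[OF k] using casimir_in_gens by blast
  ultimately show ?thesis unfolding U_sub_center_def by blast
qed

text \<open>A central element of the subalgebra lifts to an element of the product ring that lies in the filtration and is invariant:
the generators vanish in all other coordinates, so commutators need to be checked in one coordinate only.\<close>

lemma center_generated:
  assumes k: "k \<in> {1..n}" and u: "u \<in> U_sub_center n k"
  shows "u \<in> cn ` alg GZ"
proof -
  have kn: "k \<le> n" using k by simp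
  obtain x where x: "x \<in> alg (gens k)" "u = cn x"
    using u unfolding U_sub_center_def U_sub_eq[OF kn] by blast
  have "ginv k x"
    unfolding ginv_def
  proof (intro ballI)
    fix a b assume ab: "a \<in> {1..k}" "b \<in> {1..k}"
    have "EE n a b \<in> alg (gens k)" by (rule alg_gen) (use ab in \<open>auto simp: gens_def\<close>)
    then have "cn (EE n a b) \<in> U_sub n k" unfolding U_sub_eq[OF kn] by blast
    then have c: "cn x \<otimes>\<^bsub>U_gl n\<^esub> cn (EE n a b) = cn (EE n a b) \<otimes>\<^bsub>U_gl n\<^esub> cn x"
      using u x(2) unfolding U_sub_center_def by blast
    have "EE n a b * x = x * EE n a b"
    proof (rule env_eqI)
      fix m show "coord (EE n a b * x) m = coord (x * EE n a b) m"
      proof (cases "m = n")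
        case True
        then show ?thesis by (simp add: coord_mult c)
      next
        case False
        then show ?thesis by (simp add: coord_mult EE_def coord_emb)
      qed
    qed
    then show "br (EE n a b) x = 0" by (simp add: br_eq_0)
  qed
  moreover obtain D where "x \<in> Filt k D" using gens_Filt[OF x(1)] by blast
  ultimately have "x \<in> alg (range (casimir k))" by (intro centre_generated[OF kn])
  moreover have "range (casimir k) \<subseteq> GZ" unfolding GZ_def using k by blast
  ultimately show ?thesis unfolding x(2) using alg_subset by blast
qed

lemma GT_carrier: "carrier (GT_alg n) = cn ` alg GZ"
proof -
  define T where "T = {x \<in> alg GZ. cn x \<in> (\<Union>k\<in>{1..n}. U_sub_center n k)}"
  have "cn ` T = (\<Union>k\<in>{1..n}. U_sub_center n k)"
  proof (intro equalityI subsetI)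
    fix u assume u: "u \<in> (\<Union>k\<in>{1..n}. U_sub_center n k)"
    then obtain x where "x \<in> alg GZ" "u = cn x" using center_generated by blast
    then show "u \<in> cn ` T" using u unfolding T_def by blast
  qed (auto simp: T_def)
  then have "carrier (GT_alg n) = cn ` alg T"
    unfolding GT_alg_def U_gen_coord[symmetric] by simp
  moreover have "alg T \<subseteq> alg GZ" by (rule subsetI, erule alg_mono) (auto simp: T_def)
  moreover have "alg GZ \<subseteq> alg T"
  proof (rule alg_subset, rule subsetI)
    fix x assume x: "x \<in> GZ"
    then obtain k j where k: "k \<in> {1..n}" "x = casimir k j" unfolding GZ_def by blast
    then have "cn x \<in> U_sub_center n k" using center_casimir[of k j] by simp
    then show "x \<in> T" unfolding T_def using x k(1) alg_gen by blast
  qed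
  ultimately show ?thesis by blast
qed

lemma GT_simps [simp]:
  "x \<otimes>\<^bsub>GT_alg n\<^esub> y = x \<otimes>\<^bsub>U_gl n\<^esub> y" "x \<oplus>\<^bsub>GT_alg n\<^esub> y = x \<oplus>\<^bsub>U_gl n\<^esub> y"
  "\<one>\<^bsub>GT_alg n\<^esub> = \<one>\<^bsub>U_gl n\<^esub>" "\<zero>\<^bsub>GT_alg n\<^esub> = \<zero>\<^bsub>U_gl n\<^esub>"
  by (simp_all add: GT_alg_def)

lemma ring_GT: "ring (GT_alg n)"
proof -
  interpret R: ring "U_gl n" by (rule ring_U_gl)
  have "U_gen n (\<Union>k \<in> {1..n}. U_sub_center n k) = carrier (GT_alg n)" by (simp add: GT_alg_def)
  also have "\<dots> = U_gen n (cn ` GZ)" unfolding GT_carrier U_gen_coord ..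
  finally have eq: "GT_alg n = (U_gl n)\<lparr>carrier := U_gen n (cn ` GZ)\<rparr>" unfolding GT_alg_def by simp
  have "range (U_const n) \<union> cn ` GZ \<subseteq> carrier (U_gl n)"
    by (auto simp: U_const_def intro!: U_class_closed free_const_in_carrier)
  then have "subring (U_gen n (cn ` GZ)) (U_gl n)"
    unfolding U_gen_def by (rule R.generate_ring_is_subring)
  then show ?thesis unfolding eq by (rule R.subring_is_ring)
qed

text \<open>The subalgebra is commutative, hence one-sided conditions suffice.\<close>

lemma GT_idealI:
  assumes J: "J \<subseteq> cn ` alg GZ" "cn 0 \<in> J"
    and add: "\<And>x y. cn x \<in> J \<Longrightarrow> cn y \<in> J \<Longrightarrow> cn (x + y) \<in> J"
    and mult: "\<And>x y. x \<in> alg GZ \<Longrightarrow> cn y \<in> J \<Longrightarrow> cn (x * y) \<in> J"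
  shows "ideal J (GT_alg n)"
proof -
  interpret R: ring "GT_alg n" by (rule ring_GT)
  show ?thesis
  proof (rule idealI[OF ring_GT])
    show "subgroup J (add_monoid (GT_alg n))"
    proof (rule R.add.subgroupI)
      show "J \<subseteq> carrier (GT_alg n)" unfolding GT_carrier by (rule J(1))
      show "J \<noteq> {}" using J(2) by blast
    next
      fix a assume a: "a \<in> J"
      then obtain x where x: "x \<in> alg GZ" "a = cn x" using J(1) by blast
      have "\<ominus>\<^bsub>GT_alg n\<^esub> a = cn (- x)"
        by (rule R.minus_equality)
          (use x alg_uminus in \<open>auto simp: GT_carrier coord_add[symmetric] coord_0[symmetric]\<close>)
      moreover have "cn (scE (- 1) * x) \<in> J" by (rule mult[OF alg_sc]) (use a x in simp)
      ultimately show "\<ominus>\<^bsub>GT_alg n\<^esub> a \<in> J" by (simp add: sc_minus)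
    next
      fix a b assume ab: "a \<in> J" "b \<in> J"
      then obtain x y where "a = cn x" "b = cn y" using J(1) by blast
      then show "a \<oplus>\<^bsub>GT_alg n\<^esub> b \<in> J" using add[of x y] ab by (simp add: coord_add)
    qed
  next
    fix a u assume a: "a \<in> J" and u: "u \<in> carrier (GT_alg n)"
    obtain x where x: "x \<in> alg GZ" "a = cn x" using a J(1) by blast
    obtain y where y: "y \<in> alg GZ" "u = cn y" using u unfolding GT_carrier by blast
    have "cn (y * x) \<in> J" by (rule mult[OF y(1)]) (use a x in simp)
    moreover have "x * y = y * x" using GZ_commute[OF x(1) y(1)] by (simp add: br_eq_0)
    ultimately show "u \<otimes>\<^bsub>GT_alg n\<^esub> a \<in> J" "a \<otimes>\<^bsub>GT_alg n\<^esub> u \<in> J"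
      unfolding x(2) y(2) GT_simps coord_mult[symmetric] by simp_all
  qed
qed

lemma GT_idealD:
  assumes J: "ideal J (GT_alg n)"
  shows "J \<subseteq> cn ` alg GZ" "cn 0 \<in> J"
    "cn x \<in> J \<Longrightarrow> cn y \<in> J \<Longrightarrow> cn (x + y) \<in> J"
    "x \<in> alg GZ \<Longrightarrow> cn y \<in> J \<Longrightarrow> cn (x * y) \<in> J"
    "x \<in> alg GZ \<Longrightarrow> cn y \<in> J \<Longrightarrow> cn (y * x) \<in> J"
proof -
  interpret J: ideal J "GT_alg n" by (rule J)
  show "J \<subseteq> cn ` alg GZ" using J.a_subset unfolding GT_carrier .
  show "cn 0 \<in> J" using additive_subgroup.zero_closed[OF J.is_additive_subgroup] by (simp add: coord_0)
  show "cn x \<in> J \<Longrightarrow> cn y \<in> J \<Longrightarrow> cn (x + y) \<in> J" using additive_subgroup.a_closed[OF J.is_additive_subgroup] by (simp add: coord_add)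
  assume x: "x \<in> alg GZ" and y: "cn y \<in> J"
  have "cn x \<in> carrier (GT_alg n)" unfolding GT_carrier using x by blast
  then show "cn (x * y) \<in> J" "cn (y * x) \<in> J"
    using J.I_l_closed[OF y] J.I_r_closed[OF y] by (simp_all add: coord_mult)
qed

lemma coord_word: "cn (Ew w) = U_class n (monomial (map (\<lambda>(i, j). E_mat n i j) w))"
proof (induction w)
  case Nil
  have "(monomial [] :: complex mat free_alg) = 1"
    unfolding monomial_def zero_fword_def[symmetric] by (rule single_one)
  then show ?case by (simp add: coord_1 U_class_one)
next
  case (Cons p w)
  obtain i j where p: "p = (i, j)" by (cases p)
  let ?Xs = "map (\<lambda>(i, j). E_mat n i j) w"
  have 1: "monomial (E_mat n i j # ?Xs) = monomial [E_mat n i j] * monomial ?Xs"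
    by (simp add: monomial_def mult_single plus_fword_def)
  have 2: "monomial ?Xs \<in> carrier (FR n)" by (rule monomial_in_carrier) auto
  have "cn (Ew (p # w)) = cn (EE n i j) \<otimes>\<^bsub>U_gl n\<^esub> cn (Ew w)"
    by (simp add: p coord_mult)
  also have "\<dots> = U_class n (monomial [E_mat n i j]) \<otimes>\<^bsub>U_gl n\<^esub> U_class n (monomial ?Xs)"
    unfolding Cons.IH by (simp add: EE_def coord_emb)
  also have "\<dots> = U_class n (monomial (E_mat n i j # ?Xs))"
    unfolding 1 by (rule U_class_mult[OF monomial_single_carrier[OF E_mat_carrier] 2])
  finally show ?case by (simp add: p)
qed

lemma coord_sum:
  assumes "finite I" "\<And>i. i \<in> I \<Longrightarrow> p i \<in> carrier (FR n)" "\<And>i. i \<in> I \<Longrightarrow> cn (g i) = U_class n (p i)"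
  shows "cn (\<Sum>i\<in>I. g i) = U_class n (\<Sum>i\<in>I. p i) \<and> (\<Sum>i\<in>I. p i) \<in> carrier (FR n)"
  using assms
proof (induction I rule: finite_induct)
  case empty
  then show ?case using free_one_zero_carrier(2) by (simp add: coord_0 U_class_zero)
next
  case (insert i I)
  then have IH: "cn (\<Sum>i\<in>I. g i) = U_class n (\<Sum>i\<in>I. p i)" "(\<Sum>i\<in>I. p i) \<in> carrier (FR n)" by auto
  have pi: "p i \<in> carrier (FR n)" "cn (g i) = U_class n (p i)" using insert.prems by auto
  show ?case
    using insert.hyps IH pi ring.ring_simprules(1)[OF ring_free_ring pi(1) IH(2)]
    by (simp add: coord_add U_class_add free_ring_simps)
qed

lemma c_GT_eq: "k \<ge> 1 \<Longrightarrow> c_GT n m k = cn (casimir m k)"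
proof -
  assume k: "k \<ge> 1"
  have "cn (\<Sum>is\<in>Lists m k. Ew (zip is (rotate1 is))) = U_class n (\<Sum>is\<in>Lists m k. monomial (map2 (E_mat n) is (rotate1 is)))"
  proof (rule conjunct1[OF coord_sum])
    fix "is" :: "nat list"
    show "cn (Ew (zip is (rotate1 is))) = U_class n (monomial (map2 (E_mat n) is (rotate1 is)))"
      by (simp add: coord_word)
    have "set (map2 (E_mat n) is (rotate1 is)) \<subseteq> gl n" by auto
    then show "monomial (map2 (E_mat n) is (rotate1 is)) \<in> carrier (FR n)" by (rule monomial_in_carrier)
  qed simp
  then show ?thesis unfolding casimir_Lists[OF k] c_GT_def Lists_def by simp
qed

end

section \<open>Modules over the enveloping algebra\<close>

sublocale gl_module \<subseteq> G: gl_env n .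

sublocale gl_module \<subseteq> M: gl_rep "EE n" scE n s "\<lambda>x v. U_act s \<rho> (coord x n) v"
proof (rule gl_rep.intro[OF gl_family_env], unfold_locales)
  have cl: "\<exists>p\<in>carrier (FR n). coord x n = U_class n p" for x
    by (rule U_class_exists[OF coord_closed])
  note act = U_act_U_class[OF gl_module_axioms]
  have R1: "p + q \<in> carrier (FR n)" "p * q \<in> carrier (FR n)" if "p \<in> carrier (FR n)" "q \<in> carrier (FR n)" for p q
    using ring.ring_simprules(1)[OF ring_free_ring that] ring.ring_simprules(5)[OF ring_free_ring that]
    by (simp_all add: free_ring_simps)
  fix x y v w a
  obtain p where p: "p \<in> carrier (FR n)" "coord x n = U_class n p" using cl by blast
  obtain q where q: "q \<in> carrier (FR n)" "coord y n = U_class n q" using cl by blast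
  show "U_act s \<rho> (coord (x + y) n) v = U_act s \<rho> (coord x n) v + U_act s \<rho> (coord y n) v"
    by (simp add: coord_add p q U_class_add act R1 free_act_add)
  show "U_act s \<rho> (coord (x * y) n) v = U_act s \<rho> (coord x n) (U_act s \<rho> (coord y n) v)"
    by (simp add: coord_mult p q U_class_mult act R1 free_act_mult)
  show "U_act s \<rho> (coord (scE a) n) v = s a v"
    by (simp add: coord_scE act[OF free_const_in_carrier]) (simp add: free_const_def free_act_single zero_fword_def)
  interpret L: Vector_Spaces.linear s s "free_act s \<rho> p" by (rule free_act_linear[OF p(1)])
  show "U_act s \<rho> (coord x n) (v + w) = U_act s \<rho> (coord x n) v + U_act s \<rho> (coord x n) w"
    by (simp add: p act L.add)
qed

section \<open>Maximal ideals and weights\<close>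

context gl_module
begin

abbreviation ac :: "env \<Rightarrow> 'v \<Rightarrow> 'v"
  where "ac x v \<equiv> U_act s \<rho> (coord x n) v"

lemma ac_emb: "X \<in> gl n \<Longrightarrow> ac (emb n X) v = \<rho> X v"
proof -
  assume X: "X \<in> gl n"
  have "ac (emb n X) v = free_act s \<rho> (monomial [X]) v"
    using U_act_U_class[OF gl_module_axioms monomial_single_carrier[OF X]] by (simp add: coord_emb X)
  then show ?thesis by (simp add: monomial_def free_act_single)
qed

lemma gens_invariant:
  assumes N: "subspace N" and E: "\<And>i j v. i \<in> {1..n} \<Longrightarrow> j \<in> {1..n} \<Longrightarrow> v \<in> N \<Longrightarrow> ac (EE n i j) v \<in> N"
    and x: "x \<in> G.alg (G.gens n)"
  shows "v \<in> N \<Longrightarrow> ac x v \<in> N"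
  using x
proof (induction arbitrary: v)
  case (alg_sc c)
  then show ?case by (simp add: M.act_sc subspace_scale[OF N])
next
  case (alg_gen x)
  then show ?case using E unfolding G.gens_def by blast
next
  case (alg_add x y)
  then show ?case by (simp add: M.act_add_left subspace_add[OF N])
next
  case (alg_mult x y)
  then show ?case by (simp add: M.act_mult)
qed

lemma gl_corner_full: "gl_corner n n = gl n"
  by (auto simp: gl_corner_def)

lemma irreducible_M:
  assumes "irreducible_module n s \<rho>" shows "M.irreducible"
  unfolding M.irreducible_def
proof (intro allI impI)
  fix N assume N: "subspace N" and E: "\<forall>i\<in>{1..n}. \<forall>j\<in>{1..n}. \<forall>x\<in>N. ac (EE n i j) x \<in> N"
  have "submodule n s \<rho> N"
    unfolding submodule_def
  proof (intro conjI ballI)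
    show "subspace N" by (rule N)
    fix X v assume X: "X \<in> gl n" and v: "v \<in> N"
    have "emb n X \<in> G.alg (G.gens n)"
      by (rule G.emb_corner[OF order_refl]) (simp add: gl_corner_full X)
    then have "ac (emb n X) v \<in> N"
      by (rule gens_invariant[OF N _ _ v, rotated]) (use E in blast)
    then show "\<rho> X v \<in> N" unfolding ac_emb[OF X] .
  qed
  then show "N = {0} \<or> N = UNIV" using assms unfolding irreducible_module_def by blast
qed

text \<open>For the least power of the ideal that kills x, an element of the previous power carries x to the required vector.\<close>

lemma killed_vector:
  assumes m: "ideal \<mm> (GT_alg n)" and x: "x \<in> GT_component n s \<rho> \<mm>" "x \<noteq> 0"
  shows "\<exists>y. y \<noteq> 0 \<and> (\<forall>u\<in>\<mm>. U_act s \<rho> u y = 0)"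
proof -
  let ?P = "\<lambda>k. \<forall>u\<in>ideal_pow (GT_alg n) \<mm> k. U_act s \<rho> u x = 0"
  interpret R: ring "GT_alg n" by (rule G.ring_GT)
  have carr: "ideal_pow (GT_alg n) \<mm> k \<subseteq> carrier (GT_alg n)" for k
  proof (induction k)
    case (Suc k)
    show ?case
    proof
      fix u assume "u \<in> ideal_pow (GT_alg n) \<mm> (Suc k)"
      then have "u \<in> \<mm> \<cdot>\<^bsub>GT_alg n\<^esub> ideal_pow (GT_alg n) \<mm> k" by simp
      then show "u \<in> carrier (GT_alg n)"
      proof induction
        case (prod i j)
        have "i \<in> carrier (GT_alg n)" by (rule ideal.Icarr[OF m prod(1)])
        then show ?case using Suc prod(2) by (intro R.m_closed) auto
      next
        case (sum a b)
        then show ?case by (intro R.a_closed)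
      qed
    qed
  qed simp
  obtain k0 where "?P k0" using x(1) unfolding GT_component_def by blast
  define k where "k = (LEAST k. ?P k)"
  have Pk: "?P k" unfolding k_def by (rule LeastI[of ?P, OF \<open>?P k0\<close>])
  have least: "\<not> ?P j" if "j < k" for j using not_less_Least[of j ?P] that unfolding k_def by blast
  show ?thesis
  proof (cases k)
    case 0
    have "coord 1 n \<in> carrier (GT_alg n)" using R.one_closed by (simp add: coord_1)
    then have "ac 1 x = 0" by (rule bspec[OF Pk[unfolded 0 ideal_pow.simps]])
    then show ?thesis using x(2) by simp
  next
    case (Suc j)
    have "\<not> ?P j" by (rule least) (simp add: Suc)
    then obtain u where u: "u \<in> ideal_pow (GT_alg n) \<mm> j" "U_act s \<rho> u x \<noteq> 0" by blast
    obtain b where b: "u = coord b n" using carr u(1) unfolding G.GT_carrier by blast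
    have "U_act s \<rho> r (U_act s \<rho> u x) = 0" if r: "r \<in> \<mm>" for r
    proof -
      obtain a where a: "r = coord a n" using ideal.Icarr[OF m r] unfolding G.GT_carrier by blast
      have "r \<otimes>\<^bsub>GT_alg n\<^esub> u \<in> ideal_pow (GT_alg n) \<mm> k"
        unfolding Suc ideal_pow.simps by (rule ideal_prod.prod[OF r u(1)])
      then have "U_act s \<rho> (coord (a * b) n) x = 0"
        using Pk unfolding a b by (simp add: coord_mult)
      then show ?thesis unfolding a b by (simp add: M.act_mult)
    qed
    then show ?thesis using u(2) by blast
  qed
qed

lemma annihilator_ideal: "ideal {u \<in> carrier (GT_alg n). U_act s \<rho> u y = 0} (GT_alg n)"
proof (rule G.GT_idealI)
  show "coord 0 n \<in> {u \<in> carrier (GT_alg n). U_act s \<rho> u y = 0}"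
    unfolding G.GT_carrier using G.alg_0 by auto
  show "{u \<in> carrier (GT_alg n). U_act s \<rho> u y = 0} \<subseteq> (\<lambda>x. coord x n) ` G.alg G.GZ"
    unfolding G.GT_carrier by blast
  interpret R: ring "GT_alg n" by (rule G.ring_GT)
  fix a b
  show "coord a n \<in> {u \<in> carrier (GT_alg n). U_act s \<rho> u y = 0} \<Longrightarrow> coord b n \<in> {u \<in> carrier (GT_alg n). U_act s \<rho> u y = 0} \<Longrightarrow>
    coord (a + b) n \<in> {u \<in> carrier (GT_alg n). U_act s \<rho> u y = 0}"
    using R.a_closed[of "coord a n" "coord b n"] by (simp add: M.act_add_left) (simp add: coord_add)
  assume "a \<in> G.alg G.GZ" "coord b n \<in> {u \<in> carrier (GT_alg n). U_act s \<rho> u y = 0}"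
  moreover from this have "coord a n \<in> carrier (GT_alg n)" unfolding G.GT_carrier by blast
  ultimately show "coord (a * b) n \<in> {u \<in> carrier (GT_alg n). U_act s \<rho> u y = 0}"
    using R.m_closed[of "coord a n" "coord b n"] by (simp add: M.act_mult) (simp add: coord_mult)
qed

text \<open>The annihilator of y is a proper ideal containing \<open>\<mm>\<close>, hence equal to it. If \<open>t y\<close> is nonzero, the
elements that carry y into the multiples of \<open>t y\<close> form a strictly larger ideal, so they include 1. This is the
division property needed in \<open>eigenvalue_exists\<close>. The last conjunct shows that \<open>\<chi>\<close> depends only on
\<open>\<mm>\<close>.\<close>

theorem joint_eigenvector:
  assumes m: "maximalideal \<mm> (GT_alg n)" and V: "GT_component n s \<rho> \<mm> \<noteq> {0}"
  shows "\<exists>y \<chi>. y \<noteq> 0 \<and> (\<forall>u\<in>\<mm>. U_act s \<rho> u y = 0) \<and>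
    (\<forall>x\<in>G.alg G.GZ. ac x y = s (\<chi> x) y \<and> coord (x - scE (\<chi> x)) n \<in> \<mm>)"
proof -
  interpret m: maximalideal \<mm> "GT_alg n" by (rule m)
  have mi: "ideal \<mm> (GT_alg n)" by (rule m.is_ideal)
  have "0 \<in> GT_component n s \<rho> \<mm>"
  proof -
    have "U_act s \<rho> u 0 = 0" if "u \<in> carrier (GT_alg n)" for u
      using that unfolding G.GT_carrier by auto
    then have "\<forall>u\<in>ideal_pow (GT_alg n) \<mm> 0. U_act s \<rho> u 0 = 0" by simp
    then show ?thesis unfolding GT_component_def by blast
  qed
  then obtain x where "x \<in> GT_component n s \<rho> \<mm>" "x \<noteq> 0" using V by blast
  from killed_vector[OF mi this] obtain y where y: "y \<noteq> 0" "\<And>u. u \<in> \<mm> \<Longrightarrow> U_act s \<rho> u y = 0" by blast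
  define J where "J = {u \<in> carrier (GT_alg n). U_act s \<rho> u y = 0}"
  have "\<mm> \<subseteq> J" unfolding J_def using y(2) m.Icarr by blast
  moreover have "coord 1 n \<notin> J" unfolding J_def using y(1) by simp
  moreover have one: "coord 1 n \<in> carrier (GT_alg n)" unfolding G.GT_carrier using G.alg_1 by blast
  ultimately have Jm: "J = \<mm>"
    using m.I_maximal[OF annihilator_ideal[of y]] unfolding J_def by blast
  have eig: "\<exists>c. ac x y = s c y" if x: "x \<in> G.alg G.GZ" for x
  proof (rule M.eigenvalue_exists[where S = G.GZ, OF G.GZ_gens G.GZ_commute y(1) x])
    fix c assume nz: "ac (x - scE c) y \<noteq> 0"
    define t where "t = x - scE c"
    have t: "t \<in> G.alg G.GZ" unfolding t_def by (rule G.alg_diff[OF x G.alg_sc])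
    define I where "I = {u \<in> carrier (GT_alg n). \<exists>h\<in>G.alg G.GZ. U_act s \<rho> u y = ac h (ac t y)}"
    have I: "ideal I (GT_alg n)"
    proof (rule G.GT_idealI)
      show "I \<subseteq> (\<lambda>x. coord x n) ` G.alg G.GZ" unfolding I_def G.GT_carrier by blast
      have "coord 0 n \<in> carrier (GT_alg n)" unfolding G.GT_carrier using G.alg_0 by blast
      moreover have "ac 0 y = ac 0 (ac t y)" by simp
      ultimately show "coord 0 n \<in> I" unfolding I_def using G.alg_0 by blast
      fix a b
      {
        assume ab: "coord a n \<in> I" "coord b n \<in> I"
        then obtain h h' where h: "h \<in> G.alg G.GZ" "ac a y = ac h (ac t y)" "h' \<in> G.alg G.GZ" "ac b y = ac h' (ac t y)"
          unfolding I_def by blast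
        have "ac (a + b) y = ac (h + h') (ac t y)" by (simp add: M.act_add_left h)
        moreover have "coord (a + b) n \<in> carrier (GT_alg n)"
          using ring.ring_simprules(1)[OF G.ring_GT, of "coord a n" "coord b n"] ab unfolding I_def by (simp add: coord_add)
        ultimately show "coord (a + b) n \<in> I" unfolding I_def using G.alg_add[OF h(1,3)] by blast
      next
        assume a: "a \<in> G.alg G.GZ" and b: "coord b n \<in> I"
        then obtain h where h: "h \<in> G.alg G.GZ" "ac b y = ac h (ac t y)" unfolding I_def by blast
        have "ac (a * b) y = ac (a * h) (ac t y)" by (simp add: M.act_mult h)
        moreover have "coord a n \<in> carrier (GT_alg n)" using a unfolding G.GT_carrier by blast
        then have "coord (a * b) n \<in> carrier (GT_alg n)"
          using ring.ring_simprules(5)[OF G.ring_GT, of "coord a n" "coord b n"] b unfolding I_def by (simp add: coord_mult)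
        ultimately show "coord (a * b) n \<in> I" unfolding I_def using G.alg_mult[OF a h(1)] by blast
      }
    qed
    have "\<mm> \<subseteq> I"
    proof
      fix u assume u: "u \<in> \<mm>"
      then have "U_act s \<rho> u y = ac 0 (ac t y)" using y(2) by simp
      then show "u \<in> I" unfolding I_def using m.Icarr[OF u] G.alg_0 by blast
    qed
    moreover have "coord t n \<in> I"
    proof -
      have "coord t n \<in> carrier (GT_alg n)" unfolding G.GT_carrier using t by blast
      moreover have "ac t y = ac 1 (ac t y)" by simp
      ultimately show ?thesis unfolding I_def using G.alg_1 by blast
    qed
    moreover have "coord t n \<notin> \<mm>" using y(2) nz unfolding t_def by blast
    moreover have "I \<subseteq> carrier (GT_alg n)" unfolding I_def by blast
    ultimately have "I = carrier (GT_alg n)" using m.I_maximal[OF I] by blast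
    then have "coord 1 n \<in> I" using one by simp
    then obtain h where "h \<in> G.alg G.GZ" "ac 1 y = ac h (ac t y)" unfolding I_def by blast
    then show "\<exists>w\<in>G.alg G.GZ. ac w (ac (x - scE c) y) = y" unfolding t_def by (intro bexI[of _ h]) simp_all
  qed
  have "\<forall>x. \<exists>c. x \<in> G.alg G.GZ \<longrightarrow> ac x y = s c y" using eig by blast
  from choice[OF this] obtain \<chi> where \<chi>: "\<forall>x. x \<in> G.alg G.GZ \<longrightarrow> ac x y = s (\<chi> x) y" by (rule exE)
  have "coord (x - scE (\<chi> x)) n \<in> \<mm>" if x: "x \<in> G.alg G.GZ" for x
  proof -
    have "ac (x - scE (\<chi> x)) y = 0" using \<chi> x by (simp add: M.act_diff_left M.act_sc)
    moreover have "coord (x - scE (\<chi> x)) n \<in> carrier (GT_alg n)"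
      unfolding G.GT_carrier using G.alg_diff[OF x G.alg_sc] by blast
    ultimately show ?thesis unfolding Jm[symmetric] J_def by blast
  qed
  then show ?thesis using y \<chi> by blast
qed

text \<open>The ideal of the tableau belonging to L kills y and contains every generator up to a scalar. Therefore
its quotient is the field of scalars, the ideal is maximal, and its component contains y.\<close>

theorem weight_noncritical:
  assumes nc: "\<not> critical_module n s \<rho>" and y: "y \<in> M.wt L" "y \<noteq> 0"
  shows "noncrit n L"
proof (rule ccontr)
  assume crit: "\<not> noncrit n L"
  define T where "T m i = L m i - of_nat m + 1" for m i
  define g where "g m k = gamma_row m k (T m)" for m k
  define D where "D = {c_GT n m k \<ominus>\<^bsub>U_gl n\<^esub> U_const n (gamma_row m k (T m)) | m k. 1 \<le> k \<and> k \<le> m \<and> m \<le> n}"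
  define \<mm> where "\<mm> = max_of_tableau n T"
  have mD: "\<mm> = Idl\<^bsub>GT_alg n\<^esub> D" unfolding \<mm>_def max_of_tableau_def D_def ..
  have cas: "G.casimir m k \<in> G.alg G.GZ" if "m \<in> {1..n}" for m k
    by (rule G.alg_gen) (unfold G.GZ_def, rule UN_I[OF that], rule rangeI)
  have gen: "c_GT n m k \<ominus>\<^bsub>U_gl n\<^esub> U_const n (gamma_row m k (T m)) = coord (G.casimir m k - scE (g m k)) n" if "1 \<le> k" for m k
  proof -
    have U: "U_const n c = coord (scE c) n" for c unfolding U_const_def coord_scE ..
    show ?thesis
      unfolding G.c_GT_eq[OF that] U a_minus_def minus_env_def coord_add coord_uminus g_def ..
  qed
  have casy: "ac (G.casimir m k - scE (g m k)) y = 0" if "m \<in> {1..n}" for m k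
    using M.wt_casimir[OF y(1), of m k] that by (simp add: M.act_diff_left M.act_sc g_def T_def[abs_def])
  have Dsub: "D \<subseteq> {u \<in> carrier (GT_alg n). U_act s \<rho> u y = 0}"
  proof
    fix u assume "u \<in> D"
    then obtain m k where mk: "1 \<le> k" "k \<le> m" "m \<le> n" "u = coord (G.casimir m k - scE (g m k)) n"
      unfolding D_def using gen by blast
    then have m: "m \<in> {1..n}" by simp
    show "u \<in> {u \<in> carrier (GT_alg n). U_act s \<rho> u y = 0}"
      unfolding mk(4) using casy[OF m] G.alg_diff[OF cas[OF m] G.alg_sc] by (auto simp: G.GT_carrier)
  qed
  have Dc: "D \<subseteq> carrier (GT_alg n)" using Dsub by blast
  have mi: "ideal \<mm> (GT_alg n)" unfolding mD by (rule ring.genideal_ideal[OF G.ring_GT Dc])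
  have kill: "U_act s \<rho> u y = 0" if "u \<in> \<mm>" for u
    using ring.genideal_minimal[OF G.ring_GT annihilator_ideal Dsub] that unfolding mD by blast
  note id = G.GT_idealD[OF mi]
  have congr: "\<exists>c. coord (x - scE c) n \<in> \<mm>" if "x \<in> G.alg {G.casimir k j | k j. 1 \<le> j \<and> j \<le> k \<and> k \<le> n}" for x
  proof -
    have sub: "G.alg {G.casimir k j | k j. 1 \<le> j \<and> j \<le> k \<and> k \<le> n} \<subseteq> G.alg G.GZ"
      by (rule G.alg_subset) (force simp: G.GZ_def)
    from that show ?thesis
    proof induction
      case (alg_sc c)
      then show ?case using id(2) by (intro exI[of _ c]) simp
    next
      case (alg_gen x)
      then obtain k j where kj: "x = G.casimir k j" "1 \<le> j" "j \<le> k" "k \<le> n" by blast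
      have eq: "coord (x - scE (g k j)) n = c_GT n k j \<ominus>\<^bsub>U_gl n\<^esub> U_const n (gamma_row k j (T k))"
        unfolding kj(1) by (rule gen[OF kj(2), symmetric])
      have "coord (x - scE (g k j)) n \<in> D" unfolding D_def eq using kj(2-4) by blast
      then show ?case using ring.genideal_self[OF G.ring_GT Dc] unfolding mD by blast
    next
      case (alg_add x z)
      then obtain c d where cd: "coord (x - scE c) n \<in> \<mm>" "coord (z - scE d) n \<in> \<mm>" by blast
      have "x + z - scE (c + d) = (x - scE c) + (z - scE d)" by (simp add: scE_add)
      then show ?case using id(3)[OF cd] by metis
    next
      case (alg_mult x z)
      then obtain c d where cd: "coord (x - scE c) n \<in> \<mm>" "coord (z - scE d) n \<in> \<mm>" by blast
      have xG: "x \<in> G.alg G.GZ" using alg_mult sub by blast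
      have "x * z - scE (c * d) = x * (z - scE d) + (x - scE c) * scE d"
        by (simp add: scE_mult algebra_simps)
      then show ?case using id(3)[OF id(4)[OF xG cd(2)] id(5)[OF G.alg_sc cd(1)]] by metis
    qed
  qed
  have max: "maximalideal \<mm> (GT_alg n)"
  proof (rule maximalidealI[OF mi])
    have "coord 1 n \<notin> \<mm>" using kill[of "coord 1 n"] y(2) by auto
    moreover have "coord 1 n \<in> carrier (GT_alg n)" unfolding G.GT_carrier using G.alg_1 by blast
    ultimately show "carrier (GT_alg n) \<noteq> \<mm>" by blast
    fix J assume J: "ideal J (GT_alg n)" "\<mm> \<subseteq> J" "J \<subseteq> carrier (GT_alg n)"
    note jd = G.GT_idealD[OF J(1)]
    show "J = \<mm> \<or> J = carrier (GT_alg n)"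
    proof (rule disjCI)
      assume "J \<noteq> carrier (GT_alg n)"
      have "J \<subseteq> \<mm>"
      proof
        fix u assume u: "u \<in> J"
        then obtain x where x: "x \<in> G.alg G.GZ" "u = coord x n" using jd(1) by blast
        obtain c where c: "coord (x - scE c) n \<in> \<mm>" using congr x(1) G.GZ_generators by blast
        have "c = 0"
        proof (rule ccontr)
          assume c0: "c \<noteq> 0"
          have 1: "coord (scE (- 1) * (x - scE c)) n \<in> J" by (rule jd(4)[OF G.alg_sc]) (use c J(2) in blast)
          have "coord (x + scE (- 1) * (x - scE c)) n \<in> J" by (rule jd(3)[OF _ 1]) (use u x in simp)
          moreover have "x + scE (- 1) * (x - scE c) = scE c" by (simp add: G.sc_minus scE_1)
          ultimately have "coord (scE (1 / c) * scE c) n \<in> J" by (intro jd(4)[OF G.alg_sc]) simp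
          moreover have "scE (1 / c) * scE c = 1" using c0 by (simp flip: scE_mult add: scE_1)
          ultimately have "\<one>\<^bsub>GT_alg n\<^esub> \<in> J" by (simp add: coord_1)
          then have "J = carrier (GT_alg n)" by (rule ideal.one_imp_carrier[OF J(1)])
          then show False using \<open>J \<noteq> carrier (GT_alg n)\<close> by simp
        qed
        then show "u \<in> \<mm>" using c x(2) G.sc_0 by simp
      qed
      then show "J = \<mm>" using J(2) by blast
    qed
  qed
  have "y \<in> GT_component n s \<rho> \<mm>"
  proof -
    have "U_act s \<rho> u y = 0" if "u \<in> ideal_pow (GT_alg n) \<mm> (Suc 0)" for u
    proof -
      have "u \<in> \<mm> \<cdot>\<^bsub>GT_alg n\<^esub> carrier (GT_alg n)" using that by simp
      then have "u \<in> \<mm>"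
      proof induction
        case (prod i j)
        then show ?case by (intro ideal.I_r_closed[OF mi])
      next
        case (sum a b)
        then show ?case by (intro additive_subgroup.a_closed[OF ideal.axioms(1)[OF mi]])
      qed
      then show ?thesis by (rule kill)
    qed
    then show ?thesis unfolding GT_component_def by blast
  qed
  then have "GT_component n s \<rho> \<mm> \<noteq> {0}" using y(2) by blast
  moreover have "critical_ideal n \<mm>"
  proof -
    obtain k where k: "k \<in> {1..n}" "\<not> inj_on (L k) {1..k}" using crit unfolding noncrit_def by blast
    have "inj_on (L k) {1..k}" if "inj_on (T k) {1..k}"
      by (rule inj_onI) (rule inj_onD[OF that], simp_all add: T_def)
    then have "critical_tableau n T" unfolding critical_tableau_def using k by blast
    then show ?thesis unfolding critical_ideal_def \<mm>_def by blast
  qed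
  ultimately show False using nc max unfolding critical_module_def by blast
qed

lemma noncritical_M:
  assumes "\<not> critical_module n s \<rho>"
  shows "noncritical_rep (EE n) scE n s (\<lambda>x v. U_act s \<rho> (coord x n) v)"
  by unfold_locales (rule weight_noncritical[OF assms])

end

lemma GT_module_component:
  assumes GT: "GT_module n s \<rho>" and nz: "(UNIV :: 'v::ab_group_add set) \<noteq> {0}"
  shows "\<exists>\<mm>. maximalideal \<mm> (GT_alg n) \<and> GT_component n s (\<rho> :: complex mat \<Rightarrow> 'v \<Rightarrow> 'v) \<mm> \<noteq> {0}"
proof -
  obtain v :: 'v where v: "v \<noteq> 0" using nz by blast
  obtain h where h: "\<forall>\<mm>. if maximalideal \<mm> (GT_alg n) then h \<mm> \<in> GT_component n s \<rho> \<mm> else h \<mm> = 0"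
    "v = (\<Sum>\<mm> | h \<mm> \<noteq> 0. h \<mm>)"
    using GT unfolding GT_module_def by blast
  have "\<exists>\<mm>. h \<mm> \<noteq> 0"
  proof (rule ccontr)
    assume "\<nexists>\<mm>. h \<mm> \<noteq> 0"
    then show False using h(2) v by simp
  qed
  then obtain \<mm> where m: "h \<mm> \<noteq> 0" by blast
  have "maximalideal \<mm> (GT_alg n) \<and> h \<mm> \<in> GT_component n s \<rho> \<mm>"
    using h(1)[THEN spec, of \<mm>] m by (cases "maximalideal \<mm> (GT_alg n)") simp_all
  then show ?thesis using m by blast
qed

theorem mainTheorem1:
  fixes n :: nat
    and sV :: "complex \<Rightarrow> 'v::ab_group_add \<Rightarrow> 'v" and \<rho>V :: "complex mat \<Rightarrow> 'v \<Rightarrow> 'v"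
  assumes "n \<ge> 2"
    and "GT_module n sV \<rho>V"
    and "irreducible_module n sV \<rho>V"
    and "\<not> critical_module n sV \<rho>V"
  shows "tame_module n sV \<rho>V \<and>
    (\<forall>\<mm> (sW :: complex \<Rightarrow> 'w::ab_group_add \<Rightarrow> 'w) (\<rho>W :: complex mat \<Rightarrow> 'w \<Rightarrow> 'w).
       maximalideal \<mm> (GT_alg n) \<and> GT_component n sV \<rho>V \<mm> \<noteq> {0} \<and>
       GT_module n sW \<rho>W \<and> irreducible_module n sW \<rho>W \<and> \<not> critical_module n sW \<rho>W \<and>
       GT_component n sW \<rho>W \<mm> \<noteq> {0} \<longrightarrow>
       module_isomorphic n sW \<rho>W sV \<rho>V)"
proof -
  interpret V: gl_module n sV \<rho>V using assms(2) unfolding GT_module_def by blast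
  interpret NV: noncritical_rep "EE n" scE n sV "\<lambda>x v. U_act sV \<rho>V (coord x n) v"
    by (rule V.noncritical_M[OF assms(4)])
  have irrV: "V.M.irreducible" by (rule V.irreducible_M[OF assms(3)])
  have "(UNIV :: 'v set) \<noteq> {0}" using assms(3) unfolding irreducible_module_def by blast
  from GT_module_component[OF assms(2) this]
  obtain \<mm> where \<mm>: "maximalideal \<mm> (GT_alg n)" "GT_component n sV \<rho>V \<mm> \<noteq> {0}" by blast
  obtain y \<chi> where y: "y \<noteq> 0" "\<forall>x\<in>V.G.alg V.G.GZ. V.ac x y = sV (\<chi> x) y"
    using V.joint_eigenvector[OF \<mm>] by blast
  have ywt: "y \<in> V.M.wt (V.G.roots \<chi>)"
    by (rule V.M.eigenvector_wt) (use y(2) in blast)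
  have tame: "tame_module n sV \<rho>V"
  proof -
    have span: "V.span (NV.orbit (V.G.roots \<chi>) y) = UNIV"
      by (rule NV.orbit_spans[OF irrV ywt y(1)])
    obtain B where B: "B \<subseteq> NV.orbit (V.G.roots \<chi>) y" "\<not> V.dependent B" "NV.orbit (V.G.roots \<chi>) y \<subseteq> V.span B"
      using V.maximal_independent_subset[of "NV.orbit (V.G.roots \<chi>) y"] by blast
    have "V.span (NV.orbit (V.G.roots \<chi>) y) \<subseteq> V.span B"
      by (rule V.span_minimal[OF B(3) V.subspace_span])
    then have "V.span B = UNIV" unfolding span by blast
    moreover have "\<exists>c. U_act sV \<rho>V u b = sV c b" if b: "b \<in> B" and u: "u \<in> carrier (GT_alg n)" for b u
    proof -
      obtain M where "b \<in> V.M.wt M" using NV.orbit_wt[OF ywt] B(1) b by blast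
      moreover obtain x where "x \<in> V.G.alg V.G.GZ" "u = coord x n" using u unfolding V.G.GT_carrier by blast
      ultimately show ?thesis using V.M.wt_GZ by blast
    qed
    ultimately show ?thesis unfolding tame_module_def using B(2) by blast
  qed
  have iso: "module_isomorphic n sW \<rho>W sV \<rho>V"
    if \<mm>: "maximalideal \<mm> (GT_alg n)" and Vm: "GT_component n sV \<rho>V \<mm> \<noteq> {0}"
      and GW: "GT_module n sW \<rho>W" and iW: "irreducible_module n sW \<rho>W"
      and nW: "\<not> critical_module n sW \<rho>W" and Wm: "GT_component n sW \<rho>W \<mm> \<noteq> {0}"
    for \<mm> and sW :: "complex \<Rightarrow> 'w \<Rightarrow> 'w" and \<rho>W :: "complex mat \<Rightarrow> 'w \<Rightarrow> 'w"
  proof -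
    interpret W: gl_module n sW \<rho>W using GW unfolding GT_module_def by blast
    obtain y \<chi> where y: "y \<noteq> 0" "\<forall>x\<in>V.G.alg V.G.GZ. V.ac x y = sV (\<chi> x) y \<and> coord (x - scE (\<chi> x)) n \<in> \<mm>"
      using V.joint_eigenvector[OF \<mm> Vm] by blast
    obtain w where w: "w \<noteq> 0" "\<forall>u\<in>\<mm>. U_act sW \<rho>W u w = 0"
      using W.joint_eigenvector[OF \<mm> Wm] by blast
    have "y \<in> V.M.wt (V.G.roots \<chi>)"
      by (rule V.M.eigenvector_wt) (use y(2) in blast)
    moreover have "w \<in> W.M.wt (V.G.roots \<chi>)"
    proof (rule W.M.eigenvector_wt)
      fix x assume x: "x \<in> V.G.alg V.G.GZ"
      have "W.ac (x - scE (\<chi> x)) w = 0" using w(2) y(2) x by blast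
      then show "W.ac x w = sW (\<chi> x) w" by (simp add: W.M.act_diff_left W.M.act_sc)
    qed
    ultimately obtain g where g: "Vector_Spaces.linear sW sV g" "bij g"
      "\<forall>i\<in>{1..n}. \<forall>j\<in>{1..n}. \<forall>x. g (W.ac (EE n i j) x) = V.ac (EE n i j) (g x)"
      using common_weight_isomorphic[OF W.noncritical_M[OF nW] V.noncritical_M[OF assms(4)]
          W.irreducible_M[OF iW] irrV _ w(1) _ y(1)] by blast
    interpret g: Vector_Spaces.linear sW sV g by (rule g(1))
    have "g (W.ac x v) = V.ac x (g v)" if "x \<in> V.G.alg (V.G.gens n)" for x v
      using that
    proof (induction arbitrary: v)
      case (alg_sc c)
      then show ?case by (simp add: W.M.act_sc V.M.act_sc g.scale)
    next
      case (alg_gen x)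
      then show ?case using g(3) unfolding V.G.gens_def by blast
    next
      case (alg_add x z)
      then show ?case by (simp add: W.M.act_add_left V.M.act_add_left g.add)
    next
      case (alg_mult x z)
      then show ?case by (simp add: W.M.act_mult V.M.act_mult)
    qed
    then have "g (\<rho>W X v) = \<rho>V X (g v)" if X: "X \<in> gl n" for X v
      using V.G.emb_corner[OF order_refl, of X] X
      by (simp add: gl_module.ac_emb[OF V.gl_module_axioms X, symmetric] gl_module.ac_emb[OF W.gl_module_axioms X, symmetric]
          V.gl_corner_full)
    then show ?thesis unfolding module_isomorphic_def using g(1,2) by blast
  qed
  show ?thesis using tame iso by blast
qed

end
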